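(* Let $d\geq 4$ and let $\mathbf c,\boldsymbol\omega\in\mathbb R^d$ be linearly independent vectors (possibly chosen at random). Let $Z_1,\dots,Z_n$ be independent random points, each uniformly distributed on the unit sphere $\mathbb S^{d-1}\subset\mathbb R^d$, and let $P_n=\mathrm{conv}(Z_1,\dots,Z_n)$. Let $L_n$ be the length of the coherent $\mathbf c$-monotone path on $P_n$ captured by $\boldsymbol\omega$. Then \[ \frac{L_n-\mathbb E(L_n)}{\sqrt{\operatorname{Var}(L_n)}}\xrightarrow[n\to\infty]{} U\quad\text{in distribution}, \] where $U\sim\mathcal N(0,1)$ is a standard normal random variable. Moreover, $\mathbb E(L_n)\sim c\,n^{\frac1{d-1}}$ as $n\to\infty$ for some constant $c>0$, and for every $a>0$ there are constants $c',c''>0$ such that, for all sufficiently large $n$, \[ c'\,n^{\frac1{d-1}-a}\leq\operatorname{Var}(L_n)\leq c''\,(\log n)^{3-\frac1{d-1}}\,n^{\frac1{d-1}}. \]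
   Context: For a polytope $P\subset\mathbb R^d$ and linearly independent $\mathbf c,\boldsymbol\omega$, consider the polygon $P_{\mathbf c,\boldsymbol\omega}=\{(\langle x,\mathbf c\rangle,\langle x,\boldsymbol\omega\rangle): x\in P\}\subset\mathbb R^2$. A proper face (vertex or edge) of this polygon is an upper face if it has an outer normal vector with positive second coordinate. The coherent $\mathbf c$-monotone path captured by $\boldsymbol\omega$ is the path in the graph of $P$ formed by the preimages of the upper faces of $P_{\mathbf c,\boldsymbol\omega}$; its length is its number of edges, i.e. the number of edges of the upper boundary path of $P_{\mathbf c,\boldsymbol\omega}$. Constants $c,c',c''$ do not depend on $n$. *)

theory Defs
  imports "HOL-Probability.Probability" "HOL-Library.Landau_Symbols"
begin

definition plane_map :: "'a::euclidean_space \<Rightarrow> 'a \<Rightarrow> 'a \<Rightarrow> real \<times> real" where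
  "plane_map c w x = (x \<bullet> c, x \<bullet> w)"

abbreviation shadow_polygon :: "'a::euclidean_space set \<Rightarrow> 'a \<Rightarrow> 'a \<Rightarrow> (real \<times> real) set" where
  "shadow_polygon P c w \<equiv> plane_map c w ` P"

definition outer_normal :: "'b::euclidean_space set \<Rightarrow> 'b set \<Rightarrow> 'b \<Rightarrow> bool" where
  "outer_normal Q F u \<longleftrightarrow> u \<noteq> 0 \<and> (\<forall>y\<in>F. \<forall>z\<in>Q. z \<bullet> u \<le> y \<bullet> u)"

text \<open>The condition on the affine dimension excludes the empty face, so a proper face is a
  vertex or an edge.\<close>

definition upper_face :: "(real \<times> real) set \<Rightarrow> (real \<times> real) set \<Rightarrow> bool" where
  "upper_face Q F \<longleftrightarrow> F face_of Q \<and> F \<noteq> Q \<and> (aff_dim F = 0 \<or> aff_dim F = 1) \<and>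
     (\<exists>u. outer_normal Q F u \<and> snd u > 0)"

definition coherent_path :: "'a::euclidean_space set \<Rightarrow> 'a \<Rightarrow> 'a \<Rightarrow> 'a set set" where
  "coherent_path P c w =
     {P \<inter> plane_map c w -` F | F. upper_face (shadow_polygon P c w) F}"

definition path_length :: "'a::euclidean_space set \<Rightarrow> 'a \<Rightarrow> 'a \<Rightarrow> nat" where
  "path_length P c w = card {G \<in> coherent_path P c w. G edge_of P}"

lemma linear_plane_map: "linear (plane_map c w)"
  by (rule linearI) (auto simp: plane_map_def inner_add_left)

lemma preimage_face_of:
  assumes P: "convex P" and F: "F face_of shadow_polygon P c w"
  shows "(P \<inter> plane_map c w -` F) face_of P"
proof -
  let ?f = "plane_map c w"
  have lin: "linear ?f" by (rule linear_plane_map)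
  show ?thesis
    unfolding face_of_def
  proof (intro conjI ballI impI)
    show "convex (P \<inter> ?f -` F)"
      by (intro convex_Int P convex_linear_vimage lin face_of_imp_convex[OF F])
    fix a b x assume ab: "a \<in> P" "b \<in> P" and x: "x \<in> P \<inter> ?f -` F" "x \<in> open_segment a b"
    obtain t where t: "0 < t" "t < 1" "x = (1 - t) *\<^sub>R a + t *\<^sub>R b"
      using x(2) by (auto simp: in_segment)
    have fx: "?f x = (1 - t) *\<^sub>R ?f a + t *\<^sub>R ?f b"
      using t(3) by (simp add: linear_add[OF lin] linear_scale[OF lin])
    have "?f a \<in> F \<and> ?f b \<in> F"
    proof (cases "?f a = ?f b")
      case True
      then have "?f x = ?f a" using fx by (simp flip: scaleR_left.add)
      then show ?thesis using True x(1) by auto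
    next
      case False
      then have "?f x \<in> open_segment (?f a) (?f b)"
        using t fx by (auto simp: in_segment)
      then show ?thesis using F ab x(1) unfolding face_of_def by blast
    qed
    then show "a \<in> P \<inter> ?f -` F" "b \<in> P \<inter> ?f -` F" using ab by auto
  qed auto
qed

text \<open>For generic \<open>c\<close> and \<open>w\<close>, where the preimages form a path in the graph of \<open>P\<close>, the length is
  the number of edges of the upper boundary path of the polygon.\<close>

lemma path_length_eq_upper_edges:
  assumes "convex P"
    and gen: "\<And>F. upper_face (shadow_polygon P c w) F \<Longrightarrow>
              aff_dim (P \<inter> plane_map c w -` F) = aff_dim F"
  shows "path_length P c w = card {F. upper_face (shadow_polygon P c w) F \<and> aff_dim F = 1}"
proof -
  let ?g = "\<lambda>F. P \<inter> plane_map c w -` F"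
  let ?E = "{F. upper_face (shadow_polygon P c w) F \<and> aff_dim F = 1}"
  have sub: "F \<subseteq> shadow_polygon P c w" if "F \<in> ?E" for F
    using that face_of_imp_subset by (auto simp: upper_face_def)
  have "inj_on ?g ?E"
  proof (rule inj_on_inverseI)
    fix F assume "F \<in> ?E"
    then show "plane_map c w ` (?g F) = F" using sub[of F] by auto
  qed
  moreover have "{G \<in> coherent_path P c w. G edge_of P} = ?g ` ?E"
  proof -
    have "?g F edge_of P \<longleftrightarrow> aff_dim F = 1" if "upper_face (shadow_polygon P c w) F" for F
      using gen[OF that] preimage_face_of[OF assms(1), of F c w] that
      by (auto simp: edge_of_def upper_face_def)
    then show ?thesis unfolding coherent_path_def by auto
  qed
  ultimately show ?thesis unfolding path_length_def by (simp add: card_image)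
qed

text \<open>The uniform distribution on the unit sphere, as the normalised cone measure: a Borel set
  \<open>A\<close> of directions is weighted by the volume of the points of the unit ball whose direction
  lies in \<open>A\<close>. The origin is a null set, so its image under the normalisation is irrelevant.\<close>

definition sphere_uniform :: "'a::euclidean_space measure" where
  "sphere_uniform = distr (uniform_measure lborel (ball 0 1)) borel (\<lambda>x. x /\<^sub>R norm x)"

lemma prob_space_uniform_ball:
  "prob_space (uniform_measure lborel (ball (0::'a::euclidean_space) 1))"
proof (rule prob_space_uniform_measure)
  show "emeasure lborel (ball (0::'a) 1) \<noteq> 0"
  proof
    assume "emeasure lborel (ball (0::'a) 1) = 0"
    then have "negligible (ball (0::'a) 1)"
      by (auto simp: negligible_iff_null_sets intro!: null_sets_completionI)
    then show False using open_not_negligible[of "ball (0::'a) 1"] by simp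
  qed
  show "emeasure lborel (ball (0::'a) 1) \<noteq> \<infinity>"
    using emeasure_lborel_ball_finite[of "0::'a" 1] by auto
qed

lemma prob_space_sphere_uniform: "prob_space (sphere_uniform :: 'a::euclidean_space measure)"
  unfolding sphere_uniform_def
  by (rule prob_space.prob_space_distr[OF prob_space_uniform_ball]) simp

lemma AE_sphere_uniform: "AE x in sphere_uniform. x \<in> sphere (0::'a::euclidean_space) 1"
proof -
  have "AE x in lborel. x \<noteq> (0::'a)"
    by (rule AE_lborel_singleton)
  then have "AE x in uniform_measure lborel (ball (0::'a) 1). x \<noteq> 0"
    by (intro AE_uniform_measureI) auto
  then show ?thesis
    unfolding sphere_uniform_def by (subst AE_distr_iff) (auto simp: field_simps)
qed

text \<open>The class \<open>wellorder\<close> is inherited from the library's change of variables theory.\<close>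

lemma sphere_uniform_orthogonal:
  fixes f :: "real ^ 'n::{finite,wellorder} \<Rightarrow> real ^ 'n::{finite,wellorder}"
  assumes f: "orthogonal_transformation f"
  shows "distr sphere_uniform borel f = sphere_uniform"
proof -
  let ?U = "uniform_measure lborel (ball (0 :: real ^ 'n::{finite,wellorder}) 1)"
  have lin: "linear f" using f by (rule orthogonal_transformation_linear)
  have [measurable]: "f \<in> borel_measurable borel"
    by (intro borel_measurable_continuous_onI linear_continuous_on linear_conv_bounded_linear[THEN iffD1] lin)
  have nrm: "norm (f x) = norm x" for x using f by (rule orthogonal_transformation_norm)
  let ?g = "inv f"
  have g: "orthogonal_transformation ?g" using f by (rule orthogonal_transformation_inv)
  have bij: "bij f" using f by (rule orthogonal_transformation_bij)
  have em: "emeasure lborel (f -` A \<inter> ball 0 1) = emeasure lborel (A \<inter> ball 0 1)"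
    if [measurable]: "A \<in> sets borel" for A
  proof -
    have fin: "A \<inter> ball 0 1 \<in> lmeasurable"
      by (rule bounded_set_imp_lmeasurable) auto
    have m: "f -` A \<inter> ball 0 1 \<in> sets borel" using measurable_sets_borel[of f borel A] by auto
    then have fin2: "f -` A \<inter> ball 0 1 \<in> lmeasurable"
      by (intro bounded_set_imp_lmeasurable) auto
    have "f -` A \<inter> ball 0 1 = ?g ` (A \<inter> ball 0 1)"
    proof
      show "f -` A \<inter> ball 0 1 \<subseteq> ?g ` (A \<inter> ball 0 1)"
      proof
        fix x assume "x \<in> f -` A \<inter> ball 0 1"
        moreover have "x = ?g (f x)" using bij by (simp add: bij_is_inj)
        ultimately show "x \<in> ?g ` (A \<inter> ball 0 1)" by (intro image_eqI) (auto simp: nrm)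
      qed
      show "?g ` (A \<inter> ball 0 1) \<subseteq> f -` A \<inter> ball 0 1"
        using orthogonal_transformation_norm[OF g] bij by (auto simp: bij_is_surj surj_f_inv_f)
    qed
    then have "measure lebesgue (f -` A \<inter> ball 0 1) = measure lebesgue (A \<inter> ball 0 1)"
      using measure_orthogonal_image[OF g fin] by simp
    then have "emeasure lebesgue (f -` A \<inter> ball 0 1) = emeasure lebesgue (A \<inter> ball 0 1)"
      by (simp only: emeasure_eq_measure2[OF fin] emeasure_eq_measure2[OF fin2])
    then show ?thesis using m by simp
  qed
  have fU: "distr ?U borel f = ?U"
  proof (rule measure_eqI)
    fix A assume "A \<in> sets (distr ?U borel f)"
    then have A[measurable]: "A \<in> sets borel" by simp
    have B: "f -` A \<in> sets borel" using measurable_sets_borel[of f borel A] by simp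
    show "emeasure (distr ?U borel f) A = emeasure ?U A"
      using em[OF A] B by (simp add: emeasure_distr Int_commute)
  qed simp
  have "distr sphere_uniform borel f = distr ?U borel (\<lambda>x. f (x /\<^sub>R norm x))"
    unfolding sphere_uniform_def by (subst distr_distr) (auto simp: comp_def)
  also have "(\<lambda>x. f (x /\<^sub>R norm x)) = (\<lambda>x. x /\<^sub>R norm x) \<circ> f"
    by (auto simp: linear_scale[OF lin] nrm)
  also have "distr ?U borel ((\<lambda>x. x /\<^sub>R norm x) \<circ> f) = distr (distr ?U borel f) borel (\<lambda>x. x /\<^sub>R norm x)"
    by (subst distr_distr) auto
  also have "\<dots> = sphere_uniform" by (simp add: fU sphere_uniform_def)
  finally show ?thesis .
qed

text \<open>\<open>L\<^sub>n\<close>, for \<open>P\<^sub>n\<close> the convex hull of the first \<open>n\<close> points \<open>Z 0, \<dots>, Z (n - 1)\<close>; the vectors \<open>C\<close>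
  and \<open>W\<close> may be random.\<close>

definition random_path_length ::
  "('w \<Rightarrow> 'a::euclidean_space) \<Rightarrow> ('w \<Rightarrow> 'a) \<Rightarrow> (nat \<Rightarrow> 'w \<Rightarrow> 'a) \<Rightarrow> nat \<Rightarrow> 'w \<Rightarrow> real" where
  "random_path_length C W Z n x =
     real (path_length (convex hull ((\<lambda>i. Z i x) ` {..<n})) (C x) (W x))"

text \<open>Independence of two random variables whose value types differ, as independence of the
  generated sigma-algebras.\<close>

definition indep_rv ::
  "'w measure \<Rightarrow> 'b measure \<Rightarrow> ('w \<Rightarrow> 'b) \<Rightarrow> 'c measure \<Rightarrow> ('w \<Rightarrow> 'c) \<Rightarrow> bool" where
  "indep_rv M N X N' Y \<longleftrightarrow>
     X \<in> M \<rightarrow>\<^sub>M N \<and> Y \<in> M \<rightarrow>\<^sub>M N' \<and>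
     prob_space.indep_set M (sets (vimage_algebra (space M) X N)) (sets (vimage_algebra (space M) Y N'))"

end

theory Submission
  imports Defs "HOL-Real_Asymp.Real_Asymp"
begin

text \<open>
  The projection of the uniform distribution on the sphere to the span of \<open>c\<close> and \<open>w\<close> has a density
  proportional to \<open>(1 - r\<^sup>2) powr ((d - 4) / 2)\<close> on the unit disc, \<open>r\<close> being the distance from the
  origin. So the length of the path is distributed as the number of upper edges of the convex hull
  of \<open>n\<close> independent points in the disc with this density.

  For the mean, the probability that no point lies above the line through two given points is
  integrated in line coordinates; this gives the order \<open>n powr (1 / (d - 1))\<close>.

  For the fluctuations, the upper half circle is divided into \<open>m\<close> arcs, \<open>m\<close> being of order
  \<open>(n / ln n) powr (1 / (d - 1))\<close>. Except with negligible probability there is a point in each of \<open>m\<close> small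
  caps, one per arc, and then the edges with normal in an arc only depend on the \<open>O(ln n)\<close> points in
  a slightly larger cap. Hence the number of edges is essentially a sum of \<open>m\<close> local functionals, each
  bounded by a multiple of \<open>ln n\<close>, and those of distant arcs are almost independent. This yields the
  upper bound for the variance and, by a differential equation for the characteristic function, the
  central limit theorem. For the lower bound, Cauchy-Schwarz is applied to the covariance of the
  number of edges with the number of points in the union of the larger caps: this covariance is
  governed by the increments of the mean number of edges.
\<close>

section \<open>Covariance of local functionals\<close>

text \<open>The number of points is fixed, so the contents of disjoint caps are never independent.
  An exchange coupling takes the place of Poissonisation: it bounds the covariance of bounded
  functionals of disjoint regions by a multiple of n times the product of the measures of the
  regions. The regions have measure of order ln n / n and their number m is at most n powr (1 / (d -
  1)). Accumulated over all pairs of arcs, the covariance error is therefore of order m^3 * (ln n)^2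
  / n, which d \<ge> 4 keeps logarithmic and hence negligible against the variance. The asymptotics
  of the mean says nothing about single increments, which the lower bound for the variance requires.
  But the probability that a given pair of points spans an upper edge is convex in the number of the
  other points, and convexity turns its decay rate into a bound for its decrements. The lower bound
  obtained is n powr (1 / (d - 1)) / ln n; the logarithm is the reason for the exponent a. The
  vectors c and w matter only up to a triangular change of the plane, so they may be taken
  orthonormal. The law of the length then does not depend on them, which settles the case of random
  vectors.\<close>

definition depends_on_region :: "'i set \<Rightarrow> 'a set \<Rightarrow> (('i \<Rightarrow> 'a) \<Rightarrow> 'b) \<Rightarrow> bool" where
  "depends_on_region I S f \<longleftrightarrow>
     (\<forall>x y. (\<forall>i\<in>I. x i \<in> S \<or> y i \<in> S \<longrightarrow> x i = y i) \<longrightarrow> f x = f y)"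

text \<open>Passes from two independent samples to one sample of independent pairs, on which an
  exchange can act in each coordinate separately.\<close>

lemma distr_zip_PiM:
  fixes N :: "'a measure" and I :: "'i set"
  assumes N: "prob_space N" and I: "finite I"
  shows "distr (Pi\<^sub>M I (\<lambda>_. N) \<Otimes>\<^sub>M Pi\<^sub>M I (\<lambda>_. N)) (Pi\<^sub>M I (\<lambda>_. N \<Otimes>\<^sub>M N))
           (\<lambda>(x, y). \<lambda>i\<in>I. (x i, y i)) = Pi\<^sub>M I (\<lambda>_. N \<Otimes>\<^sub>M N)"
    (is "distr (?P \<Otimes>\<^sub>M ?P) ?Q ?z = ?Q")
proof -
  interpret N: prob_space N by fact
  interpret NN: pair_prob_space N N ..
  interpret PN: product_sigma_finite "\<lambda>_::'i. N" by standard
  interpret PNN: product_sigma_finite "\<lambda>_::'i. N \<Otimes>\<^sub>M N" by standard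
  interpret P: prob_space ?P by (intro prob_space_PiM N)
  interpret sample_law: pair_prob_space ?P ?P ..
  have zm[measurable]: "?z \<in> ?P \<Otimes>\<^sub>M ?P \<rightarrow>\<^sub>M ?Q"
    unfolding split_beta by (rule measurable_restrict) measurable
  show ?thesis
  proof (rule PNN.PiM_eqI[OF I])
    fix A :: "'i \<Rightarrow> ('a \<times> 'a) set" assume A: "\<And>i. i \<in> I \<Longrightarrow> A i \<in> sets (N \<Otimes>\<^sub>M N)"
    have mA[measurable]: "PiE I A \<in> sets ?Q" using A I by (intro sets_PiM_I_finite) auto
    have "emeasure (distr (?P \<Otimes>\<^sub>M ?P) ?Q ?z) (PiE I A)
        = (\<integral>\<^sup>+ p. indicator (PiE I A) (?z p) \<partial>(?P \<Otimes>\<^sub>M ?P))"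
      by (simp add: nn_integral_distr flip: nn_integral_indicator)
    also have "\<dots> = (\<integral>\<^sup>+ x. \<integral>\<^sup>+ y. indicator (PiE I A) (?z (x, y)) \<partial>?P \<partial>?P)"
      by (subst sample_law.nn_integral_snd[symmetric] P.nn_integral_fst[symmetric]; simp)+
    also have "\<dots> = (\<integral>\<^sup>+ x. \<integral>\<^sup>+ y. (\<Prod>i\<in>I. indicator (A i) (x i, y i)) \<partial>?P \<partial>?P)"
    proof (intro nn_integral_cong)
      fix x y
      show "indicator (PiE I A) (?z (x, y)) = (\<Prod>i\<in>I. indicator (A i) (x i, y i) :: ennreal)"
      proof (cases "\<forall>i\<in>I. (x i, y i) \<in> A i")
        case True then show ?thesis by (auto simp: indicator_def PiE_iff)
      next
        case False
        then have "(\<Prod>i\<in>I. indicator (A i) (x i, y i) :: ennreal) = 0"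
          using I by (intro prod_zero) (auto simp: indicator_def)
        then show ?thesis using False by (auto simp: indicator_def PiE_iff)
      qed
    qed
    also have "\<dots> = (\<integral>\<^sup>+ x. (\<Prod>i\<in>I. \<integral>\<^sup>+ v. indicator (A i) (x i, v) \<partial>N) \<partial>?P)"
    proof (intro nn_integral_cong)
      fix x assume x: "x \<in> space ?P"
      show "(\<integral>\<^sup>+ y. (\<Prod>i\<in>I. indicator (A i) (x i, y i)) \<partial>?P) = (\<Prod>i\<in>I. \<integral>\<^sup>+ v. indicator (A i) (x i, v) \<partial>N)"
      proof (rule PN.product_nn_integral_prod[OF I])
        fix i assume i: "i \<in> I"
        then have [measurable]: "A i \<in> sets (N \<Otimes>\<^sub>M N)" and [measurable]: "x i \<in> space N"
          using A x by (auto simp: space_PiM)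
        show "(\<lambda>v. indicator (A i) (x i, v)) \<in> borel_measurable N" by measurable
      qed
    qed
    also have "\<dots> = (\<Prod>i\<in>I. \<integral>\<^sup>+ u. \<integral>\<^sup>+ v. indicator (A i) (u, v) \<partial>N \<partial>N)"
    proof (rule PN.product_nn_integral_prod[OF I])
      fix i assume i: "i \<in> I"
      then have [measurable]: "A i \<in> sets (N \<Otimes>\<^sub>M N)" using A by auto
      show "(\<lambda>u. \<integral>\<^sup>+ v. indicator (A i) (u, v) \<partial>N) \<in> borel_measurable N" by measurable
    qed
    also have "\<dots> = (\<Prod>i\<in>I. emeasure (N \<Otimes>\<^sub>M N) (A i))"
      using A by (intro prod.cong refl) (simp add: N.emeasure_pair_measure)
    finally show "emeasure (distr (?P \<Otimes>\<^sub>M ?P) ?Q ?z) (PiE I A) = (\<Prod>i\<in>I. emeasure (N \<Otimes>\<^sub>M N) (A i))" .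
  qed simp
qed

text \<open>Given an independent copy \<open>y\<close> of \<open>x\<close>, exchange \<open>x i\<close> and \<open>y i\<close> whenever neither lies in \<open>S\<close>.
  This preserves the joint law, does not change \<open>A x\<close>, and turns \<open>B y\<close> into a functional of a
  sample that agrees with \<open>x\<close> on \<open>R\<close> except with small probability.\<close>

lemma covariance_disjoint_regions:
  fixes N :: "'a measure" and I :: "'i set" and A B :: "('i \<Rightarrow> 'a) \<Rightarrow> real"
  defines "P \<equiv> Pi\<^sub>M I (\<lambda>_. N)"
  assumes N: "prob_space N" and I: "finite I"
    and S[measurable]: "S \<in> sets N" and R[measurable]: "R \<in> sets N" and disj: "S \<inter> R = {}"
    and A[measurable]: "A \<in> borel_measurable P" and B[measurable]: "B \<in> borel_measurable P"
    and bA: "\<And>x. \<bar>A x\<bar> \<le> a" and bB: "\<And>x. \<bar>B x\<bar> \<le> b"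
    and locA: "depends_on_region I S A" and locB: "depends_on_region I R B"
  shows "\<bar>(\<integral>x. A x * B x \<partial>P) - (\<integral>x. A x \<partial>P) * (\<integral>x. B x \<partial>P)\<bar>
           \<le> 4 * a * b * card I * measure N S * measure N R"
proof -
  interpret N: prob_space N by fact
  interpret NN: pair_prob_space N N ..
  interpret P: prob_space P unfolding P_def by (intro prob_space_PiM N)
  interpret sample_law: pair_prob_space P P ..
  let ?Q = "Pi\<^sub>M I (\<lambda>_::'i. N \<Otimes>\<^sub>M N)"
  have NNp: "prob_space (N \<Otimes>\<^sub>M N)" by (rule NN.P.prob_space_axioms)
  interpret Q: prob_space ?Q by (intro prob_space_PiM NNp)
  interpret QP: product_prob_space "\<lambda>_::'i. N \<Otimes>\<^sub>M N" I by standard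
  define \<theta> where "\<theta> = (\<lambda>(u, v). if u \<in> S \<or> v \<in> S then (u, v) else (v, u :: 'a))"
  have th_m[measurable]: "\<theta> \<in> N \<Otimes>\<^sub>M N \<rightarrow>\<^sub>M N \<Otimes>\<^sub>M N"
    unfolding \<theta>_def split_beta by measurable
  have th_inv: "distr (N \<Otimes>\<^sub>M N) (N \<Otimes>\<^sub>M N) \<theta> = N \<Otimes>\<^sub>M N"
  proof (rule measure_eqI)
    fix X assume "X \<in> sets (distr (N \<Otimes>\<^sub>M N) (N \<Otimes>\<^sub>M N) \<theta>)"
    then have X[measurable]: "X \<in> sets (N \<Otimes>\<^sub>M N)" by simp
    \<comment> \<open>\<open>\<theta>\<close> is the swap on the symmetric set \<open>?C\<close> and
      the identity off it, and the product of N with itself is invariant under the swap; hence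
      \<open>\<theta>\<close> preserves it.\<close>
    let ?C = "{p \<in> space (N \<Otimes>\<^sub>M N). fst p \<notin> S \<and> snd p \<notin> S}"
    have C[measurable]: "?C \<in> sets (N \<Otimes>\<^sub>M N)" by measurable
    let ?s = "\<lambda>(x, y). (y, x)"
    have sw: "emeasure (N \<Otimes>\<^sub>M N) (?s -` (X \<inter> ?C) \<inter> space (N \<Otimes>\<^sub>M N)) = emeasure (N \<Otimes>\<^sub>M N) (X \<inter> ?C)"
      by (subst (2) NN.distr_pair_swap, subst emeasure_distr) auto
    have e1: "\<theta> -` X \<inter> space (N \<Otimes>\<^sub>M N) = (X - ?C) \<union> (?s -` (X \<inter> ?C) \<inter> space (N \<Otimes>\<^sub>M N))"
      using sets.sets_into_space[OF X] by (auto simp: \<theta>_def space_pair_measure split: if_splits)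
    have m2: "?s -` (X \<inter> ?C) \<inter> space (N \<Otimes>\<^sub>M N) \<in> sets (N \<Otimes>\<^sub>M N)"
      by (rule measurable_sets[OF measurable_pair_swap']) auto
    have "emeasure (distr (N \<Otimes>\<^sub>M N) (N \<Otimes>\<^sub>M N) \<theta>) X
        = emeasure (N \<Otimes>\<^sub>M N) (X - ?C) + emeasure (N \<Otimes>\<^sub>M N) (?s -` (X \<inter> ?C) \<inter> space (N \<Otimes>\<^sub>M N))"
      using m2 by (subst emeasure_distr) (auto simp: e1 intro!: plus_emeasure[symmetric])
    also have "\<dots> = emeasure (N \<Otimes>\<^sub>M N) (X - ?C) + emeasure (N \<Otimes>\<^sub>M N) (X \<inter> ?C)" by (simp only: sw)
    also have "\<dots> = emeasure (N \<Otimes>\<^sub>M N) X"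
      by (subst plus_emeasure) (auto simp: Diff_Int_distrib2 Un_commute Int_Diff_Un intro!: arg_cong[where f="emeasure _"])
    finally show "emeasure (distr (N \<Otimes>\<^sub>M N) (N \<Otimes>\<^sub>M N) \<theta>) X = emeasure (N \<Otimes>\<^sub>M N) X" .
  qed simp
  define \<Theta> where "\<Theta> = (\<lambda>z. \<lambda>i\<in>I. \<theta> (z i))"
  have Th_m[measurable]: "\<Theta> \<in> ?Q \<rightarrow>\<^sub>M ?Q"
    unfolding \<Theta>_def by (rule measurable_restrict) measurable
  have Th_inv: "distr ?Q ?Q \<Theta> = ?Q"
    using distr_PiM_finite_prob_space'[OF I, of "\<lambda>_. N \<Otimes>\<^sub>M N" "\<lambda>_. N \<Otimes>\<^sub>M N" \<theta>] NNp
    by (simp add: th_inv \<Theta>_def compose_def[abs_def])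
  define X where "X = (\<lambda>z. \<lambda>i\<in>I. fst (z i :: 'a \<times> 'a))"
  define Y where "Y = (\<lambda>z. \<lambda>i\<in>I. snd (z i :: 'a \<times> 'a))"
  have [measurable]: "X \<in> ?Q \<rightarrow>\<^sub>M P" "Y \<in> ?Q \<rightarrow>\<^sub>M P"
    unfolding X_def Y_def P_def by (auto intro!: measurable_restrict)
  have zm[measurable]: "(\<lambda>(x, y). \<lambda>i\<in>I. (x i, y i)) \<in> P \<Otimes>\<^sub>M P \<rightarrow>\<^sub>M ?Q"
    unfolding split_beta P_def by (rule measurable_restrict) measurable
  have zip: "distr (P \<Otimes>\<^sub>M P) ?Q (\<lambda>(x, y). \<lambda>i\<in>I. (x i, y i)) = ?Q"
    unfolding P_def by (rule distr_zip_PiM[OF N I])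
  have res: "(\<lambda>i\<in>I. x i) = x" if "x \<in> space P" for x
    using that by (auto simp: P_def space_PiM PiE_iff extensional_restrict)
  have PX: "distr ?Q P X = P"
    unfolding X_def P_def using distr_PiM_finite_prob_space'[OF I, of "\<lambda>_. N \<Otimes>\<^sub>M N" "\<lambda>_. N" fst] NNp N
    by (simp add: NN.distr_pair_fst compose_def[abs_def] N.distr_pair_fst)
  have bab: "\<bar>A x * B y\<bar> \<le> a * b" for x y
    by (simp add: abs_mult mult_mono bA bB order_trans[OF abs_ge_zero bA])
  have a0: "0 \<le> a" using bA order_trans[OF abs_ge_zero] by blast
  have b0: "0 \<le> b" using bB order_trans[OF abs_ge_zero] by blast
  have "(\<integral>z. A (X z) * B (Y z) \<partial>?Q) = (\<integral>p. A (fst p) * B (snd p) \<partial>(P \<Otimes>\<^sub>M P))"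
  proof -
    have "(\<integral>z. A (X z) * B (Y z) \<partial>?Q) = (\<integral>z. A (X z) * B (Y z) \<partial>distr (P \<Otimes>\<^sub>M P) ?Q (\<lambda>(x, y). \<lambda>i\<in>I. (x i, y i)))"
      by (simp only: zip)
    also have "\<dots> = (\<integral>p. A (X (case p of (x, y) \<Rightarrow> \<lambda>i\<in>I. (x i, y i))) * B (Y (case p of (x, y) \<Rightarrow> \<lambda>i\<in>I. (x i, y i))) \<partial>(P \<Otimes>\<^sub>M P))"
      by (rule integral_distr) measurable
    also have "\<dots> = (\<integral>p. A (fst p) * B (snd p) \<partial>(P \<Otimes>\<^sub>M P))"
    proof (rule Bochner_Integration.integral_cong)
      fix p assume "p \<in> space (P \<Otimes>\<^sub>M P)"
      then obtain x y where p: "p = (x, y)" "x \<in> space P" "y \<in> space P" by (auto simp: space_pair_measure)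
      then show "A (X (case p of (x, y) \<Rightarrow> \<lambda>i\<in>I. (x i, y i))) * B (Y (case p of (x, y) \<Rightarrow> \<lambda>i\<in>I. (x i, y i)))
            = A (fst p) * B (snd p)"
        using res by (simp add: X_def Y_def cong: restrict_cong)
    qed simp
    finally show ?thesis .
  qed
  also have "\<dots> = (\<integral>x. A x \<partial>P) * (\<integral>x. B x \<partial>P)"
  proof -
    have "integrable (P \<Otimes>\<^sub>M P) (\<lambda>p. A (fst p) * B (snd p))"
      by (rule sample_law.integrable_const_bound[where B="a * b"]) (auto simp: bab)
    then have "(\<integral>p. A (fst p) * B (snd p) \<partial>(P \<Otimes>\<^sub>M P)) = (\<integral>x. (\<integral>y. A x * B y \<partial>P) \<partial>P)"
      using sample_law.integral_fst'[of "\<lambda>p. A (fst p) * B (snd p)"] by simp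
    then show ?thesis by simp
  qed
  finally have prod: "(\<integral>z. A (X z) * B (Y z) \<partial>?Q) = (\<integral>x. A x \<partial>P) * (\<integral>x. B x \<partial>P)" .
  have "(\<integral>z. A (X z) * B (Y z) \<partial>?Q) = (\<integral>z. A (X z) * B (Y z) \<partial>distr ?Q ?Q \<Theta>)" by (simp only: Th_inv)
  also have "\<dots> = (\<integral>z. A (X (\<Theta> z)) * B (Y (\<Theta> z)) \<partial>?Q)" by (rule integral_distr) measurable
  also have "\<dots> = (\<integral>z. A (X z) * B (Y (\<Theta> z)) \<partial>?Q)"
  proof (rule Bochner_Integration.integral_cong)
    fix z
    have "A (X (\<Theta> z)) = A (X z)"
      using locA unfolding depends_on_region_def
      by (rule allE[where x="X (\<Theta> z)"]) (auto simp: X_def \<Theta>_def \<theta>_def split_beta)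
    then show "A (X (\<Theta> z)) * B (Y (\<Theta> z)) = A (X z) * B (Y (\<Theta> z))" by simp
  qed simp
  finally have eq2: "(\<integral>z. A (X z) * B (Y (\<Theta> z)) \<partial>?Q) = (\<integral>x. A x \<partial>P) * (\<integral>x. B x \<partial>P)" using prod by simp
  have "(\<integral>z. A (X z) * B (X z) \<partial>?Q) = (\<integral>x. A x * B x \<partial>distr ?Q P X)"
    by (rule integral_distr[symmetric]) measurable
  then have eq1: "(\<integral>z. A (X z) * B (X z) \<partial>?Q) = (\<integral>x. A x * B x \<partial>P)" by (simp only: PX)
  \<comment> \<open>Inside R the samples \<open>X z\<close> and \<open>Y (\<Theta> z)\<close> can
    differ only at an index where one point of the pair is in S and the other in R: a pair avoiding
    S is exchanged, which makes them equal there. A union bound over the indices gives the factor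
    \<open>card I\<close>, and the two orders of the pair give a factor 2.\<close>
  define E where "E i = {z \<in> space ?Q. (fst (z i) \<in> S \<and> snd (z i) \<in> R) \<or> (fst (z i) \<in> R \<and> snd (z i) \<in> S)}" for i
  have E_m[measurable]: "E i \<in> sets ?Q" if "i \<in> I" for i
    using that unfolding E_def by measurable
  have PE: "measure ?Q (E i) \<le> 2 * measure N S * measure N R" if i: "i \<in> I" for i
  proof -
    have d: "distr ?Q (N \<Otimes>\<^sub>M N) (\<lambda>z. z i) = N \<Otimes>\<^sub>M N" using i by (rule QP.PiM_component)
    have "E i = (\<lambda>z. z i) -` (S \<times> R \<union> R \<times> S) \<inter> space ?Q" by (auto simp: E_def mem_Times_iff)
    then have "measure ?Q (E i) = measure (distr ?Q (N \<Otimes>\<^sub>M N) (\<lambda>z. z i)) (S \<times> R \<union> R \<times> S)"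
      using i by (subst measure_distr) auto
    also have "\<dots> \<le> measure (N \<Otimes>\<^sub>M N) (S \<times> R) + measure (N \<Otimes>\<^sub>M N) (R \<times> S)"
      unfolding d by (intro measure_Un_le) auto
    also have "\<dots> = 2 * measure N S * measure N R"
      by (simp add: N.emeasure_pair_measure_Times measure_def enn2real_mult)
    finally show ?thesis .
  qed
  have diff: "\<bar>A (X z) * B (X z) - A (X z) * B (Y (\<Theta> z))\<bar> \<le> (\<Sum>i\<in>I. 2 * a * b * indicator (E i) z)"
    if z: "z \<in> space ?Q" for z
  proof (cases "\<exists>i\<in>I. z \<in> E i")
    case True
    then obtain i where i: "i \<in> I" "z \<in> E i" by blast
    have "\<bar>A (X z) * B (X z) - A (X z) * B (Y (\<Theta> z))\<bar> \<le> a * b + a * b"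
      using bab[of "X z" "X z"] bab[of "X z" "Y (\<Theta> z)"] by linarith
    also have "\<dots> = 2 * a * b * indicator (E i) z" using i by simp
    also have "\<dots> \<le> (\<Sum>i\<in>I. 2 * a * b * indicator (E i) z)"
      by (rule member_le_sum[OF i(1)]) (auto simp: I a0 b0)
    finally show ?thesis .
  next
    case False
    have "B (X z) = B (Y (\<Theta> z))"
    proof -
      have "\<forall>i\<in>I. X z i \<in> R \<or> Y (\<Theta> z) i \<in> R \<longrightarrow> X z i = Y (\<Theta> z) i"
        using False z disj by (auto simp: X_def Y_def \<Theta>_def \<theta>_def E_def split_beta)
      then show ?thesis using locB unfolding depends_on_region_def by blast
    qed
    then show ?thesis by (simp add: sum_nonneg a0 b0)
  qed
  have iAB1: "integrable ?Q (\<lambda>z. A (X z) * B (X z))" and iAB2: "integrable ?Q (\<lambda>z. A (X z) * B (Y (\<Theta> z)))"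
    by (rule Q.integrable_const_bound[where B="a * b"]; use bab in \<open>auto\<close>)+
  have iE: "integrable ?Q (\<lambda>z. 2 * a * b * indicator (E i) z)" if "i \<in> I" for i
    using E_m[OF that] by (intro integrable_mult_right Q.integrable_const_bound[where B=1]) auto
  have "\<bar>(\<integral>x. A x * B x \<partial>P) - (\<integral>x. A x \<partial>P) * (\<integral>x. B x \<partial>P)\<bar>
      = \<bar>\<integral>z. A (X z) * B (X z) - A (X z) * B (Y (\<Theta> z)) \<partial>?Q\<bar>"
    using iAB1 iAB2 eq1 eq2 by simp
  also have "\<dots> \<le> (\<integral>z. \<bar>A (X z) * B (X z) - A (X z) * B (Y (\<Theta> z))\<bar> \<partial>?Q)"
    by (rule integral_abs_bound)
  also have "\<dots> \<le> (\<integral>z. (\<Sum>i\<in>I. 2 * a * b * indicator (E i) z) \<partial>?Q)"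
    using iE iAB1 iAB2 diff by (intro integral_mono) auto
  also have "\<dots> = (\<Sum>i\<in>I. 2 * a * b * measure ?Q (E i))"
    using iE E_m by (subst Bochner_Integration.integral_sum) auto
  also have "\<dots> \<le> (\<Sum>i\<in>I. 2 * a * b * (2 * measure N S * measure N R))"
    using PE a0 b0 by (intro sum_mono mult_left_mono) auto
  also have "\<dots> = 4 * a * b * card I * measure N S * measure N R" by simp
  finally show ?thesis .
qed

section \<open>Upper edges of planar point sets\<close>

text \<open>For \<open>fst p < fst q\<close> this says that z lies strictly below the line through p
  and q. Multiplying out the slope leaves the sign of an orientation determinant.\<close>

definition below :: "real \<times> real \<Rightarrow> real \<times> real \<Rightarrow> real \<times> real \<Rightarrow> bool" where
  "below p q z \<longleftrightarrow> (fst q - fst p) * (snd z - snd p) < (snd q - snd p) * (fst z - fst p)"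

text \<open>An edge is an ordered pair of indices with the left endpoint first, so it is counted
  once.\<close>

definition upper_edge :: "'i set \<Rightarrow> ('i \<Rightarrow> real \<times> real) \<Rightarrow> 'i \<Rightarrow> 'i \<Rightarrow> bool" where
  "upper_edge I x i j \<longleftrightarrow> i \<in> I \<and> j \<in> I \<and> fst (x i) < fst (x j) \<and>
     (\<forall>l\<in>I - {i, j}. below (x i) (x j) (x l))"

definition upper_edges :: "'i set \<Rightarrow> ('i \<Rightarrow> real \<times> real) \<Rightarrow> nat" where
  "upper_edges I x = card {(i, j). upper_edge I x i j}"

text \<open>Angles are measured from the vertical axis: the upper half circle is the range from -pi
  / 2 to pi / 2, and the normal of an upper edge has the arctangent of its negated slope as its
  angle.\<close>

definition dir :: "real \<Rightarrow> real \<times> real" where "dir \<phi> = (sin \<phi>, cos \<phi>)"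

definition normal_angle :: "real \<times> real \<Rightarrow> real \<times> real \<Rightarrow> real" where
  "normal_angle p q = arctan ((snd p - snd q) / (fst q - fst p))"

definition arc_index :: "nat \<Rightarrow> real \<times> real \<Rightarrow> real \<times> real \<Rightarrow> nat" where
  "arc_index m p q = nat \<lfloor>(normal_angle p q + pi / 2) / (pi / m)\<rfloor>"

definition center :: "nat \<Rightarrow> nat \<Rightarrow> real" where
  "center m k = (k + 1 / 2) * (pi / m) - pi / 2"

definition cap :: "real \<times> real \<Rightarrow> real \<Rightarrow> (real \<times> real) set" where
  "cap u s = {z. norm z \<le> 1 \<and> 1 - s \<le> z \<bullet> u}"

text \<open>With w = pi / m, the depths 2 w^2 of the region and w^2 / 8 of the cell are chosen such
  that for every direction of the k-th arc the cap of depth w^2 contains the cell and is contained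
  in the region.\<close>

definition region :: "nat \<Rightarrow> nat \<Rightarrow> (real \<times> real) set" where
  "region m k = cap (dir (center m k)) (2 * (pi / m)\<^sup>2)"

definition cell :: "nat \<Rightarrow> nat \<Rightarrow> (real \<times> real) set" where
  "cell m k = cap (dir (center m k)) ((pi / m)\<^sup>2 / 8)"

text \<open>The endpoints are also required to lie in the region, so that the predicate is local on
  every sample, including those where it differs from \<open>upper_edge\<close>.\<close>

definition local_edge ::
  "nat \<Rightarrow> nat \<Rightarrow> 'i set \<Rightarrow> ('i \<Rightarrow> real \<times> real) \<Rightarrow> 'i \<Rightarrow> 'i \<Rightarrow> bool" where
  "local_edge m k I x i j \<longleftrightarrow> i \<in> I \<and> j \<in> I \<and> fst (x i) < fst (x j) \<and> arc_index m (x i) (x j) = k \<and>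
     x i \<in> region m k \<and> x j \<in> region m k \<and>
     (\<forall>l\<in>I - {i, j}. x l \<in> region m k \<longrightarrow> below (x i) (x j) (x l))"

definition local_edges :: "nat \<Rightarrow> nat \<Rightarrow> 'i set \<Rightarrow> ('i \<Rightarrow> real \<times> real) \<Rightarrow> nat" where
  "local_edges m k I x = card {(i, j). local_edge m k I x i j}"

section \<open>Geometry of caps and localisation of upper edges\<close>

lemma norm_dir [simp]: "norm (dir \<phi>) = 1"
  by (simp add: dir_def norm_Pair)

lemma inner_dir: "z \<bullet> dir \<phi> = fst z * sin \<phi> + snd z * cos \<phi>"
  by (simp add: dir_def inner_prod_def)

lemma normal_angle_bounds: "- (pi / 2) < normal_angle p q" "normal_angle p q < pi / 2"
  unfolding normal_angle_def by (rule arctan_lbound arctan_ubound)+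

text \<open>\<open>dir (normal_angle p q)\<close> is the unit normal of the line through p and q
  that points upwards, so the line is a level set of the corresponding linear form.\<close>

lemma
  assumes pq: "fst p < fst q"
  shows below_iff_inner: "below p q z \<longleftrightarrow> z \<bullet> dir (normal_angle p q) < p \<bullet> dir (normal_angle p q)"
    and inner_normal_angle: "q \<bullet> dir (normal_angle p q) = p \<bullet> dir (normal_angle p q)"
proof -
  let ?f = "normal_angle p q"
  have c: "cos ?f > 0" using normal_angle_bounds[of p q] by (intro cos_gt_zero_pi) auto
  have t: "tan ?f = (snd p - snd q) / (fst q - fst p)" by (simp add: normal_angle_def tan_arctan)
  have s: "sin ?f = (snd p - snd q) / (fst q - fst p) * cos ?f" using c t by (simp add: tan_def field_simps)
  have d: "fst q - fst p > 0" using pq by simp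
  have sc: "(fst q - fst p) * sin ?f = (snd p - snd q) * cos ?f" using d by (subst s) (simp add: field_simps)
  have "z \<bullet> dir ?f < p \<bullet> dir ?f \<longleftrightarrow> (fst q - fst p) * (z \<bullet> dir ?f) < (fst q - fst p) * (p \<bullet> dir ?f)"
    using d by simp
  also have "(fst q - fst p) * (z \<bullet> dir ?f) = (fst z * (snd p - snd q) + snd z * (fst q - fst p)) * cos ?f"
    unfolding inner_dir using sc by algebra
  also have "(fst q - fst p) * (p \<bullet> dir ?f) = (fst p * (snd p - snd q) + snd p * (fst q - fst p)) * cos ?f"
    unfolding inner_dir using sc by algebra
  finally have "z \<bullet> dir ?f < p \<bullet> dir ?f \<longleftrightarrow> (fst z * (snd p - snd q) + snd z * (fst q - fst p)) < (fst p * (snd p - snd q) + snd p * (fst q - fst p))"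
    using c by simp
  also have "\<dots> \<longleftrightarrow> below p q z" by (auto simp: below_def algebra_simps)
  finally show "below p q z \<longleftrightarrow> z \<bullet> dir ?f < p \<bullet> dir ?f" by simp
  have "q \<bullet> dir ?f - p \<bullet> dir ?f = (fst q - fst p) * sin ?f + (snd q - snd p) * cos ?f"
    by (simp add: inner_dir algebra_simps)
  also have "\<dots> = 0" unfolding sc by (simp add: algebra_simps)
  finally show "q \<bullet> dir ?f = p \<bullet> dir ?f" by simp
qed

lemma arc_less: assumes "m > 0" shows "arc_index m p q < m"
proof -
  let ?y = "(normal_angle p q + pi / 2) / (pi / m)"
  have "?y < m" using normal_angle_bounds[of p q] assms by (simp add: field_simps)
  then have "\<lfloor>?y\<rfloor> < int m" by (simp only: floor_less_iff of_int_of_nat_eq)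
  then show ?thesis unfolding arc_index_def using assms by linarith
qed

lemma arc_center: assumes "m > 0"
  shows "\<bar>normal_angle p q - center m (arc_index m p q)\<bar> \<le> (pi / m) / 2"
proof -
  define w where "w = pi / m"
  define y where "y = (normal_angle p q + pi / 2) / w"
  have w: "w > 0" using assms by (simp add: w_def)
  have y0: "0 \<le> y" unfolding y_def using normal_angle_bounds[of p q] w by (intro divide_nonneg_pos) auto
  have k: "real (arc_index m p q) = of_int \<lfloor>y\<rfloor>" unfolding arc_index_def w_def[symmetric] y_def[symmetric] using y0 by simp
  have b: "real (arc_index m p q) \<le> y" "y < real (arc_index m p q) + 1" unfolding k by linarith+
  have "y * w = normal_angle p q + pi / 2" using w by (simp add: y_def)
  then have "normal_angle p q = y * w - pi / 2" by linarith
  then have "normal_angle p q - center m (arc_index m p q) = (y - (real (arc_index m p q) + 1 / 2)) * w"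
    unfolding center_def w_def[symmetric] by (simp add: algebra_simps)
  also have "\<bar>\<dots>\<bar> \<le> 1 / 2 * w"
  proof -
    have "\<bar>y - (real (arc_index m p q) + 1 / 2)\<bar> \<le> 1 / 2" using b by linarith
    then show ?thesis unfolding abs_mult using w by (intro mult_mono) auto
  qed
  finally show ?thesis by (simp add: w_def)
qed

text \<open>In the frame of \<open>dir \<psi>\<close> the normal coordinate of z is at least 1 - s,
  so the unit disc leaves at most sqrt (2 * s) for the tangential one. Turning the frame by at most
  \<delta> costs \<delta>^2 / 2 through the cosine and \<delta> * sqrt (2 * s) through the
  sine.\<close>

lemma cap_shift:
  assumes z: "z \<in> cap (dir \<psi>) s" and s: "0 \<le> s" "s \<le> 1" and d: "\<bar>\<phi> - \<psi>\<bar> \<le> \<delta>" "\<delta> \<le> 1"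
  shows "1 - s - \<delta>\<^sup>2 / 2 - \<delta> * sqrt (2 * s) \<le> z \<bullet> dir \<phi>"
proof -
  let ?a = "z \<bullet> dir \<psi>" and ?b = "fst z * cos \<psi> - snd z * sin \<psi>"
  have a1: "1 - s \<le> ?a" and nz: "norm z \<le> 1" using z by (auto simp: cap_def)
  have "?a\<^sup>2 + ?b\<^sup>2 = ((sin \<psi>)\<^sup>2 + (cos \<psi>)\<^sup>2) * ((fst z)\<^sup>2 + (snd z)\<^sup>2)"
    unfolding inner_dir by algebra
  also have "\<dots> = (norm z)\<^sup>2" by (simp add: norm_prod_def)
  also have "\<dots> \<le> 1" using nz by (simp add: abs_square_le_1)
  finally have ab: "?a\<^sup>2 + ?b\<^sup>2 \<le> 1" .
  have "(1 - s)\<^sup>2 \<le> ?a\<^sup>2" using a1 s by (intro power_mono) auto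
  moreover have "(1 - s)\<^sup>2 = 1 - 2 * s + s\<^sup>2" by (simp add: power2_diff)
  ultimately have "?b\<^sup>2 \<le> 2 * s" using ab zero_le_power2[of s] by linarith
  then have b: "\<bar>?b\<bar> \<le> sqrt (2 * s)" by (metis real_sqrt_abs real_sqrt_le_iff)
  have d0: "0 \<le> \<delta>" using d by linarith
  have dd: "(\<phi> - \<psi>)\<^sup>2 \<le> \<delta>\<^sup>2" using power_mono[OF d(1), of 2] by simp
  have c: "1 - \<delta>\<^sup>2 / 2 \<le> cos (\<phi> - \<psi>)"
  proof -
    have "1 - (\<phi> - \<psi>)\<^sup>2 / 2 \<le> cos (\<phi> - \<psi>)" 
    proof -
      have "cos (\<phi> - \<psi>) = cos (2 * ((\<phi> - \<psi>) / 2))" by (simp only: nonzero_mult_div_cancel_left times_divide_eq_right)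
      then have "cos (\<phi> - \<psi>) = 1 - 2 * \<bar>sin ((\<phi> - \<psi>) / 2)\<bar>\<^sup>2" unfolding cos_double_sin by simp
      moreover have "\<bar>sin ((\<phi> - \<psi>) / 2)\<bar>\<^sup>2 \<le> \<bar>(\<phi> - \<psi>) / 2\<bar>\<^sup>2"
        by (intro power_mono abs_sin_x_le_abs_x) auto
      ultimately show ?thesis by (simp add: power_divide)
    qed
    then show ?thesis using dd by linarith
  qed
  have c0: "0 \<le> 1 - \<delta>\<^sup>2 / 2" using d0 d(2) by (smt (verit) field_sum_of_halves power_le_one)
  have eq: "z \<bullet> dir \<phi> = cos (\<phi> - \<psi>) * ?a + sin (\<phi> - \<psi>) * ?b"
  proof -
    have "z \<bullet> dir \<phi> = z \<bullet> dir (\<psi> + (\<phi> - \<psi>))" by simp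
    also have "\<dots> = cos (\<phi> - \<psi>) * ?a + sin (\<phi> - \<psi>) * ?b"
      unfolding inner_dir sin_add cos_add by (simp add: algebra_simps)
    finally show ?thesis .
  qed
  have "\<bar>sin (\<phi> - \<psi>) * ?b\<bar> \<le> \<delta> * sqrt (2 * s)"
    unfolding abs_mult using abs_sin_x_le_abs_x[of "\<phi> - \<psi>"] d(1) b d0 by (intro mult_mono) auto
  moreover have "(1 - \<delta>\<^sup>2 / 2) * (1 - s) \<le> cos (\<phi> - \<psi>) * ?a"
    using c c0 a1 s by (intro mult_mono) auto
  moreover have "1 - s - \<delta>\<^sup>2 / 2 \<le> (1 - \<delta>\<^sup>2 / 2) * (1 - s)"
    using s by (simp add: algebra_simps)
  ultimately show ?thesis unfolding eq by linarith
qed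

lemma cap_subset_region:
  assumes m: "m \<ge> 4" and d: "\<bar>\<phi> - center m k\<bar> \<le> (pi / m) / 2"
  shows "cap (dir \<phi>) ((pi / m)\<^sup>2) \<subseteq> region m k"
proof
  define w where "w = pi / m"
  have w: "0 < w" "w \<le> 1" using m pi_less_4 by (auto simp: w_def field_simps)
  fix z assume "z \<in> cap (dir \<phi>) ((pi / m)\<^sup>2)"
  then have z: "z \<in> cap (dir \<phi>) (w\<^sup>2)" by (simp add: w_def)
  have "1 - w\<^sup>2 - (w / 2)\<^sup>2 / 2 - w / 2 * sqrt (2 * w\<^sup>2) \<le> z \<bullet> dir (center m k)"
    using w d by (intro cap_shift[OF z]) (auto simp: w_def[symmetric] abs_minus_commute power_le_one)
  moreover have "w / 2 * sqrt (2 * w\<^sup>2) \<le> 3 / 4 * w\<^sup>2"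
  proof -
    have "sqrt (2 * w\<^sup>2) = sqrt 2 * w" using w by (simp add: real_sqrt_mult)
    moreover have "sqrt 2 \<le> 3 / 2" by (rule real_le_lsqrt) (auto simp: power2_eq_square)
    ultimately show ?thesis using w mult_right_mono[of "sqrt 2" "3 / 2" "w * w"] by (simp add: power2_eq_square mult_ac)
  qed
  moreover have "(w / 2)\<^sup>2 / 2 = w\<^sup>2 / 8" by (simp add: power2_eq_square)
  moreover have "0 \<le> w\<^sup>2" by simp
  ultimately have "1 - 2 * w\<^sup>2 \<le> z \<bullet> dir (center m k)" by linarith
  then show "z \<in> region m k" using z by (simp add: region_def cap_def w_def)
qed

lemma cell_subset_cap:
  assumes m: "m \<ge> 4" and d: "\<bar>\<phi> - center m k\<bar> \<le> (pi / m) / 2"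
  shows "cell m k \<subseteq> cap (dir \<phi>) ((pi / m)\<^sup>2)"
proof
  define w where "w = pi / m"
  have w: "0 < w" "w \<le> 1" using m pi_less_4 by (auto simp: w_def field_simps)
  fix z assume z: "z \<in> cell m k"
  have "w\<^sup>2 \<le> 1" using w by (simp add: power_le_one)
  then have "1 - w\<^sup>2 / 8 - (w / 2)\<^sup>2 / 2 - w / 2 * sqrt (2 * (w\<^sup>2 / 8)) \<le> z \<bullet> dir \<phi>"
    using w d by (intro cap_shift[OF z[unfolded cell_def, folded w_def]]) (auto simp: w_def[symmetric])
  moreover have "sqrt (2 * (w\<^sup>2 / 8)) = w / 2"
    using w by (intro real_sqrt_unique) (auto simp: power2_eq_square)
  then have "w / 2 * sqrt (2 * (w\<^sup>2 / 8)) = w\<^sup>2 / 4" by (simp add: power2_eq_square)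
  moreover have "(w / 2)\<^sup>2 / 2 = w\<^sup>2 / 8" by (simp add: power2_eq_square)
  moreover have "0 \<le> w\<^sup>2" by simp
  ultimately have "1 - w\<^sup>2 \<le> z \<bullet> dir \<phi>" by linarith
  then show "z \<in> cap (dir \<phi>) ((pi / m)\<^sup>2)" using z by (simp add: cell_def cap_def w_def)
qed

lemma cell_subset_region: "cell m k \<subseteq> region m k"
proof
  fix z assume z: "z \<in> cell m k"
  define q where "q = (pi / real m)\<^sup>2"
  have "q \<ge> 0" by (simp add: q_def)
  then show "z \<in> region m k" using z unfolding cell_def region_def cap_def q_def[symmetric] by auto
qed

lemma sin_ge_half: assumes "0 \<le> x" "x \<le> pi / 2" shows "x / 2 \<le> sin (x :: real)"
proof -
  have "x < 1.6" using assms(2) pi_approx by simp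
  then have "x\<^sup>2 \<le> 3" using assms(1) power_mono[of x "1.6" 2] by (simp add: power2_eq_square)
  then have "x * x\<^sup>2 \<le> x * 3" using assms(1) by (intro mult_left_mono) auto
  moreover have "x - x ^ 3 / 6 \<le> sin x"
    using Maclaurin_sin_bound[of x 3] assms
    by (simp add: eval_nat_numeral sin_coeff_def abs_if split: if_splits)
  ultimately show ?thesis by (simp add: power3_eq_cube power2_eq_square)
qed

lemma power2_norm_diff:
  fixes z u :: "'a::real_inner" shows "(norm (z - u))\<^sup>2 = (norm z)\<^sup>2 + (norm u)\<^sup>2 - 2 * (z \<bullet> u)"
  by (simp add: power2_norm_eq_inner inner_diff_left inner_diff_right inner_commute)

lemma dist_dir: "(norm (dir a - dir b))\<^sup>2 = (2 * sin ((a - b) / 2))\<^sup>2"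
proof -
  have "(norm (dir a - dir b))\<^sup>2 = 2 - 2 * (dir a \<bullet> dir b)"
    unfolding power2_norm_diff by simp
  also have "dir a \<bullet> dir b = cos (a - b)"
    unfolding inner_dir cos_diff by (simp add: dir_def)
  also have "cos (a - b) = cos (2 * ((a - b) / 2))"
    by (simp only: nonzero_mult_div_cancel_left times_divide_eq_right)
  also have "\<dots> = 1 - 2 * (sin ((a - b) / 2))\<^sup>2" by (rule cos_double_sin)
  also have "2 - 2 * (1 - 2 * c\<^sup>2) = (2 * c)\<^sup>2" for c :: real by (simp add: power2_eq_square)
  finally show ?thesis .
qed

lemma region_near_dir:
  assumes "z \<in> region m k" shows "norm (z - dir (center m k)) \<le> 2 * (pi / m)"
proof (rule power2_le_imp_le)
  have z: "norm z \<le> 1" "1 - 2 * (pi / m)\<^sup>2 \<le> z \<bullet> dir (center m k)" using assms unfolding region_def cap_def by blast+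
  have z2: "(norm z)\<^sup>2 \<le> 1" using z(1) by (intro power_le_one) auto
  have *: "a + 1\<^sup>2 - 2 * b \<le> (2 * c)\<^sup>2" if "a \<le> 1" "1 - 2 * c\<^sup>2 \<le> b" for a b c :: real
    using that by (simp add: power2_eq_square)
  show "(norm (z - dir (center m k)))\<^sup>2 \<le> (2 * (pi / m))\<^sup>2"
    unfolding power2_norm_diff norm_dir by (rule *[OF z2 z(2)])
qed auto

text \<open>Origin of the constant 8: a region lies within 2 w of its central direction, w = pi / m,
  so a common point puts the two directions at distance at most 4 w. For an angle D > 8 w their
  chord 2 * sin (D / 2) is at least D / 2, which exceeds 4 w.\<close>

lemma region_disjoint:
  assumes kl: "k < m" "l < m" "k + 8 < l"
  shows "region m k \<inter> region m l = {}"
proof (rule ccontr)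
  assume "region m k \<inter> region m l \<noteq> {}"
  then obtain z where z: "z \<in> region m k" "z \<in> region m l" by blast
  define w where "w = pi / m"
  have w: "0 < w" using kl by (simp add: w_def)
  define D where "D = center m l - center m k"
  have D: "D = (real l - real k) * w" by (simp add: D_def center_def w_def algebra_simps)
  have Dl: "8 * w < D" unfolding D using kl w by (intro mult_strict_right_mono) auto
  have Du: "D \<le> pi"
  proof -
    have "D \<le> m * w" unfolding D using kl w by (intro mult_right_mono) auto
    also have "m * w = pi" using kl by (simp add: w_def)
    finally show ?thesis .
  qed
  have "norm (dir (center m l) - dir (center m k)) \<le> norm (z - dir (center m k)) + norm (z - dir (center m l))"
    using norm_triangle_ineq4[of "z - dir (center m k)" "z - dir (center m l)"] by simp
  also have "\<dots> \<le> 2 * w + 2 * w"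
    unfolding w_def by (intro add_mono region_near_dir z)
  finally have n: "norm (dir (center m l) - dir (center m k)) \<le> 4 * w" by linarith
  have s0: "0 \<le> sin (D / 2)" using Dl w Du by (intro sin_ge_zero) linarith+
  have "norm (dir (center m l) - dir (center m k)) = 2 * sin (D / 2)"
    unfolding D_def by (rule power2_eq_imp_eq[OF dist_dir]) (use s0 in \<open>simp_all add: D_def\<close>)
  moreover have "D / 2 / 2 \<le> sin (D / 2)" using Dl w Du by (intro sin_ge_half) linarith+
  ultimately have "D \<le> 8 * w" using n by linarith
  then show False using Dl by simp
qed

text \<open>Let u be the normal of the line and s = (pi / m)^2. The point in the cell has height at
  least 1 - s in direction u. If no point lies above the line, the line has at least this height, so
  both endpoints are in the region. Conversely, a point outside the region has height below 1 - s;
  if it were not below the line, the point in the cell, which is in the region, would be above the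
  line.\<close>

theorem upper_edge_iff_local_edge:
  assumes m: "m \<ge> 4" and cells: "\<And>k. k < m \<Longrightarrow> \<exists>i\<in>I. x i \<in> cell m k"
    and disk: "\<And>i. i \<in> I \<Longrightarrow> norm (x i) \<le> 1"
  shows "upper_edge I x i j \<and> arc_index m (x i) (x j) = k \<longleftrightarrow> local_edge m k I x i j"
proof (cases "i \<in> I \<and> j \<in> I \<and> fst (x i) < fst (x j) \<and> k = arc_index m (x i) (x j)")
  case False
  then show ?thesis unfolding upper_edge_def local_edge_def by blast
next
  case True
  then have ij: "i \<in> I" "j \<in> I" and lt: "fst (x i) < fst (x j)" and k: "k = arc_index m (x i) (x j)" by auto
  define s where "s = (pi / m)\<^sup>2"
  define u where "u = dir (normal_angle (x i) (x j))"
  have d: "\<bar>normal_angle (x i) (x j) - center m k\<bar> \<le> (pi / m) / 2"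
    unfolding k using m by (intro arc_center) auto
  have "k < m" unfolding k using m by (intro arc_less) auto
  then obtain c where c: "c \<in> I" "x c \<in> cell m k" using cells by blast
  have cr: "x c \<in> region m k" using c(2) cell_subset_region by blast
  have "x c \<in> cap u s" using cell_subset_cap[OF m d] c(2) unfolding u_def s_def by blast
  then have cu: "1 - s \<le> x c \<bullet> u" by (simp add: cap_def)
  have reg: "z \<in> region m k" if "norm z \<le> 1" "1 - s \<le> z \<bullet> u" for z
    using cap_subset_region[OF m d] that unfolding u_def s_def cap_def by blast
  have bel: "below (x i) (x j) z \<longleftrightarrow> z \<bullet> u < x i \<bullet> u" for z
    unfolding u_def by (rule below_iff_inner[OF lt])
  have ju: "x j \<bullet> u = x i \<bullet> u" unfolding u_def by (rule inner_normal_angle[OF lt])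
  have "(\<forall>l\<in>I - {i, j}. below (x i) (x j) (x l)) \<longleftrightarrow>
      x i \<in> region m k \<and> x j \<in> region m k \<and> (\<forall>l\<in>I - {i, j}. x l \<in> region m k \<longrightarrow> below (x i) (x j) (x l))"
    (is "?A \<longleftrightarrow> ?B")
  proof
    assume A: ?A
    have "x c \<bullet> u \<le> x i \<bullet> u"
    proof (cases "c \<in> I - {i, j}")
      case True
      then have "x c \<bullet> u < x i \<bullet> u" using A unfolding bel by blast
      then show ?thesis by simp
    next
      case False
      then have "c = i \<or> c = j" using c(1) by blast
      then show ?thesis using ju by auto
    qed
    then have "1 - s \<le> x i \<bullet> u" using cu by linarith
    then show ?B using reg disk ij ju A by simp
  next
    assume B: ?B
    show ?A
    proof (rule ccontr)
      assume "\<not> ?A"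
      then obtain l where l: "l \<in> I - {i, j}" "\<not> x l \<bullet> u < x i \<bullet> u" unfolding bel by blast
      then have "x l \<notin> region m k" using B unfolding bel by blast
      then have "x l \<bullet> u < 1 - s" using reg[of "x l"] disk[of l] l(1) by fastforce
      then have lt: "x i \<bullet> u < x c \<bullet> u" using l(2) cu by linarith
      then have "c \<in> I - {i, j}" using c(1) ju by auto
      then show False using B cr lt unfolding bel by fastforce
    qed
  qed
  then show ?thesis unfolding upper_edge_def local_edge_def using True by blast
qed

theorem upper_edges_eq_sum:
  assumes I: "finite I" and m: "m \<ge> 4" and cells: "\<And>k. k < m \<Longrightarrow> \<exists>i\<in>I. x i \<in> cell m k"
    and disk: "\<And>i. i \<in> I \<Longrightarrow> norm (x i) \<le> 1"
  shows "upper_edges I x = (\<Sum>k<m. local_edges m k I x)"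
proof -
  have fin: "finite {(i, j). local_edge m k I x i j}" for k
    by (rule finite_subset[of _ "I \<times> I"]) (auto simp: local_edge_def I)
  have al: "arc_index m (x a) (x b) < m" for a b using m by (intro arc_less) auto
  have "{(i, j). upper_edge I x i j} = (\<Union>k<m. {(i, j). local_edge m k I x i j})"
  proof -
    have "local_edge m k I x i j \<longleftrightarrow> upper_edge I x i j \<and> arc_index m (x i) (x j) = k" for i j k
      using upper_edge_iff_local_edge[OF m cells disk] by blast
    then show ?thesis using al by blast
  qed
  also have "card \<dots> = (\<Sum>k<m. card {(i, j). local_edge m k I x i j})"
    using fin by (intro card_UN_disjoint) (auto simp: local_edge_def)
  finally show ?thesis by (simp add: upper_edges_def local_edges_def)
qed

section \<open>Bounds, locality and measurability of the edge counts\<close>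

lemma below_antisym:
  assumes "fst p < fst q" "fst p < fst z" "below p q z" shows "\<not> below p z q"
  using assms(3) unfolding below_def by (simp add: mult.commute)

text \<open>The left endpoint determines the edge: of two edges leaving the same point, each right
  endpoint would be strictly below the line of the other edge.\<close>

lemma local_edges_le: 
  assumes I: "finite I" shows "local_edges m k I x \<le> card {i\<in>I. x i \<in> region m k}"
proof -
  have "inj_on fst {(i, j). local_edge m k I x i j}"
  proof (rule inj_onI, clarsimp)
    fix i j j' assume e: "local_edge m k I x i j" "local_edge m k I x i j'"
    show "j = j'"
    proof (rule ccontr)
      assume "j \<noteq> j'"
      then have "below (x i) (x j) (x j')" "below (x i) (x j') (x j)"
        using e by (auto simp: local_edge_def)
      then show False using below_antisym[of "x i" "x j" "x j'"] e by (auto simp: local_edge_def)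
    qed
  qed
  moreover have "fst ` {(i, j). local_edge m k I x i j} \<subseteq> {i\<in>I. x i \<in> region m k}"
    by (auto simp: local_edge_def)
  ultimately show ?thesis unfolding local_edges_def using I by (intro card_inj_on_le) auto
qed

lemma upper_edges_le: assumes I: "finite I" shows "upper_edges I x \<le> card I"
proof -
  have "inj_on fst {(i, j). upper_edge I x i j}"
  proof (rule inj_onI, clarsimp)
    fix i j j' assume e: "upper_edge I x i j" "upper_edge I x i j'"
    show "j = j'"
    proof (rule ccontr)
      assume "j \<noteq> j'"
      then have "below (x i) (x j) (x j')" "below (x i) (x j') (x j)"
        using e by (auto simp: upper_edge_def)
      then show False using below_antisym[of "x i" "x j" "x j'"] e by (auto simp: upper_edge_def)
    qed
  qed
  moreover have "fst ` {(i, j). upper_edge I x i j} \<subseteq> I"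
    by (auto simp: upper_edge_def)
  ultimately show ?thesis unfolding upper_edges_def using I by (intro card_inj_on_le) auto
qed

lemma local_edge_transfer:
  assumes a: "\<forall>i\<in>I. x i \<in> region m k \<or> y i \<in> region m k \<longrightarrow> x i = y i" and e: "local_edge m k I x i j"
  shows "local_edge m k I y i j"
proof -
  have "i \<in> I" "j \<in> I" "x i \<in> region m k" "x j \<in> region m k" using e unfolding local_edge_def by blast+
  then have "y i = x i" "y j = x j" using a by metis+
  moreover have "y l \<in> region m k \<Longrightarrow> l \<in> I - {i, j} \<Longrightarrow> below (x i) (x j) (y l)" for l
    using a e unfolding local_edge_def by (metis DiffD1)
  ultimately show ?thesis using e unfolding local_edge_def by simp
qed

lemma local_edges_depends: "depends_on_region I (region m k) (local_edges m k I)"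
  unfolding depends_on_region_def
proof (intro allI impI)
  fix x y assume a: "\<forall>i\<in>I. x i \<in> region m k \<or> y i \<in> region m k \<longrightarrow> x i = y i"
  then have a': "\<forall>i\<in>I. y i \<in> region m k \<or> x i \<in> region m k \<longrightarrow> y i = x i" by metis
  have "local_edge m k I x i j \<longleftrightarrow> local_edge m k I y i j" for i j
    using local_edge_transfer[OF a] local_edge_transfer[OF a'] by blast
  then show "local_edges m k I x = local_edges m k I y" by (simp add: local_edges_def)
qed

lemma local_edges_remove:
  assumes "x i \<notin> region m k" shows "local_edges m k (I - {i}) x = local_edges m k I x"
proof -
  have "local_edge m k (I - {i}) x a b \<longleftrightarrow> local_edge m k I x a b" for a b
    using assms by (auto simp: local_edge_def)
  then show ?thesis by (simp add: local_edges_def)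
qed

lemma cap_borel[measurable]: "cap u s \<in> sets borel"
proof -
  have "closed (cap u s)" unfolding cap_def
    by (intro closed_Collect_conj closed_Collect_le continuous_intros)
  then show ?thesis by simp
qed

lemma region_borel[measurable]: "region m k \<in> sets borel" and cell_borel[measurable]: "cell m k \<in> sets borel"
  by (simp_all add: region_def cell_def)

lemma upper_edges_eq_double_sum:
  assumes "finite I" shows "real (upper_edges I x) = (\<Sum>i\<in>I. \<Sum>j\<in>I. of_bool (upper_edge I x i j))"
proof -
  have "{(i, j). upper_edge I x i j} = {p\<in>I \<times> I. upper_edge I x (fst p) (snd p)}" by (auto simp: upper_edge_def)
  then have "real (upper_edges I x) = (\<Sum>p\<in>I \<times> I. of_bool (upper_edge I x (fst p) (snd p)))"
    unfolding upper_edges_def using assms by (simp add: Int_def)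
  then show ?thesis by (simp add: sum.cartesian_product split_beta)
qed

lemma local_edges_eq_double_sum:
  assumes "finite I" shows "real (local_edges m k I x) = (\<Sum>i\<in>I. \<Sum>j\<in>I. of_bool (local_edge m k I x i j))"
proof -
  have "{(i, j). local_edge m k I x i j} = {p\<in>I \<times> I. local_edge m k I x (fst p) (snd p)}" by (auto simp: local_edge_def)
  then have "real (local_edges m k I x) = (\<Sum>p\<in>I \<times> I. of_bool (local_edge m k I x (fst p) (snd p)))"
    unfolding local_edges_def using assms by (simp add: Int_def)
  then show ?thesis by (simp add: sum.cartesian_product split_beta)
qed


text \<open>The sample may carry more indices than those that are counted: the lower bound for the
  variance removes a point from the count but stays on the same sample space.\<close>

lemma edge_predicates_measurable:
  fixes I J :: "'i set"
  assumes I: "finite I" "I \<subseteq> J" and ij: "i \<in> I" "j \<in> I"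
  shows "Measurable.pred (Pi\<^sub>M J (\<lambda>_. borel)) (\<lambda>x. upper_edge I x i j)"
    and "Measurable.pred (Pi\<^sub>M J (\<lambda>_. borel)) (\<lambda>x. local_edge m k I x i j)"
proof -
  let ?P = "Pi\<^sub>M J (\<lambda>_. borel :: (real \<times> real) measure)"
  have c: "(\<lambda>x. x l) \<in> ?P \<rightarrow>\<^sub>M borel" if "l \<in> I" for l
    using measurable_component_singleton[of l J] that I by auto
  have f: "(\<lambda>x. fst (x l)) \<in> borel_measurable ?P" if "l \<in> I" for l
    by (rule measurable_compose[OF c[OF that]]) (intro borel_measurable_continuous_onI continuous_intros)
  have s: "(\<lambda>x. snd (x l)) \<in> borel_measurable ?P" if "l \<in> I" for l
    by (rule measurable_compose[OF c[OF that]]) (intro borel_measurable_continuous_onI continuous_intros)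
  note [measurable] = f[OF ij(1)] f[OF ij(2)] s[OF ij(1)] s[OF ij(2)]
  have b: "Measurable.pred ?P (\<lambda>x. below (x i) (x j) (x l))" if "l \<in> I" for l
  proof -
    note [measurable] = f[OF that] s[OF that]
    show ?thesis unfolding below_def by measurable
  qed
  have r: "Measurable.pred ?P (\<lambda>x. x l \<in> region m k)" if "l \<in> I" for l
    using c[OF that] by measurable
  have "Measurable.pred ?P (\<lambda>x. \<forall>l\<in>I - {i, j}. below (x i) (x j) (x l))"
    using I b by (intro pred_intros_finite) auto
  then show "Measurable.pred ?P (\<lambda>x. upper_edge I x i j)"
    using ij unfolding upper_edge_def by measurable
  have "Measurable.pred ?P (\<lambda>x. \<forall>l\<in>I - {i, j}. x l \<in> region m k \<longrightarrow> below (x i) (x j) (x l))"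
    using I b r by (intro pred_intros_finite pred_intros_logic) auto
  moreover have "Measurable.pred ?P (\<lambda>x. arc_index m (x i) (x j) = k)"
    unfolding arc_index_def normal_angle_def by measurable
  ultimately show "Measurable.pred ?P (\<lambda>x. local_edge m k I x i j)"
    using ij r[OF ij(1)] r[OF ij(2)] unfolding local_edge_def by measurable
qed

lemma edge_counts_measurable:
  fixes I J :: "'i set"
  assumes N: "sets N = sets (borel :: (real \<times> real) measure)" and I: "finite I" "I \<subseteq> J"
  shows "(\<lambda>x. real (upper_edges I x)) \<in> borel_measurable (Pi\<^sub>M J (\<lambda>_. N))"
    and "(\<lambda>x. real (local_edges m k I x)) \<in> borel_measurable (Pi\<^sub>M J (\<lambda>_. N))"
proof -
  have *: "measurable (Pi\<^sub>M J (\<lambda>_. N)) borel = measurable (Pi\<^sub>M J (\<lambda>_. borel :: (real \<times> real) measure)) (borel :: real measure)"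
    using N by (intro measurable_cong_sets sets_PiM_cong) auto
  show "(\<lambda>x. real (upper_edges I x)) \<in> borel_measurable (Pi\<^sub>M J (\<lambda>_. N))"
    unfolding * upper_edges_eq_double_sum[OF I(1)] of_bool_def using edge_predicates_measurable[OF I]
    by (intro borel_measurable_sum measurable_If borel_measurable_const) auto
  show "(\<lambda>x. real (local_edges m k I x)) \<in> borel_measurable (Pi\<^sub>M J (\<lambda>_. N))"
    unfolding * local_edges_eq_double_sum[OF I(1)] of_bool_def using edge_predicates_measurable[OF I]
    by (intro borel_measurable_sum measurable_If borel_measurable_const) auto
qed

section \<open>Normal approximation under weak dependence\<close>

lemma abs_le_square_bound: "\<bar>x\<bar> \<le> K \<Longrightarrow> x\<^sup>2 \<le> K\<^sup>2" for x K :: real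
  using abs_ge_zero order_trans power_mono[of "\<bar>x\<bar>" K 2] by fastforce

lemma norm_integral_le:
  fixes f :: "'a \<Rightarrow> 'b::{banach,second_countable_topology}"
  assumes "integrable M f" "integrable M g" "\<And>x. x \<in> space M \<Longrightarrow> norm (f x) \<le> g x"
  shows "norm (\<integral>x. f x \<partial>M) \<le> (\<integral>x. g x \<partial>M)"
  by (rule order_trans[OF integral_norm_bound]) (use assms in \<open>auto intro!: integral_mono\<close>)

lemma norm_iexp_linear: "norm (iexp x - 1 - \<i> * x) \<le> x\<^sup>2 / 2"
  using iexp_approx1[of x 1] by (simp add: diff_diff_eq power2_eq_square)

lemma norm_iexp_diff_le: "norm (iexp x - iexp y) \<le> \<bar>x - y\<bar>"
proof -
  have "iexp x - iexp y = iexp y * (iexp (x - y) - 1)"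
    by (simp add: algebra_simps flip: exp_add)
  also have "norm \<dots> = norm (iexp (x - y) - 1)" by (simp add: norm_mult)
  also have "\<dots> \<le> \<bar>x - y\<bar>" using iexp_approx1[of "x - y" 0] by simp
  finally show ?thesis .
qed

lemma (in prob_space) char_has_vector_derivative:
  assumes W[measurable]: "W \<in> borel_measurable M" and b: "\<And>x. \<bar>W x\<bar> \<le> (K :: real)"
  shows "((\<lambda>l. expectation (\<lambda>x. iexp (l * W x))) has_vector_derivative
           expectation (\<lambda>x. \<i> * W x * iexp (l * W x))) (at l)"
proof -
  have K: "0 \<le> K" using b order_trans[OF abs_ge_zero] by blast
  have i1: "integrable M (\<lambda>x. iexp (l * W x))" for l
    by (rule integrable_const_bound[where B=1]) auto
  have i2: "integrable M (\<lambda>x. \<i> * W x * iexp (l * W x))" for l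
    by (rule integrable_const_bound[where B=K]) (auto simp: norm_mult b)
  let ?f = "\<lambda>l. expectation (\<lambda>x. iexp (l * W x))"
  let ?D = "expectation (\<lambda>x. \<i> * W x * iexp (l * W x))"
  have bd: "norm (?f (l + h) - ?f l - h *\<^sub>R ?D) \<le> K\<^sup>2 * h\<^sup>2" for h
  proof -
    have "?f (l + h) - ?f l - h *\<^sub>R ?D
        = expectation (\<lambda>x. iexp ((l + h) * W x) - iexp (l * W x) - h *\<^sub>R (\<i> * W x * iexp (l * W x)))"
      using i1[of l] i1[of "l + h"] i2[of l] by (simp del: of_real_mult of_real_add)
    also have "norm \<dots> \<le> expectation (\<lambda>x. K\<^sup>2 * h\<^sup>2)"
    proof (rule norm_integral_le)
      show "integrable M (\<lambda>x. iexp ((l + h) * W x) - iexp (l * W x) - h *\<^sub>R (\<i> * W x * iexp (l * W x)))"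
        by (intro Bochner_Integration.integrable_diff integrable_scaleR_right i1 i2)
      fix x
      have "iexp ((l + h) * W x) - iexp (l * W x) - h *\<^sub>R (\<i> * W x * iexp (l * W x))
          = iexp (l * W x) * (iexp (h * W x) - 1 - \<i> * (h * W x))"
        by (simp add: algebra_simps scaleR_conv_of_real exp_add)
      also have "norm \<dots> = norm (iexp (h * W x) - 1 - \<i> * (h * W x))" by (simp add: norm_mult)
      also have "\<dots> \<le> (h * W x)\<^sup>2 / 2" using norm_iexp_linear[of "h * W x"] by simp
      also have "\<dots> \<le> (h * W x)\<^sup>2" by simp
      also have "\<dots> \<le> K\<^sup>2 * h\<^sup>2"
        using abs_le_square_bound[OF b[of x]] by (simp add: power_mult_distrib mult.commute[of "K\<^sup>2"] mult_left_mono)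
      finally show "norm (iexp ((l + h) * W x) - iexp (l * W x) - h *\<^sub>R (\<i> * W x * iexp (l * W x))) \<le> K\<^sup>2 * h\<^sup>2" .
    qed auto
    finally show ?thesis by (simp add: prob_space)
  qed
  show ?thesis
    unfolding has_vector_derivative_def has_derivative_at
  proof (intro conjI)
    show "(\<lambda>h. norm (?f (l + h) - ?f l - h *\<^sub>R ?D) / norm h) \<midarrow>0\<rightarrow> 0"
    proof (rule Lim_null_comparison)
      show "\<forall>\<^sub>F h in at 0. norm (norm (?f (l + h) - ?f l - h *\<^sub>R ?D) / norm h) \<le> K\<^sup>2 * \<bar>h\<bar>"
      proof (rule eventually_at_filter[THEN iffD2], rule always_eventually, safe)
        fix h :: real assume "h \<noteq> 0"
        then show "norm (norm (?f (l + h) - ?f l - h *\<^sub>R ?D) / norm h) \<le> K\<^sup>2 * \<bar>h\<bar>"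
          using bd[of h] by (simp add: divide_le_eq power2_eq_square mult.assoc abs_mult_self_eq)
      qed
      show "((\<lambda>h. K\<^sup>2 * \<bar>h\<bar>) \<longlongrightarrow> 0) (at 0)"
        by (auto intro!: tendsto_eq_intros)
    qed
  qed (rule bounded_linear_scaleR_left)
qed

text \<open>The Stein-Tikhomirov method: the characteristic function almost satisfies
  \<open>\<psi>' = - u \<psi>\<close>, hence \<open>\<psi> e\<^sup>u\<^sup>2\<^sup>/\<^sup>2\<close> is almost constant.\<close>

lemma gaussian_ode_stability:
  fixes \<psi> \<psi>' :: "real \<Rightarrow> complex"
  assumes d: "\<And>u. (\<psi> has_vector_derivative \<psi>' u) (at u)" and 0: "\<psi> 0 = 1"
    and bd: "\<And>u. \<bar>u\<bar> \<le> \<bar>t\<bar> \<Longrightarrow> norm (\<psi>' u + u * \<psi> u) \<le> \<delta>"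
  shows "norm (\<psi> t - of_real (exp (- t\<^sup>2 / 2))) \<le> \<bar>t\<bar> * \<delta>"
proof -
  let ?h = "\<lambda>u. exp (u\<^sup>2 / 2) *\<^sub>R \<psi> u"
  have dh: "(?h has_vector_derivative exp (u\<^sup>2 / 2) *\<^sub>R (\<psi>' u + u * \<psi> u)) (at u within S)" for u S
  proof -
    have "(?h has_vector_derivative exp (u\<^sup>2 / 2) *\<^sub>R \<psi>' u + (exp (u\<^sup>2 / 2) * u) *\<^sub>R \<psi> u) (at u)"
      by (rule has_vector_derivative_scaleR[OF _ d]) (auto intro!: derivative_eq_intros)
    moreover have "exp (u\<^sup>2 / 2) *\<^sub>R \<psi>' u + (exp (u\<^sup>2 / 2) * u) *\<^sub>R \<psi> u = exp (u\<^sup>2 / 2) *\<^sub>R (\<psi>' u + u * \<psi> u)"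
      by (simp add: scaleR_conv_of_real algebra_simps)
    ultimately show ?thesis using has_vector_derivative_at_within by fastforce
  qed
  have "norm (?h t - ?h 0) \<le> (exp (t\<^sup>2 / 2) * \<delta>) * norm (t - 0)"
  proof (rule differentiable_bound[where S="closed_segment 0 t" and f'="\<lambda>u h. h *\<^sub>R (exp (u\<^sup>2 / 2) *\<^sub>R (\<psi>' u + u * \<psi> u))"])
    fix u assume u: "u \<in> closed_segment 0 t"
    then show "(?h has_derivative (\<lambda>h. h *\<^sub>R (exp (u\<^sup>2 / 2) *\<^sub>R (\<psi>' u + u * \<psi> u)))) (at u within closed_segment 0 t)"
      using dh[of u] by (simp add: has_vector_derivative_def)
    have ut: "\<bar>u\<bar> \<le> \<bar>t\<bar>" using u by (auto simp: closed_segment_eq_real_ivl split: if_splits)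
    have "onorm (\<lambda>h. h *\<^sub>R (exp (u\<^sup>2 / 2) *\<^sub>R (\<psi>' u + u * \<psi> u))) \<le> norm (exp (u\<^sup>2 / 2) *\<^sub>R (\<psi>' u + u * \<psi> u))"
      by (rule onorm_le) (auto simp: abs_mult mult_ac)
    also have "\<dots> \<le> exp (t\<^sup>2 / 2) * \<delta>"
      using ut bd[OF ut] by (auto intro!: mult_mono simp: abs_le_square_iff)
    finally show "onorm (\<lambda>h. h *\<^sub>R (exp (u\<^sup>2 / 2) *\<^sub>R (\<psi>' u + u * \<psi> u))) \<le> exp (t\<^sup>2 / 2) * \<delta>" .
  qed auto
  then have *: "norm (?h t - 1) \<le> exp (t\<^sup>2 / 2) * \<delta> * \<bar>t\<bar>" using 0 by simp
  have "\<psi> t - of_real (exp (- t\<^sup>2 / 2)) = exp (- t\<^sup>2 / 2) *\<^sub>R (?h t - 1)"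
    by (simp add: scaleR_right_diff_distrib scaleR_conv_of_real exp_minus exp_of_real[symmetric] field_simps)
  then have "norm (\<psi> t - of_real (exp (- t\<^sup>2 / 2))) = exp (- t\<^sup>2 / 2) * norm (?h t - 1)" by simp
  also have "\<dots> \<le> exp (- t\<^sup>2 / 2) * (exp (t\<^sup>2 / 2) * \<delta> * \<bar>t\<bar>)" using * by (intro mult_left_mono) auto
  also have "\<dots> = \<bar>t\<bar> * \<delta>" by (simp add: exp_minus field_simps)
  finally show ?thesis .
qed

lemma (in prob_space) expectation_abs_le_sqrt:
  assumes [measurable]: "X \<in> borel_measurable M" and b: "\<And>x. \<bar>X x\<bar> \<le> (K :: real)"
    and "expectation (\<lambda>x. (X x)\<^sup>2) \<le> v"
  shows "expectation (\<lambda>x. \<bar>X x\<bar>) \<le> sqrt v"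
proof -
  have i: "integrable M (\<lambda>x. \<bar>X x\<bar>)" by (rule integrable_const_bound[where B=K]) (auto simp: b)
  have i2: "integrable M (\<lambda>x. (X x)\<^sup>2)"
    by (rule integrable_const_bound[where B="K\<^sup>2"]) (use b in \<open>auto intro!: abs_le_square_bound\<close>)
  have "(expectation (\<lambda>x. \<bar>X x\<bar>))\<^sup>2 \<le> expectation (\<lambda>x. \<bar>X x\<bar>\<^sup>2)"
    using variance_positive[of "\<lambda>x. \<bar>X x\<bar>"] variance_eq[of "\<lambda>x. \<bar>X x\<bar>"] i i2 by simp
  then show ?thesis using assms(3) by (intro real_le_rsqrt) simp
qed

text \<open>Independence of distant variables is not assumed. What replaces it is handed to
  \<open>char_total_bound\<close> as four bounds for expectations, the form in which disjoint
  regions of a sample of fixed size can provide it.\<close>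

locale weakly_dependent = prob_space M for M :: "'a measure" +
  fixes Z :: "nat \<Rightarrow> 'a \<Rightarrow> real" and m r :: nat and b \<epsilon> :: real
  assumes Z_measurable[measurable]: "\<And>k. Z k \<in> borel_measurable M"
    and Z_bound: "\<And>k x. \<bar>Z k x\<bar> \<le> b"
begin

definition near where "near k l \<longleftrightarrow> k \<le> l + r \<and> l \<le> k + r"
definition nbhd where "nbhd k x = (\<Sum>l | l < m \<and> near k l. Z l x)"
definition rest where "rest k x = (\<Sum>l | l < m \<and> \<not> near k l. Z l x)"
definition total where "total x = (\<Sum>l<m. Z l x)"
definition nbhd_size where "nbhd_size = real (2 * r + 1)"

lemma total_split: "total x = nbhd k x + rest k x"
proof -
  have "{..<m} = {l. l < m \<and> near k l} \<union> {l. l < m \<and> \<not> near k l}" by auto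
  then show ?thesis unfolding total_def nbhd_def rest_def
    by (simp only: sum.union_disjoint[symmetric, OF _ _ , of "{l. l < m \<and> near k l}" "{l. l < m \<and> \<not> near k l}"]) (subst sum.union_disjoint, auto)
qed

lemma [measurable]: "nbhd k \<in> borel_measurable M" "rest k \<in> borel_measurable M" "total \<in> borel_measurable M"
  unfolding nbhd_def rest_def total_def by measurable

lemma b_nonneg: "0 \<le> b" using Z_bound order_trans[OF abs_ge_zero] by blast

lemma card_near: "card {l. l < m \<and> near k l} \<le> 2 * r + 1"
proof -
  have "{l. l < m \<and> near k l} \<subseteq> {k - r..k + r}" by (auto simp: near_def)
  then have "card {l. l < m \<and> near k l} \<le> card {k - r..k + r}" by (intro card_mono) auto
  then show ?thesis by simp
qed

lemma nbhd_bound: "\<bar>nbhd k x\<bar> \<le> nbhd_size * b"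
proof -
  have "\<bar>nbhd k x\<bar> \<le> (\<Sum>l | l < m \<and> near k l. \<bar>Z l x\<bar>)" unfolding nbhd_def by (rule sum_abs)
  also have "\<dots> \<le> (\<Sum>l | l < m \<and> near k l. b)" by (intro sum_mono Z_bound)
  also have "\<dots> \<le> nbhd_size * b" unfolding nbhd_size_def using card_near[of k] b_nonneg
    by (auto intro!: mult_right_mono simp del: of_nat_add of_nat_mult of_nat_Suc)
  finally show ?thesis .
qed

lemma total_bound: "\<bar>total x\<bar> \<le> m * b"
proof -
  have "\<bar>total x\<bar> \<le> (\<Sum>l<m. \<bar>Z l x\<bar>)" unfolding total_def by (rule sum_abs)
  also have "\<dots> \<le> (\<Sum>l<m. b)" by (intro sum_mono Z_bound)
  finally show ?thesis by simp
qed

lemma nbhd_size_nonneg: "0 \<le> nbhd_size" by (simp add: nbhd_size_def)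

lemma Zn_bound: "\<bar>Z k x * nbhd k x\<bar> \<le> nbhd_size * b\<^sup>2"
  using mult_mono[OF Z_bound[of k x] nbhd_bound[of k x]] b_nonneg by (simp add: abs_mult power2_eq_square mult_ac)

text \<open>The derivative of the characteristic function \<open>\<phi>\<close> of the total is \<i>
  times \<open>F\<close>, and \<open>F l\<close> is compared with \<i> * l * \<sigma>^2 *
  \<open>\<phi> l\<close>. In each summand the exponential is expanded around the distant part
  \<open>rest k\<close>: the zeroth order is a covariance of distant variables, the first order
  produces \<open>V\<close>, whose mean is nearly \<sigma>^2. Rescaling by \<sigma> and
  \<open>gaussian_ode_stability\<close> finish the proof.\<close>

lemma char_total_bound:
  assumes cosZ: "\<And>k t. k < m \<Longrightarrow> \<bar>expectation (\<lambda>x. Z k x * cos (t * rest k x))\<bar> \<le> b * \<epsilon>"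
    and sinZ: "\<And>k t. k < m \<Longrightarrow> \<bar>expectation (\<lambda>x. Z k x * sin (t * rest k x))\<bar> \<le> b * \<epsilon>"
    and cov2: "\<And>k l. k < m \<Longrightarrow> l < m \<Longrightarrow> \<not> near k l \<Longrightarrow> \<bar>expectation (\<lambda>x. Z k x * Z l x)\<bar> \<le> b\<^sup>2 * \<epsilon>"
    and cov4: "\<And>k l. k < m \<Longrightarrow> l < m \<Longrightarrow> k + 3 * r < l \<or> l + 3 * r < k \<Longrightarrow>
        \<bar>expectation (\<lambda>x. (Z k x * nbhd k x) * (Z l x * nbhd l x))
          - expectation (\<lambda>x. Z k x * nbhd k x) * expectation (\<lambda>x. Z l x * nbhd l x)\<bar> \<le> (nbhd_size * b\<^sup>2)\<^sup>2 * \<epsilon>"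
    and sig: "\<sigma> > 0" "\<sigma>\<^sup>2 = expectation (\<lambda>x. (total x)\<^sup>2)" and eps: "0 \<le> \<epsilon>"
  shows "norm (expectation (\<lambda>x. iexp (t / \<sigma> * total x)) - of_real (exp (- t\<^sup>2 / 2))) \<le>
      \<bar>t\<bar> * (2 * m * b * \<epsilon> / \<sigma> + 3 / 2 * t\<^sup>2 * m * nbhd_size\<^sup>2 * b ^ 3 / \<sigma> ^ 3
        + \<bar>t\<bar> * (sqrt (2 * m * (6 * r + 1) * (nbhd_size * b\<^sup>2)\<^sup>2 + m\<^sup>2 * (nbhd_size * b\<^sup>2)\<^sup>2 * \<epsilon>) + m\<^sup>2 * b\<^sup>2 * \<epsilon>) / \<sigma>\<^sup>2)"
proof -
  have b0: "0 \<le> b" by (rule b_nonneg)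
  \<comment> \<open>The mean of \<open>V\<close> is \<sigma>^2 up to covariances of distant
    variables (\<open>cov2\<close>), and its variance is small because distant products are nearly
    uncorrelated (\<open>cov4\<close>).\<close>
  define V where "V x = (\<Sum>k<m. Z k x * nbhd k x)" for x
  have [measurable]: "V \<in> borel_measurable M" unfolding V_def by measurable
  have V_bound: "\<bar>V x\<bar> \<le> m * (nbhd_size * b\<^sup>2)" for x
  proof -
    have "\<bar>V x\<bar> \<le> (\<Sum>k<m. \<bar>Z k x * nbhd k x\<bar>)" unfolding V_def by (rule sum_abs)
    also have "\<dots> \<le> (\<Sum>k<m. nbhd_size * b\<^sup>2)" by (intro sum_mono Zn_bound)
    finally show ?thesis by simp
  qed
  define vb where "vb = 2 * m * (6 * r + 1) * (nbhd_size * b\<^sup>2)\<^sup>2 + m\<^sup>2 * (nbhd_size * b\<^sup>2)\<^sup>2 * \<epsilon>"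
  have iZn: "integrable M (\<lambda>x. Z k x * nbhd k x)" for k
    by (rule integrable_const_bound[where B="nbhd_size * b\<^sup>2"]) (auto simp: Zn_bound)
  have iZnZn: "integrable M (\<lambda>x. (Z k x * nbhd k x) * (Z l x * nbhd l x))" for k l
    by (rule integrable_const_bound[where B="(nbhd_size * b\<^sup>2) * (nbhd_size * b\<^sup>2)"])
       (use mult_mono[OF Zn_bound[of k] Zn_bound[of l]] nbhd_size_nonneg b0 in \<open>auto simp: abs_mult\<close>)
  have iZZ: "integrable M (\<lambda>x. Z k x * Z l x)" for k l
    by (rule integrable_const_bound[where B="b * b"])
       (use mult_mono[OF Z_bound[of k] Z_bound[of l]] b0 in \<open>auto simp: abs_mult\<close>)
  let ?E = "\<lambda>k. expectation (\<lambda>x. Z k x * nbhd k x)"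
  have EV: "expectation V = (\<Sum>k<m. ?E k)" unfolding V_def using iZn by simp
  have iV2: "integrable M (\<lambda>x. (V x)\<^sup>2)" and iV: "integrable M V"
    by (rule integrable_const_bound[where B="(m * (nbhd_size * b\<^sup>2))\<^sup>2"]; use V_bound in \<open>auto intro!: abs_le_square_bound\<close>; fail)
       (rule integrable_const_bound[where B="m * (nbhd_size * b\<^sup>2)"]; use V_bound in auto)
  have varV: "variance V \<le> vb"
  proof -
    have "variance V = expectation (\<lambda>x. (V x)\<^sup>2) - (expectation V)\<^sup>2" by (rule variance_eq[OF iV iV2])
    also have "(\<lambda>x. (V x)\<^sup>2) = (\<lambda>x. \<Sum>k<m. \<Sum>l<m. (Z k x * nbhd k x) * (Z l x * nbhd l x))"
      by (simp add: V_def power2_eq_square sum_product)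
    also have "expectation \<dots> - (expectation V)\<^sup>2 = (\<Sum>k<m. \<Sum>l<m. expectation (\<lambda>x. (Z k x * nbhd k x) * (Z l x * nbhd l x)) - ?E k * ?E l)"
      using iZnZn by (simp add: EV power2_eq_square sum_product sum_subtractf)
    \<comment> \<open>If k and l differ by more than 3 r, their neighbourhoods are still more than r
      apart, which is the situation of \<open>cov4\<close>. Only the at most 6 r + 1 remaining l are
      estimated trivially.\<close>
    also have "\<dots> \<le> (\<Sum>k<m. \<Sum>l<m. (if k \<le> l + 3 * r \<and> l \<le> k + 3 * r then 2 * (nbhd_size * b\<^sup>2)\<^sup>2 else 0) + (nbhd_size * b\<^sup>2)\<^sup>2 * \<epsilon>)"
    proof (intro sum_mono)
      fix k l assume kl: "k \<in> {..<m}" "l \<in> {..<m}"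
      show "expectation (\<lambda>x. (Z k x * nbhd k x) * (Z l x * nbhd l x)) - ?E k * ?E l
          \<le> (if k \<le> l + 3 * r \<and> l \<le> k + 3 * r then 2 * (nbhd_size * b\<^sup>2)\<^sup>2 else 0) + (nbhd_size * b\<^sup>2)\<^sup>2 * \<epsilon>"
      proof (cases "k \<le> l + 3 * r \<and> l \<le> k + 3 * r")
        case False
        then show ?thesis using cov4[of k l] kl by auto
      next
        case True
        have Eb: "\<bar>?E k\<bar> \<le> nbhd_size * b\<^sup>2" for k
        proof -
          have "\<bar>?E k\<bar> \<le> expectation (\<lambda>x. \<bar>Z k x * nbhd k x\<bar>)" by (rule integral_abs_bound)
          also have "\<dots> \<le> expectation (\<lambda>x. nbhd_size * b\<^sup>2)" using iZn Zn_bound by (intro integral_mono) auto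
          finally show ?thesis by (simp add: prob_space)
        qed
        have "expectation (\<lambda>x. (Z k x * nbhd k x) * (Z l x * nbhd l x)) \<le> expectation (\<lambda>x. (nbhd_size * b\<^sup>2)\<^sup>2)"
        proof (intro integral_mono iZnZn)
          fix x
          have "\<bar>(Z k x * nbhd k x) * (Z l x * nbhd l x)\<bar> \<le> (nbhd_size * b\<^sup>2) * (nbhd_size * b\<^sup>2)"
            using mult_mono[OF Zn_bound[of k] Zn_bound[of l]] nbhd_size_nonneg b0 by (auto simp: abs_mult)
          then show "(Z k x * nbhd k x) * (Z l x * nbhd l x) \<le> (nbhd_size * b\<^sup>2)\<^sup>2" by (simp add: power2_eq_square)
        qed auto
        moreover have "\<bar>?E k * ?E l\<bar> \<le> (nbhd_size * b\<^sup>2)\<^sup>2"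
          using mult_mono[OF Eb[of k] Eb[of l]] nbhd_size_nonneg b0 by (simp add: abs_mult power2_eq_square)
        moreover have "0 \<le> (nbhd_size * b\<^sup>2)\<^sup>2 * \<epsilon>" using eps by simp
        ultimately show ?thesis using True by (simp add: prob_space)
      qed
    qed
    also have "\<dots> = (\<Sum>k<m. real (card {l\<in>{..<m}. k \<le> l + 3 * r \<and> l \<le> k + 3 * r}) * (2 * (nbhd_size * b\<^sup>2)\<^sup>2)) + m\<^sup>2 * (nbhd_size * b\<^sup>2)\<^sup>2 * \<epsilon>"
      by (simp add: sum.distrib power2_eq_square sum.If_cases Int_def)
    also have "\<dots> \<le> (\<Sum>k<m. real (6 * r + 1) * (2 * (nbhd_size * b\<^sup>2)\<^sup>2)) + m\<^sup>2 * (nbhd_size * b\<^sup>2)\<^sup>2 * \<epsilon>"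
    proof (intro add_mono sum_mono order_refl mult_right_mono of_nat_mono)
      fix k
      have "{l\<in>{..<m}. k \<le> l + 3 * r \<and> l \<le> k + 3 * r} \<subseteq> {k - 3 * r..k + 3 * r}" by auto
      then have "card {l\<in>{..<m}. k \<le> l + 3 * r \<and> l \<le> k + 3 * r} \<le> card {k - 3 * r..k + 3 * r}" by (intro card_mono) auto
      then show "card {l\<in>{..<m}. k \<le> l + 3 * r \<and> l \<le> k + 3 * r} \<le> 6 * r + 1" by simp
    qed auto
    also have "\<dots> = vb" by (simp add: vb_def algebra_simps)
    finally show ?thesis .
  qed
  have sigV: "\<bar>\<sigma>\<^sup>2 - expectation V\<bar> \<le> m\<^sup>2 * b\<^sup>2 * \<epsilon>"
  proof -
    have "(total x)\<^sup>2 = V x + (\<Sum>k<m. \<Sum>l | l < m \<and> \<not> near k l. Z k x * Z l x)" for x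
    proof -
      have "(total x)\<^sup>2 = (\<Sum>k<m. Z k x * total x)" by (simp add: power2_eq_square total_def sum_distrib_right)
      also have "\<dots> = (\<Sum>k<m. Z k x * nbhd k x + Z k x * rest k x)"
        by (intro sum.cong refl) (subst total_split, simp add: algebra_simps)
      finally show ?thesis by (simp add: V_def sum.distrib rest_def sum_distrib_left)
    qed
    then have "\<sigma>\<^sup>2 - expectation V = (\<Sum>k<m. \<Sum>l | l < m \<and> \<not> near k l. expectation (\<lambda>x. Z k x * Z l x))"
      using iV iZZ by (simp add: sig(2))
    also have "\<bar>\<dots>\<bar> \<le> (\<Sum>k<m. \<Sum>l | l < m \<and> \<not> near k l. \<bar>expectation (\<lambda>x. Z k x * Z l x)\<bar>)"
      by (rule order_trans[OF sum_abs]) (intro sum_mono sum_abs)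
    also have "\<dots> \<le> (\<Sum>k<m. \<Sum>l | l < m \<and> \<not> near k l. b\<^sup>2 * \<epsilon>)"
      by (intro sum_mono cov2) auto
    also have "\<dots> \<le> (\<Sum>k<m. \<Sum>l<m. b\<^sup>2 * \<epsilon>)"
      using eps by (intro sum_mono sum_mono2) auto
    also have "\<dots> = m\<^sup>2 * b\<^sup>2 * \<epsilon>" by (simp add: power2_eq_square)
    finally show ?thesis .
  qed
  define \<phi> where "\<phi> l = expectation (\<lambda>x. iexp (l * total x))" for l
  define F where "F l = expectation (\<lambda>x. total x * iexp (l * total x))" for l
  have iI[simp]: "integrable M (\<lambda>x. iexp (l * f x))" if [measurable]: "f \<in> borel_measurable M" for f :: "'a \<Rightarrow> real" and l
    by (rule integrable_const_bound[where B=1]) auto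
  have icx: "integrable M (\<lambda>x. complex_of_real (f x) * g x)"
    if [measurable]: "f \<in> borel_measurable M" "g \<in> borel_measurable M" and "\<And>x. \<bar>f x\<bar> \<le> K" "\<And>x. norm (g x) \<le> 1"
    for f :: "'a \<Rightarrow> real" and g K
  proof (rule integrable_const_bound[where B=K])
    have "norm (complex_of_real (f x) * g x) \<le> K * 1" for x
      unfolding norm_mult using that(3)[of x] that(4)[of x] by (intro mult_mono) auto
    then show "AE x in M. norm (complex_of_real (f x) * g x) \<le> K" by simp
  qed simp
  have F_est: "norm (F l - \<i> * l * \<sigma>\<^sup>2 * \<phi> l) \<le> 2 * m * b * \<epsilon> + 3 / 2 * l\<^sup>2 * m * nbhd_size\<^sup>2 * b ^ 3 + \<bar>l\<bar> * (sqrt vb + m\<^sup>2 * b\<^sup>2 * \<epsilon>)" for l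
  proof -
    \<comment> \<open>The error terms: \<open>?A\<close> pairs Z k with the distant part,
      \<open>?B\<close> is the second-order remainder of the exponential, \<open>?C\<close> is the
      cost of putting the total back in place of \<open>rest k\<close> in the first-order term, and
      \<open>?G\<close> is the deviation of \<open>V\<close> from its mean. The cubic contributions
      1/2 of \<open>?B\<close> and 1 of \<open>?C\<close> add up to 3/2.\<close>
    let ?A = "\<lambda>k. expectation (\<lambda>x. Z k x * iexp (l * rest k x))"
    let ?B = "\<lambda>k. expectation (\<lambda>x. complex_of_real (Z k x) * (iexp (l * total x) - iexp (l * rest k x) - \<i> * l * nbhd k x * iexp (l * rest k x)))"
    let ?C = "\<lambda>k. expectation (\<lambda>x. complex_of_real (Z k x * nbhd k x) * (iexp (l * rest k x) - iexp (l * total x)))"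
    let ?G = "expectation (\<lambda>x. complex_of_real (V x - expectation V) * iexp (l * total x))"
    have iA: "integrable M (\<lambda>x. complex_of_real (Z k x) * iexp (l * f x))" if [measurable]: "f \<in> borel_measurable M" for k f
      by (rule icx[OF _ _ Z_bound]) (auto simp: Z_bound)
    have iB: "integrable M (\<lambda>x. complex_of_real (Z k x * nbhd k x) * iexp (l * f x))" if [measurable]: "f \<in> borel_measurable M" for k f
      by (rule icx[OF _ _ Zn_bound]) (auto simp: Zn_bound simp del: of_real_mult)
    have iVI: "integrable M (\<lambda>x. complex_of_real (V x) * iexp (l * total x))"
      by (rule icx[OF _ _ V_bound]) (auto simp: V_bound)
    have "F l = (\<Sum>k<m. expectation (\<lambda>x. complex_of_real (Z k x) * iexp (l * total x)))"
      unfolding F_def total_def[THEN arg_cong[where f=complex_of_real]]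
      using iA[of total] by (simp add: sum_distrib_right)
    also have "\<dots> = (\<Sum>k<m. ?A k + ?B k + \<i> * l * ?C k + \<i> * l * expectation (\<lambda>x. complex_of_real (Z k x * nbhd k x) * iexp (l * total x)))"
    proof (intro sum.cong refl)
      fix k
      have B: "?B k = expectation (\<lambda>x. complex_of_real (Z k x) * iexp (l * total x)) - ?A k - \<i> * l * expectation (\<lambda>x. complex_of_real (Z k x * nbhd k x) * iexp (l * rest k x))"
      proof -
        have "(\<lambda>x. complex_of_real (Z k x) * (iexp (l * total x) - iexp (l * rest k x) - \<i> * l * nbhd k x * iexp (l * rest k x)))
            = (\<lambda>x. complex_of_real (Z k x) * iexp (l * total x) - complex_of_real (Z k x) * iexp (l * rest k x)
                - (\<i> * l) * (complex_of_real (Z k x * nbhd k x) * iexp (l * rest k x)))"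
          by (auto simp: algebra_simps)
        then show ?thesis using iA[of total] iA[of "rest k"] iB[of "rest k"] by (simp del: of_real_mult)
      qed
      have C: "?C k = expectation (\<lambda>x. complex_of_real (Z k x * nbhd k x) * iexp (l * rest k x)) - expectation (\<lambda>x. complex_of_real (Z k x * nbhd k x) * iexp (l * total x))"
        using iB[of "rest k"] iB[of total] by (simp add: right_diff_distrib del: of_real_mult)
      show "expectation (\<lambda>x. complex_of_real (Z k x) * iexp (l * total x)) = ?A k + ?B k + \<i> * l * ?C k + \<i> * l * expectation (\<lambda>x. complex_of_real (Z k x * nbhd k x) * iexp (l * total x))"
        unfolding B C by (simp add: algebra_simps)
    qed
    also have "\<dots> = (\<Sum>k<m. ?A k) + (\<Sum>k<m. ?B k) + \<i> * l * (\<Sum>k<m. ?C k) + \<i> * l * expectation (\<lambda>x. complex_of_real (V x) * iexp (l * total x))"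
      using iB[of total] by (simp add: sum.distrib V_def sum_distrib_left sum_distrib_right)
    also have "expectation (\<lambda>x. complex_of_real (V x) * iexp (l * total x)) = ?G + expectation V * \<phi> l"
      using iVI iI[of total l] by (simp add: \<phi>_def left_diff_distrib del: of_real_mult)
    finally have eq: "F l - \<i> * l * \<sigma>\<^sup>2 * \<phi> l = (\<Sum>k<m. ?A k) + (\<Sum>k<m. ?B k) + \<i> * l * (\<Sum>k<m. ?C k) + \<i> * l * ?G + \<i> * l * (expectation V - \<sigma>\<^sup>2) * \<phi> l"
      by (simp add: algebra_simps)
    have nA: "norm (\<Sum>k<m. ?A k) \<le> (\<Sum>k<m. 2 * b * \<epsilon>)"
    proof (rule sum_norm_le)
      fix k assume k: "k \<in> {..<m}"
      have "Re (?A k) = expectation (\<lambda>x. Z k x * cos (l * rest k x))"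
        using iA[of "rest k" k] by (subst integral_Re[symmetric]) (auto simp: Re_exp Im_exp)
      moreover have "Im (?A k) = expectation (\<lambda>x. Z k x * sin (l * rest k x))"
        using iA[of "rest k" k] by (subst integral_Im[symmetric]) (auto simp: Re_exp Im_exp)
      ultimately show "norm (?A k) \<le> 2 * b * \<epsilon>"
        using cmod_le[of "?A k"] cosZ[of k l] sinZ[of k l] k by simp
    qed
    have nB: "norm (\<Sum>k<m. ?B k) \<le> (\<Sum>k<m. b * (l\<^sup>2 * (nbhd_size * b)\<^sup>2 / 2))"
    proof (rule sum_norm_le)
      fix k
      have "norm (?B k) \<le> expectation (\<lambda>x. b * (l\<^sup>2 * (nbhd_size * b)\<^sup>2 / 2))"
      proof (rule norm_integral_le)
        show pt: "norm (complex_of_real (Z k x) * (iexp (l * total x) - iexp (l * rest k x) - \<i> * l * nbhd k x * iexp (l * rest k x))) \<le> b * (l\<^sup>2 * (nbhd_size * b)\<^sup>2 / 2)" for x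
        proof -
          have "iexp (l * total x) - iexp (l * rest k x) - \<i> * l * nbhd k x * iexp (l * rest k x)
              = iexp (l * rest k x) * (iexp (l * nbhd k x) - 1 - \<i> * (l * nbhd k x))"
            by (subst total_split[of x k]) (simp add: algebra_simps exp_add)
          also have "norm \<dots> \<le> (l * nbhd k x)\<^sup>2 / 2"
            using norm_iexp_linear[of "l * nbhd k x"] by (simp add: norm_mult)
          also have "\<dots> \<le> l\<^sup>2 * (nbhd_size * b)\<^sup>2 / 2"
            using power_mono[OF nbhd_bound[of k x], of 2] by (simp add: power_mult_distrib mult_left_mono)
          finally show ?thesis
            unfolding norm_mult using Z_bound[of k x] b0 by (intro mult_mono) auto
        qed
        show "integrable M (\<lambda>x. complex_of_real (Z k x) * (iexp (l * total x) - iexp (l * rest k x) - \<i> * l * nbhd k x * iexp (l * rest k x)))"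
          by (rule integrable_const_bound[where B="b * (l\<^sup>2 * (nbhd_size * b)\<^sup>2 / 2)"]) (use pt in auto)
      qed auto
      then show "norm (?B k) \<le> b * (l\<^sup>2 * (nbhd_size * b)\<^sup>2 / 2)" by (simp add: prob_space)
    qed
    have nC: "norm (\<Sum>k<m. ?C k) \<le> (\<Sum>k<m. nbhd_size * b\<^sup>2 * (\<bar>l\<bar> * (nbhd_size * b)))"
    proof (rule sum_norm_le)
      fix k
      have "norm (?C k) \<le> expectation (\<lambda>x. nbhd_size * b\<^sup>2 * (\<bar>l\<bar> * (nbhd_size * b)))"
      proof (rule norm_integral_le)
        show pt: "norm (complex_of_real (Z k x * nbhd k x) * (iexp (l * rest k x) - iexp (l * total x))) \<le> nbhd_size * b\<^sup>2 * (\<bar>l\<bar> * (nbhd_size * b))" for x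
        proof -
          have "norm (iexp (l * rest k x) - iexp (l * total x)) \<le> \<bar>l * rest k x - l * total x\<bar>" by (rule norm_iexp_diff_le)
          also have "\<dots> = \<bar>l\<bar> * \<bar>nbhd k x\<bar>" by (subst total_split[of x k]) (simp add: algebra_simps abs_mult)
          also have "\<dots> \<le> \<bar>l\<bar> * (nbhd_size * b)" by (intro mult_left_mono nbhd_bound) auto
          finally show ?thesis
            unfolding norm_mult norm_of_real using Zn_bound[of k x] b0 nbhd_size_nonneg by (intro mult_mono) auto
        qed
        show "integrable M (\<lambda>x. complex_of_real (Z k x * nbhd k x) * (iexp (l * rest k x) - iexp (l * total x)))"
          by (rule integrable_const_bound[where B="nbhd_size * b\<^sup>2 * (\<bar>l\<bar> * (nbhd_size * b))"]) (use pt in auto)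
      qed auto
      then show "norm (?C k) \<le> nbhd_size * b\<^sup>2 * (\<bar>l\<bar> * (nbhd_size * b))" by (simp add: prob_space)
    qed
    have Vd: "\<bar>V x - expectation V\<bar> \<le> m * (nbhd_size * b\<^sup>2) + \<bar>expectation V\<bar>" for x using V_bound[of x] by linarith
    have nG: "norm ?G \<le> sqrt vb"
    proof -
      have "norm ?G \<le> expectation (\<lambda>x. \<bar>V x - expectation V\<bar>)"
      proof (rule norm_integral_le)
        show "integrable M (\<lambda>x. complex_of_real (V x - expectation V) * iexp (l * total x))"
          by (rule icx[OF _ _ Vd]) (auto simp: Vd simp del: of_real_diff)
      qed (use iV in \<open>auto simp: norm_mult simp del: of_real_diff\<close>)
      also have "\<dots> \<le> sqrt vb"
        by (rule expectation_abs_le_sqrt[OF _ Vd]) (use varV in auto)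
      finally show ?thesis .
    qed
    have nphi: "norm (\<phi> l) \<le> 1"
    proof -
      have "norm (\<phi> l) \<le> expectation (\<lambda>x. 1)"
        unfolding \<phi>_def by (rule norm_integral_le[OF iI]) auto
      then show ?thesis by (simp add: prob_space)
    qed
    have "norm (F l - \<i> * l * \<sigma>\<^sup>2 * \<phi> l) \<le> norm (\<Sum>k<m. ?A k) + norm (\<Sum>k<m. ?B k) + norm (\<i> * l * (\<Sum>k<m. ?C k)) + norm (\<i> * l * ?G) + norm (\<i> * l * (expectation V - \<sigma>\<^sup>2) * \<phi> l)"
      unfolding eq by (intro norm_triangle_mono order_refl)
    also have "\<dots> \<le> (\<Sum>k<m. 2 * b * \<epsilon>) + (\<Sum>k<m. b * (l\<^sup>2 * (nbhd_size * b)\<^sup>2 / 2)) + \<bar>l\<bar> * (\<Sum>k<m. nbhd_size * b\<^sup>2 * (\<bar>l\<bar> * (nbhd_size * b))) + \<bar>l\<bar> * sqrt vb + \<bar>l\<bar> * (m\<^sup>2 * b\<^sup>2 * \<epsilon>)"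
    proof (intro add_mono nA nB)
      show "norm (\<i> * l * (\<Sum>k<m. ?C k)) \<le> \<bar>l\<bar> * (\<Sum>k<m. nbhd_size * b\<^sup>2 * (\<bar>l\<bar> * (nbhd_size * b)))"
        using nC by (simp add: norm_mult mult_left_mono)
      show "norm (\<i> * l * ?G) \<le> \<bar>l\<bar> * sqrt vb" using nG by (simp add: norm_mult mult_left_mono)
      have "norm (\<i> * l * (expectation V - \<sigma>\<^sup>2) * \<phi> l) = \<bar>l\<bar> * \<bar>expectation V - \<sigma>\<^sup>2\<bar> * norm (\<phi> l)"
        by (simp add: norm_mult flip: of_real_diff of_real_power)
      also have "\<dots> \<le> \<bar>l\<bar> * (m\<^sup>2 * b\<^sup>2 * \<epsilon>) * 1"
        using sigV nphi eps by (intro mult_mono) (auto simp: abs_minus_commute)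
      finally show "norm (\<i> * l * (expectation V - \<sigma>\<^sup>2) * \<phi> l) \<le> \<bar>l\<bar> * (m\<^sup>2 * b\<^sup>2 * \<epsilon>)" by simp
    qed
    also have "\<dots> = 2 * m * b * \<epsilon> + 3 / 2 * l\<^sup>2 * m * nbhd_size\<^sup>2 * b ^ 3 + \<bar>l\<bar> * (sqrt vb + m\<^sup>2 * b\<^sup>2 * \<epsilon>)"
      by (simp add: power2_eq_square power3_eq_cube algebra_simps)
    finally show ?thesis .
  qed
  define \<psi>' where "\<psi>' u = (1 / \<sigma>) *\<^sub>R (\<i> * F (u / \<sigma>))" for u
  have "norm (\<phi> (t / \<sigma>) - of_real (exp (- t\<^sup>2 / 2))) \<le> \<bar>t\<bar> * ((2 * m * b * \<epsilon> + 3 / 2 * (t / \<sigma>)\<^sup>2 * m * nbhd_size\<^sup>2 * b ^ 3 + \<bar>t / \<sigma>\<bar> * (sqrt vb + m\<^sup>2 * b\<^sup>2 * \<epsilon>)) / \<sigma>)"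
  proof (rule gaussian_ode_stability[where \<psi>' = \<psi>' and \<psi> = "\<lambda>u. \<phi> (u / \<sigma>)"])
    fix u
    have "(\<phi> has_vector_derivative (\<i> * F l)) (at l)" for l
      unfolding \<phi>_def[abs_def] F_def using char_has_vector_derivative[of total "m * b" l] total_bound
      by (simp add: mult.assoc)
    note phi_deriv = this
    have "((\<lambda>u. u / \<sigma>) has_vector_derivative 1 / \<sigma>) (at u)"
      using sig(1) by (auto intro!: derivative_eq_intros simp: has_real_derivative_iff_has_vector_derivative[symmetric])
    from vector_diff_chain_at[OF this phi_deriv]
    show "((\<lambda>u. \<phi> (u / \<sigma>)) has_vector_derivative \<psi>' u) (at u)"
      unfolding \<psi>'_def comp_def .
  next
    show "\<phi> (0 / \<sigma>) = 1" by (simp add: \<phi>_def prob_space)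
  next
    fix u assume u: "\<bar>u\<bar> \<le> \<bar>t\<bar>"
    have "\<psi>' u + u * \<phi> (u / \<sigma>) = (1 / \<sigma>) *\<^sub>R (\<i> * (F (u / \<sigma>) - \<i> * (u / \<sigma>) * \<sigma>\<^sup>2 * \<phi> (u / \<sigma>)))"
      using sig(1) by (simp add: \<psi>'_def algebra_simps scaleR_conv_of_real power2_eq_square)
    then have "norm (\<psi>' u + u * \<phi> (u / \<sigma>)) = norm (F (u / \<sigma>) - \<i> * (u / \<sigma>) * \<sigma>\<^sup>2 * \<phi> (u / \<sigma>)) / \<sigma>"
      using sig(1) by (simp add: norm_mult)
    also have "\<dots> \<le> (2 * m * b * \<epsilon> + 3 / 2 * (u / \<sigma>)\<^sup>2 * m * nbhd_size\<^sup>2 * b ^ 3 + \<bar>u / \<sigma>\<bar> * (sqrt vb + m\<^sup>2 * b\<^sup>2 * \<epsilon>)) / \<sigma>"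
      using F_est[of "u / \<sigma>"] sig(1) by (intro divide_right_mono) auto
    also have "\<dots> \<le> (2 * m * b * \<epsilon> + 3 / 2 * (t / \<sigma>)\<^sup>2 * m * nbhd_size\<^sup>2 * b ^ 3 + \<bar>t / \<sigma>\<bar> * (sqrt vb + m\<^sup>2 * b\<^sup>2 * \<epsilon>)) / \<sigma>"
    proof -
      have 1: "\<bar>u / \<sigma>\<bar> \<le> \<bar>t / \<sigma>\<bar>" using u sig(1) by (simp add: divide_right_mono)
      then have 2: "(u / \<sigma>)\<^sup>2 \<le> (t / \<sigma>)\<^sup>2" by (simp only: abs_le_square_iff)
      have vb0: "0 \<le> vb" unfolding vb_def using eps by simp
      show ?thesis using 1 2 sig(1) eps b0 vb0
        by (intro divide_right_mono add_mono mult_right_mono mult_left_mono) auto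
    qed
    finally show "norm (\<psi>' u + u * \<phi> (u / \<sigma>)) \<le> (2 * m * b * \<epsilon> + 3 / 2 * (t / \<sigma>)\<^sup>2 * m * nbhd_size\<^sup>2 * b ^ 3 + \<bar>t / \<sigma>\<bar> * (sqrt vb + m\<^sup>2 * b\<^sup>2 * \<epsilon>)) / \<sigma>" .
  qed
  also have "\<dots> = \<bar>t\<bar> * (2 * m * b * \<epsilon> / \<sigma> + 3 / 2 * t\<^sup>2 * m * nbhd_size\<^sup>2 * b ^ 3 / \<sigma> ^ 3 + \<bar>t\<bar> * (sqrt vb + m\<^sup>2 * b\<^sup>2 * \<epsilon>) / \<sigma>\<^sup>2)"
    using sig(1) by (simp add: field_simps power2_eq_square power3_eq_cube)
  finally show ?thesis unfolding \<phi>_def vb_def .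
qed

end

section \<open>Planar beta densities\<close>

text \<open>The argument is the squared distance from the origin, so that the density is evaluated
  at sums of squares.\<close>

definition radial_density :: "nat \<Rightarrow> real \<Rightarrow> real \<Rightarrow> ennreal" where
  "radial_density d c t = ennreal (if t < 1 then c * (1 - t) powr ((real d - 4) / 2) else 0)"

lemma radial_density_measurable[measurable]: "radial_density d c \<in> borel_measurable borel"
  unfolding radial_density_def by measurable

text \<open>A chord at distance \<rho> from the origin, rescaled to the length of a diameter,
  carries the profile of the diameter times a power of 1 - \<rho>^2. This self-similarity makes both
  the marginal and the pair kernel explicit.\<close>

lemma radial_density_scale:
  assumes "\<bar>\<rho>\<bar> < 1" "4 \<le> d" "c \<ge> 0"
  shows "radial_density d c (\<rho>\<^sup>2 + (sqrt (1 - \<rho>\<^sup>2) * t)\<^sup>2)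
           = ennreal ((1 - \<rho>\<^sup>2) powr ((real d - 4) / 2)) * radial_density d c (t\<^sup>2)"
proof -
  have r: "0 < 1 - \<rho>\<^sup>2" using assms(1) by (simp add: abs_square_less_1)
  have eq: "1 - (\<rho>\<^sup>2 + (sqrt (1 - \<rho>\<^sup>2) * t)\<^sup>2) = (1 - \<rho>\<^sup>2) * (1 - t\<^sup>2)"
    using r by (simp add: power_mult_distrib algebra_simps)
  have lt: "\<rho>\<^sup>2 + (sqrt (1 - \<rho>\<^sup>2) * t)\<^sup>2 < 1 \<longleftrightarrow> t\<^sup>2 < 1"
  proof -
    have "\<rho>\<^sup>2 + (sqrt (1 - \<rho>\<^sup>2) * t)\<^sup>2 < 1 \<longleftrightarrow> 0 < (1 - \<rho>\<^sup>2) * (1 - t\<^sup>2)"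
      using eq by linarith
    also have "\<dots> \<longleftrightarrow> t\<^sup>2 < 1" using r by (simp add: zero_less_mult_iff)
    finally show ?thesis .
  qed
  show ?thesis
    unfolding radial_density_def lt eq using r assms(3)
    by (simp add: powr_mult ennreal_mult[symmetric] mult.left_commute)
qed

lemma radial_density_eq_0: "1 \<le> t \<Longrightarrow> radial_density d c t = 0"
  by (simp add: radial_density_def)

lemma inner_normal_angle_eq:
  assumes "fst p < fst q"
  defines "s \<equiv> (snd q - snd p) / (fst q - fst p)"
  shows "p \<bullet> dir (normal_angle p q) = (snd p - s * fst p) / sqrt (1 + s\<^sup>2)"
proof -
  have "normal_angle p q = arctan (- s)"
    unfolding normal_angle_def s_def minus_divide_left minus_diff_eq ..
  then show ?thesis
    by (simp add: inner_dir sin_arctan cos_arctan diff_divide_distrib)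
qed

lemma nn_integral_scale_real:
  fixes v :: real assumes "f \<in> borel_measurable borel" "v > 0"
  shows "(\<integral>\<^sup>+x. f x \<partial>lborel) = ennreal v * (\<integral>\<^sup>+x. f (v * x) \<partial>lborel)"
  using nn_integral_real_affine[of f v 0] assms by simp

lemma lborel_Fubini4:
  fixes f :: "real \<Rightarrow> real \<Rightarrow> real \<Rightarrow> real \<Rightarrow> ennreal"
  assumes [measurable]: "(\<lambda>(a, b, s, r). f a b s r) \<in> borel_measurable (borel \<Otimes>\<^sub>M borel \<Otimes>\<^sub>M borel \<Otimes>\<^sub>M borel)"
  shows "(\<integral>\<^sup>+a. \<integral>\<^sup>+b. \<integral>\<^sup>+s. \<integral>\<^sup>+r. f a b s r \<partial>lborel \<partial>lborel \<partial>lborel \<partial>lborel)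
       = (\<integral>\<^sup>+s. \<integral>\<^sup>+r. \<integral>\<^sup>+a. \<integral>\<^sup>+b. f a b s r \<partial>lborel \<partial>lborel \<partial>lborel \<partial>lborel)"
proof -
  define h where "h = (\<lambda>(a, b, s, r). f a b s r)"
  have [measurable]: "h \<in> borel_measurable (borel \<Otimes>\<^sub>M borel \<Otimes>\<^sub>M borel \<Otimes>\<^sub>M borel)" unfolding h_def by fact
  have h: "f a b s r = h (a, b, s, r)" for a b s r by (simp add: h_def)
  have "(\<integral>\<^sup>+a. \<integral>\<^sup>+b. \<integral>\<^sup>+s. \<integral>\<^sup>+r. h (a, b, s, r) \<partial>lborel \<partial>lborel \<partial>lborel \<partial>lborel)
     = (\<integral>\<^sup>+a. \<integral>\<^sup>+s. \<integral>\<^sup>+b. \<integral>\<^sup>+r. h (a, b, s, r) \<partial>lborel \<partial>lborel \<partial>lborel \<partial>lborel)"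
    by (intro nn_integral_cong lborel_pair.Fubini') measurable
  also have "\<dots> = (\<integral>\<^sup>+s. \<integral>\<^sup>+a. \<integral>\<^sup>+b. \<integral>\<^sup>+r. h (a, b, s, r) \<partial>lborel \<partial>lborel \<partial>lborel \<partial>lborel)"
    by (rule lborel_pair.Fubini') measurable
  also have "\<dots> = (\<integral>\<^sup>+s. \<integral>\<^sup>+a. \<integral>\<^sup>+r. \<integral>\<^sup>+b. h (a, b, s, r) \<partial>lborel \<partial>lborel \<partial>lborel \<partial>lborel)"
    by (intro nn_integral_cong lborel_pair.Fubini') measurable
  also have "\<dots> = (\<integral>\<^sup>+s. \<integral>\<^sup>+r. \<integral>\<^sup>+a. \<integral>\<^sup>+b. h (a, b, s, r) \<partial>lborel \<partial>lborel \<partial>lborel \<partial>lborel)"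
    by (intro nn_integral_cong lborel_pair.Fubini') measurable
  finally show ?thesis unfolding h .
qed

text \<open>The factor u - t is the Jacobian of the parametrisation of point pairs by lines, the
  planar case of the affine Blaschke-Petkantschin formula.\<close>

definition pair_kernel :: "nat \<Rightarrow> real \<Rightarrow> real \<Rightarrow> ennreal" where
  "pair_kernel d c \<rho> = (\<integral>\<^sup>+t. \<integral>\<^sup>+u. (if t < u then ennreal (u - t) * radial_density d c (\<rho>\<^sup>2 + t\<^sup>2) * radial_density d c (\<rho>\<^sup>2 + u\<^sup>2) else 0) \<partial>lborel \<partial>lborel)"

lemma pair_kernel_measurable[measurable]: "pair_kernel d c \<in> borel_measurable borel"
  unfolding pair_kernel_def by measurable

text \<open>Rescaling t and u by sqrt (1 - \<rho>^2) gives three half powers, two from the integrals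
  and one from u - t, and the power (d - 4) / 2 from each density: 3 / 2 + (d - 4) = d - 5 /
  2.\<close>

lemma pair_kernel_scale:
  assumes \<rho>: "\<bar>\<rho>\<bar> < 1" and d: "4 \<le> d" and c: "c \<ge> 0"
  shows "pair_kernel d c \<rho> = ennreal ((1 - \<rho>\<^sup>2) powr (real d - 5 / 2)) * pair_kernel d c 0"
proof -
  define v where "v = sqrt (1 - \<rho>\<^sup>2)"
  define k where "k = (1 - \<rho>\<^sup>2) powr ((real d - 4) / 2)"
  have r: "0 < 1 - \<rho>\<^sup>2" using \<rho> by (simp add: abs_square_less_1)
  have v: "v > 0" using r by (simp add: v_def)
  have k: "k \<ge> 0" by (simp add: k_def)
  have sc: "radial_density d c (\<rho>\<^sup>2 + (v * t)\<^sup>2) = ennreal k * radial_density d c (t\<^sup>2)" for t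
    unfolding v_def k_def by (rule radial_density_scale[OF \<rho> d c])
  have "pair_kernel d c \<rho> = ennreal v * (\<integral>\<^sup>+t. \<integral>\<^sup>+u. (if v * t < u then ennreal (u - v * t) * radial_density d c (\<rho>\<^sup>2 + (v * t)\<^sup>2) * radial_density d c (\<rho>\<^sup>2 + u\<^sup>2) else 0) \<partial>lborel \<partial>lborel)"
    unfolding pair_kernel_def by (rule nn_integral_scale_real[OF _ v]) measurable
  also have "\<dots> = ennreal v * (\<integral>\<^sup>+t. ennreal v * (\<integral>\<^sup>+u. (if v * t < v * u then ennreal (v * u - v * t) * radial_density d c (\<rho>\<^sup>2 + (v * t)\<^sup>2) * radial_density d c (\<rho>\<^sup>2 + (v * u)\<^sup>2) else 0) \<partial>lborel) \<partial>lborel)"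
    by (intro arg_cong[where f="\<lambda>x. ennreal v * x"] nn_integral_cong nn_integral_scale_real[OF _ v]) measurable
  also have "\<dots> = ennreal v * (\<integral>\<^sup>+t. ennreal v * (\<integral>\<^sup>+u. ennreal (v * k * k) * (if t < u then ennreal (u - t) * radial_density d c (0\<^sup>2 + t\<^sup>2) * radial_density d c (0\<^sup>2 + u\<^sup>2) else 0) \<partial>lborel) \<partial>lborel)"
  proof (intro arg_cong[where f="\<lambda>x. ennreal v * x"] nn_integral_cong)
    fix t u
    show "(if v * t < v * u then ennreal (v * u - v * t) * radial_density d c (\<rho>\<^sup>2 + (v * t)\<^sup>2) * radial_density d c (\<rho>\<^sup>2 + (v * u)\<^sup>2) else 0)
      = ennreal (v * k * k) * (if t < u then ennreal (u - t) * radial_density d c (0\<^sup>2 + t\<^sup>2) * radial_density d c (0\<^sup>2 + u\<^sup>2) else 0)"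
    proof (cases "t < u")
      case True
      then have lt: "v * t < v * u" using v by simp
      have e1: "ennreal (v * u - v * t) = ennreal v * ennreal (u - t)"
        using v True by (simp add: right_diff_distrib[symmetric] ennreal_mult)
      have e2: "ennreal (v * k * k) = ennreal v * ennreal k * ennreal k" using v k by (simp add: ennreal_mult)
      have *: "A * B * (K * R1) * (K * R2) = A * K * K * (B * R1 * R2)" for A B K R1 R2 :: ennreal
        by (simp add: mult_ac)
      show ?thesis unfolding if_P[OF True] if_P[OF lt] sc e1 e2 * by simp
    qed (use v in simp)
  qed
  also have "\<dots> = ennreal (v * v * (v * k * k)) * pair_kernel d c 0"
    unfolding pair_kernel_def using v k by (simp add: nn_integral_cmult ennreal_mult mult_ac)
  also have "v * v * (v * k * k) = (1 - \<rho>\<^sup>2) powr (real d - 5 / 2)"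
  proof -
    have "v = (1 - \<rho>\<^sup>2) powr (1 / 2)" unfolding v_def using r by (simp add: powr_half_sqrt)
    then have "v * v * (v * k * k) = (1 - \<rho>\<^sup>2) powr (1/2 + 1/2 + (1/2 + (real d - 4) / 2 + (real d - 4) / 2))"
      unfolding k_def by (simp only: powr_add)
    also have "1/2 + 1/2 + (1/2 + (real d - 4) / 2 + (real d - 4) / 2) = real d - 5 / 2" by (simp add: field_simps)
    finally show ?thesis .
  qed
  finally show ?thesis .
qed

lemma pair_kernel_eq_0: assumes "1 \<le> \<bar>\<rho>\<bar>" shows "pair_kernel d c \<rho> = 0"
proof -
  have "1 \<le> \<rho>\<^sup>2" using assms by (metis abs_le_square_iff abs_one one_power2)
  then have "radial_density d c (\<rho>\<^sup>2 + t\<^sup>2) = 0" for t by (intro radial_density_eq_0) (simp add: add_increasing2)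
  then show ?thesis by (simp add: pair_kernel_def cong: if_cong)
qed

text \<open>A pair of points is parametrised by the slope \<open>s\<close> of its line, the signed distance \<open>\<rho>\<close> of the
  line from the origin, and the positions \<open>t < u\<close> along the line.\<close>

lemma line_substitution:
  fixes g :: "real \<Rightarrow> ennreal" and d :: nat and c :: real
  assumes [measurable]: "g \<in> borel_measurable borel"
  defines "H \<equiv> radial_density d c"
  defines "w \<equiv> \<lambda>s :: real. sqrt (1 + s\<^sup>2)"
  shows "(\<integral>\<^sup>+a. \<integral>\<^sup>+b. (if a < b then \<integral>\<^sup>+y. \<integral>\<^sup>+z. g ((y - (z - y) / (b - a) * a) / w ((z - y) / (b - a))) * H (a\<^sup>2 + y\<^sup>2) * H (b\<^sup>2 + z\<^sup>2) \<partial>lborel \<partial>lborel else 0) \<partial>lborel \<partial>lborel)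
    = (\<integral>\<^sup>+s. ennreal (1 / (1 + s\<^sup>2)) \<partial>lborel) * (\<integral>\<^sup>+\<rho>. g \<rho> * pair_kernel d c \<rho> \<partial>lborel)"
proof -
  have [measurable]: "H \<in> borel_measurable borel" unfolding H_def by measurable
  have [measurable]: "w \<in> borel_measurable borel" unfolding w_def by measurable
  have w: "w s > 0" for s unfolding w_def by (simp add: add_pos_nonneg)
  have w2: "w s * w s = 1 + s\<^sup>2" for s unfolding w_def by (simp add: add_nonneg_nonneg)
  let ?F = "\<lambda>a b s r. ennreal (b - a) * (g (r / w s) * H (a\<^sup>2 + (r + s * a)\<^sup>2) * H (b\<^sup>2 + (r + s * b)\<^sup>2))"
  have step1: "(\<integral>\<^sup>+y. \<integral>\<^sup>+z. g ((y - (z - y) / (b - a) * a) / w ((z - y) / (b - a))) * H (a\<^sup>2 + y\<^sup>2) * H (b\<^sup>2 + z\<^sup>2) \<partial>lborel \<partial>lborel)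
      = (\<integral>\<^sup>+s. \<integral>\<^sup>+r. ?F a b s r \<partial>lborel \<partial>lborel)" if ab: "a < b" for a b
  proof -
    have "(\<integral>\<^sup>+y. \<integral>\<^sup>+z. g ((y - (z - y) / (b - a) * a) / w ((z - y) / (b - a))) * H (a\<^sup>2 + y\<^sup>2) * H (b\<^sup>2 + z\<^sup>2) \<partial>lborel \<partial>lborel)
       = (\<integral>\<^sup>+y. ennreal (b - a) * (\<integral>\<^sup>+s. g ((y - s * a) / w s) * H (a\<^sup>2 + y\<^sup>2) * H (b\<^sup>2 + (y + (b - a) * s)\<^sup>2) \<partial>lborel) \<partial>lborel)"
    proof (rule nn_integral_cong)
      fix y
      show "(\<integral>\<^sup>+z. g ((y - (z - y) / (b - a) * a) / w ((z - y) / (b - a))) * H (a\<^sup>2 + y\<^sup>2) * H (b\<^sup>2 + z\<^sup>2) \<partial>lborel)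
       = ennreal (b - a) * (\<integral>\<^sup>+s. g ((y - s * a) / w s) * H (a\<^sup>2 + y\<^sup>2) * H (b\<^sup>2 + (y + (b - a) * s)\<^sup>2) \<partial>lborel)"
        using ab by (subst nn_integral_real_affine[where c="b - a" and t=y]) auto
    qed
    also have "\<dots> = (\<integral>\<^sup>+y. \<integral>\<^sup>+s. ennreal (b - a) * (g ((y - s * a) / w s) * H (a\<^sup>2 + y\<^sup>2) * H (b\<^sup>2 + (y + (b - a) * s)\<^sup>2)) \<partial>lborel \<partial>lborel)"
      by (intro nn_integral_cong nn_integral_cmult[symmetric]) measurable
    also have "\<dots> = (\<integral>\<^sup>+s. \<integral>\<^sup>+y. ennreal (b - a) * (g ((y - s * a) / w s) * H (a\<^sup>2 + y\<^sup>2) * H (b\<^sup>2 + (y + (b - a) * s)\<^sup>2)) \<partial>lborel \<partial>lborel)"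
      by (rule lborel_pair.Fubini') measurable
    also have "\<dots> = (\<integral>\<^sup>+s. \<integral>\<^sup>+r. ?F a b s r \<partial>lborel \<partial>lborel)"
    proof (rule nn_integral_cong)
      fix s
      show "(\<integral>\<^sup>+y. ennreal (b - a) * (g ((y - s * a) / w s) * H (a\<^sup>2 + y\<^sup>2) * H (b\<^sup>2 + (y + (b - a) * s)\<^sup>2)) \<partial>lborel) = (\<integral>\<^sup>+r. ?F a b s r \<partial>lborel)"
      proof -
        have "(\<integral>\<^sup>+y. f y \<partial>lborel) = (\<integral>\<^sup>+r. f (s * a + r) \<partial>lborel)" if "f \<in> borel_measurable borel" for f :: "real \<Rightarrow> ennreal"
          using nn_integral_real_affine[OF that, of 1 "s * a"] by simp
        from this[of "\<lambda>y. ennreal (b - a) * (g ((y - s * a) / w s) * H (a\<^sup>2 + y\<^sup>2) * H (b\<^sup>2 + (y + (b - a) * s)\<^sup>2))"]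
        have "(\<integral>\<^sup>+y. ennreal (b - a) * (g ((y - s * a) / w s) * H (a\<^sup>2 + y\<^sup>2) * H (b\<^sup>2 + (y + (b - a) * s)\<^sup>2)) \<partial>lborel)
          = (\<integral>\<^sup>+r. ennreal (b - a) * (g ((s * a + r - s * a) / w s) * H (a\<^sup>2 + (s * a + r)\<^sup>2) * H (b\<^sup>2 + (s * a + r + (b - a) * s)\<^sup>2)) \<partial>lborel)"
          by simp
        moreover have "s * a + r - s * a = r" "s * a + r = r + s * a" "s * a + r + (b - a) * s = r + s * b" for r
          by (simp_all add: algebra_simps)
        ultimately show ?thesis by (simp only:)
      qed
    qed
    finally show ?thesis .
  qed
  let ?I = "\<lambda>a b x. if a < b then x else (0 :: ennreal)"
  have "(\<integral>\<^sup>+a. \<integral>\<^sup>+b. (if a < b then \<integral>\<^sup>+y. \<integral>\<^sup>+z. g ((y - (z - y) / (b - a) * a) / w ((z - y) / (b - a))) * H (a\<^sup>2 + y\<^sup>2) * H (b\<^sup>2 + z\<^sup>2) \<partial>lborel \<partial>lborel else 0) \<partial>lborel \<partial>lborel)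
     = (\<integral>\<^sup>+a. \<integral>\<^sup>+b. \<integral>\<^sup>+s. \<integral>\<^sup>+r. ?I a b (?F a b s r) \<partial>lborel \<partial>lborel \<partial>lborel \<partial>lborel)"
  proof (intro nn_integral_cong)
    fix a b :: real
    show "(if a < b then \<integral>\<^sup>+y. \<integral>\<^sup>+z. g ((y - (z - y) / (b - a) * a) / w ((z - y) / (b - a))) * H (a\<^sup>2 + y\<^sup>2) * H (b\<^sup>2 + z\<^sup>2) \<partial>lborel \<partial>lborel else 0)
       = (\<integral>\<^sup>+s. \<integral>\<^sup>+r. ?I a b (?F a b s r) \<partial>lborel \<partial>lborel)"
    proof (cases "a < b")
      case True
      show ?thesis unfolding step1[OF True] if_P[OF True] ..
    next
      case False
      show ?thesis unfolding if_not_P[OF False] by simp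
    qed
  qed
  also have "\<dots> = (\<integral>\<^sup>+s. \<integral>\<^sup>+r. \<integral>\<^sup>+a. \<integral>\<^sup>+b. ?I a b (?F a b s r) \<partial>lborel \<partial>lborel \<partial>lborel \<partial>lborel)"
  proof (rule lborel_Fubini4)
    show "(\<lambda>(a, b, s, r). ?I a b (?F a b s r)) \<in> borel_measurable (borel \<Otimes>\<^sub>M borel \<Otimes>\<^sub>M borel \<Otimes>\<^sub>M borel)"
      unfolding split_beta by measurable
  qed
  also have "\<dots> = (\<integral>\<^sup>+s. ennreal (1 / (1 + s\<^sup>2)) * (\<integral>\<^sup>+\<rho>. g \<rho> * pair_kernel d c \<rho> \<partial>lborel) \<partial>lborel)"
  proof (rule nn_integral_cong)
    fix s :: real
    define v where "v = w s"
    have v: "v > 0" unfolding v_def by (rule w)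
    \<comment> \<open>On the line of slope s at signed distance \<rho>, the point with abscissa x
      has position t = v * x + s * \<rho> relative to the foot of the perpendicular from the origin;
      Pythagoras gives the squared norm.\<close>
    have sq: "x\<^sup>2 + (\<rho> * v + s * x)\<^sup>2 = \<rho>\<^sup>2 + t\<^sup>2" if "x = (t - s * \<rho>) / v" for x \<rho> t
    proof -
      have "t = v * x + s * \<rho>" using that v by (simp add: field_simps)
      then show ?thesis using w2[of s] unfolding v_def[symmetric] by algebra
    qed
    have "(\<integral>\<^sup>+r. \<integral>\<^sup>+a. \<integral>\<^sup>+b. ?I a b (?F a b s r) \<partial>lborel \<partial>lborel \<partial>lborel)
       = ennreal v * (\<integral>\<^sup>+\<rho>. \<integral>\<^sup>+a. \<integral>\<^sup>+b. ?I a b (?F a b s (\<rho> * v)) \<partial>lborel \<partial>lborel \<partial>lborel)"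
    proof -
      have "(\<integral>\<^sup>+r. \<integral>\<^sup>+a. \<integral>\<^sup>+b. ?I a b (?F a b s r) \<partial>lborel \<partial>lborel \<partial>lborel)
         = ennreal v * (\<integral>\<^sup>+\<rho>. \<integral>\<^sup>+a. \<integral>\<^sup>+b. ?I a b (?F a b s (v * \<rho>)) \<partial>lborel \<partial>lborel \<partial>lborel)"
        by (rule nn_integral_scale_real[OF _ v]) measurable
      then show ?thesis by (simp only: mult.commute[of v])
    qed
    also have "(\<integral>\<^sup>+\<rho>. \<integral>\<^sup>+a. \<integral>\<^sup>+b. ?I a b (?F a b s (\<rho> * v)) \<partial>lborel \<partial>lborel \<partial>lborel)
       = (\<integral>\<^sup>+\<rho>. ennreal (1 / v ^ 3) * (g \<rho> * pair_kernel d c \<rho>) \<partial>lborel)"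
    proof (rule nn_integral_cong)
      fix \<rho>
      let ?x = "\<lambda>t. - (s * \<rho>) / v + 1 / v * t"
      have affine: "(\<integral>\<^sup>+a. f a \<partial>lborel) = ennreal (1 / v) * (\<integral>\<^sup>+t. f (?x t) \<partial>lborel)"
        if "f \<in> borel_measurable borel" for f
        using nn_integral_real_affine[OF that, of "1 / v" "- (s * \<rho>) / v"] v by simp
      have x: "?x t = (t - s * \<rho>) / v" for t by (simp add: diff_divide_distrib)
      have "(\<integral>\<^sup>+a. \<integral>\<^sup>+b. ?I a b (?F a b s (\<rho> * v)) \<partial>lborel \<partial>lborel)
         = ennreal (1 / v) * (\<integral>\<^sup>+t. \<integral>\<^sup>+b. ?I (?x t) b (?F (?x t) b s (\<rho> * v)) \<partial>lborel \<partial>lborel)"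
        by (rule affine[of "\<lambda>a. \<integral>\<^sup>+b. ?I a b (?F a b s (\<rho> * v)) \<partial>lborel"]) measurable
      also have "\<dots> = ennreal (1 / v) * (\<integral>\<^sup>+t. ennreal (1 / v) * (\<integral>\<^sup>+u. ?I (?x t) (?x u) (?F (?x t) (?x u) s (\<rho> * v)) \<partial>lborel) \<partial>lborel)"
        by (intro arg_cong[where f="\<lambda>x. ennreal (1 / v) * x"] nn_integral_cong affine) measurable
      also have "\<dots> = ennreal (1 / v) * (\<integral>\<^sup>+t. ennreal (1 / v) * (\<integral>\<^sup>+u. (ennreal (1 / v) * g \<rho>) * (if t < u then ennreal (u - t) * H (\<rho>\<^sup>2 + t\<^sup>2) * H (\<rho>\<^sup>2 + u\<^sup>2) else 0) \<partial>lborel) \<partial>lborel)"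
      proof (intro arg_cong[where f="\<lambda>x. ennreal (1 / v) * x"] nn_integral_cong)
        fix t u
        have lt: "?x t < ?x u \<longleftrightarrow> t < u" using v by (simp add: divide_less_cancel)
        have df: "?x u - ?x t = 1 / v * (u - t)" by (simp add: right_diff_distrib diff_divide_distrib)
        have rv: "\<rho> * v / w s = \<rho>" using v by (simp add: v_def)
        show "?I (?x t) (?x u) (?F (?x t) (?x u) s (\<rho> * v)) = (ennreal (1 / v) * g \<rho>) * (if t < u then ennreal (u - t) * H (\<rho>\<^sup>2 + t\<^sup>2) * H (\<rho>\<^sup>2 + u\<^sup>2) else 0)"
        proof (cases "t < u")
          case True
          have e: "ennreal (1 / v * (u - t)) = ennreal (1 / v) * ennreal (u - t)" by (rule ennreal_mult) (use v True in auto) 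
          have *: "A * B * (G * R1 * R2) = A * G * (B * R1 * R2)" for A B G R1 R2 :: ennreal
            by (simp add: mult_ac)
          show ?thesis unfolding lt df rv sq[OF x] if_P[OF True] e * ..
        next
          case False
          then show ?thesis unfolding lt by simp
        qed
      qed
      also have "\<dots> = ennreal (1 / v) * ennreal (1 / v) * ennreal (1 / v) * (g \<rho> * pair_kernel d c \<rho>)"
        unfolding pair_kernel_def H_def[symmetric] by (simp add: nn_integral_cmult mult_ac)
      also have "ennreal (1 / v) * ennreal (1 / v) * ennreal (1 / v) = ennreal (1 / v ^ 3)"
        using v by (simp add: ennreal_mult[symmetric] power3_eq_cube)
      finally show "(\<integral>\<^sup>+a. \<integral>\<^sup>+b. ?I a b (?F a b s (\<rho> * v)) \<partial>lborel \<partial>lborel) = ennreal (1 / v ^ 3) * (g \<rho> * pair_kernel d c \<rho>)" .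
    qed
    also have "\<dots> = ennreal (1 / v ^ 3) * (\<integral>\<^sup>+\<rho>. g \<rho> * pair_kernel d c \<rho> \<partial>lborel)"
      by (rule nn_integral_cmult) measurable
    \<comment> \<open>The substitution r = \<rho> * v contributes v, while both abscissae and the
      factor b - a contribute 1 / v each. The remaining weight 1 / (1 + s^2) is the uniform measure
      of the angle of the line.\<close>
    also have "ennreal v * (ennreal (1 / v ^ 3) * (\<integral>\<^sup>+\<rho>. g \<rho> * pair_kernel d c \<rho> \<partial>lborel)) = ennreal (1 / (1 + s\<^sup>2)) * (\<integral>\<^sup>+\<rho>. g \<rho> * pair_kernel d c \<rho> \<partial>lborel)"
    proof -
      have "v * (1 / v ^ 3) = 1 / (1 + s\<^sup>2)" using v w2[of s] unfolding v_def[symmetric] by (simp add: power3_eq_cube)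
      then show ?thesis using v by (simp add: mult.assoc[symmetric] ennreal_mult[symmetric])
    qed
    finally show "(\<integral>\<^sup>+r. \<integral>\<^sup>+a. \<integral>\<^sup>+b. ?I a b (?F a b s r) \<partial>lborel \<partial>lborel \<partial>lborel) = ennreal (1 / (1 + s\<^sup>2)) * (\<integral>\<^sup>+\<rho>. g \<rho> * pair_kernel d c \<rho> \<partial>lborel)" .
  qed
  also have "\<dots> = (\<integral>\<^sup>+s. ennreal (1 / (1 + s\<^sup>2)) \<partial>lborel) * (\<integral>\<^sup>+\<rho>. g \<rho> * pair_kernel d c \<rho> \<partial>lborel)"
    by (rule nn_integral_multc) measurable
  finally show ?thesis .
qed

section \<open>Convex sequences and elementary limits\<close>

lemma tendsto_eventually_eq:
  assumes "(f \<longlongrightarrow> l) F" "\<forall>\<^sub>F n in F. f n = g n" "l = l'"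
  shows "(g \<longlongrightarrow> l') F"
  using Lim_transform_eventually[OF assms(1,2)] assms(3) by simp

text \<open>By convexity the decrements are nonincreasing, so each of the j earlier decrements is at
  least the one that follows them.\<close>

lemma convex_sequence_telescope:
  fixes a :: "nat \<Rightarrow> real"
  assumes conv: "\<And>n. a (n + 1) - a (n + 2) \<le> a n - a (n + 1)"
  shows "real j * (a (k + j) - a (k + j + 1)) \<le> a k - a (k + j)"
proof (induction j)
  case (Suc j)
  have "real (Suc j) * (a (k + Suc j) - a (k + Suc j + 1)) \<le> real (Suc j) * (a (k + j) - a (k + j + 1))"
    using conv[of "k + j"] by (intro mult_left_mono) (auto simp: algebra_simps)
  also have "\<dots> = real j * (a (k + j) - a (k + j + 1)) + (a (k + j) - a (k + j + 1))" by (simp add: algebra_simps)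
  also have "\<dots> \<le> a k - a (k + Suc j)" using Suc by simp
  finally show ?case .
qed simp

text \<open>The monotone density argument: a convex sequence of order \<open>n powr (-\<tau>)\<close> decreases at relative rate
  at most \<open>\<tau> / n\<close>, while the number of pairs of points grows at relative rate \<open>2 / n\<close>.\<close>

lemma convex_sequence_increment:
  fixes a :: "nat \<Rightarrow> real" and \<tau> L :: real
  assumes conv: "\<And>n. a (n + 1) - a (n + 2) \<le> a n - a (n + 1)"
    and lim: "(\<lambda>n. a n * real n powr \<tau>) \<longlonglongrightarrow> L" and L: "L > 0" and \<tau>: "0 < \<tau>" "\<tau> < 2"
  shows "\<exists>\<delta>>0. \<forall>\<^sub>F n in sequentially.
     \<delta> * real n powr (1 - \<tau>) \<le> real (n + 1) * real n * a (n - 1) - real n * (real n - 1) * a (n - 2)"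
proof -
  \<comment> \<open>The relative decrease over the last e * n indices, divided by e, tends to \<tau>
    < 2 as e tends to 0. An e for which it is still below 2 is fixed, and the gap gives
    \<open>\<delta>\<close>.\<close>
  have "((\<lambda>e. ((1 - e) powr (- \<tau>) - 1) / e) \<longlongrightarrow> \<tau>) (at_right 0)"
    by real_asymp
  then have "eventually (\<lambda>e. ((1 - e) powr (- \<tau>) - 1) / e < 2) (at_right 0)"
    by (rule order_tendstoD) (use \<tau> in auto)
  moreover have "eventually (\<lambda>e :: real. e < 1 / 2) (at_right 0)" by real_asymp
  moreover have "eventually (\<lambda>e :: real. e > 0) (at_right 0)" by (rule eventually_at_right_less)
  ultimately have "eventually (\<lambda>e. ((1 - e) powr (- \<tau>) - 1) / e < 2 \<and> e < 1 / 2 \<and> e > 0) (at_right 0)"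
    by eventually_elim auto
  then obtain e :: real where e: "((1 - e) powr (- \<tau>) - 1) / e < 2" "e < 1 / 2" "e > 0"
    using eventually_happens'[OF trivial_limit_at_right_real] by blast
  define \<delta> where "\<delta> = L * (2 - ((1 - e) powr (- \<tau>) - 1) / e)"
  have \<delta>: "\<delta> > 0" using e L by (simp add: \<delta>_def)
  \<comment> \<open>The window over which the decrements are averaged: it consists of the last
    \<open>j n\<close> indices and starts at \<open>f n\<close>.\<close>
  define j where "j n = nat \<lfloor>e * real n\<rfloor>" for n
  define f where "f n = n - 1 - j n" for n
  have jr: "real (j n) = of_int \<lfloor>e * real n\<rfloor>" for n using e by (simp add: j_def)
  have jle: "real (j n) \<le> e * real n" for n unfolding jr by linarith
  have f_eq: "real (f n) = real n - 1 - real (j n)" if "n \<ge> 2" for n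
  proof -
    have "real (j n) \<le> real n / 2" using jle[of n] e(2) mult_right_mono[of e "1 / 2" "real n"] by simp
    then have "j n \<le> n - 1" using that by linarith
    then show ?thesis using that by (simp add: f_def of_nat_diff)
  qed
  have jlim: "(\<lambda>n. real (j n) / real n) \<longlonglongrightarrow> e"
    unfolding jr using e by real_asymp
  have flim: "(\<lambda>n. real (f n) / real n) \<longlonglongrightarrow> 1 - e"
  proof -
    have "(\<lambda>n. 1 - 1 / real n - real (j n) / real n) \<longlonglongrightarrow> 1 - 0 - e"
      by (intro tendsto_intros jlim lim_1_over_n)
    moreover have "\<forall>\<^sub>F n in sequentially. 1 - 1 / real n - real (j n) / real n = real (f n) / real n"
      using eventually_ge_at_top[of 2] by eventually_elim (simp add: f_eq diff_divide_distrib)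
    ultimately show ?thesis by (rule tendsto_eventually_eq) simp
  qed
  have ftop: "filterlim f at_top sequentially"
  proof -
    have "filterlim (\<lambda>n. real (f n) / real n * real n) at_top sequentially"
      by (rule filterlim_tendsto_pos_mult_at_top[OF flim]) (use e in \<open>auto intro: filterlim_real_sequentially\<close>)
    moreover have "\<forall>\<^sub>F n in sequentially. real (f n) / real n * real n = real (f n)"
      using eventually_gt_at_top[of 0] by eventually_elim simp
    ultimately have "filterlim (\<lambda>n. real (f n)) at_top sequentially"
      using filterlim_cong[OF refl refl] by fast
    then show ?thesis by (simp only: filterlim_sequentially_iff_filterlim_real)
  qed
  have A: "(\<lambda>n. a (f n) * real n powr \<tau>) \<longlonglongrightarrow> L * (1 - e) powr (- \<tau>)"
  proof -
    have "(\<lambda>n. (a (f n) * real (f n) powr \<tau>) * (real (f n) / real n) powr (- \<tau>)) \<longlonglongrightarrow> L * (1 - e) powr (- \<tau>)"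
      using e by (intro tendsto_mult filterlim_compose[OF lim ftop] tendsto_powr flim tendsto_const) auto
    moreover have "\<forall>\<^sub>F n in sequentially. (a (f n) * real (f n) powr \<tau>) * (real (f n) / real n) powr (- \<tau>) = a (f n) * real n powr \<tau>"
      using filterlim_at_top[THEN iffD1, OF ftop, rule_format, of 1] eventually_gt_at_top[of 0]
      by eventually_elim (simp add: powr_divide powr_minus field_simps)
    ultimately show ?thesis by (rule Lim_transform_eventually)
  qed
  have B: "(\<lambda>n. a (n - 1) * real n powr \<tau>) \<longlonglongrightarrow> L"
  proof -
    have t: "filterlim (\<lambda>n :: nat. n - 1) at_top sequentially"
      by (rule filterlim_minus_const_nat_at_top)
    have "(\<lambda>n. real (n - 1) / real n) \<longlonglongrightarrow> 1" by real_asymp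
    then have "(\<lambda>n. (a (n - 1) * real (n - 1) powr \<tau>) * (real (n - 1) / real n) powr (- \<tau>)) \<longlonglongrightarrow> L * 1 powr (- \<tau>)"
      by (intro tendsto_mult filterlim_compose[OF lim t] tendsto_powr tendsto_const) auto
    moreover have "\<forall>\<^sub>F n in sequentially. (a (n - 1) * real (n - 1) powr \<tau>) * (real (n - 1) / real n) powr (- \<tau>) = a (n - 1) * real n powr \<tau>"
      using eventually_gt_at_top[of 1]
      by eventually_elim (simp add: powr_divide powr_minus field_simps)
    ultimately show ?thesis by (rule tendsto_eventually_eq) simp
  qed
  have C: "(\<lambda>n. (real n - 1) / real (j n)) \<longlonglongrightarrow> 1 / e"
  proof -
    have "(\<lambda>n. ((real n - 1) / real n) / (real (j n) / real n)) \<longlonglongrightarrow> 1 / e"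
      using e by (intro tendsto_divide jlim) (real_asymp, simp)
    moreover have "\<forall>\<^sub>F n in sequentially. ((real n - 1) / real n) / (real (j n) / real n) = (real n - 1) / real (j n)"
      using eventually_gt_at_top[of 0] by eventually_elim simp
    ultimately show ?thesis by (rule Lim_transform_eventually)
  qed
  have "(\<lambda>n. 2 * (a (n - 1) * real n powr \<tau>) - (real n - 1) / real (j n) * (a (f n) * real n powr \<tau> - a (n - 1) * real n powr \<tau>))
      \<longlonglongrightarrow> 2 * L - 1 / e * (L * (1 - e) powr (- \<tau>) - L)"
    by (intro tendsto_intros A B C)
  also have "2 * L - 1 / e * (L * (1 - e) powr (- \<tau>) - L) = \<delta>" using e by (simp add: \<delta>_def field_simps)
  finally have "\<forall>\<^sub>F n in sequentially. \<delta> / 2 < 2 * (a (n - 1) * real n powr \<tau>) - (real n - 1) / real (j n) * (a (f n) * real n powr \<tau> - a (n - 1) * real n powr \<tau>)"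
    by (rule order_tendstoD) (use \<delta> in auto)
  moreover have "\<forall>\<^sub>F n in sequentially. j n > 0"
  proof -
    have "\<forall>\<^sub>F n in sequentially. e / 2 < real (j n) / real n" by (rule order_tendstoD[OF jlim]) (use e in auto)
    then show ?thesis by eventually_elim (use e in \<open>auto intro!: Nat.gr0I\<close>)
  qed
  ultimately have "\<forall>\<^sub>F n in sequentially. \<delta> / 2 * real n powr (1 - \<tau>) \<le> real (n + 1) * real n * a (n - 1) - real n * (real n - 1) * a (n - 2)"
    using eventually_ge_at_top[of 2]
  proof eventually_elim
    case (elim n)
    \<comment> \<open>In terms of \<open>D\<close> the increment is n * (2 * a (n - 1) - (n - 1) *
      D), so an upper bound for \<open>D\<close> is wanted. Convexity bounds it by the mean
      decrement over the window.\<close>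
    define D where "D = a (n - 2) - a (n - 1)"
    have fj: "f n + j n = n - 1" using f_eq[of n] elim by linarith
    have j1: "j n \<ge> 1" using elim by simp
    have k: "f n + (j n - 1) = n - 2" "n - 2 + 1 = n - 1" using fj j1 elim by linarith+
    have "real (j n - 1) * D \<le> a (f n) - a (n - 2)"
      using convex_sequence_telescope[OF conv, where j="j n - 1" and k="f n", unfolded k] unfolding D_def .
    then have "real (j n) * D \<le> a (f n) - a (n - 1)"
      using j1 by (simp add: D_def of_nat_diff algebra_simps)
    then have "(real n - 1) * D \<le> (real n - 1) / real (j n) * (a (f n) - a (n - 1))"
      using j1 elim(3) mult_left_mono[of "real (j n) * D" "a (f n) - a (n - 1)" "(real n - 1) / real (j n)"] by simp
    then have "(2 * a (n - 1) - (real n - 1) / real (j n) * (a (f n) - a (n - 1))) * real n powr \<tau> \<le> (2 * a (n - 1) - (real n - 1) * D) * real n powr \<tau>"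
      by (intro mult_right_mono) auto
    then have "\<delta> / 2 \<le> (2 * a (n - 1) - (real n - 1) * D) * real n powr \<tau>"
      using elim(1) by (simp add: algebra_simps)
    then have "\<delta> / 2 * (real n * real n powr (- \<tau>)) \<le> (2 * a (n - 1) - (real n - 1) * D) * real n powr \<tau> * (real n * real n powr (- \<tau>))"
      by (rule mult_right_mono) auto
    also have "\<dots> = (2 * a (n - 1) - (real n - 1) * D) * real n * (real n powr \<tau> * real n powr (- \<tau>))" by simp
    also have "real n powr \<tau> * real n powr (- \<tau>) = 1" using elim(3) by (simp flip: powr_add)
    also have "(2 * a (n - 1) - (real n - 1) * D) * real n * 1 = real (n + 1) * real n * a (n - 1) - real n * (real n - 1) * a (n - 2)"
      by (simp add: D_def algebra_simps)
    also have "real n * real n powr (- \<tau>) = real n powr (1 - \<tau>)"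
      using elim(3) powr_add[of "real n" 1 "- \<tau>"] by simp
    finally show ?case .
  qed
  then show ?thesis using \<delta> by (intro exI[of _ "\<delta> / 2"]) auto
qed

lemma power_one_minus_limit:
  fixes t :: "nat \<Rightarrow> real"
  assumes lim: "(\<lambda>n. real n * t n) \<longlonglongrightarrow> x"
  shows "(\<lambda>n. (1 - t n) ^ n) \<longlonglongrightarrow> exp (- x)"
proof -
  have t0: "t \<longlonglongrightarrow> 0"
  proof -
    have "(\<lambda>n. 1 / real n * (real n * t n)) \<longlonglongrightarrow> 0 * x" by (intro tendsto_mult lim lim_1_over_n)
    moreover have "\<forall>\<^sub>F n in sequentially. 1 / real n * (real n * t n) = t n"
      using eventually_gt_at_top[of 0] by eventually_elim simp
    ultimately show ?thesis by (rule tendsto_eventually_eq) simp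
  qed
  have lower: "exp (- (u / (1 - u))) \<le> 1 - u" if "u < 1" for u :: real
  proof -
    have "1 + u / (1 - u) \<le> exp (u / (1 - u))" by (rule exp_ge_add_one_self)
    moreover have "1 + u / (1 - u) = 1 / (1 - u)" using that by (simp add: field_simps)
    ultimately show ?thesis using that by (simp add: exp_minus field_simps)
  qed
  have small: "\<forall>\<^sub>F n in sequentially. t n < 1" by (rule order_tendstoD[OF t0]) auto
  show ?thesis
  proof (rule tendsto_sandwich)
    show "\<forall>\<^sub>F n in sequentially. exp (- ((real n * t n) / (1 - t n))) \<le> (1 - t n) ^ n"
      using small
    proof eventually_elim
      case (elim n)
      have "exp (- ((real n * t n) / (1 - t n))) = exp (- (t n / (1 - t n))) ^ n"
        by (simp flip: exp_of_nat_mult)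
      also have "\<dots> \<le> (1 - t n) ^ n" by (intro power_mono lower elim) auto
      finally show ?case .
    qed
    show "\<forall>\<^sub>F n in sequentially. (1 - t n) ^ n \<le> exp (- (real n * t n))"
      using small
    proof eventually_elim
      case (elim n)
      have "1 - t n \<le> exp (- t n)" using exp_ge_add_one_self[of "- t n"] by simp
      then have "(1 - t n) ^ n \<le> exp (- t n) ^ n" using elim by (intro power_mono) auto
      then show ?case by (simp flip: exp_of_nat_mult)
    qed
    show "(\<lambda>n. exp (- ((real n * t n) / (1 - t n)))) \<longlonglongrightarrow> exp (- x)"
      using tendsto_divide[OF lim tendsto_diff[OF tendsto_const t0], of 1] by (intro tendsto_exp tendsto_minus) simp
    show "(\<lambda>n. exp (- (real n * t n))) \<longlonglongrightarrow> exp (- x)" by (intro tendsto_exp tendsto_minus lim)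
  qed
qed

lemma nn_integral_powr_from_0:
  assumes "0 \<le> a" "0 \<le> s"
  shows "(\<integral>\<^sup>+v. (if 0 < v \<and> v \<le> s then ennreal (v powr a) else 0) \<partial>lborel) = ennreal (s powr (a + 1) / (a + 1))"
proof -
  have "((\<lambda>v. if v \<in> {0..s} then v powr a else 0) has_integral (s powr (a + 1) / (a + 1))) UNIV"
    unfolding has_integral_restrict_UNIV using assms by (intro has_integral_powr_from_0) auto
  then have "(\<integral>\<^sup>+v. ennreal (if v \<in> {0..s} then v powr a else 0) \<partial>lborel) = ennreal (s powr (a + 1) / (a + 1))"
    by (intro nn_integral_has_integral_lborel) auto
  moreover have "(\<integral>\<^sup>+v. (if 0 < v \<and> v \<le> s then ennreal (v powr a) else 0) \<partial>lborel) = (\<integral>\<^sup>+v. ennreal (if v \<in> {0..s} then v powr a else 0) \<partial>lborel)"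
  proof (rule nn_integral_cong_AE)
    have "AE v in lborel. v \<noteq> (0 :: real)" by (rule AE_lborel_singleton)
    then show "AE v in lborel. (if 0 < v \<and> v \<le> s then ennreal (v powr a) else 0) = ennreal (if v \<in> {0..s} then v powr a else 0)"
      by eventually_elim auto
  qed
  ultimately show ?thesis by simp
qed

lemma square_lt_1_iff: "\<rho>\<^sup>2 < 1 \<longleftrightarrow> \<bar>\<rho>\<bar> < (1 :: real)"
  by (rule abs_square_less_1)

section \<open>Marginals and cap measures of the planar law\<close>

lemma fst_snd_measurable[measurable]:
  "(fst :: real \<times> real \<Rightarrow> real) \<in> borel_measurable borel" "(snd :: real \<times> real \<Rightarrow> real) \<in> borel_measurable borel"
  by (intro borel_measurable_continuous_onI continuous_intros)+

text \<open>Rotation invariance is stated as the equality of all one-dimensional marginals: this is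
  how the measure of a cap or a half plane in any direction reduces to the vertical
  direction.\<close>

locale planar_beta =
  fixes \<nu> :: "(real \<times> real) measure" and d :: nat and c :: real
  assumes d4: "4 \<le> d" and c_pos: "0 < c"
    and nu_density: "\<nu> = density lborel (\<lambda>z. radial_density d c ((fst z)\<^sup>2 + (snd z)\<^sup>2))"
    and nu_prob: "prob_space \<nu>"
    and rot: "\<And>\<phi>. distr \<nu> borel (\<lambda>z. z \<bullet> dir \<phi>) = distr \<nu> borel snd"
begin

sublocale prob_space \<nu> by (rule nu_prob)

lemma sets_nu[measurable_cong, simp]: "sets \<nu> = sets borel" by (simp add: nu_density)
lemma space_nu[simp]: "space \<nu> = UNIV" by (simp add: nu_density)

lemma nn_integral_nu:
  assumes [measurable]: "g \<in> borel_measurable borel"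
  shows "(\<integral>\<^sup>+z. g z \<partial>\<nu>) = (\<integral>\<^sup>+a. \<integral>\<^sup>+y. radial_density d c (a\<^sup>2 + y\<^sup>2) * g (a, y) \<partial>lborel \<partial>lborel)"
proof -
  have "(\<integral>\<^sup>+z. g z \<partial>\<nu>) = (\<integral>\<^sup>+z. radial_density d c ((fst z)\<^sup>2 + (snd z)\<^sup>2) * g z \<partial>lborel)"
    unfolding nu_density by (rule nn_integral_density) measurable
  also have "\<dots> = (\<integral>\<^sup>+z. radial_density d c ((fst z)\<^sup>2 + (snd z)\<^sup>2) * g z \<partial>(lborel \<Otimes>\<^sub>M lborel))"
    by (simp only: lborel_prod)
  also have "\<dots> = (\<integral>\<^sup>+a. \<integral>\<^sup>+y. radial_density d c (a\<^sup>2 + y\<^sup>2) * g (a, y) \<partial>lborel \<partial>lborel)"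
    by (subst lborel.nn_integral_fst[symmetric]) (simp_all add: lborel_prod)
  finally show ?thesis .
qed

text \<open>The marginal density is proportional to (1 - y^2) powr \<open>marg_exp\<close>, with
  factor \<open>K1\<close>, and integrates to a cap measure of order s powr \<open>tail_exp\<close>
  at depth s.\<close>

definition marg_exp :: real where "marg_exp = (real d - 3) / 2"
definition tail_exp :: real where "tail_exp = (real d - 1) / 2"
definition K1 :: ennreal where "K1 = (\<integral>\<^sup>+a. radial_density d c (a\<^sup>2) \<partial>lborel)"

lemma marg_exp_pos: "0 < marg_exp" and tail_exp_marg_exp: "tail_exp = marg_exp + 1" and tail_exp_pos: "1 < tail_exp"
  using d4 by (simp_all add: marg_exp_def tail_exp_def field_simps)

definition marg :: "real \<Rightarrow> ennreal" where
  "marg y = (if \<bar>y\<bar> < 1 then ennreal ((1 - y\<^sup>2) powr marg_exp) else 0)"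

lemma marg_measurable[measurable]: "marg \<in> borel_measurable borel"
  unfolding marg_def by measurable

lemma marginal_density: "(\<integral>\<^sup>+a. radial_density d c (a\<^sup>2 + y\<^sup>2) \<partial>lborel) = K1 * marg y"
proof (cases "\<bar>y\<bar> < 1")
  case True
  then have r: "0 < 1 - y\<^sup>2" by (simp add: abs_square_less_1)
  have "(\<integral>\<^sup>+a. radial_density d c (a\<^sup>2 + y\<^sup>2) \<partial>lborel)
      = ennreal (sqrt (1 - y\<^sup>2)) * (\<integral>\<^sup>+a. radial_density d c ((sqrt (1 - y\<^sup>2) * a)\<^sup>2 + y\<^sup>2) \<partial>lborel)"
    by (rule nn_integral_scale_real) (use r in auto)
  also have "\<dots> = ennreal (sqrt (1 - y\<^sup>2)) * (\<integral>\<^sup>+a. ennreal ((1 - y\<^sup>2) powr ((real d - 4) / 2)) * radial_density d c (a\<^sup>2) \<partial>lborel)"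
    using radial_density_scale[OF True d4, of c] c_pos by (simp add: add.commute)
  also have "\<dots> = ennreal (sqrt (1 - y\<^sup>2)) * ennreal ((1 - y\<^sup>2) powr ((real d - 4) / 2)) * K1"
    unfolding K1_def by (subst nn_integral_cmult) (auto simp: mult.assoc)
  also have "ennreal (sqrt (1 - y\<^sup>2)) * ennreal ((1 - y\<^sup>2) powr ((real d - 4) / 2)) = ennreal ((1 - y\<^sup>2) powr (1 / 2) * (1 - y\<^sup>2) powr ((real d - 4) / 2))"
    using r by (subst ennreal_mult) (auto simp: powr_half_sqrt)
  also have "(1 - y\<^sup>2) powr (1 / 2) * (1 - y\<^sup>2) powr ((real d - 4) / 2) = (1 - y\<^sup>2) powr marg_exp"
    unfolding powr_add[symmetric] marg_exp_def by (rule arg_cong2[where f="(powr)"]) (simp_all add: field_simps)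
  finally show ?thesis using True by (simp add: marg_def mult.commute)
next
  case False
  then have "1 \<le> y\<^sup>2" using square_lt_1_iff[of y] by simp
  then have "radial_density d c (a\<^sup>2 + y\<^sup>2) = 0" for a by (intro radial_density_eq_0) (simp add: add_increasing)
  then show ?thesis using False by (simp add: marg_def)
qed

lemma nn_integral_snd:
  assumes [measurable]: "g \<in> borel_measurable borel"
  shows "(\<integral>\<^sup>+z. g (snd z) \<partial>\<nu>) = K1 * (\<integral>\<^sup>+y. g y * marg y \<partial>lborel)"
proof -
  have "(\<integral>\<^sup>+z. g (snd z) \<partial>\<nu>) = (\<integral>\<^sup>+a. \<integral>\<^sup>+y. radial_density d c (a\<^sup>2 + y\<^sup>2) * g y \<partial>lborel \<partial>lborel)"
    using nn_integral_nu[of "\<lambda>z. g (snd z)"] by simp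
  also have "\<dots> = (\<integral>\<^sup>+y. \<integral>\<^sup>+a. radial_density d c (a\<^sup>2 + y\<^sup>2) * g y \<partial>lborel \<partial>lborel)"
    by (rule lborel_pair.Fubini'[symmetric]) measurable
  also have "\<dots> = (\<integral>\<^sup>+y. K1 * (g y * marg y) \<partial>lborel)"
    by (intro nn_integral_cong) (subst nn_integral_multc, measurable, simp add: marginal_density mult_ac)
  also have "\<dots> = K1 * (\<integral>\<^sup>+y. g y * marg y \<partial>lborel)" by (rule nn_integral_cmult) measurable
  finally show ?thesis .
qed

lemma emeasure_snd_ge: "emeasure \<nu> {z. r \<le> snd z} = (\<integral>\<^sup>+z. indicator {r..} (snd z) \<partial>\<nu>)"
proof -
  have "emeasure \<nu> {z. r \<le> snd z} = (\<integral>\<^sup>+z. indicator {z. r \<le> snd z} z \<partial>\<nu>)"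
    by (subst nn_integral_indicator) auto
  also have "\<dots> = (\<integral>\<^sup>+z. indicator {r..} (snd z) \<partial>\<nu>)"
    by (intro nn_integral_cong) (simp add: indicator_def)
  finally show ?thesis .
qed

definition tail :: "real \<Rightarrow> real" where "tail s = measure \<nu> {z. 1 - s \<le> snd z}"
definition phi :: "real \<Rightarrow> real" where "phi r = measure \<nu> {z. snd z < r}"

lemma emeasure_tail: "emeasure \<nu> {z. 1 - s \<le> snd z}
    = K1 * (\<integral>\<^sup>+v. (if 0 < v \<and> v < 2 \<and> v \<le> s then ennreal ((v * (2 - v)) powr marg_exp) else 0) \<partial>lborel)"
proof -
  have "emeasure \<nu> {z. 1 - s \<le> snd z} = (\<integral>\<^sup>+z. indicator {1 - s..} (snd z) \<partial>\<nu>)"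
    by (rule emeasure_snd_ge)
  also have "\<dots> = K1 * (\<integral>\<^sup>+y. indicator {1 - s..} y * marg y \<partial>lborel)" by (rule nn_integral_snd) measurable
  also have "(\<integral>\<^sup>+y. indicator {1 - s..} y * marg y \<partial>lborel) = (\<integral>\<^sup>+v. indicator {1 - s..} (1 + (-1) * v) * marg (1 + (-1) * v) \<partial>lborel)"
    by (subst nn_integral_real_affine[where c="-1" and t=1]) auto
  also have "\<dots> = (\<integral>\<^sup>+v. (if 0 < v \<and> v < 2 \<and> v \<le> s then ennreal ((v * (2 - v)) powr marg_exp) else 0) \<partial>lborel)"
  proof (rule nn_integral_cong)
    fix v :: real
    have "1 - (1 + (-1) * v)\<^sup>2 = v * (2 - v)" by (simp add: power2_eq_square algebra_simps)
    then show "indicator {1 - s..} (1 + (-1) * v) * marg (1 + (-1) * v) = (if 0 < v \<and> v < 2 \<and> v \<le> s then ennreal ((v * (2 - v)) powr marg_exp) else 0)"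
      unfolding marg_def by (auto simp: indicator_def abs_if)
  qed
  finally show ?thesis .
qed

lemma tail_bounds_ennreal:
  assumes "0 \<le> s" "s \<le> 2"
  shows "K1 * ennreal ((2 - s) powr marg_exp * (s powr tail_exp / tail_exp)) \<le> emeasure \<nu> {z. 1 - s \<le> snd z}"
    and "emeasure \<nu> {z. 1 - s \<le> snd z} \<le> K1 * ennreal (2 powr marg_exp * (s powr tail_exp / tail_exp))"
proof -
  have I: "(\<integral>\<^sup>+v. (if 0 < v \<and> v \<le> s then ennreal (v powr marg_exp) else 0) \<partial>lborel) = ennreal (s powr tail_exp / tail_exp)"
    unfolding tail_exp_marg_exp using marg_exp_pos assms by (intro nn_integral_powr_from_0) auto
  have m: "ennreal k * (\<integral>\<^sup>+v. (if 0 < v \<and> v \<le> s then ennreal (v powr marg_exp) else 0) \<partial>lborel)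
      = (\<integral>\<^sup>+v. (if 0 < v \<and> v \<le> s then ennreal (k * v powr marg_exp) else 0) \<partial>lborel)" if "0 \<le> k" for k
    by (subst nn_integral_cmult[symmetric]) (auto intro!: nn_integral_cong simp: ennreal_mult that)
  have k: "ennreal (k * (s powr tail_exp / tail_exp)) = ennreal k * ennreal (s powr tail_exp / tail_exp)" if "0 \<le> k" for k
    using that tail_exp_pos by (intro ennreal_mult) auto
  have AE2: "AE v in lborel. v \<noteq> (2 :: real)" by (rule AE_lborel_singleton)
  show "K1 * ennreal ((2 - s) powr marg_exp * (s powr tail_exp / tail_exp)) \<le> emeasure \<nu> {z. 1 - s \<le> snd z}"
    unfolding emeasure_tail k[OF powr_ge_zero] I[symmetric] m[OF powr_ge_zero]
  proof (rule mult_left_mono[OF nn_integral_mono_AE])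
    show "AE v in lborel. (if 0 < v \<and> v \<le> s then ennreal ((2 - s) powr marg_exp * v powr marg_exp) else 0)
        \<le> (if 0 < v \<and> v < 2 \<and> v \<le> s then ennreal ((v * (2 - v)) powr marg_exp) else 0)"
      using AE2
    proof eventually_elim
      case (elim v)
      show ?case
      proof (cases "0 < v \<and> v \<le> s")
        case True
        then have "(2 - s) powr marg_exp * v powr marg_exp \<le> (2 - v) powr marg_exp * v powr marg_exp"
          using marg_exp_pos assms by (intro mult_right_mono powr_mono2) auto
        also have "\<dots> = (v * (2 - v)) powr marg_exp" using True assms by (simp add: powr_mult mult.commute)
        finally show ?thesis using True elim assms by (auto intro: ennreal_leI)
      qed auto
    qed
  qed simp
  show "emeasure \<nu> {z. 1 - s \<le> snd z} \<le> K1 * ennreal (2 powr marg_exp * (s powr tail_exp / tail_exp))"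
    unfolding emeasure_tail k[OF powr_ge_zero] I[symmetric] m[OF powr_ge_zero]
  proof (intro mult_left_mono nn_integral_mono)
    fix v :: real
    show "(if 0 < v \<and> v < 2 \<and> v \<le> s then ennreal ((v * (2 - v)) powr marg_exp) else 0)
        \<le> (if 0 < v \<and> v \<le> s then ennreal (2 powr marg_exp * v powr marg_exp) else 0)"
    proof (cases "0 < v \<and> v < 2 \<and> v \<le> s")
      case True
      then have "(v * (2 - v)) powr marg_exp = (2 - v) powr marg_exp * v powr marg_exp" by (simp add: powr_mult mult.commute)
      also have "\<dots> \<le> 2 powr marg_exp * v powr marg_exp"
        using marg_exp_pos True by (intro mult_right_mono powr_mono2) auto
      finally show ?thesis using True by (auto intro: ennreal_leI)
    qed auto
  qed simp
qed

lemma total_tail: "emeasure \<nu> {z. 1 - 2 \<le> snd z} = 1"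
proof -
  have "1 = (\<integral>\<^sup>+z. 1 \<partial>\<nu>)" using emeasure_space_1 by simp
  also have "\<dots> = K1 * (\<integral>\<^sup>+y. 1 * marg y \<partial>lborel)" by (rule nn_integral_snd) measurable
  also have "(\<integral>\<^sup>+y. 1 * marg y \<partial>lborel) = (\<integral>\<^sup>+y. indicator {1 - 2..} y * marg y \<partial>lborel)"
    by (intro nn_integral_cong) (auto simp: marg_def indicator_def)
  also have "K1 * \<dots> = (\<integral>\<^sup>+z. indicator {1 - 2..} (snd z) \<partial>\<nu>)" by (rule nn_integral_snd[symmetric]) measurable
  also have "\<dots> = emeasure \<nu> {z. 1 - 2 \<le> snd z}"
    by (rule emeasure_snd_ge[symmetric])
  finally show ?thesis by simp
qed

text \<open>Read off from the total mass one: \<open>K1 = 0\<close> would make the whole disc a null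
  set, and an infinite \<open>K1\<close> would give infinite mass to the upper half plane.\<close>

lemma K1_bounds: "K1 \<noteq> 0" "K1 \<noteq> \<infinity>"
proof -
  show "K1 \<noteq> 0" using tail_bounds_ennreal(2)[of 2] total_tail by auto
  have "ennreal ((2 - 1) powr marg_exp * (1 powr tail_exp / tail_exp)) > 0" using tail_exp_pos by simp
  moreover have "K1 * ennreal ((2 - 1) powr marg_exp * (1 powr tail_exp / tail_exp)) \<le> emeasure \<nu> {z. 1 - 1 \<le> snd z}"
    by (rule tail_bounds_ennreal) auto
  moreover have "emeasure \<nu> {z. 1 - 1 \<le> snd z} < \<infinity>" by (simp add: less_top[symmetric])
  ultimately show "K1 \<noteq> \<infinity>" by (auto simp: ennreal_top_mult split: if_splits)
qed

definition k1 :: real where "k1 = enn2real K1"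
lemma K1_eq: "K1 = ennreal k1" and k1_pos: "0 < k1"
  using K1_bounds by (auto simp: k1_def enn2real_positive_iff less_top[symmetric] zero_less_iff_neq_zero)

lemma tail_lower: assumes "0 \<le> s" "s \<le> 2" shows "k1 / tail_exp * (2 - s) powr marg_exp * s powr tail_exp \<le> tail s"
proof -
  have "ennreal (k1 / tail_exp * (2 - s) powr marg_exp * s powr tail_exp) = K1 * ennreal ((2 - s) powr marg_exp * (s powr tail_exp / tail_exp))"
    unfolding K1_eq using k1_pos tail_exp_pos by (subst ennreal_mult[symmetric]) (auto simp: field_simps)
  also have "\<dots> \<le> ennreal (tail s)" using tail_bounds_ennreal(1)[OF assms] by (simp add: tail_def emeasure_eq_measure)
  finally show ?thesis by (subst (asm) ennreal_le_iff) (auto simp: tail_def)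
qed

lemma tail_upper: assumes "0 \<le> s" "s \<le> 2" shows "tail s \<le> k1 / tail_exp * 2 powr marg_exp * s powr tail_exp"
proof -
  have "ennreal (tail s) \<le> K1 * ennreal (2 powr marg_exp * (s powr tail_exp / tail_exp))"
    using tail_bounds_ennreal(2)[OF assms] by (simp add: tail_def emeasure_eq_measure)
  also have "\<dots> = ennreal (k1 / tail_exp * 2 powr marg_exp * s powr tail_exp)"
    unfolding K1_eq using k1_pos tail_exp_pos by (subst ennreal_mult[symmetric]) (auto simp: field_simps)
  finally show ?thesis using k1_pos tail_exp_pos by (subst (asm) ennreal_le_iff) auto
qed

definition lower_const :: real where "lower_const = k1 / tail_exp * 2 powr (- tail_exp)"
definition upper_const :: real where "upper_const = k1 / tail_exp * 2 powr marg_exp"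

lemma lower_const_pos: "0 < lower_const" and upper_const_pos: "0 < upper_const" using k1_pos tail_exp_pos by (auto simp: lower_const_def upper_const_def)

lemma tail_mono: "s \<le> s' \<Longrightarrow> tail s \<le> tail s'"
  unfolding tail_def by (intro finite_measure_mono) auto

text \<open>Up to s = 1 the bound \<open>tail_lower\<close> has a factor at least 1. Beyond,
  \<open>tail s\<close> is at least \<open>tail 1\<close>, and the factor 2 powr (-
  \<open>tail_exp\<close>) in \<open>lower_const\<close> compensates for the growth of s powr
  \<open>tail_exp\<close>.\<close>

lemma tail_ge: assumes "0 \<le> s" "s \<le> 2" shows "lower_const * s powr tail_exp \<le> tail s"
proof (cases "s \<le> 1")
  case True
  have "lower_const * s powr tail_exp \<le> k1 / tail_exp * 1 * s powr tail_exp"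
    unfolding lower_const_def using k1_pos tail_exp_pos powr_mono[of "- tail_exp" 0 2]
    by (intro mult_right_mono mult_left_mono) auto
  also have "\<dots> \<le> k1 / tail_exp * (2 - s) powr marg_exp * s powr tail_exp"
    using k1_pos tail_exp_pos True marg_exp_pos by (intro mult_right_mono mult_left_mono ge_one_powr_ge_zero) auto
  also have "\<dots> \<le> tail s" by (rule tail_lower[OF assms])
  finally show ?thesis .
next
  case False
  have "s powr tail_exp \<le> 2 powr tail_exp" using assms tail_exp_pos by (intro powr_mono2) auto
  then have "lower_const * s powr tail_exp \<le> lower_const * 2 powr tail_exp" using lower_const_pos by simp
  also have "\<dots> = k1 / tail_exp" unfolding lower_const_def by (simp add: powr_minus)
  also have "\<dots> = k1 / tail_exp * (2 - 1) powr marg_exp * 1 powr tail_exp" by simp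
  also have "\<dots> \<le> tail 1" by (rule tail_lower) auto
  also have "\<dots> \<le> tail s" using False by (intro tail_mono) auto
  finally show ?thesis .
qed

lemma tail_le: assumes "0 \<le> s" "s \<le> 2" shows "tail s \<le> upper_const * s powr tail_exp"
  using tail_upper[OF assms] by (simp add: upper_const_def)

text \<open>The lower and upper bounds meet as the depth tends to 0, so \<open>upper_const\<close>
  is the exact constant; it enters the limit of the mean.\<close>

lemma tail_limit:
  assumes "filterlim f (at_right 0) sequentially"
  shows "(\<lambda>n. tail (f n) / f n powr tail_exp) \<longlonglongrightarrow> upper_const"
proof (rule tendsto_sandwich)
  have f0: "f \<longlonglongrightarrow> 0" using assms by (simp add: filterlim_at)
  have ev: "\<forall>\<^sub>F n in sequentially. 0 < f n \<and> f n < 2"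
    using assms eventually_at_right_real[of 0 2] unfolding filterlim_iff by fastforce
  show "\<forall>\<^sub>F n in sequentially. k1 / tail_exp * (2 - f n) powr marg_exp \<le> tail (f n) / f n powr tail_exp"
    using ev by eventually_elim (use tail_lower in \<open>simp add: field_simps\<close>)
  show "\<forall>\<^sub>F n in sequentially. tail (f n) / f n powr tail_exp \<le> upper_const"
    using ev by eventually_elim (use tail_le in \<open>simp add: field_simps\<close>)
  have "(\<lambda>n. k1 / tail_exp * (2 - f n) powr marg_exp) \<longlonglongrightarrow> k1 / tail_exp * (2 - 0) powr marg_exp"
    by (intro tendsto_intros f0) auto
  then show "(\<lambda>n. k1 / tail_exp * (2 - f n) powr marg_exp) \<longlonglongrightarrow> upper_const" by (simp add: upper_const_def)
qed simp

lemma phi_eq_tail: "phi (1 - s) = 1 - tail s"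
proof -
  have "{z. snd z < 1 - s} = space \<nu> - {z. 1 - s \<le> snd z}" by auto
  then show ?thesis unfolding phi_def tail_def by (simp only:) (rule prob_compl, measurable)
qed

lemma measure_dir: assumes [measurable]: "A \<in> sets borel"
  shows "measure \<nu> {z. z \<bullet> dir \<theta> \<in> A} = measure \<nu> {z. snd z \<in> A}"
proof -
  have [measurable]: "(\<lambda>z. z \<bullet> dir \<theta>) \<in> borel_measurable borel"
    by (intro borel_measurable_continuous_onI continuous_intros)
  have "measure \<nu> {z. z \<bullet> dir \<theta> \<in> A} = measure (distr \<nu> borel (\<lambda>z. z \<bullet> dir \<theta>)) A"
    by (subst measure_distr) (auto simp: vimage_def)
  also have "\<dots> = measure \<nu> {z. snd z \<in> A}"
    unfolding rot by (subst measure_distr) (auto simp: vimage_def)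
  finally show ?thesis .
qed

lemma measure_below: assumes "fst p < fst q"
  shows "measure \<nu> {z. below p q z} = phi (p \<bullet> dir (normal_angle p q))"
  unfolding below_iff_inner[OF assms] phi_def using measure_dir[of "{..<r}" "normal_angle p q" for r] by simp

lemma AE_norm_le_1: "AE z in \<nu>. norm z \<le> 1"
proof -
  have "AE z in lborel. radial_density d c ((fst z)\<^sup>2 + (snd z)\<^sup>2) \<noteq> 0 \<longrightarrow> norm z \<le> 1"
  proof (rule AE_I2, rule impI)
    fix z :: "real \<times> real"
    assume "radial_density d c ((fst z)\<^sup>2 + (snd z)\<^sup>2) \<noteq> 0"
    then have "(fst z)\<^sup>2 + (snd z)\<^sup>2 < 1" by (simp add: radial_density_def split: if_splits)
    then show "norm z \<le> 1" by (simp add: norm_prod_def real_le_lsqrt)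
  qed
  then show ?thesis unfolding nu_density by (subst AE_density) (auto elim: eventually_mono)
qed

lemma measure_cap: assumes "0 \<le> s" shows "measure \<nu> (cap (dir \<theta>) s) = tail s"
proof -
  have [measurable]: "(\<lambda>z. z \<bullet> dir \<theta>) \<in> borel_measurable borel"
    by (intro borel_measurable_continuous_onI continuous_intros)
  have "measure \<nu> (cap (dir \<theta>) s) = measure \<nu> {z. z \<bullet> dir \<theta> \<in> {1 - s..}}"
    using AE_norm_le_1 by (intro finite_measure_eq_AE) (auto simp: cap_def elim: eventually_mono)
  also have "\<dots> = measure \<nu> {z. snd z \<in> {1 - s..}}" by (rule measure_dir) simp
  finally show ?thesis by (simp add: tail_def)
qed

lemma AE_fst_neq: "AE z in \<nu>. fst z \<noteq> a"
proof -
  have "(\<integral>\<^sup>+z. indicator {a} (fst z) \<partial>\<nu>) = (\<integral>\<^sup>+x. \<integral>\<^sup>+y. radial_density d c (x\<^sup>2 + y\<^sup>2) * indicator {a} x \<partial>lborel \<partial>lborel)"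
    using nn_integral_nu[of "\<lambda>z. indicator {a} (fst z)"] by simp
  also have "\<dots> = (\<integral>\<^sup>+x. (\<integral>\<^sup>+y. radial_density d c (x\<^sup>2 + y\<^sup>2) \<partial>lborel) * indicator {a} x \<partial>lborel)"
    by (intro nn_integral_cong nn_integral_multc) measurable
  also have "\<dots> = 0"
    by (subst nn_integral_0_iff_AE) (use AE_lborel_singleton[of a] in \<open>auto elim!: eventually_mono\<close>)
  finally have "AE z in \<nu>. indicator {a} (fst z) = (0 :: ennreal)" by (subst (asm) nn_integral_0_iff_AE) auto
  then show ?thesis by eventually_elim (auto simp: indicator_def split: if_splits)
qed

end

text \<open>A rescaled Gamma integral; it serves as the majorant for the dominated convergence of
  the mean.\<close>

lemma integrable_powr_exp:
  fixes e k :: real assumes e: "0 \<le> e" and k: "0 < k"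
  shows "integrable lborel (\<lambda>y. if 0 < y then y powr e * exp (- k * y) else 0)"
proof -
  have "((\<lambda>t. t powr (e + 1 - 1) / exp t) has_integral Gamma (e + 1)) {0..}"
    using e by (intro Gamma_integral_real) simp
  then have "(\<lambda>t. t powr e / exp t) absolutely_integrable_on {0..}"
    by (intro nonnegative_absolutely_integrable_1) auto
  then have "integrable lebesgue (\<lambda>t. indicator {0..} t *\<^sub>R (t powr e / exp t))"
    by (simp add: set_integrable_def)
  then have "integrable lborel (\<lambda>t. indicator {0..} t *\<^sub>R (t powr e / exp t))"
    by (subst (asm) integrable_completion) auto
  then have "integrable lborel (\<lambda>y. indicator {0..} (0 + k * y) *\<^sub>R ((0 + k * y) powr e / exp (0 + k * y)))"
    using k by (intro lborel_integrable_real_affine) auto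
  then have "integrable lborel (\<lambda>y. k powr (- e) * (indicator {0..} (k * y) *\<^sub>R ((k * y) powr e / exp (k * y))))"
    by (intro integrable_mult_right) simp
  then show ?thesis
  proof (rule Bochner_Integration.integrable_cong_AE_imp)
    have "AE y in lborel. y \<noteq> (0 :: real)" by (rule AE_lborel_singleton)
    then show "AE y in lborel. k powr (- e) * (indicator {0..} (k * y) *\<^sub>R ((k * y) powr e / exp (k * y))) = (if 0 < y then y powr e * exp (- k * y) else 0)"
    proof eventually_elim
      case (elim y)
      have "k powr (- e) * (k * y) powr e = y powr e" if "0 < y"
        using that k by (simp add: powr_mult powr_minus)
      then show ?case using elim k
        by (auto simp: indicator_def zero_le_mult_iff exp_minus field_simps)
    qed
  qed measurable
qed

section \<open>The line through two random points and the mean number of edges\<close>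

context planar_beta
begin

lemma snd_nu_measurable[measurable]: "snd \<in> borel_measurable \<nu>"
  using fst_snd_measurable by (auto cong: measurable_cong_sets)

definition chord_weight :: "real \<Rightarrow> real" where
  "chord_weight \<rho> = (if \<bar>\<rho>\<bar> < 1 then (1 - \<rho>\<^sup>2) powr (real d - 5 / 2) else 0)"

lemma chord_weight_measurable[measurable]: "chord_weight \<in> borel_measurable borel" unfolding chord_weight_def by measurable

definition K2 :: ennreal where
  "K2 = (\<integral>\<^sup>+s. ennreal (1 / (1 + s\<^sup>2)) \<partial>lborel) * pair_kernel d c 0"

text \<open>The slope of the line and the positions of the points on it integrate out. Only the
  signed distance from the origin remains, with a density proportional to
  \<open>chord_weight\<close>.\<close>

lemma pair_law:
  assumes [measurable]: "g \<in> borel_measurable borel"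
  shows "(\<integral>\<^sup>+p. \<integral>\<^sup>+q. (if fst p < fst q then g (p \<bullet> dir (normal_angle p q)) else 0) \<partial>\<nu> \<partial>\<nu>)
     = K2 * (\<integral>\<^sup>+\<rho>. g \<rho> * ennreal (chord_weight \<rho>) \<partial>lborel)"
proof -
  define H where "H = radial_density d c"
  have [measurable]: "H \<in> borel_measurable borel" unfolding H_def by measurable
  define r where "r a y b z = (y - (z - y) / (b - a) * a) / sqrt (1 + ((z - y) / (b - a))\<^sup>2)" for a y b z :: real
  let ?G = "\<lambda>p q :: real \<times> real. if fst p < fst q then g (p \<bullet> dir (normal_angle p q)) else 0"
  have G: "?G (a, y) (b, z) = (if a < b then g (r a y b z) else 0)" for a y b z
    using inner_normal_angle_eq[of "(a, y)" "(b, z)"] by (simp add: r_def)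
  have mG: "(\<lambda>x. ?G (fst x) (snd x)) \<in> borel_measurable (borel \<Otimes>\<^sub>M borel)"
    unfolding inner_dir normal_angle_def by measurable
  have mr: "(\<lambda>x. r (A x) (Y x) (B x) (Z x)) \<in> borel_measurable M"
    if [measurable]: "A \<in> borel_measurable M" "Y \<in> borel_measurable M" "B \<in> borel_measurable M" "Z \<in> borel_measurable M"
    for A Y B Z :: "'z \<Rightarrow> real" and M
    unfolding r_def by measurable
  have "(\<integral>\<^sup>+p. \<integral>\<^sup>+q. ?G p q \<partial>\<nu> \<partial>\<nu>) = (\<integral>\<^sup>+p. (\<integral>\<^sup>+b. \<integral>\<^sup>+z. H (b\<^sup>2 + z\<^sup>2) * ?G p (b, z) \<partial>lborel \<partial>lborel) \<partial>\<nu>)"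
  proof (rule nn_integral_cong)
    fix p
    have [measurable]: "(\<lambda>q. ?G p q) \<in> borel_measurable borel"
      using measurable_compose[OF measurable_Pair1' mG, of p] unfolding fst_conv snd_conv by simp
    show "(\<integral>\<^sup>+q. ?G p q \<partial>\<nu>) = (\<integral>\<^sup>+b. \<integral>\<^sup>+z. H (b\<^sup>2 + z\<^sup>2) * ?G p (b, z) \<partial>lborel \<partial>lborel)"
      unfolding H_def by (rule nn_integral_nu) measurable
  qed
  also have "\<dots> = (\<integral>\<^sup>+a. \<integral>\<^sup>+y. H (a\<^sup>2 + y\<^sup>2) * (\<integral>\<^sup>+b. \<integral>\<^sup>+z. H (b\<^sup>2 + z\<^sup>2) * ?G (a, y) (b, z) \<partial>lborel \<partial>lborel) \<partial>lborel \<partial>lborel)"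
  proof -
    have [measurable]: "(\<lambda>p. \<integral>\<^sup>+q. ?G p q \<partial>\<nu>) \<in> borel_measurable borel"
    proof -
      have "(\<lambda>x. ?G (fst x) (snd x)) \<in> borel_measurable (borel \<Otimes>\<^sub>M \<nu>)"
        using mG by (simp cong: measurable_cong_sets sets_pair_measure_cong)
      from borel_measurable_nn_integral_fst[OF this] show ?thesis unfolding fst_conv snd_conv .
    qed
    have eq: "(\<integral>\<^sup>+b. \<integral>\<^sup>+z. H (b\<^sup>2 + z\<^sup>2) * ?G p (b, z) \<partial>lborel \<partial>lborel) = (\<integral>\<^sup>+q. ?G p q \<partial>\<nu>)" for p
    proof -
      have [measurable]: "(\<lambda>q. ?G p q) \<in> borel_measurable borel"
        using measurable_compose[OF measurable_Pair1' mG, of p] unfolding fst_conv snd_conv by simp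
      show ?thesis unfolding H_def by (rule nn_integral_nu[symmetric]) measurable
    qed
    show ?thesis unfolding eq unfolding H_def by (rule nn_integral_nu) measurable
  qed
  also have "\<dots> = (\<integral>\<^sup>+a. \<integral>\<^sup>+y. \<integral>\<^sup>+b. \<integral>\<^sup>+z. (if a < b then g (r a y b z) * H (a\<^sup>2 + y\<^sup>2) * H (b\<^sup>2 + z\<^sup>2) else 0) \<partial>lborel \<partial>lborel \<partial>lborel \<partial>lborel)"
  proof (intro nn_integral_cong)
    fix a y :: real
    note [measurable] = mr
    have "H (a\<^sup>2 + y\<^sup>2) * (\<integral>\<^sup>+b. \<integral>\<^sup>+z. H (b\<^sup>2 + z\<^sup>2) * ?G (a, y) (b, z) \<partial>lborel \<partial>lborel)
       = (\<integral>\<^sup>+b. \<integral>\<^sup>+z. H (a\<^sup>2 + y\<^sup>2) * (H (b\<^sup>2 + z\<^sup>2) * (if a < b then g (r a y b z) else 0)) \<partial>lborel \<partial>lborel)"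
      unfolding G by (simp add: nn_integral_cmult)
    also have "\<dots> = (\<integral>\<^sup>+b. \<integral>\<^sup>+z. (if a < b then g (r a y b z) * H (a\<^sup>2 + y\<^sup>2) * H (b\<^sup>2 + z\<^sup>2) else 0) \<partial>lborel \<partial>lborel)"
      by (intro nn_integral_cong) (simp add: mult_ac)
    finally show "H (a\<^sup>2 + y\<^sup>2) * (\<integral>\<^sup>+b. \<integral>\<^sup>+z. H (b\<^sup>2 + z\<^sup>2) * ?G (a, y) (b, z) \<partial>lborel \<partial>lborel)
       = (\<integral>\<^sup>+b. \<integral>\<^sup>+z. (if a < b then g (r a y b z) * H (a\<^sup>2 + y\<^sup>2) * H (b\<^sup>2 + z\<^sup>2) else 0) \<partial>lborel \<partial>lborel)" .
  qed
  also have "\<dots> = (\<integral>\<^sup>+a. \<integral>\<^sup>+b. \<integral>\<^sup>+y. \<integral>\<^sup>+z. (if a < b then g (r a y b z) * H (a\<^sup>2 + y\<^sup>2) * H (b\<^sup>2 + z\<^sup>2) else 0) \<partial>lborel \<partial>lborel \<partial>lborel \<partial>lborel)"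
  proof (rule nn_integral_cong, rule lborel_pair.Fubini')
    fix a :: real
    note [measurable] = mr
    show "(\<lambda>(b, y). \<integral>\<^sup>+z. (if a < b then g (r a y b z) * H (a\<^sup>2 + y\<^sup>2) * H (b\<^sup>2 + z\<^sup>2) else 0) \<partial>lborel) \<in> borel_measurable (lborel \<Otimes>\<^sub>M lborel)"
      unfolding r_def by measurable
  qed
  also have "\<dots> = (\<integral>\<^sup>+a. \<integral>\<^sup>+b. (if a < b then \<integral>\<^sup>+y. \<integral>\<^sup>+z. g (r a y b z) * H (a\<^sup>2 + y\<^sup>2) * H (b\<^sup>2 + z\<^sup>2) \<partial>lborel \<partial>lborel else 0) \<partial>lborel \<partial>lborel)"
  proof (intro nn_integral_cong)
    fix a b :: real
    show "(\<integral>\<^sup>+y. \<integral>\<^sup>+z. (if a < b then g (r a y b z) * H (a\<^sup>2 + y\<^sup>2) * H (b\<^sup>2 + z\<^sup>2) else 0) \<partial>lborel \<partial>lborel)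
       = (if a < b then \<integral>\<^sup>+y. \<integral>\<^sup>+z. g (r a y b z) * H (a\<^sup>2 + y\<^sup>2) * H (b\<^sup>2 + z\<^sup>2) \<partial>lborel \<partial>lborel else 0)"
      by (cases "a < b") (simp_all only: if_True if_False nn_integral_const mult_zero_left)
  qed
  also have "\<dots> = (\<integral>\<^sup>+s. ennreal (1 / (1 + s\<^sup>2)) \<partial>lborel) * (\<integral>\<^sup>+\<rho>. g \<rho> * pair_kernel d c \<rho> \<partial>lborel)"
    unfolding r_def H_def by (rule line_substitution) measurable
  also have "(\<integral>\<^sup>+\<rho>. g \<rho> * pair_kernel d c \<rho> \<partial>lborel) = (\<integral>\<^sup>+\<rho>. pair_kernel d c 0 * (g \<rho> * ennreal (chord_weight \<rho>)) \<partial>lborel)"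
  proof (rule nn_integral_cong)
    fix \<rho>
    show "g \<rho> * pair_kernel d c \<rho> = pair_kernel d c 0 * (g \<rho> * ennreal (chord_weight \<rho>))"
    proof (cases "\<bar>\<rho>\<bar> < 1")
      case True
      then show ?thesis using pair_kernel_scale[OF True d4] c_pos by (simp add: chord_weight_def mult_ac)
    next
      case False
      then show ?thesis using pair_kernel_eq_0[of \<rho>] by (simp add: chord_weight_def)
    qed
  qed
  also have "\<dots> = pair_kernel d c 0 * (\<integral>\<^sup>+\<rho>. g \<rho> * ennreal (chord_weight \<rho>) \<partial>lborel)" by (rule nn_integral_cmult) measurable
  finally show ?thesis by (simp add: K2_def mult.assoc)
qed

text \<open>Instead of evaluating the integrals, \<open>pair_law\<close> is applied to the constant
  function 1: by symmetry, and since equal abscissae have probability 0, a pair is ordered from left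
  to right with probability 1/2.\<close>

lemma K2_bounds: "K2 \<noteq> 0" "K2 \<noteq> \<infinity>"
proof -
  let ?U = "\<integral>\<^sup>+p. \<integral>\<^sup>+q. (if fst p < fst q then 1 else 0 :: ennreal) \<partial>\<nu> \<partial>\<nu>"
  let ?V = "\<integral>\<^sup>+p. \<integral>\<^sup>+q. (if fst q < fst p then 1 else 0 :: ennreal) \<partial>\<nu> \<partial>\<nu>"
  interpret NN: pair_sigma_finite \<nu> \<nu> by standard
  have UV: "?U = ?V" by (rule NN.Fubini') measurable
  have "?U + ?V = (\<integral>\<^sup>+p. \<integral>\<^sup>+q. (if fst p < fst q then 1 else 0 :: ennreal) + (if fst q < fst p then 1 else 0 :: ennreal) \<partial>\<nu> \<partial>\<nu>)"
    by (simp add: nn_integral_add)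
  also have "\<dots> = (\<integral>\<^sup>+p. \<integral>\<^sup>+q. 1 \<partial>\<nu> \<partial>\<nu>)"
  proof (rule nn_integral_cong, rule nn_integral_cong_AE)
    fix p :: "real \<times> real"
    show "AE q in \<nu>. (if fst p < fst q then 1 else 0 :: ennreal) + (if fst q < fst p then 1 else 0 :: ennreal) = 1"
      using AE_fst_neq[of "fst p"] by eventually_elim auto
  qed
  also have "\<dots> = 1" using emeasure_space_1 by simp
  finally have U: "?U + ?U = 1" using UV by simp
  have U0: "?U \<noteq> 0" "?U \<noteq> \<infinity>" using U by auto
  have eq: "?U = K2 * (\<integral>\<^sup>+\<rho>. ennreal (chord_weight \<rho>) \<partial>lborel)"
    using pair_law[of "\<lambda>_. 1"] by simp
  show "K2 \<noteq> 0" using eq U0 by auto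
  have "(\<integral>\<^sup>+\<rho>. ennreal (chord_weight \<rho>) \<partial>lborel) \<noteq> 0" using eq U0 by auto
  then show "K2 \<noteq> \<infinity>" using eq U0 by (auto simp: ennreal_top_mult)
qed

definition k2 :: real where "k2 = enn2real K2"
lemma K2_eq: "K2 = ennreal k2" and k2_pos: "0 < k2"
  using K2_bounds by (auto simp: k2_def enn2real_positive_iff less_top[symmetric] zero_less_iff_neq_zero)

lemma phi_range: "0 \<le> phi r" "phi r \<le> 1" by (auto simp: phi_def)

lemma phi_measurable[measurable]: "phi \<in> borel_measurable borel"
proof (rule borel_measurable_mono)
  show "mono phi" unfolding phi_def by (intro monoI finite_measure_mono) auto
qed

lemma chord_weight_integrable: "integrable lborel chord_weight"
proof (rule Bochner_Integration.integrable_bound)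
  show "integrable lborel (\<lambda>\<rho> :: real. indicator {-1..1} \<rho> :: real)" by simp
  have "chord_weight \<rho> \<le> 1" for \<rho>
  proof (cases "\<bar>\<rho>\<bar> < 1")
    case True
    have "(1 - \<rho>\<^sup>2) powr (real d - 5 / 2) \<le> 1"
      using d4 True by (intro powr_le1) (auto simp: abs_square_le_1)
    then show ?thesis using True by (simp add: chord_weight_def)
  qed (simp add: chord_weight_def)
  moreover have "0 \<le> chord_weight \<rho>" for \<rho> by (simp add: chord_weight_def)
  ultimately show "AE \<rho> in lborel. norm (chord_weight \<rho>) \<le> norm (indicator {-1..1} \<rho> :: real)"
  proof (intro AE_I2)
    fix \<rho>
    show "norm (chord_weight \<rho>) \<le> norm (indicator {-1..1} \<rho> :: real)"
      using \<open>\<And>\<rho>. chord_weight \<rho> \<le> 1\<close>[of \<rho>] \<open>\<And>\<rho>. 0 \<le> chord_weight \<rho>\<close>[of \<rho>]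
      by (cases "\<rho> \<in> {-1..1}") (auto simp: chord_weight_def)
  qed
qed measurable

lemma chord_weight_nonneg: "0 \<le> chord_weight \<rho>" by (simp add: chord_weight_def)

lemma phi_chord_weight_integrable: "integrable lborel (\<lambda>\<rho>. phi \<rho> ^ n * chord_weight \<rho>)"
  by (rule Bochner_Integration.integrable_bound[OF chord_weight_integrable])
     (auto simp: abs_mult phi_range power_le_one mult_left_le_one_le)

text \<open>The probability that a given ordered pair of points is an upper edge in the presence of
  n further points.\<close>

definition amean :: "nat \<Rightarrow> real" where
  "amean n = k2 * (\<integral>\<rho>. phi \<rho> ^ n * chord_weight \<rho> \<partial>lborel)"

lemma amean_eq:
  "(\<integral>\<^sup>+p. \<integral>\<^sup>+q. (if fst p < fst q then ennreal (phi (p \<bullet> dir (normal_angle p q)) ^ n) else 0) \<partial>\<nu> \<partial>\<nu>) = ennreal (amean n)"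
proof -
  have "(\<integral>\<^sup>+\<rho>. ennreal (phi \<rho> ^ n) * ennreal (chord_weight \<rho>) \<partial>lborel) = ennreal (\<integral>\<rho>. phi \<rho> ^ n * chord_weight \<rho> \<partial>lborel)"
    using phi_chord_weight_integrable[of n]
    by (subst nn_integral_eq_integral[symmetric]) (auto simp: phi_range chord_weight_nonneg ennreal_mult)
  then show ?thesis
    using pair_law[of "\<lambda>r. ennreal (phi r ^ n)"] k2_pos
    by (simp add: amean_def K2_eq ennreal_mult'[symmetric])
qed

lemma amean_nonneg: "0 \<le> amean n"
  unfolding amean_def using k2_pos by (intro mult_nonneg_nonneg integral_nonneg_AE) (auto simp: phi_range chord_weight_nonneg)

text \<open>The second difference integrates \<open>phi \<rho> ^ n\<close> times the square of
  \<open>1 - phi \<rho>\<close> against a nonnegative weight.\<close>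

lemma amean_convex: "amean (n + 1) - amean (n + 2) \<le> amean n - amean (n + 1)"
proof -
  have "amean n - amean (n + 1) - (amean (n + 1) - amean (n + 2))
     = k2 * (\<integral>\<rho>. phi \<rho> ^ n * chord_weight \<rho> - phi \<rho> ^ (n + 1) * chord_weight \<rho> - (phi \<rho> ^ (n + 1) * chord_weight \<rho> - phi \<rho> ^ (n + 2) * chord_weight \<rho>) \<partial>lborel)"
    using phi_chord_weight_integrable unfolding amean_def
    by (simp only: Bochner_Integration.integral_diff Bochner_Integration.integrable_diff right_diff_distrib)
  also have "\<dots> = k2 * (\<integral>\<rho>. phi \<rho> ^ n * (1 - phi \<rho>)\<^sup>2 * chord_weight \<rho> \<partial>lborel)"
    by (intro arg_cong[where f="\<lambda>x. k2 * x"] Bochner_Integration.integral_cong) (auto simp: power2_eq_square algebra_simps)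
  also have "\<dots> \<ge> 0"
    using k2_pos by (intro mult_nonneg_nonneg integral_nonneg_AE) (auto simp: phi_range chord_weight_nonneg)
  finally show ?thesis by simp
qed

text \<open>The relevant depth is that of a cap of measure of order 1 / n, that is n powr (- 1 /
  \<open>tail_exp\<close>). The weight of order y powr (d - 5 / 2) at depth y integrates to a power
  d - 3 / 2 of this depth.\<close>

definition tau :: real where "tau = (real d - 3 / 2) / tail_exp"

lemma tau_eq: "tau = 2 - 1 / (real d - 1)" using d4 by (simp add: tau_def tail_exp_def field_simps)

text \<open>Laplace's method at the boundary of the disc. With depth n powr (- 1 /
  \<open>tail_exp\<close>) * y the power of \<open>phi\<close> tends to exp (-
  \<open>upper_const\<close> * y powr \<open>tail_exp\<close>), the rescaled weight tends to a power
  of 2 * y, and dominated convergence applies.\<close>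

lemma amean_limit: "\<exists>L>0. (\<lambda>n. amean n * real n powr tau) \<longlonglongrightarrow> L"
proof -
  define e where "e = real d - 5 / 2"
  have e0: "0 < e" using d4 by (simp add: e_def)
  have q1: "1 < tail_exp" by (rule tail_exp_pos)
  \<comment> \<open>The integrand after rescaling, cleared of the powers of n. At n = 0 the scale n
    powr (- 1 / \<open>tail_exp\<close>) is 0, and without the guard the function would be an
    unbounded power of y that has no integrable majorant.\<close>
  define F where "F n y = (if 0 < n \<and> 0 < y \<and> real n powr (- 1 / tail_exp) * y < 2 then (1 - tail (real n powr (- 1 / tail_exp) * y)) ^ n * (y * (2 - real n powr (- 1 / tail_exp) * y)) powr e else 0)" for n y
  define G where "G y = (if 0 < y then exp (- upper_const * y powr tail_exp) * (2 * y) powr e else 0)" for y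
  have tail_m[measurable]: "tail \<in> borel_measurable borel"
    by (rule borel_measurable_mono) (auto intro!: monoI tail_mono)
  have Fm[measurable]: "F n \<in> borel_measurable lborel" for n unfolding F_def by measurable
  have Gm[measurable]: "G \<in> borel_measurable lborel" unfolding G_def by measurable
  have scale: "amean n * real n powr tau = k2 * (\<integral>y. F n y \<partial>lborel)" if n: "n > 0" for n
  proof -
    define s where "s = real n powr (- 1 / tail_exp)"
    have s: "s > 0" using n by (simp add: s_def)
    have "(\<integral>\<rho>. phi \<rho> ^ n * chord_weight \<rho> \<partial>lborel) = s * (\<integral>y. phi (1 + (- s) * y) ^ n * chord_weight (1 + (- s) * y) \<partial>lborel)"
      using s by (subst lborel_integral_real_affine[where c="- s" and t=1]) auto
    also have "(\<integral>y. phi (1 + (- s) * y) ^ n * chord_weight (1 + (- s) * y) \<partial>lborel) = (\<integral>y. s powr e * F n y \<partial>lborel)"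
    proof (rule Bochner_Integration.integral_cong[OF refl])
      fix y
      have p: "phi (1 + (- s) * y) = 1 - tail (s * y)" using phi_eq_tail[of "s * y"] by simp
      have r: "1 - (1 + (- s) * y)\<^sup>2 = s * (y * (2 - s * y))" by (simp add: power2_eq_square algebra_simps)
      have b: "\<bar>1 + (- s) * y\<bar> < 1 \<longleftrightarrow> 0 < y \<and> s * y < 2" 
      proof -
        have "\<bar>1 + (- s) * y\<bar> < 1 \<longleftrightarrow> 0 < s * y \<and> s * y < 2" by auto
        moreover have "0 < s * y \<longleftrightarrow> 0 < y" using s by (simp add: zero_less_mult_iff)
        ultimately show ?thesis by blast
      qed
      show "phi (1 + (- s) * y) ^ n * chord_weight (1 + (- s) * y) = s powr e * F n y"
        unfolding p chord_weight_def b r F_def s_def[symmetric] e_def[symmetric] using s n by (auto simp: powr_mult)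
    qed
    finally have "amean n = k2 * (s * s powr e * (\<integral>y. F n y \<partial>lborel))" by (simp add: amean_def)
    moreover have "s * s powr e * real n powr tau = 1"
    proof -
      have "s * s powr e = s powr (1 + e)" using s by (simp add: powr_add)
      also have "\<dots> = real n powr (- tau)" unfolding s_def powr_powr tau_def e_def by (simp add: field_simps)
      finally show ?thesis using n by (simp flip: powr_add)
    qed
    ultimately show ?thesis by (simp add: mult_ac)
  qed
  \<comment> \<open>\<open>tail_ge\<close> gives the decay exp (- \<open>lower_const\<close> * y
    powr \<open>tail_exp\<close>); the inequality y - 1 \<le> y powr \<open>tail_exp\<close> reduces
    it to an exponential at the price of the factor exp \<open>lower_const\<close>.\<close>
  let ?w = "\<lambda>y. 2 powr e * exp lower_const * (if 0 < y then y powr e * exp (- lower_const * y) else 0)"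
  have w: "integrable lborel ?w"
    using e0 lower_const_pos by (intro integrable_mult_right integrable_powr_exp) auto
  have ptw: "AE y in lborel. (\<lambda>n. F n y) \<longlonglongrightarrow> G y"
    proof (rule AE_I2)
      fix y :: real
      show "(\<lambda>n. F n y) \<longlonglongrightarrow> G y"
      proof (cases "0 < y")
        case True
        have s0: "(\<lambda>n. real n powr (- 1 / tail_exp) * y) \<longlonglongrightarrow> 0"
        proof -
          have "(\<lambda>n. real n powr (- 1 / tail_exp)) \<longlonglongrightarrow> 0"
            using q1 by (intro tendsto_neg_powr filterlim_real_sequentially) auto
          then show ?thesis using tendsto_mult_left_zero by blast
        qed
        have sr: "filterlim (\<lambda>n. real n powr (- 1 / tail_exp) * y) (at_right 0) sequentially"
        proof -
          have "\<forall>\<^sub>F n in sequentially. 0 < real n powr (- 1 / tail_exp) * y"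
            using eventually_gt_at_top[of 0] by eventually_elim (use True in simp)
          then show ?thesis using s0 by (auto simp: filterlim_at elim!: eventually_mono intro!: Nat.gr0I)
        qed
        have "(\<lambda>n. (tail (real n powr (- 1 / tail_exp) * y) / (real n powr (- 1 / tail_exp) * y) powr tail_exp) * y powr tail_exp) \<longlonglongrightarrow> upper_const * y powr tail_exp"
          by (intro tendsto_mult tail_limit sr tendsto_const)
        then have "(\<lambda>n. real n * tail (real n powr (- 1 / tail_exp) * y)) \<longlonglongrightarrow> upper_const * y powr tail_exp"
        proof (rule tendsto_eventually_eq)
          show "\<forall>\<^sub>F n in sequentially. (tail (real n powr (- 1 / tail_exp) * y) / (real n powr (- 1 / tail_exp) * y) powr tail_exp) * y powr tail_exp = real n * tail (real n powr (- 1 / tail_exp) * y)"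
            using eventually_gt_at_top[of 0]
          proof eventually_elim
            case (elim n)
            have "(real n powr (- 1 / tail_exp) * y) powr tail_exp = real n powr (- 1) * y powr tail_exp"
              using q1 elim True by (simp add: powr_mult powr_powr)
            also have "real n powr (- 1) = 1 / real n" using elim by (simp add: powr_minus field_simps)
            finally show ?case using True by simp
          qed
        qed simp
        then have "(\<lambda>n. (1 - tail (real n powr (- 1 / tail_exp) * y)) ^ n) \<longlonglongrightarrow> exp (- (upper_const * y powr tail_exp))"
          by (rule power_one_minus_limit)
        moreover have "(\<lambda>n. (y * (2 - real n powr (- 1 / tail_exp) * y)) powr e) \<longlonglongrightarrow> (y * (2 - 0)) powr e"
          using True by (intro tendsto_intros s0) auto
        ultimately have "(\<lambda>n. (1 - tail (real n powr (- 1 / tail_exp) * y)) ^ n * (y * (2 - real n powr (- 1 / tail_exp) * y)) powr e) \<longlonglongrightarrow> exp (- (upper_const * y powr tail_exp)) * (y * (2 - 0)) powr e"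
          by (rule tendsto_mult)
        then show ?thesis
        proof (rule tendsto_eventually_eq)
          have "\<forall>\<^sub>F n in sequentially. real n powr (- 1 / tail_exp) * y < 2" by (rule order_tendstoD[OF s0]) auto
          then show "\<forall>\<^sub>F n in sequentially. (1 - tail (real n powr (- 1 / tail_exp) * y)) ^ n * (y * (2 - real n powr (- 1 / tail_exp) * y)) powr e = F n y"
            using eventually_gt_at_top[of 0] by eventually_elim (use True in \<open>simp add: F_def\<close>)
        qed (use True in \<open>simp add: G_def mult.commute\<close>)
      qed (simp add: F_def G_def)
    qed
  have bnd: "AE y in lborel. norm (F n y) \<le> ?w y" for n
    proof (rule AE_I2)
      fix y :: real
      define s where "s = real n powr (- 1 / tail_exp)"
      show "norm (F n y) \<le> 2 powr e * exp lower_const * (if 0 < y then y powr e * exp (- lower_const * y) else 0)"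
      proof (cases "0 < n \<and> 0 < y \<and> s * y < 2")
        case True
        have s0: "0 \<le> s" by (simp add: s_def)
        have t: "0 \<le> 1 - tail (s * y)" by (simp add: tail_def)
        have "(1 - tail (s * y)) ^ n \<le> exp (- lower_const * y powr tail_exp)"
        proof -
          have "lower_const * (s * y) powr tail_exp \<le> tail (s * y)" using True s0 by (intro tail_ge) auto
          also have "(s * y) powr tail_exp = 1 / real n * y powr tail_exp"
          proof -
            have "s powr tail_exp = real n powr (- 1)" unfolding s_def powr_powr using q1 by simp
            also have "\<dots> = 1 / real n" using True by (simp add: powr_minus field_simps)
            finally show ?thesis using True s0 by (simp add: powr_mult)
          qed
          finally have tl: "lower_const * (1 / real n * y powr tail_exp) \<le> tail (s * y)" .
          have "1 - tail (s * y) \<le> exp (- tail (s * y))" using exp_ge_add_one_self[of "- tail (s * y)"] by simp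
          then have "(1 - tail (s * y)) ^ n \<le> exp (- tail (s * y)) ^ n" using t by (intro power_mono) auto
          also have "\<dots> = exp (- (real n * tail (s * y)))" by (simp flip: exp_of_nat_mult)
          also have "\<dots> \<le> exp (- lower_const * y powr tail_exp)" using tl True by (simp add: field_simps)
          finally show ?thesis .
        qed
        also have "\<dots> \<le> exp (lower_const + - lower_const * y)"
        proof -
          have "y - 1 \<le> y powr tail_exp"
          proof (cases "1 \<le> y")
            case True
            then have "y powr 1 \<le> y powr tail_exp" using q1 by (intro powr_mono) auto
            then show ?thesis using True by simp
          next
            case False
            then show ?thesis using powr_ge_zero[of y tail_exp] by linarith
          qed
          then have "lower_const * (y - 1) \<le> lower_const * y powr tail_exp" using lower_const_pos by (intro mult_left_mono) auto
          then show ?thesis by (simp add: algebra_simps)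
        qed
        finally have 1: "(1 - tail (s * y)) ^ n \<le> exp lower_const * exp (- lower_const * y)" unfolding exp_add .
        have 2: "(y * (2 - s * y)) powr e \<le> 2 powr e * y powr e"
        proof -
          have "y * (2 - s * y) \<le> y * 2" using True s0 by (intro mult_left_mono) auto
          then have "(y * (2 - s * y)) powr e \<le> (y * 2) powr e" using True e0 by (intro powr_mono2) auto
          then show ?thesis using True by (simp add: powr_mult mult.commute)
        qed
        have "norm (F n y) = (1 - tail (s * y)) ^ n * (y * (2 - s * y)) powr e"
          using True t unfolding F_def s_def[symmetric] by (simp add: abs_mult)
        also have "\<dots> \<le> (exp lower_const * exp (- lower_const * y)) * (2 powr e * y powr e)"
          using 1 2 t by (intro mult_mono) auto
        finally show ?thesis using True by (simp add: mult_ac)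
      next
        case False
        then show ?thesis unfolding F_def s_def[symmetric] by auto
      qed
    qed
  have Fint: "(\<lambda>n. \<integral>y. F n y \<partial>lborel) \<longlonglongrightarrow> (\<integral>y. G y \<partial>lborel)"
    by (rule integral_dominated_convergence[OF Gm Fm w ptw bnd])
  have Gint: "integrable lborel G"
    by (rule integrable_dominated_convergence[OF Gm Fm w ptw bnd])
  have "(\<lambda>n. k2 * (\<integral>y. F n y \<partial>lborel)) \<longlonglongrightarrow> k2 * (\<integral>y. G y \<partial>lborel)" by (intro tendsto_intros Fint)
  then have lim: "(\<lambda>n. amean n * real n powr tau) \<longlonglongrightarrow> k2 * (\<integral>y. G y \<partial>lborel)"
  proof (rule tendsto_eventually_eq)
    show "\<forall>\<^sub>F n in sequentially. k2 * (\<integral>y. F n y \<partial>lborel) = amean n * real n powr tau"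
      using eventually_gt_at_top[of 0] by eventually_elim (simp add: scale)
  qed simp
  have Gnn: "0 \<le> G y" for y by (simp add: G_def)
  have "(\<integral>y. G y \<partial>lborel) \<noteq> 0"
  proof
    assume "(\<integral>y. G y \<partial>lborel) = 0"
    then have "AE y in lborel. G y = 0"
      using integral_nonneg_eq_0_iff_AE[OF Gint] Gnn by simp
    then have "AE y in lborel. y \<notin> {1..2 :: real}" by eventually_elim (auto simp: G_def)
    then have "{1..2 :: real} \<in> null_sets lborel" by (subst AE_iff_null_sets) auto
    then show False by (simp add: null_sets_def)
  qed
  moreover have "0 \<le> (\<integral>y. G y \<partial>lborel)" by (intro integral_nonneg_AE) (simp add: G_def)
  ultimately have "0 < k2 * (\<integral>y. G y \<partial>lborel)" using k2_pos by simp
  then show ?thesis using lim by blast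
qed


text \<open>Given the two points of an ordered pair, the others are independently below their line,
  each with probability \<open>phi\<close> of its distance from the origin. For fewer than two
  points the prefactor is 0, so the truncated subtraction is harmless.\<close>

lemma upper_edges_expectation:
  assumes I: "finite I"
  shows "(\<integral>x. real (upper_edges I x) \<partial>Pi\<^sub>M I (\<lambda>_. \<nu>)) = real (card I) * (real (card I) - 1) * amean (card I - 2)"
proof -
  let ?P = "\<lambda>J. Pi\<^sub>M J (\<lambda>_. \<nu>)"
  interpret PS: product_sigma_finite "\<lambda>_. \<nu>" by standard
  have psP: "prob_space (?P J)" for J by (intro prob_space_PiM nu_prob)
  interpret P: prob_space "?P I" by (rule psP)
  have pm: "Measurable.pred (?P I) (\<lambda>x. upper_edge I x i j)" if "i \<in> I" "j \<in> I" for i j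
  proof -
    have "measurable (?P I) (count_space UNIV) = measurable (Pi\<^sub>M I (\<lambda>_. borel :: (real \<times> real) measure)) (count_space (UNIV :: bool set))"
      by (intro measurable_cong_sets sets_PiM_cong) auto
    then show ?thesis using edge_predicates_measurable(1)[OF I order_refl that] by simp
  qed
  have int1: "(\<integral>x. of_bool (upper_edge I x i j) \<partial>?P I) = (if i = j then 0 else amean (card I - 2))"
    if ij: "i \<in> I" "j \<in> I" for i j
  proof (cases "i = j")
    case True
    then show ?thesis by (simp add: upper_edge_def)
  next
    case False
    define J where "J = I - {i, j}"
    have J: "finite J" "i \<notin> insert j J" "j \<notin> J" "insert i (insert j J) = I" "card J = card I - 2"
      using ij False I by (auto simp: J_def card_Diff_subset)
    let ?f = "\<lambda>x. indicator {x. upper_edge I x i j} x :: ennreal"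
    have mf: "?f \<in> borel_measurable (?P (insert i (insert j J)))"
      unfolding J(4) indicator_def using pm[OF ij] by simp
    have "(\<integral>\<^sup>+x. ?f x \<partial>?P I) = (\<integral>\<^sup>+p. \<integral>\<^sup>+x. ?f (x(i := p)) \<partial>?P (insert j J) \<partial>\<nu>)"
      using PS.product_nn_integral_insert_rev[of "insert j J" i ?f] J mf by simp
    also have "\<dots> = (\<integral>\<^sup>+p. \<integral>\<^sup>+q. \<integral>\<^sup>+x. ?f (x(j := q, i := p)) \<partial>?P J \<partial>\<nu> \<partial>\<nu>)"
    proof (rule nn_integral_cong)
      fix p assume p: "p \<in> space \<nu>"
      have "(\<lambda>x. x(i := p)) \<in> ?P (insert j J) \<rightarrow>\<^sub>M ?P (insert i (insert j J))"
        using p by (intro measurable_fun_upd[where J="insert j J"]) auto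
      from measurable_compose[OF this mf]
      show "(\<integral>\<^sup>+x. ?f (x(i := p)) \<partial>?P (insert j J)) = (\<integral>\<^sup>+q. \<integral>\<^sup>+x. ?f (x(j := q, i := p)) \<partial>?P J \<partial>\<nu>)"
        by (rule PS.product_nn_integral_insert_rev[OF J(1,3)])
    qed
    also have "\<dots> = (\<integral>\<^sup>+p. \<integral>\<^sup>+q. (if fst p < fst q then ennreal (phi (p \<bullet> dir (normal_angle p q)) ^ (card I - 2)) else 0) \<partial>\<nu> \<partial>\<nu>)"
    proof (intro nn_integral_cong)
      fix p q :: "real \<times> real"
      have bm: "{z. below p q z} \<in> sets borel" unfolding below_def by measurable
      have eq: "?f (x(j := q, i := p)) = (if fst p < fst q then (\<Prod>l\<in>J. indicator {z. below p q z} (x l)) else 0)" for x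
      proof -
        have "upper_edge I (x(j := q, i := p)) i j \<longleftrightarrow> fst p < fst q \<and> (\<forall>l\<in>J. below p q (x l))"
          using ij False by (auto simp: upper_edge_def J_def)
        moreover have "(\<Prod>l\<in>J. indicator {z. below p q z} (x l) :: ennreal) = of_bool (\<forall>l\<in>J. below p q (x l))"
        proof (cases "\<forall>l\<in>J. below p q (x l)")
          case False
          then have "(\<Prod>l\<in>J. indicator {z. below p q z} (x l) :: ennreal) = 0"
            using J(1) by (intro prod_zero) (auto simp: indicator_def)
          then show ?thesis using False by simp
        qed (simp add: indicator_def)
        ultimately show ?thesis by (simp add: indicator_def)
      qed
      show "(\<integral>\<^sup>+x. ?f (x(j := q, i := p)) \<partial>?P J) = (if fst p < fst q then ennreal (phi (p \<bullet> dir (normal_angle p q)) ^ (card I - 2)) else 0)"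
      proof (cases "fst p < fst q")
        case True
        have "(\<integral>\<^sup>+x. ?f (x(j := q, i := p)) \<partial>?P J) = (\<integral>\<^sup>+x. (\<Prod>l\<in>J. indicator {z. below p q z} (x l)) \<partial>?P J)"
          unfolding eq if_P[OF True] ..
        also have "\<dots> = (\<Prod>l\<in>J. \<integral>\<^sup>+z. indicator {z. below p q z} z \<partial>\<nu>)"
          using bm J(1) by (intro PS.product_nn_integral_prod) auto
        also have "\<dots> = ennreal (phi (p \<bullet> dir (normal_angle p q))) ^ card J"
          using bm measure_below[OF True] by (simp add: emeasure_eq_measure)
        also have "\<dots> = ennreal (phi (p \<bullet> dir (normal_angle p q)) ^ (card I - 2))"
          by (simp add: J(5) ennreal_power phi_range)
        finally show ?thesis using True by simp
      next
        case False
        then show ?thesis unfolding eq by simp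
      qed
    qed
    also have "\<dots> = ennreal (amean (card I - 2))" by (rule amean_eq)
    also have "(\<integral>\<^sup>+x. ?f x \<partial>?P I) = (\<integral>\<^sup>+x. ennreal (of_bool (upper_edge I x i j)) \<partial>?P I)"
      by (intro nn_integral_cong) (simp add: indicator_def of_bool_def)
    finally have fin: "(\<integral>\<^sup>+x. ennreal (of_bool (upper_edge I x i j)) \<partial>?P I) = ennreal (amean (card I - 2))" .
    have "(\<integral>x. of_bool (upper_edge I x i j) \<partial>?P I) = amean (card I - 2)"
      using pm[OF ij] amean_nonneg fin by (subst integral_eq_nn_integral) auto
    then show ?thesis using False by simp
  qed
  have intg: "integrable (?P I) (\<lambda>x. of_bool (upper_edge I x i j) :: real)" if "i \<in> I" "j \<in> I" for i j
    using pm[OF that] by (intro P.integrable_const_bound[where B=1]) (auto simp: of_bool_def)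
  have "(\<integral>x. real (upper_edges I x) \<partial>?P I) = (\<Sum>i\<in>I. \<Sum>j\<in>I. (\<integral>x. of_bool (upper_edge I x i j) \<partial>?P I))"
    unfolding upper_edges_eq_double_sum[OF I] using intg by (simp add: Bochner_Integration.integral_sum)
  also have "\<dots> = (\<Sum>i\<in>I. \<Sum>j\<in>I. if i = j then 0 else amean (card I - 2))"
    by (intro sum.cong refl int1)
  also have "\<dots> = (\<Sum>i\<in>I. \<Sum>j\<in>I - {i}. amean (card I - 2))"
  proof (rule sum.cong[OF refl])
    fix i assume "i \<in> I"
    then have "(\<Sum>j\<in>I. if i = j then 0 else amean (card I - 2)) = (\<Sum>j\<in>I - {i}. if i = j then 0 else amean (card I - 2))"
      by (subst sum.remove[OF I, of i]) auto
    also have "\<dots> = (\<Sum>j\<in>I - {i}. amean (card I - 2))" by (rule sum.cong) auto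
    finally show "(\<Sum>j\<in>I. if i = j then 0 else amean (card I - 2)) = (\<Sum>j\<in>I - {i}. amean (card I - 2))" .
  qed
  also have "\<dots> = (\<Sum>i\<in>I. (real (card I) - 1) * amean (card I - 2))"
  proof (rule sum.cong[OF refl])
    fix i assume i: "i \<in> I"
    then have "1 \<le> card I" using I by (auto simp: Suc_le_eq card_gt_0_iff)
    then show "(\<Sum>j\<in>I - {i}. amean (card I - 2)) = (real (card I) - 1) * amean (card I - 2)"
      using i I by (simp add: card_Diff_singleton of_nat_diff)
  qed
  also have "\<dots> = real (card I) * (real (card I) - 1) * amean (card I - 2)" by simp
  finally show ?thesis .
qed

definition mean_edges :: "nat \<Rightarrow> real" where
  "mean_edges n = real n * (real n - 1) * amean (n - 2)"

lemma mean_edges_asymp: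
  "\<exists>L>0. (\<lambda>n. mean_edges n / real n powr (1 / (real d - 1))) \<longlonglongrightarrow> L"
proof -
  obtain L where L: "L > 0" "(\<lambda>n. amean n * real n powr tau) \<longlonglongrightarrow> L" using amean_limit by blast
  have t: "filterlim (\<lambda>n :: nat. n - 2) at_top sequentially" by (rule filterlim_minus_const_nat_at_top)
  have "(\<lambda>n. (amean (n - 2) * real (n - 2) powr tau) * ((real n - 1) / real n * (real (n - 2) / real n) powr (- tau))) \<longlonglongrightarrow> L * (1 * 1 powr (- tau))"
    by (intro tendsto_mult filterlim_compose[OF L(2) t] tendsto_powr tendsto_const) (real_asymp+, simp)
  then have "(\<lambda>n. mean_edges n / real n powr (1 / (real d - 1))) \<longlonglongrightarrow> L"
  proof (rule tendsto_eventually_eq)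
    show "\<forall>\<^sub>F n in sequentially. (amean (n - 2) * real (n - 2) powr tau) * ((real n - 1) / real n * (real (n - 2) / real n) powr (- tau)) = mean_edges n / real n powr (1 / (real d - 1))"
      using eventually_gt_at_top[of 2]
    proof eventually_elim
      case (elim n)
      have "real n powr (1 / (real d - 1)) = real n powr 2 * real n powr (- tau)"
        unfolding powr_add[symmetric] tau_eq by (simp add: algebra_simps)
      also have "real n powr 2 = real n * real n" using elim by (simp add: powr_numeral power2_eq_square)
      finally have e: "real n powr (1 / (real d - 1)) = real n * real n * real n powr (- tau)" .
      have "(real (n - 2) / real n) powr (- tau) = real (n - 2) powr (- tau) / real n powr (- tau)"
        by (simp add: powr_divide)
      moreover have "real (n - 2) powr tau * real (n - 2) powr (- tau) = 1"
        using elim by (simp flip: powr_add)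
      moreover have "real n powr (- tau) > 0" using elim by simp
      moreover have "a * A * ((r - 1) / r * (B / C)) = r * (r - 1) * a / (r * r * C)"
        if "A * B = 1" "C > 0" "r > 0" for a A B C r :: real
      proof -
        have "a * A * ((r - 1) / r * (B / C)) = (A * B) * (a * ((r - 1) / r / C))" by simp
        also have "\<dots> = r * (r - 1) * a / (r * r * C)" unfolding that(1) using that(2,3) by (simp add: field_simps)
        finally show ?thesis .
      qed
      ultimately show ?case unfolding e mean_edges_def using elim by simp
    qed
  qed simp
  then show ?thesis using L(1) by blast
qed

lemma mean_edges_increment:
  "\<exists>\<delta>>0. \<forall>\<^sub>F n in sequentially. \<delta> * real n powr (1 / (real d - 1) - 1) \<le> mean_edges (n + 1) - mean_edges n"
proof -
  obtain L where L: "L > 0" "(\<lambda>n. amean n * real n powr tau) \<longlonglongrightarrow> L" using amean_limit by blast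
  have tau: "0 < tau" "tau < 2" using d4 by (auto simp: tau_eq field_simps)
  have e: "1 - tau = 1 / (real d - 1) - 1" by (simp add: tau_eq)
  have "\<exists>\<delta>>0. \<forall>\<^sub>F n in sequentially.
     \<delta> * real n powr (1 - tau) \<le> real (n + 1) * real n * amean (n - 1) - real n * (real n - 1) * amean (n - 2)"
    by (rule convex_sequence_increment[OF amean_convex L(2,1) tau])
  then show ?thesis unfolding e mean_edges_def by (simp add: numeral_2_eq_2 algebra_simps)
qed

end

section \<open>Fluctuations of the number of upper edges\<close>

lemma depends_on_region_mono:
  "depends_on_region I S f \<Longrightarrow> S \<subseteq> T \<Longrightarrow> depends_on_region I T f"
  unfolding depends_on_region_def by blast

lemma depends_on_region_comp: "depends_on_region I S f \<Longrightarrow> depends_on_region I S (\<lambda>x. h (f x))"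
  unfolding depends_on_region_def by metis

lemma depends_on_region_comp2:
  "depends_on_region I S f \<Longrightarrow> depends_on_region I S g \<Longrightarrow> depends_on_region I S (\<lambda>x. h (f x) (g x))"
  unfolding depends_on_region_def by metis

lemma depends_on_region_sum:
  assumes "\<And>k. k \<in> K \<Longrightarrow> depends_on_region I S (f k)"
  shows "depends_on_region I S (\<lambda>x. \<Sum>k\<in>K. f k x)"
  unfolding depends_on_region_def using assms unfolding depends_on_region_def by (metis (no_types, lifting) sum.cong)

text \<open>\<open>\<rho>\<close> bounds the measure of the regions and \<open>B\<close> is the
  truncation level of the local counts. They are later taken as constant multiples of ln n / n and
  of ln n.\<close>

locale edge_sample = planar_beta +
  fixes n m :: nat and \<rho> B :: real
  assumes m4: "4 \<le> m" and n1: "1 \<le> n"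
    and region_prob: "\<And>k. measure \<nu> (region m k) \<le> \<rho>"
    and B_nonneg: "0 \<le> B"
begin

definition P where "P = Pi\<^sub>M {..<n} (\<lambda>_. \<nu>)"

sublocale P: prob_space P unfolding P_def by (intro prob_space_PiM nu_prob)

definition good :: "(nat \<Rightarrow> real \<times> real) \<Rightarrow> bool" where
  "good x \<longleftrightarrow> (\<forall>k<m. \<exists>i<n. x i \<in> cell m k) \<and> (\<forall>k<m. real (card {i\<in>{..<n}. x i \<in> region m k}) \<le> B)
     \<and> (\<forall>i<n. norm (x i) \<le> 1)"

definition L :: "(nat \<Rightarrow> real \<times> real) \<Rightarrow> real" where "L x = real (upper_edges {..<n} x)"
text \<open>The truncation makes the variable bounded on every sample, as the covariance bound
  demands; on good samples it has no effect.\<close>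

definition Y :: "nat \<Rightarrow> (nat \<Rightarrow> real \<times> real) \<Rightarrow> real" where
  "Y k x = min (real (local_edges m k {..<n} x)) B"
definition W :: "(nat \<Rightarrow> real \<times> real) \<Rightarrow> real" where "W x = (\<Sum>k<m. Y k x)"
definition Z :: "nat \<Rightarrow> (nat \<Rightarrow> real \<times> real) \<Rightarrow> real" where "Z k x = Y k x - P.expectation (Y k)"
text \<open>1156 = 4 * 17^2: the covariance bound has a factor 4, and the neighbourhoods of two
  indices consist of at most 17 = 2 * 8 + 1 regions each, where 8 is the separation in
  \<open>region_disjoint\<close>. The factor m covers one region against all distant ones.\<close>

definition eps :: real where "eps = 1156 * n * m * \<rho>\<^sup>2"

lemma n_le_nm: "real n \<le> real n * real m"
  using m4 mult_left_mono[of 1 "real m" "real n"] by simp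

lemma rho_nonneg: "0 \<le> \<rho>" using region_prob[of 0] measure_nonneg[of \<nu> "region m 0"] by linarith
lemma eps_nonneg: "0 \<le> eps" by (simp add: eps_def)

lemma coordinate_measurable: "i < n \<Longrightarrow> (\<lambda>x. x i) \<in> P \<rightarrow>\<^sub>M borel"
  unfolding P_def using measurable_component_singleton[of i "{..<n}" "\<lambda>_. \<nu>"] by (simp cong: measurable_cong_sets)

lemma L_measurable[measurable]: "L \<in> borel_measurable P"
  unfolding L_def P_def using edge_counts_measurable(1)[of \<nu> "{..<n}" "{..<n}"] by simp

lemma Y_measurable[measurable]: "Y k \<in> borel_measurable P"
  unfolding Y_def P_def using edge_counts_measurable(2)[of \<nu> "{..<n}" "{..<n}"] by simp

lemma W_measurable[measurable]: "W \<in> borel_measurable P" unfolding W_def by measurable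
lemma Z_measurable[measurable]: "Z k \<in> borel_measurable P" unfolding Z_def by measurable

lemma good_measurable[measurable]: "Measurable.pred P good"
proof -
  note [measurable] = coordinate_measurable
  have 1: "Measurable.pred P (\<lambda>x. \<exists>i\<in>{..<n}. x i \<in> cell m k)" for k by measurable
  have "(\<lambda>x. real (card {i\<in>{..<n}. x i \<in> region m k})) = (\<lambda>x. \<Sum>i<n. indicator (region m k) (x i))" for k
    by (auto simp: indicator_def sum.If_cases Int_def)
  moreover have "(\<lambda>x. \<Sum>i<n. indicator (region m k) (x i) :: real) \<in> borel_measurable P" for k by measurable
  ultimately have 2[measurable]: "(\<lambda>x. real (card {i\<in>{..<n}. x i \<in> region m k})) \<in> borel_measurable P" for k by simp
  have 3: "Measurable.pred P (\<lambda>x. \<forall>i\<in>{..<n}. norm (x i) \<le> 1)" by measurable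
  have 4: "Measurable.pred P (\<lambda>x. \<forall>k\<in>{..<m}. \<exists>i\<in>{..<n}. x i \<in> cell m k)"
    using 1 by (intro pred_intros_finite) auto
  have 5: "Measurable.pred P (\<lambda>x. \<forall>k\<in>{..<m}. real (card {i\<in>{..<n}. x i \<in> region m k}) \<le> B)"
    using 2 by (intro pred_intros_finite) measurable
  show ?thesis using 3 4 5 unfolding good_def by (simp add: Ball_def Bex_def)
qed

lemma L_eq_W: assumes "good x" shows "L x = W x"
proof -
  have c: "\<exists>i\<in>{..<n}. x i \<in> cell m k" if "k < m" for k using assms that by (auto simp: good_def)
  have "upper_edges {..<n} x = (\<Sum>k<m. local_edges m k {..<n} x)"
    by (rule upper_edges_eq_sum[OF _ m4 c]) (use assms in \<open>auto simp: good_def\<close>)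
  moreover have "Y k x = real (local_edges m k {..<n} x)" if "k < m" for k
  proof -
    have "real (local_edges m k {..<n} x) \<le> real (card {i\<in>{..<n}. x i \<in> region m k})"
      by (intro of_nat_mono local_edges_le) auto
    also have "\<dots> \<le> B" using assms that by (simp add: good_def)
    finally show ?thesis by (simp add: Y_def)
  qed
  ultimately show ?thesis by (simp add: L_def W_def)
qed

lemma L_range: "0 \<le> L x" "L x \<le> n"
  using upper_edges_le[of "{..<n}" x] by (simp_all add: L_def)

lemma Y_range: "0 \<le> Y k x" "Y k x \<le> B" using B_nonneg by (auto simp: Y_def)

lemma W_range: "0 \<le> W x" "W x \<le> m * B"
proof -
  show "0 \<le> W x" unfolding W_def by (intro sum_nonneg Y_range)
  have "W x \<le> (\<Sum>k<m. B)" unfolding W_def by (intro sum_mono Y_range)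
  then show "W x \<le> m * B" by simp
qed

lemma Y_integrable: "integrable P (Y k)"
  by (rule P.integrable_const_bound[where B=B]) (use Y_range in auto)

lemma EY_range: "0 \<le> P.expectation (Y k)" "P.expectation (Y k) \<le> B"
proof -
  show "0 \<le> P.expectation (Y k)" by (intro integral_nonneg_AE) (simp add: Y_range)
  have "P.expectation (Y k) \<le> P.expectation (\<lambda>_. B)" by (intro integral_mono Y_integrable) (auto simp: Y_range)
  then show "P.expectation (Y k) \<le> B" by (simp add: P.prob_space)
qed

lemma Z_bound: "\<bar>Z k x\<bar> \<le> B"
  using Y_range[of k x] EY_range[of k] by (auto simp: Z_def abs_if)

lemma EZ: "P.expectation (Z k) = 0"
  unfolding Z_def using Y_integrable by (simp add: P.prob_space)

sublocale WD: weakly_dependent P Z m 8 B eps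
  by unfold_locales (auto simp: Z_bound)

lemma total_eq: "WD.total x = W x - P.expectation W"
  unfolding WD.total_def Z_def W_def using Y_integrable by (simp add: sum_subtractf)

definition regions :: "nat set \<Rightarrow> (real \<times> real) set" where "regions K = (\<Union>k\<in>K. region m k)"

lemma regions_borel[measurable]: "finite K \<Longrightarrow> regions K \<in> sets borel"
  unfolding regions_def by auto

lemma measure_regions: assumes "finite K" shows "measure \<nu> (regions K) \<le> card K * \<rho>"
proof -
  have "measure \<nu> (regions K) \<le> (\<Sum>k\<in>K. measure \<nu> (region m k))"
    unfolding regions_def by (rule finite_measure_subadditive_finite) (use assms in auto)
  also have "\<dots> \<le> (\<Sum>k\<in>K. \<rho>)" by (intro sum_mono region_prob)
  finally show ?thesis by simp
qed

lemma regions_disjoint: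
  assumes "\<And>k l. k \<in> K \<Longrightarrow> l \<in> J \<Longrightarrow> k < m \<and> l < m \<and> (k + 8 < l \<or> l + 8 < k)"
  shows "regions K \<inter> regions J = {}"
proof -
  have "region m k \<inter> region m l = {}" if "k \<in> K" "l \<in> J" for k l
    using assms[OF that] region_disjoint[of k m l] region_disjoint[of l m k] by blast
  then show ?thesis unfolding regions_def by blast
qed

lemma Z_depends: "k \<in> K \<Longrightarrow> depends_on_region {..<n} (regions K) (Z k)"
  unfolding Z_def Y_def
  by (rule depends_on_region_mono[where S="region m k"], intro depends_on_region_comp[of _ _ "local_edges m k {..<n}" "\<lambda>v. min (real v) B - P.expectation (\<lambda>x. min (real (local_edges m k {..<n} x)) B)"] local_edges_depends)
     (auto simp: regions_def)

lemma near_iff: "WD.near k l \<longleftrightarrow> k \<le> l + 8 \<and> l \<le> k + 8"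
  by (simp add: WD.near_def)

lemma rest_depends: "depends_on_region {..<n} (regions {l. l < m \<and> \<not> WD.near k l}) (WD.rest k)"
  unfolding WD.rest_def by (intro depends_on_region_sum Z_depends)

lemma nbhd_depends: "depends_on_region {..<n} (regions {l. l < m \<and> WD.near k l}) (WD.nbhd k)"
  unfolding WD.nbhd_def by (intro depends_on_region_sum Z_depends)

lemma covariance_regions:
  assumes K: "finite K" and J: "finite J" and dis: "regions K \<inter> regions J = {}"
    and f: "f \<in> borel_measurable P" and g: "g \<in> borel_measurable P"
    and bf: "\<And>x. \<bar>f x\<bar> \<le> a" and bg: "\<And>x. \<bar>g x\<bar> \<le> b"
    and df: "depends_on_region {..<n} (regions K) f" and dg: "depends_on_region {..<n} (regions J) g"
  shows "\<bar>P.expectation (\<lambda>x. f x * g x) - P.expectation f * P.expectation g\<bar> \<le> a * b * (4 * real n * (card K * \<rho>) * (card J * \<rho>))"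
proof -
  have a0: "0 \<le> a" "0 \<le> b" using bf bg order_trans[OF abs_ge_zero] by blast+
  have "\<bar>P.expectation (\<lambda>x. f x * g x) - P.expectation f * P.expectation g\<bar>
      \<le> 4 * a * b * card {..<n} * measure \<nu> (regions K) * measure \<nu> (regions J)"
    unfolding P_def
    by (rule covariance_disjoint_regions[OF nu_prob])
       (use K J dis f g bf bg df dg in \<open>auto simp: P_def\<close>)
  also have "\<dots> \<le> 4 * a * b * card {..<n} * (card K * \<rho>) * (card J * \<rho>)"
    using a0 rho_nonneg by (intro mult_mono measure_regions K J) auto
  finally show ?thesis by (simp add: mult_ac)
qed

lemma card_lt_m: "card {l. l < m \<and> Q l} \<le> m"
  using card_mono[of "{..<m}" "{l. l < m \<and> Q l}"] by auto

lemma far_covariance: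
  assumes k: "k < m" and g: "g \<in> borel_measurable borel" and bg: "\<And>v. \<bar>g v\<bar> \<le> (1 :: real)"
  shows "\<bar>P.expectation (\<lambda>x. Z k x * g (WD.rest k x))\<bar> \<le> B * eps"
proof -
  let ?J = "{l. l < m \<and> \<not> WD.near k l}"
  note [measurable] = g
  have "\<bar>P.expectation (\<lambda>x. Z k x * g (WD.rest k x)) - P.expectation (Z k) * P.expectation (\<lambda>x. g (WD.rest k x))\<bar>
      \<le> B * 1 * (4 * real n * (card {k} * \<rho>) * (card ?J * \<rho>))"
  proof (rule covariance_regions)
    show "regions {k} \<inter> regions ?J = {}" using k by (intro regions_disjoint) (auto simp: near_iff)
    show "depends_on_region {..<n} (regions ?J) (\<lambda>x. g (WD.rest k x))"
      by (rule depends_on_region_comp[OF rest_depends])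
  qed (auto simp: Z_bound bg Z_depends)
  also have "\<dots> \<le> B * eps"
  proof -
    have "4 * real n * (1 * \<rho>) * (card ?J * \<rho>) \<le> 4 * real n * (1 * \<rho>) * (m * \<rho>)"
      using rho_nonneg card_lt_m[of "\<lambda>l. \<not> WD.near k l"] by (intro mult_left_mono mult_right_mono) auto
    also have "\<dots> = 4 * (n * m * \<rho>\<^sup>2)" by (simp add: power2_eq_square)
    also have "\<dots> \<le> eps" unfolding eps_def by (simp add: mult.assoc[symmetric] mult_right_mono)
    finally show ?thesis using B_nonneg by (simp add: mult_left_mono)
  qed
  finally show ?thesis by (simp add: EZ)
qed

lemma far_ZZ:
  assumes "k < m" "l < m" "\<not> WD.near k l"
  shows "\<bar>P.expectation (\<lambda>x. Z k x * Z l x)\<bar> \<le> B\<^sup>2 * eps"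
proof -
  have "\<bar>P.expectation (\<lambda>x. Z k x * Z l x) - P.expectation (Z k) * P.expectation (Z l)\<bar>
      \<le> B * B * (4 * real n * (card {k} * \<rho>) * (card {l} * \<rho>))"
  proof (rule covariance_regions)
    show "regions {k} \<inter> regions {l} = {}" using assms by (intro regions_disjoint) (auto simp: near_iff)
  qed (auto simp: Z_bound Z_depends)
  also have "\<dots> \<le> B * B * eps"
  proof -
    have "4 * real n * (1 * \<rho>) * (1 * \<rho>) = 4 * (n * 1 * \<rho>\<^sup>2)" by (simp add: power2_eq_square)
    also have "\<dots> \<le> 1156 * (n * m * \<rho>\<^sup>2)" using n_le_nm by (intro mult_mono) auto
    finally show ?thesis using B_nonneg by (intro mult_left_mono) (auto simp: eps_def mult_ac)
  qed
  finally show ?thesis by (simp add: EZ power2_eq_square)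
qed

lemma far_quadratic:
  assumes "k < m" "l < m" "k + 3 * 8 < l \<or> l + 3 * 8 < k"
  shows "\<bar>P.expectation (\<lambda>x. (Z k x * WD.nbhd k x) * (Z l x * WD.nbhd l x))
     - P.expectation (\<lambda>x. Z k x * WD.nbhd k x) * P.expectation (\<lambda>x. Z l x * WD.nbhd l x)\<bar> \<le> (WD.nbhd_size * B\<^sup>2)\<^sup>2 * eps"
proof -
  let ?K = "\<lambda>k. {l. l < m \<and> WD.near k l}"
  have ck: "real (card (?K k)) \<le> 17" for k using WD.card_near[of k] by simp
  have "\<bar>P.expectation (\<lambda>x. (Z k x * WD.nbhd k x) * (Z l x * WD.nbhd l x))
     - P.expectation (\<lambda>x. Z k x * WD.nbhd k x) * P.expectation (\<lambda>x. Z l x * WD.nbhd l x)\<bar>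
     \<le> (WD.nbhd_size * B\<^sup>2) * (WD.nbhd_size * B\<^sup>2) * (4 * real n * (card (?K k) * \<rho>) * (card (?K l) * \<rho>))"
  proof (rule covariance_regions)
    show "regions (?K k) \<inter> regions (?K l) = {}" using assms by (intro regions_disjoint) (auto simp: near_iff)
    have "depends_on_region {..<n} (regions (?K k)) (\<lambda>x. Z k x * WD.nbhd k x)" if "k < m" for k
      using that by (intro depends_on_region_comp2[where h="(*)"] Z_depends nbhd_depends) (auto simp: near_iff)
    then show "depends_on_region {..<n} (regions (?K k)) (\<lambda>x. Z k x * WD.nbhd k x)"
       "depends_on_region {..<n} (regions (?K l)) (\<lambda>x. Z l x * WD.nbhd l x)" using assms by auto
  qed (auto simp: WD.Zn_bound)
  also have "\<dots> \<le> (WD.nbhd_size * B\<^sup>2) * (WD.nbhd_size * B\<^sup>2) * eps"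
  proof -
    have "4 * real n * (card (?K k) * \<rho>) * (card (?K l) * \<rho>) \<le> 4 * real n * (17 * \<rho>) * (17 * \<rho>)"
      using rho_nonneg ck by (intro mult_mono mult_left_mono mult_right_mono) auto
    also have "\<dots> = 1156 * (n * 1 * \<rho>\<^sup>2)" by (simp add: power2_eq_square)
    also have "\<dots> \<le> 1156 * (n * m * \<rho>\<^sup>2)" using n_le_nm by (intro mult_mono) auto
    also have "\<dots> = eps" by (simp add: eps_def)
    finally show ?thesis by (rule mult_left_mono) (simp add: WD.nbhd_size_nonneg)
  qed
  finally show ?thesis by (simp add: power2_eq_square)
qed

lemma W_bound: "\<bar>W x\<bar> \<le> m * B" using W_range[of x] by simp

lemma W_integrable: "integrable P W" by (rule P.integrable_const_bound[where B="m * B"]) (auto simp: W_bound)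
lemma L_integrable: "integrable P L" by (rule P.integrable_const_bound[where B=n]) (use L_range in auto)
lemma W2_integrable: "integrable P (\<lambda>x. (W x)\<^sup>2)"
  by (rule P.integrable_const_bound[where B="(m * B)\<^sup>2"]) (use abs_le_square_bound[OF W_bound] in auto)
lemma L2_integrable: "integrable P (\<lambda>x. (L x)\<^sup>2)"
  by (rule P.integrable_const_bound[where B="(real n)\<^sup>2"]) (use L_range in \<open>auto intro!: power_mono\<close>)

text \<open>Each of the m indices has at most 17 near ones, which contribute at most B^2 each; every
  other pair contributes at most B^2 * \<open>eps\<close>.\<close>

lemma variance_W_le: "P.variance W \<le> 17 * real m * B\<^sup>2 + (real m)\<^sup>2 * B\<^sup>2 * eps"
proof -
  have iZZ: "integrable P (\<lambda>x. Z k x * Z l x)" for k l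
    by (rule P.integrable_const_bound[where B="B * B"])
       (use mult_mono[OF Z_bound[of k] Z_bound[of l]] B_nonneg in \<open>auto simp: abs_mult\<close>)
  have "P.variance W = P.expectation (\<lambda>x. (WD.total x)\<^sup>2)" by (simp add: total_eq)
  also have "(\<lambda>x. (WD.total x)\<^sup>2) = (\<lambda>x. \<Sum>k<m. \<Sum>l<m. Z k x * Z l x)"
    by (simp add: WD.total_def power2_eq_square sum_product)
  also have "P.expectation \<dots> = (\<Sum>k<m. \<Sum>l<m. P.expectation (\<lambda>x. Z k x * Z l x))" using iZZ by simp
  also have "\<dots> \<le> (\<Sum>k<m. \<Sum>l<m. (if WD.near k l then B\<^sup>2 else 0) + B\<^sup>2 * eps)"
  proof (intro sum_mono)
    fix k l assume kl: "k \<in> {..<m}" "l \<in> {..<m}"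
    show "P.expectation (\<lambda>x. Z k x * Z l x) \<le> (if WD.near k l then B\<^sup>2 else 0) + B\<^sup>2 * eps"
    proof (cases "WD.near k l")
      case True
      have "P.expectation (\<lambda>x. Z k x * Z l x) \<le> P.expectation (\<lambda>x. B\<^sup>2)"
      proof (intro integral_mono iZZ)
        fix x
        have "\<bar>Z k x * Z l x\<bar> \<le> B * B"
          using mult_mono[OF Z_bound[of k] Z_bound[of l]] B_nonneg by (auto simp: abs_mult)
        then show "Z k x * Z l x \<le> B\<^sup>2" by (simp add: power2_eq_square)
      qed auto
      then show ?thesis using True eps_nonneg by (simp add: P.prob_space add_increasing2)
    next
      case False
      then show ?thesis using far_ZZ[of k l] kl by auto
    qed
  qed
  also have "\<dots> = (\<Sum>k<m. real (card {l\<in>{..<m}. WD.near k l}) * B\<^sup>2) + m\<^sup>2 * B\<^sup>2 * eps"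
    by (simp add: sum.distrib power2_eq_square sum.If_cases Int_def)
  also have "\<dots> \<le> (\<Sum>k<m. 17 * B\<^sup>2) + m\<^sup>2 * B\<^sup>2 * eps"
  proof (intro add_mono sum_mono order_refl mult_right_mono)
    fix k show "real (card {l\<in>{..<m}. WD.near k l}) \<le> 17" using WD.card_near[of k] by simp
  qed auto
  finally show ?thesis by simp
qed

lemma char_W_bound:
  assumes "0 < P.variance W"
  defines "\<sigma> \<equiv> sqrt (P.variance W)"
  shows "norm (P.expectation (\<lambda>x. iexp (t / \<sigma> * (W x - P.expectation W))) - of_real (exp (- t\<^sup>2 / 2))) \<le>
      \<bar>t\<bar> * (2 * real m * B * eps / \<sigma> + 3 / 2 * t\<^sup>2 * real m * 17\<^sup>2 * B ^ 3 / \<sigma> ^ 3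
        + \<bar>t\<bar> * (sqrt (2 * real m * 49 * (17 * B\<^sup>2)\<^sup>2 + (real m)\<^sup>2 * (17 * B\<^sup>2)\<^sup>2 * eps) + (real m)\<^sup>2 * B\<^sup>2 * eps) / \<sigma>\<^sup>2)"
proof -
  have nbhd_size: "WD.nbhd_size = 17" by (simp add: WD.nbhd_size_def)
  have s: "\<sigma> > 0" "\<sigma>\<^sup>2 = P.expectation (\<lambda>x. (WD.total x)\<^sup>2)"
    using assms(1) by (auto simp: \<sigma>_def total_eq)
  have "norm (P.expectation (\<lambda>x. iexp (t / \<sigma> * WD.total x)) - of_real (exp (- t\<^sup>2 / 2))) \<le>
      \<bar>t\<bar> * (2 * m * B * eps / \<sigma> + 3 / 2 * t\<^sup>2 * m * WD.nbhd_size\<^sup>2 * B ^ 3 / \<sigma> ^ 3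
        + \<bar>t\<bar> * (sqrt (2 * m * (6 * 8 + 1) * (WD.nbhd_size * B\<^sup>2)\<^sup>2 + m\<^sup>2 * (WD.nbhd_size * B\<^sup>2)\<^sup>2 * eps) + m\<^sup>2 * B\<^sup>2 * eps) / \<sigma>\<^sup>2)"
    using WD.char_total_bound[OF _ _ far_ZZ far_quadratic s eps_nonneg, where t=t]
      far_covariance[where g="\<lambda>v. cos (s * v)" for s] far_covariance[where g="\<lambda>v. sin (s * v)" for s] by simp
  then show ?thesis by (simp add: total_eq nbhd_size)
qed

text \<open>L and W agree on good samples and lie between 0 and n + m * B always, so moments differ
  by at most the matching power of this bound times the probability of a bad sample.\<close>

lemma bad_bounds:
  fixes \<eta> :: real
  assumes bad: "measure P {x\<in>space P. \<not> good x} \<le> \<eta>"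
  shows "P.expectation (\<lambda>x. \<bar>L x - W x\<bar>) \<le> (n + m * B) * \<eta>"
    and "\<bar>P.variance L - P.variance W\<bar> \<le> 2 * (n + m * B)\<^sup>2 * \<eta>"
proof -
  define K where "K = n + m * B"
  have K0: "0 \<le> K" using B_nonneg by (simp add: K_def)
  have U: "\<bar>L x - W x\<bar> \<le> K * indicator {x. \<not> good x} x" for x
    using L_eq_W[of x] L_range[of x] W_range[of x] by (cases "good x") (auto simp: K_def abs_if)
  have iU: "integrable P (\<lambda>x. \<bar>L x - W x\<bar>)" using L_integrable W_integrable by auto
  have mb: "{x\<in>space P. \<not> good x} \<in> sets P" by measurable
  have "P.expectation (\<lambda>x. \<bar>L x - W x\<bar>) \<le> P.expectation (\<lambda>x. K * indicator {x\<in>space P. \<not> good x} x)"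
  proof (intro integral_mono iU)
    show "integrable P (\<lambda>x. K * indicator {x\<in>space P. \<not> good x} x)"
      using mb by (intro integrable_mult_right) (simp add: less_top[symmetric])
  qed (use U in \<open>auto simp: indicator_def\<close>)
  also have "\<dots> = K * measure P {x\<in>space P. \<not> good x}" using mb by simp
  also have "\<dots> \<le> K * \<eta>" using bad K0 by (rule mult_left_mono)
  finally show EU: "P.expectation (\<lambda>x. \<bar>L x - W x\<bar>) \<le> (n + m * B) * \<eta>" by (simp add: K_def)
  have mean_count: "0 \<le> P.expectation L" "0 \<le> P.expectation W"
    by (intro integral_nonneg_AE; simp add: L_range W_range)+
  have EL2: "P.expectation L \<le> n" "P.expectation W \<le> m * B"
  proof -
    have "P.expectation L \<le> P.expectation (\<lambda>_. real n)" by (intro integral_mono L_integrable) (auto simp: L_range)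
    then show "P.expectation L \<le> n" by (simp add: P.prob_space)
    have "P.expectation W \<le> P.expectation (\<lambda>_. m * B)" by (intro integral_mono W_integrable) (auto simp: W_range)
    then show "P.expectation W \<le> m * B" by (simp add: P.prob_space)
  qed
  have E1: "\<bar>P.expectation L - P.expectation W\<bar> \<le> K * \<eta>"
  proof -
    have "\<bar>P.expectation L - P.expectation W\<bar> = \<bar>P.expectation (\<lambda>x. L x - W x)\<bar>" using L_integrable W_integrable by simp
    also have "\<dots> \<le> P.expectation (\<lambda>x. \<bar>L x - W x\<bar>)" by (rule integral_abs_bound)
    finally show ?thesis using EU by (simp add: K_def)
  qed
  have E2: "\<bar>P.expectation (\<lambda>x. (L x)\<^sup>2) - P.expectation (\<lambda>x. (W x)\<^sup>2)\<bar> \<le> K * (K * \<eta>)"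
  proof -
    have "\<bar>P.expectation (\<lambda>x. (L x)\<^sup>2) - P.expectation (\<lambda>x. (W x)\<^sup>2)\<bar> = \<bar>P.expectation (\<lambda>x. (L x)\<^sup>2 - (W x)\<^sup>2)\<bar>"
      using L2_integrable W2_integrable by simp
    also have "\<dots> \<le> P.expectation (\<lambda>x. \<bar>(L x)\<^sup>2 - (W x)\<^sup>2\<bar>)" by (rule integral_abs_bound)
    also have "\<dots> \<le> P.expectation (\<lambda>x. K * \<bar>L x - W x\<bar>)"
    proof (intro integral_mono)
      fix x
      have "\<bar>(L x)\<^sup>2 - (W x)\<^sup>2\<bar> = \<bar>L x + W x\<bar> * \<bar>L x - W x\<bar>"
        by (simp add: power2_eq_square abs_mult[symmetric] algebra_simps)
      also have "\<dots> \<le> K * \<bar>L x - W x\<bar>"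
        using L_range[of x] W_range[of x] by (intro mult_right_mono) (auto simp: K_def)
      finally show "\<bar>(L x)\<^sup>2 - (W x)\<^sup>2\<bar> \<le> K * \<bar>L x - W x\<bar>" .
    qed (use L2_integrable W2_integrable iU in auto)
    also have "\<dots> = K * P.expectation (\<lambda>x. \<bar>L x - W x\<bar>)" by simp
    also have "\<dots> \<le> K * (K * \<eta>)" using EU K0 by (intro mult_left_mono) (auto simp: K_def)
    finally show ?thesis .
  qed
  have E3: "\<bar>(P.expectation L)\<^sup>2 - (P.expectation W)\<^sup>2\<bar> \<le> K * (K * \<eta>)"
  proof -
    have "\<bar>(P.expectation L)\<^sup>2 - (P.expectation W)\<^sup>2\<bar> = \<bar>P.expectation L + P.expectation W\<bar> * \<bar>P.expectation L - P.expectation W\<bar>"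
      by (simp add: power2_eq_square abs_mult[symmetric] algebra_simps)
    also have "\<dots> \<le> K * (K * \<eta>)" using E1 mean_count EL2 K0 by (intro mult_mono) (auto simp: K_def)
    finally show ?thesis .
  qed
  have "P.variance L - P.variance W = (P.expectation (\<lambda>x. (L x)\<^sup>2) - P.expectation (\<lambda>x. (W x)\<^sup>2)) - ((P.expectation L)\<^sup>2 - (P.expectation W)\<^sup>2)"
    using P.variance_eq[OF L_integrable L2_integrable] P.variance_eq[OF W_integrable W2_integrable] by simp
  then have "\<bar>P.variance L - P.variance W\<bar> \<le> K * (K * \<eta>) + K * (K * \<eta>)" using E2 E3 by linarith
  then show "\<bar>P.variance L - P.variance W\<bar> \<le> 2 * (n + m * B)\<^sup>2 * \<eta>" by (simp add: K_def power2_eq_square mult_ac)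
qed

end

section \<open>Bad samples and the lower bound for the variance\<close>

context edge_sample
begin

lemma prob_UNIV: "measure \<nu> UNIV = 1" using prob_space by simp

lemma PS: "product_sigma_finite (\<lambda>_ :: nat. \<nu>)" by standard

lemma expectation_prod:
  assumes "\<And>i. i < n \<Longrightarrow> f i \<in> borel_measurable borel" "\<And>i z. \<bar>f i z\<bar> \<le> (C :: real)"
  shows "P.expectation (\<lambda>x. \<Prod>i<n. f i (x i)) = (\<Prod>i<n. \<integral>z. f i z \<partial>\<nu>)"
  unfolding P_def
  by (rule product_sigma_finite.product_integral_prod[OF PS])
     (use assms in \<open>auto intro!: integrable_const_bound[where B=C] simp: measurable_cong_sets[OF sets_nu refl]\<close>)

lemma prob_all:
  assumes [measurable]: "A \<in> sets borel"
  shows "measure P {x\<in>space P. \<forall>i<n. x i \<in> A} = measure \<nu> A ^ n"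
proof -
  note [measurable] = coordinate_measurable
  have m: "{x\<in>space P. \<forall>i<n. x i \<in> A} \<in> sets P"
  proof -
    have "Measurable.pred P (\<lambda>x. \<forall>i\<in>{..<n}. x i \<in> A)" by measurable
    then show ?thesis by (simp add: Ball_def pred_def)
  qed
  have "measure P {x\<in>space P. \<forall>i<n. x i \<in> A} = P.expectation (indicator {x\<in>space P. \<forall>i<n. x i \<in> A})"
    using m by simp
  also have "\<dots> = P.expectation (\<lambda>x. \<Prod>i<n. indicator A (x i))"
  proof (rule Bochner_Integration.integral_cong[OF refl])
    fix x assume x: "x \<in> space P"
    show "indicator {x\<in>space P. \<forall>i<n. x i \<in> A} x = (\<Prod>i<n. indicator A (x i) :: real)"
    proof (cases "\<forall>i<n. x i \<in> A")
      case False
      then have "(\<Prod>i<n. indicator A (x i) :: real) = 0" by (intro prod_zero) (auto simp: indicator_def)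
      then show ?thesis using False by (simp add: indicator_def)
    qed (use x in \<open>simp add: indicator_def\<close>)
  qed
  also have "\<dots> = (\<Prod>i<n. \<integral>z. indicator A z \<partial>\<nu>)" by (rule expectation_prod[where C=1]) (auto simp: indicator_def)
  finally show ?thesis by simp
qed

lemma prob_empty_cell:
  fixes pc :: real
  assumes "pc \<le> measure \<nu> (cell m k)"
  shows "measure P {x\<in>space P. \<forall>i<n. x i \<notin> cell m k} \<le> exp (- real n * pc)"
proof -
  have "measure P {x\<in>space P. \<forall>i<n. x i \<notin> cell m k} = measure P {x\<in>space P. \<forall>i<n. x i \<in> - cell m k}" by simp
  also have "\<dots> = measure \<nu> (- cell m k) ^ n" by (rule prob_all) simp
  also have "measure \<nu> (- cell m k) = 1 - measure \<nu> (cell m k)"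
    using prob_compl[of "cell m k"] by (simp add: Compl_eq_Diff_UNIV)
  also have "\<dots> ^ n \<le> exp (- pc) ^ n"
  proof (rule power_mono)
    show "1 - measure \<nu> (cell m k) \<le> exp (- pc)" using exp_ge_add_one_self[of "- pc"] assms by linarith
  qed simp
  also have "\<dots> = exp (- real n * pc)" by (simp flip: exp_of_nat_mult)
  finally show ?thesis .
qed

text \<open>Markov's inequality for 2 to the power of the number of points in the region; the
  expectation of this variable is a product over the points.\<close>

lemma prob_crowded_region:
  "measure P {x\<in>space P. B < real (card {i\<in>{..<n}. x i \<in> region m k})} \<le> exp (n * \<rho>) * 2 powr (- B)"
proof -
  note [measurable] = coordinate_measurable
  have "(\<lambda>x. real (card {i\<in>{..<n}. x i \<in> region m k})) = (\<lambda>x. \<Sum>i<n. indicator (region m k) (x i))"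
    by (auto simp: indicator_def sum.If_cases Int_def)
  moreover have "(\<lambda>x. \<Sum>i<n. indicator (region m k) (x i) :: real) \<in> borel_measurable P" by measurable
  ultimately have [measurable]: "(\<lambda>x. real (card {i\<in>{..<n}. x i \<in> region m k})) \<in> borel_measurable P" by simp
  let ?E = "{x\<in>space P. B < real (card {i\<in>{..<n}. x i \<in> region m k})}"
  let ?g = "\<lambda>x. \<Prod>i<n. 1 + indicator (region m k) (x i) :: real"
  have g2: "?g x = 2 powr real (card {i\<in>{..<n}. x i \<in> region m k})" for x
  proof -
    have "?g x = (\<Prod>i<n. if x i \<in> region m k then 2 else 1)" by (intro prod.cong) (auto simp: indicator_def)
    also have "\<dots> = 2 ^ card {i\<in>{..<n}. x i \<in> region m k}" by (simp add: prod.If_cases Int_def)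
    finally show ?thesis by (simp add: powr_realpow)
  qed
  have [measurable]: "?g \<in> borel_measurable P" by measurable
  have gb: "\<bar>?g x\<bar> \<le> 2 ^ n" for x
  proof -
    have "\<bar>?g x\<bar> \<le> (\<Prod>i<n. 2)" unfolding abs_prod by (intro prod_mono) (auto simp: indicator_def)
    then show ?thesis by simp
  qed
  have Es: "?E \<in> sets P" by measurable
  have "measure P ?E = P.expectation (indicator ?E)" by simp
  also have "\<dots> \<le> P.expectation (\<lambda>x. 2 powr (- B) * ?g x)"
  proof (intro integral_mono)
    show "integrable P (indicator ?E :: _ \<Rightarrow> real)"
      by (rule integrable_real_indicator[OF Es]) (simp add: less_top[symmetric])
    show "integrable P (\<lambda>x. 2 powr (- B) * ?g x)"
      by (intro integrable_mult_right P.integrable_const_bound[where B="2 ^ n"]) (use gb in auto)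
    fix x
    show "indicator ?E x \<le> 2 powr (- B) * ?g x"
    proof (cases "x \<in> ?E")
      case True
      then have "1 \<le> 2 powr (- B + real (card {i\<in>{..<n}. x i \<in> region m k}))" by (intro ge_one_powr_ge_zero) auto
      then show ?thesis using True unfolding g2 powr_add by simp
    qed (simp add: g2)
  qed
  also have "\<dots> = 2 powr (- B) * P.expectation ?g" by simp
  also have "P.expectation ?g = (\<Prod>i<n. \<integral>z. 1 + indicator (region m k) z \<partial>\<nu>)"
    by (rule expectation_prod[where C=2]) (auto simp: indicator_def)
  also have "\<dots> = (1 + measure \<nu> (region m k)) ^ n"
  proof -
    have "(\<integral>z. 1 + indicator (region m k) z \<partial>\<nu>) = (\<integral>z. 1 \<partial>\<nu>) + (\<integral>z. indicator (region m k) z \<partial>\<nu> :: real)"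
      by (rule Bochner_Integration.integral_add) (auto simp: less_top[symmetric])
    then show ?thesis using prob_space by simp
  qed
  also have "\<dots> \<le> exp \<rho> ^ n"
  proof (rule power_mono)
    show "1 + measure \<nu> (region m k) \<le> exp \<rho>"
      using exp_ge_add_one_self[of \<rho>] region_prob[of k] by linarith
  qed simp
  also have "\<dots> = exp (n * \<rho>)" by (simp flip: exp_of_nat_mult)
  finally show ?thesis by (simp add: mult.commute)
qed

lemma bad_prob:
  fixes pc :: real
  assumes pc: "\<And>k. pc \<le> measure \<nu> (cell m k)"
  shows "measure P {x\<in>space P. \<not> good x} \<le> m * exp (- real n * pc) + m * (exp (n * \<rho>) * 2 powr (- B))"
proof -
  note [measurable] = coordinate_measurable
  let ?E = "\<lambda>k. {x\<in>space P. \<forall>i<n. x i \<notin> cell m k}"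
  let ?C = "\<lambda>k. {x\<in>space P. B < real (card {i\<in>{..<n}. x i \<in> region m k})}"
  let ?N = "{x\<in>space P. \<not> (\<forall>i<n. norm (x i) \<le> 1)}"
  have E: "?E k \<in> sets P" for k
  proof -
    have "Measurable.pred P (\<lambda>x. \<forall>i\<in>{..<n}. x i \<notin> cell m k)" by measurable
    then show ?thesis by (simp add: Ball_def pred_def)
  qed
  have C: "?C k \<in> sets P" for k
  proof -
    have "(\<lambda>x. real (card {i\<in>{..<n}. x i \<in> region m k})) = (\<lambda>x. \<Sum>i<n. indicator (region m k) (x i))"
      by (auto simp: indicator_def sum.If_cases Int_def)
    moreover have "(\<lambda>x. \<Sum>i<n. indicator (region m k) (x i) :: real) \<in> borel_measurable P" by measurable
    ultimately have [measurable]: "(\<lambda>x. real (card {i\<in>{..<n}. x i \<in> region m k})) \<in> borel_measurable P" by simp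
    show ?thesis by measurable
  qed
  have Nm: "?N \<in> sets P"
  proof -
    have "Measurable.pred P (\<lambda>x. \<not> (\<forall>i\<in>{..<n}. norm (x i) \<le> 1))" by measurable
    then show ?thesis by (simp add: Ball_def pred_def)
  qed
  have N0: "measure P ?N = 0"
  proof -
    have "AE x in P. norm (x i) \<le> 1" if "i < n" for i
      unfolding P_def by (rule AE_PiM_component) (use that AE_norm_le_1 nu_prob in auto)
    then have "AE x in P. \<forall>i\<in>{..<n}. norm (x i) \<le> 1" by (subst AE_finite_all) auto
    then have "AE x in P. x \<notin> ?N" by eventually_elim auto
    then have "?N \<in> null_sets P" using Nm by (simp add: AE_iff_null_sets)
    then show ?thesis by (simp add: measure_eq_0_null_sets)
  qed
  have "{x\<in>space P. \<not> good x} \<subseteq> (\<Union>k<m. ?E k) \<union> (\<Union>k<m. ?C k) \<union> ?N"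
    unfolding good_def by (auto simp: not_le)
  then have "measure P {x\<in>space P. \<not> good x} \<le> measure P ((\<Union>k<m. ?E k) \<union> (\<Union>k<m. ?C k) \<union> ?N)"
    using E C Nm by (intro P.finite_measure_mono) auto
  also have "\<dots> \<le> measure P (\<Union>k<m. ?E k) + measure P (\<Union>k<m. ?C k) + measure P ?N"
    using E C Nm by (intro order_trans[OF measure_Un_le] add_mono measure_Un_le) auto
  also have "\<dots> \<le> (\<Sum>k<m. measure P (?E k)) + (\<Sum>k<m. measure P (?C k)) + 0"
    unfolding N0 using E C by (intro add_mono P.finite_measure_subadditive_finite) auto
  also have "\<dots> \<le> (\<Sum>k<m. exp (- real n * pc)) + (\<Sum>k<m. exp (n * \<rho>) * 2 powr (- B)) + 0"
    by (intro add_mono sum_mono prob_empty_cell prob_crowded_region pc order_refl)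
  finally show ?thesis by simp
qed

definition R where "R = regions {..<m}"
definition pR where "pR = measure \<nu> R"
definition T where "T x = (\<Sum>i<n. indicator R (x i) :: real)"

lemma R_borel[measurable]: "R \<in> sets borel" unfolding R_def by simp
lemma pR_le: "pR \<le> m * \<rho>" unfolding pR_def R_def using measure_regions[of "{..<m}"] by simp
lemma pR_range: "0 \<le> pR" "pR \<le> 1" by (auto simp: pR_def)

lemma indicator_R_measurable[measurable]: "i < n \<Longrightarrow> (\<lambda>x. indicator R (x i) :: real) \<in> borel_measurable P"
  using measurable_compose[OF coordinate_measurable, of i "indicator R" borel] by simp

lemma T_measurable[measurable]: "T \<in> borel_measurable P" unfolding T_def by measurable

lemma expectation_pair:
  assumes "i < n" "j < n"
  shows "P.expectation (\<lambda>x. indicator R (x i) * indicator R (x j)) = (if i = j then pR else pR\<^sup>2)"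
proof -
  have "P.expectation (\<lambda>x. indicator R (x i) * indicator R (x j) :: real) = P.expectation (\<lambda>x. \<Prod>l<n. (if l \<in> {i, j} then indicator R else (\<lambda>_. 1)) (x l))"
  proof (rule Bochner_Integration.integral_cong[OF refl])
    fix x :: "nat \<Rightarrow> real \<times> real"
    have "(\<Prod>l<n. (if l \<in> {i, j} then indicator R else (\<lambda>_. 1)) (x l) :: real) = (\<Prod>l\<in>{..<n} \<inter> {i, j}. indicator R (x l))"
      by (subst prod.inter_restrict) (auto intro!: prod.cong)
    also have "{..<n} \<inter> {i, j} = {i, j}" using assms by auto
    also have "(\<Prod>l\<in>{i, j}. indicator R (x l) :: real) = indicator R (x i) * indicator R (x j)"
      by (cases "i = j") (auto simp: indicator_def)
    finally show "indicator R (x i) * indicator R (x j) = (\<Prod>l<n. (if l \<in> {i, j} then indicator R else (\<lambda>_. 1)) (x l) :: real)" by simp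
  qed
  also have "\<dots> = (\<Prod>l<n. \<integral>z. (if l \<in> {i, j} then indicator R else (\<lambda>_. 1)) z \<partial>\<nu>)"
    by (rule expectation_prod[where C=1]) (auto simp: indicator_def)
  also have "\<dots> = (\<Prod>l\<in>{..<n} \<inter> {i, j}. pR)"
    by (subst prod.inter_restrict) (auto intro!: prod.cong simp: pR_def prob_UNIV)
  also have "{..<n} \<inter> {i, j} = {i, j}" using assms by auto
  also have "(\<Prod>l\<in>{i, j}. pR) = (if i = j then pR else pR\<^sup>2)" by (auto simp: power2_eq_square)
  finally show ?thesis .
qed

lemma ET: "P.expectation T = n * pR" and varT: "P.variance T \<le> n * pR"
proof -
  have i1: "integrable P (\<lambda>x. indicator R (x i) :: real)" if "i < n" for i
    by (rule P.integrable_const_bound[where B=1, OF _ indicator_R_measurable[OF that]]) (simp add: indicator_def)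
  have i2: "integrable P (\<lambda>x. indicator R (x i) * indicator R (x j) :: real)" if "i < n" "j < n" for i j
    by (rule P.integrable_const_bound[where B=1, OF _ borel_measurable_times[OF indicator_R_measurable[OF that(1)] indicator_R_measurable[OF that(2)]]])
       (simp add: indicator_def)
  have e1: "P.expectation (\<lambda>x. indicator R (x i)) = pR" if "i < n" for i
  proof -
    have "(\<lambda>x. indicator R (x i) :: real) = (\<lambda>x. indicator R (x i) * indicator R (x i))" by (auto simp: indicator_def)
    then show ?thesis using expectation_pair[OF that that] by simp
  qed
  show ET: "P.expectation T = n * pR"
    unfolding T_def using i1 e1 by simp
  have T2: "(T x)\<^sup>2 = (\<Sum>i<n. \<Sum>j<n. indicator R (x i) * indicator R (x j))" for x
    by (simp add: T_def power2_eq_square sum_product)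
  have iT: "integrable P T" unfolding T_def using i1 by auto
  have iT2: "integrable P (\<lambda>x. (T x)\<^sup>2)" unfolding T2 using i2 by (intro Bochner_Integration.integrable_sum) auto
  have "P.expectation (\<lambda>x. (T x)\<^sup>2) = (\<Sum>i<n. \<Sum>j<n. P.expectation (\<lambda>x. indicator R (x i) * indicator R (x j)))"
  proof -
    have "P.expectation (\<lambda>x. (T x)\<^sup>2) = (\<Sum>i<n. P.expectation (\<lambda>x. \<Sum>j<n. indicator R (x i) * indicator R (x j)))"
      unfolding T2 by (rule Bochner_Integration.integral_sum) (intro Bochner_Integration.integrable_sum i2, auto)
    also have "\<dots> = (\<Sum>i<n. \<Sum>j<n. P.expectation (\<lambda>x. indicator R (x i) * indicator R (x j)))"
      by (intro sum.cong refl Bochner_Integration.integral_sum) (use i2 in auto)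
    finally show ?thesis .
  qed
  also have "\<dots> = (\<Sum>i<n. \<Sum>j<n. if i = j then pR else pR\<^sup>2)"
    by (intro sum.cong refl) (simp add: expectation_pair)
  also have "\<dots> \<le> (\<Sum>i<n. \<Sum>j<n. (if i = j then pR else 0) + pR\<^sup>2)"
    by (intro sum_mono) (auto simp: pR_range)
  also have "\<dots> = n * pR + (n * pR)\<^sup>2"
    by (simp add: sum.distrib power2_eq_square algebra_simps)
  finally have "P.expectation (\<lambda>x. (T x)\<^sup>2) \<le> n * pR + (n * pR)\<^sup>2" .
  then show "P.variance T \<le> n * pR"
    using P.variance_eq[OF iT iT2] ET by simp
qed

lemma L_expectation: "P.expectation L = mean_edges n"
  unfolding P_def L_def mean_edges_def using upper_edges_expectation[of "{..<n}"] by simp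

text \<open>The edges of the other n - 1 points do not involve the i-th point, so the expectation
  factorises.\<close>

lemma remove_expectation:
  assumes i: "i < n"
  shows "P.expectation (\<lambda>x. real (upper_edges ({..<n} - {i}) x) * indicator (- R) (x i)) = (1 - pR) * mean_edges (n - 1)"
proof -
  let ?J = "{..<n} - {i}"
  let ?Q = "Pi\<^sub>M ?J (\<lambda>_. \<nu>)"
  interpret PSF: product_sigma_finite "\<lambda>_ :: nat. \<nu>" by (rule PS)
  interpret Q: prob_space ?Q by (intro prob_space_PiM nu_prob)
  have ins: "insert i ?J = {..<n}" using i by auto
  let ?f = "\<lambda>x. real (upper_edges ?J x) * indicator (- R) (x i)"
  have mU: "(\<lambda>x. real (upper_edges ?J x)) \<in> borel_measurable P"
    unfolding P_def using edge_counts_measurable(1)[of \<nu> ?J "{..<n}"] by simp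
  have mI: "(\<lambda>x. indicator (- R) (x i) :: real) \<in> borel_measurable P"
    using measurable_compose[OF coordinate_measurable[OF i], of "indicator (- R)" borel] by simp
  have int: "integrable P ?f"
  proof (rule P.integrable_const_bound[where B=n])
    have "real (upper_edges ?J x) \<le> n" for x
      using upper_edges_le[of ?J x] i by simp
    then show "AE x in P. norm (?f x) \<le> real n" by (auto simp: indicator_def)
    show "?f \<in> borel_measurable P" using mU mI by measurable
  qed
  have U: "upper_edges ?J (x(i := y)) = upper_edges ?J x" for x y
  proof -
    have "upper_edge ?J (x(i := y)) a b \<longleftrightarrow> upper_edge ?J x a b" for a b
      by (auto simp: upper_edge_def)
    then show ?thesis by (simp add: upper_edges_def)
  qed
  have "P.expectation ?f = (\<integral>x. (\<integral>y. ?f (x(i := y)) \<partial>\<nu>) \<partial>?Q)"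
    using PSF.product_integral_insert[of ?J i ?f] int unfolding P_def ins by simp
  also have "\<dots> = (\<integral>x. real (upper_edges ?J x) * (1 - pR) \<partial>?Q)"
  proof (rule Bochner_Integration.integral_cong[OF refl])
    fix x
    have "(\<integral>y. ?f (x(i := y)) \<partial>\<nu>) = real (upper_edges ?J x) * (\<integral>y. indicator (- R) y \<partial>\<nu>)"
      unfolding U by simp
    also have "(\<integral>y. indicator (- R) y \<partial>\<nu>) = 1 - pR"
      unfolding pR_def using prob_compl[of R] by (simp add: Compl_eq_Diff_UNIV)
    finally show "(\<integral>y. ?f (x(i := y)) \<partial>\<nu>) = real (upper_edges ?J x) * (1 - pR)" .
  qed
  also have "\<dots> = (1 - pR) * (\<integral>x. real (upper_edges ?J x) \<partial>?Q)" by simp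
  also have "(\<integral>x. real (upper_edges ?J x) \<partial>?Q) = mean_edges (n - 1)"
  proof -
    have "card ?J = n - 1" using i by simp
    then show ?thesis using upper_edges_expectation[of ?J] n1 by (simp add: mean_edges_def of_nat_diff)
  qed
  finally show ?thesis .
qed

text \<open>Away from \<open>R\<close> a point is irrelevant, so the covariance of \<open>L\<close> with the number of points in
  \<open>R\<close> is governed by the growth of the mean.\<close>

lemma covariance_LT:
  fixes \<eta> :: real
  assumes bad: "measure P {x\<in>space P. \<not> good x} \<le> \<eta>"
  shows "n * ((1 - pR) * (mean_edges n - mean_edges (n - 1)) - n * \<eta>)
     \<le> P.expectation (\<lambda>x. L x * T x) - P.expectation L * P.expectation T"
proof -
  have mb: "{x\<in>space P. \<not> good x} \<in> sets P" by measurable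
  have iLR: "integrable P (\<lambda>x. L x * indicator R (x i))" if "i < n" for i
    by (rule P.integrable_const_bound[where B=n, OF _ borel_measurable_times[OF L_measurable indicator_R_measurable[OF that]]])
       (use L_range in \<open>auto simp: indicator_def\<close>)
  have step: "mean_edges n - (1 - pR) * mean_edges (n - 1) - n * \<eta> \<le> P.expectation (\<lambda>x. L x * indicator R (x i))" if i: "i < n" for i
  proof -
    let ?J = "{..<n} - {i}"
    let ?f = "\<lambda>x. real (upper_edges ?J x) * indicator (- R) (x i)"
    have mU[measurable]: "(\<lambda>x. real (upper_edges ?J x)) \<in> borel_measurable P"
      unfolding P_def using edge_counts_measurable(1)[of \<nu> ?J "{..<n}"] by simp
    have mI[measurable]: "(\<lambda>x. indicator (- R) (x i) :: real) \<in> borel_measurable P"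
      using measurable_compose[OF coordinate_measurable[OF i], of "indicator (- R)" borel] by simp
    have Ub: "real (upper_edges ?J x) \<le> n" for x
      using upper_edges_le[of ?J x] i by simp
    have int: "integrable P ?f"
      by (rule P.integrable_const_bound[where B=n, OF _ borel_measurable_times[OF mU mI]]) (use Ub in \<open>auto simp: indicator_def\<close>)
    \<comment> \<open>A point outside R occupies no cell. After its removal every cell of a good
      sample is still occupied, and both edge counts are the same sum of local counts. On bad
      samples the term with factor n pays for the difference, and for \<open>x i\<close> in R the
      function \<open>?f\<close> vanishes.\<close>
    have pt: "L x - ?f x - real n * indicator {x\<in>space P. \<not> good x} x \<le> L x * indicator R (x i)" if x: "x \<in> space P" for x
    proof (cases "x i \<in> R \<or> \<not> good x")
      case True
      then show ?thesis using L_range[of x] x by (auto simp: indicator_def)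
    next
      case False
      then have nR: "x i \<notin> R" and g: "good x" by auto
      have nr: "x i \<notin> region m k" if "k < m" for k using nR that by (auto simp: R_def regions_def)
      have c: "\<exists>j\<in>{..<n}. x j \<in> cell m k" if "k < m" for k using g that by (auto simp: good_def)
      have c': "\<exists>j\<in>?J. x j \<in> cell m k" if "k < m" for k
        using c[OF that] nr[OF that] cell_subset_region[of m k] by blast
      have "upper_edges {..<n} x = (\<Sum>k<m. local_edges m k {..<n} x)"
        by (rule upper_edges_eq_sum[OF _ m4 c]) (use g in \<open>auto simp: good_def\<close>)
      also have "\<dots> = (\<Sum>k<m. local_edges m k ?J x)"
        by (intro sum.cong refl) (simp add: local_edges_remove nr)
      also have "\<dots> = upper_edges ?J x"
        by (rule upper_edges_eq_sum[OF _ m4 c', symmetric]) (use g in \<open>auto simp: good_def\<close>)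
      finally have "L x = real (upper_edges ?J x)" by (simp add: L_def)
      then show ?thesis using nR g by (simp add: indicator_def)
    qed
    have ib: "integrable P (\<lambda>x. real n * indicator {x\<in>space P. \<not> good x} x)"
      using mb by (intro integrable_mult_right) (simp add: less_top[symmetric])
    have "mean_edges n - (1 - pR) * mean_edges (n - 1) - n * measure P {x\<in>space P. \<not> good x}
        = P.expectation (\<lambda>x. L x - ?f x - real n * indicator {x\<in>space P. \<not> good x} x)"
      using L_integrable int ib mb by (simp add: L_expectation remove_expectation[OF i])
    also have "\<dots> \<le> P.expectation (\<lambda>x. L x * indicator R (x i))"
      using L_integrable int ib iLR[OF i] pt by (intro integral_mono) auto
    finally show ?thesis using mult_left_mono[OF bad, of "real n"] by simp
  qed
  have "P.expectation (\<lambda>x. L x * T x) = (\<Sum>i<n. P.expectation (\<lambda>x. L x * indicator R (x i)))"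
    unfolding T_def sum_distrib_left by (rule Bochner_Integration.integral_sum) (use iLR in auto)
  also have "\<dots> \<ge> (\<Sum>i<n. mean_edges n - (1 - pR) * mean_edges (n - 1) - n * \<eta>)"
    by (intro sum_mono step) auto
  finally have "n * (mean_edges n - (1 - pR) * mean_edges (n - 1) - n * \<eta>) \<le> P.expectation (\<lambda>x. L x * T x)" by simp
  \<comment> \<open>Subtracting the product of the means, n * pR * \<open>mean_edges n\<close>,
    leaves the increment of the mean with the factor 1 - pR.\<close>
  then show ?thesis unfolding ET L_expectation by (simp add: algebra_simps)
qed

text \<open>Cauchy-Schwarz for L and T, obtained from the nonnegative expectation of the square of v
  * (L - E L) - C * (T - E T), where v bounds the variance of T and C is the covariance.\<close>

lemma variance_lower:
  fixes \<eta> :: real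
  assumes bad: "measure P {x\<in>space P. \<not> good x} \<le> \<eta>"
    and v: "0 < v" "n * (m * \<rho>) \<le> v" and m\<rho>: "m * \<rho> \<le> 1"
    and \<Delta>: "0 \<le> \<Delta>" "\<Delta> \<le> mean_edges n - mean_edges (n - 1)"
    and c: "c0 = n * ((1 - m * \<rho>) * \<Delta> - n * \<eta>)" "0 \<le> c0"
  shows "c0\<^sup>2 / v \<le> P.variance L"
proof -
  define C where "C = P.expectation (\<lambda>x. L x * T x) - P.expectation L * P.expectation T"
  have "(1 - m * \<rho>) * \<Delta> \<le> (1 - pR) * (mean_edges n - mean_edges (n - 1))"
    using pR_le m\<rho> \<Delta> by (intro mult_mono) auto
  then have "c0 \<le> n * ((1 - pR) * (mean_edges n - mean_edges (n - 1)) - n * \<eta>)"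
    unfolding c by (intro mult_left_mono) auto
  also have "\<dots> \<le> C" unfolding C_def by (rule covariance_LT[OF bad])
  finally have cC: "c0 \<le> C" .
  have Tb: "\<bar>T x\<bar> \<le> n" for x
  proof -
    have "\<bar>T x\<bar> \<le> (\<Sum>i<n. \<bar>indicator R (x i)\<bar>)" unfolding T_def by (rule sum_abs)
    also have "\<dots> \<le> (\<Sum>i<n. 1)" by (intro sum_mono) (auto simp: indicator_def)
    finally show ?thesis by simp
  qed
  let ?l = "\<lambda>x. L x - P.expectation L" and ?t = "\<lambda>x. T x - P.expectation T"
  have iT: "integrable P T" by (rule P.integrable_const_bound[where B=n]) (use Tb in auto)
  have iT2: "integrable P (\<lambda>x. (T x)\<^sup>2)"
    by (rule P.integrable_const_bound[where B="(real n)\<^sup>2"]) (use abs_le_square_bound[OF Tb] in auto)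
  have iLT: "integrable P (\<lambda>x. L x * T x)"
  proof (rule P.integrable_const_bound[where B="real n * real n"])
    have "\<bar>L x * T x\<bar> \<le> real n * real n" for x
      unfolding abs_mult using L_range[of x] Tb[of x] by (intro mult_mono) auto
    then show "AE x in P. norm (L x * T x) \<le> real n * real n" by simp
  qed simp
  have il2: "integrable P (\<lambda>x. (?l x)\<^sup>2)" unfolding power2_diff using L_integrable L2_integrable by simp
  have it2: "integrable P (\<lambda>x. (?t x)\<^sup>2)" unfolding power2_diff using iT iT2 by simp
  have ilt: "integrable P (\<lambda>x. ?l x * ?t x)" 
    using iLT iT L_integrable by (simp add: left_diff_distrib right_diff_distrib)
  have Clt: "P.expectation (\<lambda>x. ?l x * ?t x) = C"
    unfolding C_def using iLT iT L_integrable
    by (simp add: left_diff_distrib right_diff_distrib P.prob_space)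
  have "0 \<le> P.expectation (\<lambda>x. (v * ?l x - C * ?t x)\<^sup>2)" by (intro integral_nonneg_AE) simp
  also have "(\<lambda>x. (v * ?l x - C * ?t x)\<^sup>2) = (\<lambda>x. v\<^sup>2 * (?l x)\<^sup>2 - 2 * v * C * (?l x * ?t x) + C\<^sup>2 * (?t x)\<^sup>2)"
    by (simp add: power2_eq_square algebra_simps)
  also have "P.expectation \<dots> = v\<^sup>2 * P.variance L - 2 * v * C * C + C\<^sup>2 * P.variance T"
    using il2 it2 ilt Clt by simp
  also have "\<dots> \<le> v\<^sup>2 * P.variance L - 2 * v * C * C + C\<^sup>2 * v"
  proof -
    have "P.variance T \<le> v" using varT pR_le v(2) mult_left_mono[of pR "m * \<rho>" "real n"] by simp
    then show ?thesis by (simp add: mult_left_mono)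
  qed
  also have "\<dots> = v * (v * P.variance L - C\<^sup>2)" by (simp add: power2_eq_square algebra_simps)
  finally have "C\<^sup>2 \<le> v * P.variance L" using v(1) by (simp add: zero_le_mult_iff)
  moreover have "c0\<^sup>2 \<le> C\<^sup>2" using cC c(2) by (intro power_mono) auto
  ultimately show ?thesis using v(1) by (simp add: field_simps)
qed

end

text \<open>\<open>iexp\<close> is 1-Lipschitz. The difference of the standardised variables
  consists of the differences of X and Y and of their means, divided by sqrt V, and of a change of
  scale, which costs at most |V - v| / V because E |Y - E Y| \<le> sqrt v.\<close>

lemma (in prob_space) char_standardised_diff:
  assumes X[measurable]: "X \<in> borel_measurable M" and bX: "\<And>x. \<bar>X x\<bar> \<le> (K :: real)"
    and Y[measurable]: "Y \<in> borel_measurable M" and bY: "\<And>x. \<bar>Y x\<bar> \<le> (K' :: real)"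
    and V: "0 < V" and v: "0 < v" "v = expectation (\<lambda>x. (Y x - expectation Y)\<^sup>2)"
    and e: "expectation (\<lambda>x. \<bar>X x - Y x\<bar>) \<le> e"
  shows "norm (expectation (\<lambda>x. iexp (t * ((X x - expectation X) / sqrt V))) - expectation (\<lambda>x. iexp (t / sqrt v * (Y x - expectation Y))))
     \<le> \<bar>t\<bar> * (2 * e / sqrt V + \<bar>V - v\<bar> / V)"
proof -
  let ?X = "\<lambda>x. X x - expectation X" and ?Y = "\<lambda>x. Y x - expectation Y"
  have iX: "integrable M X" by (rule integrable_const_bound[where B=K]) (use bX in auto)
  have iY: "integrable M Y" by (rule integrable_const_bound[where B=K']) (use bY in auto)
  have iD: "integrable M (\<lambda>x. \<bar>X x - Y x\<bar>)" using iX iY by auto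
  have iaY: "integrable M (\<lambda>x. \<bar>?Y x\<bar>)" using iY by auto
  have sV: "0 < sqrt V" and sv: "0 < sqrt v" using V v by auto
  have EY: "expectation (\<lambda>x. \<bar>?Y x\<bar>) \<le> sqrt v"
  proof (rule expectation_abs_le_sqrt[where K="K' + \<bar>expectation Y\<bar>"])
    fix x show "\<bar>?Y x\<bar> \<le> K' + \<bar>expectation Y\<bar>" using bY[of x] by linarith
  qed (use v in auto)
  have i1: "integrable M (\<lambda>x. iexp (t * (?X x / sqrt V)))" and i2: "integrable M (\<lambda>x. iexp (t / sqrt v * ?Y x))"
    by (rule integrable_const_bound[where B=1]; simp)+
  have pt: "norm (iexp (t * (?X x / sqrt V)) - iexp (t / sqrt v * ?Y x))
      \<le> \<bar>t\<bar> * ((\<bar>X x - Y x\<bar> + \<bar>expectation X - expectation Y\<bar>) / sqrt V + \<bar>?Y x\<bar> * \<bar>1 / sqrt V - 1 / sqrt v\<bar>)" for x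
  proof -
    have "norm (iexp (t * (?X x / sqrt V)) - iexp (t / sqrt v * ?Y x)) \<le> \<bar>t * (?X x / sqrt V) - t / sqrt v * ?Y x\<bar>"
      by (rule norm_iexp_diff_le)
    also have "t * (?X x / sqrt V) - t / sqrt v * ?Y x = t * (((X x - Y x) - (expectation X - expectation Y)) / sqrt V + ?Y x * (1 / sqrt V - 1 / sqrt v))"
      using sV sv by (simp add: field_simps)
    also have "\<bar>\<dots>\<bar> = \<bar>t\<bar> * \<bar>((X x - Y x) - (expectation X - expectation Y)) / sqrt V + ?Y x * (1 / sqrt V - 1 / sqrt v)\<bar>"
      by (rule abs_mult)
    also have "\<dots> \<le> \<bar>t\<bar> * (\<bar>((X x - Y x) - (expectation X - expectation Y)) / sqrt V\<bar> + \<bar>?Y x * (1 / sqrt V - 1 / sqrt v)\<bar>)"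
      by (intro mult_left_mono abs_triangle_ineq) auto
    also have "\<dots> \<le> \<bar>t\<bar> * ((\<bar>X x - Y x\<bar> + \<bar>expectation X - expectation Y\<bar>) / sqrt V + \<bar>?Y x\<bar> * \<bar>1 / sqrt V - 1 / sqrt v\<bar>)"
    proof (intro mult_left_mono add_mono)
      show "\<bar>((X x - Y x) - (expectation X - expectation Y)) / sqrt V\<bar> \<le> (\<bar>X x - Y x\<bar> + \<bar>expectation X - expectation Y\<bar>) / sqrt V"
        unfolding abs_divide using sV by (simp add: divide_right_mono abs_triangle_ineq4)
    qed (auto simp: abs_mult)
    finally show ?thesis .
  qed
  have dE: "\<bar>expectation X - expectation Y\<bar> \<le> e"
  proof -
    have "\<bar>expectation X - expectation Y\<bar> = \<bar>expectation (\<lambda>x. X x - Y x)\<bar>" using iX iY by simp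
    also have "\<dots> \<le> expectation (\<lambda>x. \<bar>X x - Y x\<bar>)" by (rule integral_abs_bound)
    finally show ?thesis using e by linarith
  qed
  have "norm (expectation (\<lambda>x. iexp (t * (?X x / sqrt V))) - expectation (\<lambda>x. iexp (t / sqrt v * ?Y x)))
      = norm (expectation (\<lambda>x. iexp (t * (?X x / sqrt V)) - iexp (t / sqrt v * ?Y x)))"
    by (subst Bochner_Integration.integral_diff[OF i1 i2]) simp
  also have "\<dots> \<le> expectation (\<lambda>x. \<bar>t\<bar> * ((\<bar>X x - Y x\<bar> + \<bar>expectation X - expectation Y\<bar>) / sqrt V + \<bar>?Y x\<bar> * \<bar>1 / sqrt V - 1 / sqrt v\<bar>))"
    by (rule norm_integral_le) (use i1 i2 iD iaY pt in auto)
  also have "\<dots> = \<bar>t\<bar> * ((expectation (\<lambda>x. \<bar>X x - Y x\<bar>) + \<bar>expectation X - expectation Y\<bar>) / sqrt V + expectation (\<lambda>x. \<bar>?Y x\<bar>) * \<bar>1 / sqrt V - 1 / sqrt v\<bar>)"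
    using iD iaY by (simp add: prob_space add_divide_distrib)
  also have "\<dots> \<le> \<bar>t\<bar> * ((e + e) / sqrt V + sqrt v * \<bar>1 / sqrt V - 1 / sqrt v\<bar>)"
    using e dE EY sV by (intro mult_left_mono add_mono divide_right_mono mult_right_mono) auto
  also have "sqrt v * \<bar>1 / sqrt V - 1 / sqrt v\<bar> \<le> \<bar>V - v\<bar> / V"
  proof -
    have "sqrt v * \<bar>1 / sqrt V - 1 / sqrt v\<bar> = \<bar>sqrt v * (1 / sqrt V - 1 / sqrt v)\<bar>" using sv by (simp add: abs_mult)
    also have "sqrt v * (1 / sqrt V - 1 / sqrt v) = (sqrt v - sqrt V) / sqrt V" using sV sv by (simp add: field_simps)
    also have "\<bar>\<dots>\<bar> = \<bar>sqrt v - sqrt V\<bar> * sqrt V / V"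
    proof -
      have "sqrt V / V = 1 / sqrt V" using V by (simp add: real_div_sqrt field_simps)
      then show ?thesis using sV by (simp only: abs_divide times_divide_eq_right[symmetric]) simp
    qed
    also have "\<dots> \<le> \<bar>sqrt v - sqrt V\<bar> * (sqrt v + sqrt V) / V"
      using sv V by (intro divide_right_mono mult_left_mono) auto
    also have "\<bar>sqrt v - sqrt V\<bar> * (sqrt v + sqrt V) = \<bar>(sqrt v - sqrt V) * (sqrt v + sqrt V)\<bar>"
      using sv sV by (simp add: abs_mult)
    also have "(sqrt v - sqrt V) * (sqrt v + sqrt V) = v - V" using v V by (simp add: algebra_simps)
    finally show ?thesis by (simp add: abs_minus_commute)
  qed
  finally show ?thesis by (simp add: mult_left_mono)
qed

text \<open>Eliminates the number M of arcs and the covariance error e from the bound, leaving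
  expressions that become explicit functions of n and the variance.\<close>

lemma char_error_mono:
  fixes M N e E1 E2 L v t :: real
  assumes "0 \<le> M" "M \<le> N" "M * e \<le> E1" "M\<^sup>2 * e \<le> E2" "0 \<le> L" "0 < v"
  shows "\<bar>t\<bar> * (2 * M * L * e / sqrt v + 3 / 2 * t\<^sup>2 * M * 17\<^sup>2 * L ^ 3 / sqrt v ^ 3
        + \<bar>t\<bar> * (sqrt (2 * M * 49 * (17 * L\<^sup>2)\<^sup>2 + M\<^sup>2 * (17 * L\<^sup>2)\<^sup>2 * e) + M\<^sup>2 * L\<^sup>2 * e) / (sqrt v)\<^sup>2)
     \<le> \<bar>t\<bar> * (2 * L * E1 / sqrt v + 3 / 2 * t\<^sup>2 * 289 * (N * L ^ 3) / sqrt v ^ 3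
        + \<bar>t\<bar> * (sqrt (98 * N * (17 * L\<^sup>2)\<^sup>2 + (17 * L\<^sup>2)\<^sup>2 * E2) + L\<^sup>2 * E2) / v)"
proof -
  have 1: "2 * M * L * e \<le> 2 * L * E1"
    using mult_left_mono[OF assms(3), of "2 * L"] assms(5) by (simp add: mult_ac)
  have 2: "3 / 2 * t\<^sup>2 * M * 17\<^sup>2 * L ^ 3 \<le> 3 / 2 * t\<^sup>2 * 289 * (N * L ^ 3)"
  proof -
    have "3 / 2 * t\<^sup>2 * 289 * (M * L ^ 3) \<le> 3 / 2 * t\<^sup>2 * 289 * (N * L ^ 3)"
      using assms by (intro mult_left_mono mult_right_mono) auto
    then show ?thesis by (simp add: mult_ac)
  qed
  have 3: "2 * M * 49 * (17 * L\<^sup>2)\<^sup>2 \<le> 98 * N * (17 * L\<^sup>2)\<^sup>2"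
    using assms by (intro mult_right_mono) auto
  have 4: "M\<^sup>2 * k * e \<le> k * E2" if "0 \<le> k" for k
    using mult_left_mono[OF assms(4) that] by (simp add: mult_ac)
  have 5: "(sqrt v)\<^sup>2 = v" using assms(6) by simp
  have 6: "sqrt (2 * M * 49 * (17 * L\<^sup>2)\<^sup>2 + M\<^sup>2 * (17 * L\<^sup>2)\<^sup>2 * e) \<le> sqrt (98 * N * (17 * L\<^sup>2)\<^sup>2 + (17 * L\<^sup>2)\<^sup>2 * E2)"
    by (rule real_sqrt_le_mono, rule add_mono[OF 3 4]) simp
  have 7: "(sqrt (2 * M * 49 * (17 * L\<^sup>2)\<^sup>2 + M\<^sup>2 * (17 * L\<^sup>2)\<^sup>2 * e) + M\<^sup>2 * L\<^sup>2 * e) / v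
      \<le> (sqrt (98 * N * (17 * L\<^sup>2)\<^sup>2 + (17 * L\<^sup>2)\<^sup>2 * E2) + L\<^sup>2 * E2) / v"
    by (rule divide_right_mono, rule add_mono[OF 6 4]) (use assms(6) in auto)
  have 8: "\<bar>t\<bar> * a / v \<le> \<bar>t\<bar> * b / v" if "a / v \<le> b / v" for a b :: real
    using mult_left_mono[OF that, of "\<bar>t\<bar>"] by simp
  have v0: "0 \<le> sqrt v" "0 \<le> sqrt v ^ 3" using assms(6) by simp_all
  show ?thesis
    unfolding 5
    by (rule mult_left_mono[OF add_mono[OF add_mono[OF divide_right_mono[OF 1 v0(1)] divide_right_mono[OF 2 v0(2)]] 8[OF 7]]]) simp
qed

section \<open>Asymptotics as the sample grows\<close>

context planar_beta
begin

definition sample_law :: "nat \<Rightarrow> (nat \<Rightarrow> real \<times> real) measure" where "sample_law n = Pi\<^sub>M {..<n} (\<lambda>_. \<nu>)"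
definition edge_count :: "nat \<Rightarrow> (nat \<Rightarrow> real \<times> real) \<Rightarrow> real" where "edge_count n x = real (upper_edges {..<n} x)"
definition mean_count :: "nat \<Rightarrow> real" where "mean_count n = (\<integral>x. edge_count n x \<partial>sample_law n)"
definition var_count :: "nat \<Rightarrow> real" where "var_count n = (\<integral>x. (edge_count n x - mean_count n)\<^sup>2 \<partial>sample_law n)"

definition growth_exp :: real where "growth_exp = 1 / (real d - 1)"

text \<open>The bound \<open>3 * growth_exp \<le> 1\<close> is exactly d \<ge> 4; it keeps the
  covariance error summed over all pairs of arcs logarithmic.\<close>

lemma growth_exp_range: "0 < growth_exp" "3 * growth_exp \<le> 1" "growth_exp < 1" and growth_exp_tail_exp: "growth_exp * (2 * tail_exp) = 1" "2 * tail_exp = 1 / growth_exp"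
  using d4 by (auto simp: growth_exp_def tail_exp_def field_simps)

lemma mean_count_eq: "mean_count n = mean_edges n"
  unfolding mean_count_def edge_count_def sample_law_def mean_edges_def using upper_edges_expectation[of "{..<n}"] by simp

theorem mean_count_asymp: "\<exists>c>0. (\<lambda>n. mean_count n / real n powr growth_exp) \<longlonglongrightarrow> c"
  unfolding mean_count_eq growth_exp_def by (rule mean_edges_asymp)

text \<open>The number \<open>m\<close> of arcs is chosen such that every cell contains at least \<open>10 ln n\<close> points on average.\<close>

lemma arc_parameters:
  obtains A C1 :: real where "A \<ge> 1" "C1 > 0"
    "\<forall>\<^sub>F n in sequentially. let m = nat \<lfloor>(real n / (A * ln (real n))) powr growth_exp\<rfloor> in
       4 \<le> m \<and> real m \<le> real n powr growth_exp * ln (real n) powr (- growth_exp)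
       \<and> (\<forall>k. measure \<nu> (region m k) \<le> C1 * ln (real n) / real n)
       \<and> (\<forall>k. 10 * ln (real n) / real n \<le> measure \<nu> (cell m k))"
proof -
  \<comment> \<open>A is so large that the lower bound for caps of depth w^2 / 8, with w = pi / m at
    least pi / x, yields 10 * ln n / n. That A is at least 1 gives the stated bound for m.\<close>
  define A where "A = max 1 (10 / (lower_const * 8 powr (- tail_exp) * pi powr (2 * tail_exp)))"
  define C1 where "C1 = upper_const * 2 powr tail_exp * (2 * pi) powr (2 * tail_exp) * A"
  have A1: "A \<ge> 1" by (simp add: A_def)
  have A2: "10 \<le> lower_const * 8 powr (- tail_exp) * pi powr (2 * tail_exp) * A"
  proof -
    have "10 / (lower_const * 8 powr (- tail_exp) * pi powr (2 * tail_exp)) \<le> A" by (simp add: A_def)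
    then show ?thesis using lower_const_pos by (simp add: field_simps)
  qed
  have C1: "C1 > 0" using upper_const_pos A1 by (simp add: C1_def)
  have "\<forall>\<^sub>F n in sequentially. 8 \<le> (real n / (A * ln (real n))) powr growth_exp"
  proof -
    have "filterlim (\<lambda>n. (real n / (A * ln (real n))) powr growth_exp) at_top sequentially"
      using growth_exp_range(1) A1 by real_asymp
    then show ?thesis by (auto simp: filterlim_at_top)
  qed
  moreover have "\<forall>\<^sub>F n in sequentially. 1 \<le> ln (real n)" by real_asymp
  ultimately have "\<forall>\<^sub>F n in sequentially. let m = nat \<lfloor>(real n / (A * ln (real n))) powr growth_exp\<rfloor> in
       4 \<le> m \<and> real m \<le> real n powr growth_exp * ln (real n) powr (- growth_exp)
       \<and> (\<forall>k. measure \<nu> (region m k) \<le> C1 * ln (real n) / real n)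
       \<and> (\<forall>k. 10 * ln (real n) / real n \<le> measure \<nu> (cell m k))"
    using eventually_gt_at_top[of 0]
  proof eventually_elim
    case (elim n)
    define l where "l = ln (real n)"
    define x where "x = (real n / (A * l)) powr growth_exp"
    define m where "m = nat \<lfloor>x\<rfloor>"
    have l1: "1 \<le> l" using elim by (simp add: l_def)
    have n0: "0 < real n" using elim by simp
    have x8: "8 \<le> x" using elim by (simp add: x_def l_def)
    have m_x: "real m \<le> x" "x \<le> 2 * real m"
    proof -
      have "real m = of_int \<lfloor>x\<rfloor>" unfolding m_def using x8 by simp
      moreover have "x - 1 \<le> of_int \<lfloor>x\<rfloor>" "of_int \<lfloor>x\<rfloor> \<le> x" by linarith+
      ultimately show "real m \<le> x" "x \<le> 2 * real m" using x8 by linarith+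
    qed
    have m4: "4 \<le> m" using m_x x8 by linarith
    have xq: "x powr (2 * tail_exp) = real n / (A * l)"
      unfolding x_def powr_powr growth_exp_tail_exp(1) using n0 A1 l1 by simp
    define w where "w = pi / real m"
    have w0: "0 < w" "w \<le> 1" using m4 pi_less_4 by (auto simp: w_def field_simps)
    have w2: "w\<^sup>2 \<le> 1" using w0 by (simp add: power_le_one)
    have wq: "(w\<^sup>2) powr tail_exp = w powr (2 * tail_exp)"
      using w0 by (simp add: powr_powr[symmetric] powr_numeral)
    have wx: "pi / x \<le> w" "w \<le> 2 * pi / x"
      using m_x x8 m4 by (auto simp: w_def field_simps)
    have frac: "(a / x) powr (2 * tail_exp) = a powr (2 * tail_exp) * A * l / real n" if "a > 0" for a
      using that x8 n0 by (simp add: powr_divide xq)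
    have wl: "pi powr (2 * tail_exp) * A * l / real n \<le> w powr (2 * tail_exp)"
      unfolding frac[OF pi_gt_zero, symmetric] using wx(1) x8 tail_exp_pos by (intro powr_mono2) auto
    have wu: "w powr (2 * tail_exp) \<le> (2 * pi) powr (2 * tail_exp) * A * l / real n"
      unfolding frac[of "2 * pi", simplified, symmetric] using wx(2) w0 tail_exp_pos by (intro powr_mono2) auto
    have reg: "measure \<nu> (region m k) \<le> C1 * l / real n" for k
    proof -
      have "measure \<nu> (region m k) = tail (2 * w\<^sup>2)"
        unfolding region_def w_def by (rule measure_cap) simp
      also have "\<dots> \<le> upper_const * (2 * w\<^sup>2) powr tail_exp" using w2 by (intro tail_le) auto
      also have "(2 * w\<^sup>2) powr tail_exp = 2 powr tail_exp * w powr (2 * tail_exp)" by (simp add: powr_mult wq)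
      also have "upper_const * (2 powr tail_exp * w powr (2 * tail_exp)) \<le> upper_const * (2 powr tail_exp * ((2 * pi) powr (2 * tail_exp) * A * l / real n))"
        using wu upper_const_pos by (intro mult_left_mono) auto
      finally show ?thesis by (simp add: C1_def mult_ac)
    qed
    have cel: "10 * l / real n \<le> measure \<nu> (cell m k)" for k
    proof -
      have "10 * l / real n \<le> (lower_const * 8 powr (- tail_exp) * pi powr (2 * tail_exp) * A) * (l / real n)"
        using mult_right_mono[OF A2, of "l / real n"] l1 n0 by simp
      also have "\<dots> = lower_const * 8 powr (- tail_exp) * (pi powr (2 * tail_exp) * A * l / real n)" by simp
      also have "\<dots> \<le> lower_const * 8 powr (- tail_exp) * w powr (2 * tail_exp)"
        using wl lower_const_pos by (intro mult_left_mono) auto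
      also have "\<dots> = lower_const * (w\<^sup>2 / 8) powr tail_exp" by (simp add: powr_divide wq powr_minus field_simps)
      also have "\<dots> \<le> tail (w\<^sup>2 / 8)" using w2 by (intro tail_ge) auto
      also have "\<dots> = measure \<nu> (cell m k)"
        unfolding cell_def w_def by (rule measure_cap[symmetric]) simp
      finally show ?thesis .
    qed
    have "x \<le> (real n / l) powr growth_exp"
      unfolding x_def using A1 l1 n0 growth_exp_range mult_right_mono[of 1 A l] by (intro powr_mono2 divide_left_mono) auto
    also have "\<dots> = real n powr growth_exp * l powr (- growth_exp)" using l1 by (simp add: powr_divide powr_minus field_simps)
    finally have mk: "real m \<le> real n powr growth_exp * l powr (- growth_exp)" using m_x by linarith
    show ?case using m4 mk reg cel unfolding m_def x_def l_def Let_def by auto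
  qed
  then show ?thesis using that A1 C1 by blast
qed

lemma sample_facts:
  obtains m :: "nat \<Rightarrow> nat" and C1 C2 :: real where "C1 > 0" "C2 > 0"
    "\<forall>\<^sub>F n in sequentially. edge_sample \<nu> d c n (m n) (C1 * ln (real n) / real n) (C2 * ln (real n))"
    "\<forall>\<^sub>F n in sequentially. real (m n) \<le> real n powr growth_exp * ln (real n) powr (- growth_exp)"
    "\<forall>\<^sub>F n in sequentially. measure (sample_law n) {x\<in>space (sample_law n). \<not> edge_sample.good n (m n) (C2 * ln (real n)) x} \<le> 2 * real n * real n powr (- 10)"
proof -
  obtain A C1 where AC: "A \<ge> 1" "C1 > 0" and
    ev: "\<forall>\<^sub>F n in sequentially. let m = nat \<lfloor>(real n / (A * ln (real n))) powr growth_exp\<rfloor> in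
       4 \<le> m \<and> real m \<le> real n powr growth_exp * ln (real n) powr (- growth_exp)
       \<and> (\<forall>k. measure \<nu> (region m k) \<le> C1 * ln (real n) / real n)
       \<and> (\<forall>k. 10 * ln (real n) / real n \<le> measure \<nu> (cell m k))"
    by (rule arc_parameters)
  define m where "m n = nat \<lfloor>(real n / (A * ln (real n))) powr growth_exp\<rfloor>" for n
  \<comment> \<open>The solution of exp (n * \<rho>) * 2 powr (- B) = n powr (- 10) with n * \<rho>
    = C1 * ln n and B = C2 * ln n.\<close>
  define C2 where "C2 = (C1 + 10) / ln 2"
  have C2: "C2 > 0" using AC by (simp add: C2_def)
  note ev' = ev[unfolded m_def[symmetric] Let_def]
  have l1: "\<forall>\<^sub>F n in sequentially. 1 \<le> ln (real n)" by real_asymp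
  have es: "\<forall>\<^sub>F n in sequentially. edge_sample \<nu> d c n (m n) (C1 * ln (real n) / real n) (C2 * ln (real n))"
    using ev' l1 eventually_gt_at_top[of 0]
  proof eventually_elim
    case (elim n)
    show ?case by unfold_locales (use elim C2 in auto)
  qed
  have mk: "\<forall>\<^sub>F n in sequentially. real (m n) \<le> real n powr growth_exp * ln (real n) powr (- growth_exp)"
    using ev' by eventually_elim auto
  have bad: "\<forall>\<^sub>F n in sequentially. measure (sample_law n) {x\<in>space (sample_law n). \<not> edge_sample.good n (m n) (C2 * ln (real n)) x} \<le> 2 * real n * real n powr (- 10)"
    using es ev' mk l1 eventually_gt_at_top[of 0]
  proof eventually_elim
    case (elim n)
    interpret ES: edge_sample \<nu> d c n "m n" "C1 * ln (real n) / real n" "C2 * ln (real n)" by (rule elim(1))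
    have n0: "0 < real n" using elim by simp
    have pc: "10 * ln (real n) / real n \<le> measure \<nu> (cell (m n) k)" for k using elim by auto
    have "measure (sample_law n) {x\<in>space (sample_law n). \<not> ES.good x}
        \<le> m n * exp (- real n * (10 * ln (real n) / real n)) + m n * (exp (real n * (C1 * ln (real n) / real n)) * 2 powr (- (C2 * ln (real n))))"
      using ES.bad_prob[OF pc] by (simp add: sample_law_def ES.P_def)
    also have "exp (- real n * (10 * ln (real n) / real n)) = real n powr (- 10)"
      using n0 by (simp add: powr_def)
    also have "exp (real n * (C1 * ln (real n) / real n)) * 2 powr (- (C2 * ln (real n))) = real n powr (- 10)"
    proof -
      have C2l: "C2 * ln 2 = C1 + 10" by (simp add: C2_def)
      have "2 powr (- (C2 * ln (real n))) = exp (- (C2 * ln 2) * ln (real n))" unfolding powr_def by (simp add: mult_ac)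
      then have "2 powr (- (C2 * ln (real n))) = exp (- (C1 + 10) * ln (real n))" unfolding C2l .
      moreover have "exp (real n * (C1 * ln (real n) / real n)) = exp (C1 * ln (real n))" using n0 by simp
      ultimately have "exp (real n * (C1 * ln (real n) / real n)) * 2 powr (- (C2 * ln (real n))) = exp (C1 * ln (real n) + - (C1 + 10) * ln (real n))"
        by (simp only: exp_add)
      also have "C1 * ln (real n) + - (C1 + 10) * ln (real n) = - 10 * ln (real n)" by (simp add: algebra_simps)
      finally show ?thesis using n0 by (simp add: powr_def)
    qed
    also have "m n * real n powr (- 10) + m n * real n powr (- 10) = 2 * real (m n) * real n powr (- 10)" by simp
    also have "\<dots> \<le> 2 * real n * real n powr (- 10)"
    proof -
      have "ln (real n) powr (- growth_exp) \<le> 1" using elim growth_exp_range by (subst powr_minus) (auto intro!: inverse_le_1_iff[THEN iffD2] ge_one_powr_ge_zero)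
      then have "real (m n) \<le> real n powr growth_exp * 1" using elim(3) by (meson mult_left_mono order_trans powr_ge_zero)
      also have "\<dots> \<le> real n powr 1" using growth_exp_range elim by (simp only: mult_1_right) (intro powr_mono, auto)
      finally show ?thesis using n0 by (intro mult_right_mono) auto
    qed
    finally show ?case .
  qed
  show ?thesis by (rule that[OF AC(2) C2 es mk bad])
qed

text \<open>The locale \<open>edge_sample\<close> is instantiated separately for each n. Here its
  conclusions are restated for sequences: \<open>Wf\<close> is the sum of truncated local counts,
  \<open>EW\<close> and \<open>v\<close> are its mean and variance, and all bounds are explicit in
  n.\<close>

lemma fluctuation_facts:
  obtains a C2 q :: real and Wf :: "nat \<Rightarrow> (nat \<Rightarrow> real \<times> real) \<Rightarrow> real" and bW EW v :: "nat \<Rightarrow> real"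
  where "a > 0" "C2 > 0" "q > 0"
    "\<And>n. EW n = (\<integral>x. Wf n x \<partial>sample_law n)" "\<And>n. v n = (\<integral>x. (Wf n x - EW n)\<^sup>2 \<partial>sample_law n)"
    "\<forall>\<^sub>F n in sequentially. \<bar>var_count n - v n\<bar> \<le> 1 / real n"
    "\<forall>\<^sub>F n in sequentially. v n \<le> 17 * (real n powr growth_exp * ln (real n) powr (- growth_exp)) * (C2 * ln (real n))\<^sup>2 + (C2 * ln (real n))\<^sup>2 * (q * ln (real n) ^ 2)"
    "\<forall>\<^sub>F n in sequentially. a * (real n powr growth_exp / ln (real n)) \<le> var_count n"
    "\<forall>\<^sub>F n in sequentially. Wf n \<in> borel_measurable (sample_law n) \<and> (\<forall>x. \<bar>Wf n x\<bar> \<le> bW n)"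
    "\<forall>\<^sub>F n in sequentially. (\<integral>x. \<bar>edge_count n x - Wf n x\<bar> \<partial>sample_law n) \<le> 1 / real n"
    "\<forall>\<^sub>F n in sequentially. \<forall>t. 0 < v n \<longrightarrow> norm ((\<integral>x. iexp (t / sqrt (v n) * (Wf n x - EW n)) \<partial>sample_law n) - of_real (exp (- t\<^sup>2 / 2))) \<le>
         \<bar>t\<bar> * (2 * (C2 * ln (real n)) * (q * ln (real n) ^ 2 * real n powr (-growth_exp)) / sqrt (v n)
           + 3 / 2 * t\<^sup>2 * 289 * (real n powr growth_exp * (C2 * ln (real n)) ^ 3) / sqrt (v n) ^ 3
           + \<bar>t\<bar> * (sqrt (98 * real n powr growth_exp * (17 * (C2 * ln (real n))\<^sup>2)\<^sup>2 + (17 * (C2 * ln (real n))\<^sup>2)\<^sup>2 * (q * ln (real n) ^ 2))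
              + (C2 * ln (real n))\<^sup>2 * (q * ln (real n) ^ 2)) / v n)"
proof -
  obtain m :: "nat \<Rightarrow> nat" and C1 C2 :: real where C1: "C1 > 0" and C2: "C2 > 0"
    and es: "\<forall>\<^sub>F n in sequentially. edge_sample \<nu> d c n (m n) (C1 * ln (real n) / real n) (C2 * ln (real n))"
    and mk: "\<forall>\<^sub>F n in sequentially. real (m n) \<le> real n powr growth_exp * ln (real n) powr (- growth_exp)"
    and bad: "\<forall>\<^sub>F n in sequentially. measure (sample_law n) {x\<in>space (sample_law n). \<not> edge_sample.good n (m n) (C2 * ln (real n)) x} \<le> 2 * real n * real n powr (- 10)"
    by (rule sample_facts)
  obtain \<delta> where \<delta>: "\<delta> > 0" and inc: "\<forall>\<^sub>F n in sequentially. \<delta> * real n powr (growth_exp - 1) \<le> mean_edges (n + 1) - mean_edges n"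
    using mean_edges_increment unfolding growth_exp_def by auto
  have inc': "\<forall>\<^sub>F n in sequentially. \<delta> * real n powr (growth_exp - 1) \<le> mean_edges n - mean_edges (n - 1)"
  proof -
    have "\<forall>\<^sub>F n in sequentially. \<delta> * real (n - 1) powr (growth_exp - 1) \<le> mean_edges (n - 1 + 1) - mean_edges (n - 1)"
      using inc filterlim_minus_const_nat_at_top[of 1] by (rule eventually_compose_filterlim)
    then show ?thesis
      using eventually_gt_at_top[of 1]
    proof eventually_elim
      case (elim n)
      have "real n powr (growth_exp - 1) \<le> real (n - 1) powr (growth_exp - 1)"
        using elim growth_exp_range by (intro powr_mono2') auto
      then have "\<delta> * real n powr (growth_exp - 1) \<le> \<delta> * real (n - 1) powr (growth_exp - 1)" using \<delta> by simp
      also have "\<dots> \<le> mean_edges n - mean_edges (n - 1)" using elim by simp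
      finally show ?case .
    qed
  qed
  have kk0: "0 < growth_exp" by (rule growth_exp_range)
  have l1: "\<forall>\<^sub>F n in sequentially. 1 \<le> ln (real n)" by real_asymp
  \<comment> \<open>The reason for the power 10: the edge counts and their approximations are at
    most n + n * B with B = C2 * ln n, so a bad event of probability 2 * n powr (- 9) changes even
    second moments by at most 1 / n.\<close>
  have small: "\<forall>\<^sub>F n in sequentially. 2 * (real n + real n * (C2 * ln (real n)))\<^sup>2 * (2 * real n * real n powr (-10)) \<le> 1 / real n"
    using C2 by real_asymp
  have mr: "\<forall>\<^sub>F n in sequentially. real n powr growth_exp * (C1 * ln (real n) / real n) \<le> 1 / 2"
    using C1 kk0 growth_exp_range(3) by real_asymp
  have tiny: "\<forall>\<^sub>F n in sequentially. real n * (2 * real n * real n powr (- 10)) \<le> \<delta> / 4 * real n powr (growth_exp - 1)"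
    using \<delta> kk0 by real_asymp
  define q where "q = 1156 * C1\<^sup>2"
  have q: "q > 0" using C1 by (simp add: q_def)
  define Wf where "Wf n = edge_sample.W n (m n) (C2 * ln (real n))" for n
  define EW where "EW n = (\<integral>x. Wf n x \<partial>sample_law n)" for n
  define v where "v n = (\<integral>x. (Wf n x - EW n)\<^sup>2 \<partial>sample_law n)" for n
  have facts: "\<forall>\<^sub>F n in sequentially. (\<bar>var_count n - v n\<bar> \<le> 1 / real n
      \<and> v n \<le> 17 * (real n powr growth_exp * ln (real n) powr (- growth_exp)) * (C2 * ln (real n))\<^sup>2 + (C2 * ln (real n))\<^sup>2 * (q * ln (real n) ^ 2)
      \<and> \<delta>\<^sup>2 / (16 * C1) * (real n powr growth_exp / ln (real n)) \<le> var_count n)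
      \<and> (Wf n \<in> borel_measurable (sample_law n) \<and> (\<forall>x. \<bar>Wf n x\<bar> \<le> m n * (C2 * ln (real n)))
      \<and> (\<integral>x. \<bar>edge_count n x - Wf n x\<bar> \<partial>sample_law n) \<le> 1 / real n)
      \<and> (\<forall>t. 0 < v n \<longrightarrow> norm ((\<integral>x. iexp (t / sqrt (v n) * (Wf n x - EW n)) \<partial>sample_law n) - of_real (exp (- t\<^sup>2 / 2))) \<le>
         \<bar>t\<bar> * (2 * (C2 * ln (real n)) * (q * ln (real n) ^ 2 * real n powr (-growth_exp)) / sqrt (v n)
           + 3 / 2 * t\<^sup>2 * 289 * (real n powr growth_exp * (C2 * ln (real n)) ^ 3) / sqrt (v n) ^ 3
           + \<bar>t\<bar> * (sqrt (98 * real n powr growth_exp * (17 * (C2 * ln (real n))\<^sup>2)\<^sup>2 + (17 * (C2 * ln (real n))\<^sup>2)\<^sup>2 * (q * ln (real n) ^ 2))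
              + (C2 * ln (real n))\<^sup>2 * (q * ln (real n) ^ 2)) / v n))"
    using es mk bad inc' l1 small mr tiny eventually_gt_at_top[of 0]
  proof eventually_elim
    case (elim n)
    define l where "l = ln (real n)"
    define N where "N = real n powr growth_exp"
    define M where "M = real (m n)"
    interpret ES: edge_sample \<nu> d c n "m n" "C1 * ln (real n) / real n" "C2 * ln (real n)" by (rule elim(1))
    have PPn: "sample_law n = ES.P" by (simp add: sample_law_def ES.P_def)
    have LLn: "edge_count n = ES.L" by (auto simp: edge_count_def ES.L_def)
    have VLn: "var_count n = ES.P.variance ES.L" by (simp add: var_count_def mean_count_def PPn LLn)
    have n0: "0 < real n" and n1: "1 \<le> real n" using elim by auto
    have l1: "1 \<le> l" using elim by (simp add: l_def)
    have lk: "l powr (- growth_exp) \<le> 1" "0 < l powr (- growth_exp)"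
      using l1 kk0 by (auto simp: powr_minus inverse_le_1_iff ge_one_powr_ge_zero)
    have MN: "M \<le> N * l powr (- growth_exp)" using elim by (simp add: M_def N_def l_def)
    have N0: "0 < N" using n0 by (simp add: N_def)
    have MN1: "M \<le> N" using MN lk N0 mult_left_mono[of "l powr (- growth_exp)" 1 N] by linarith
    have Nn: "N \<le> real n" unfolding N_def using powr_mono[of growth_exp 1 "real n"] growth_exp_range n1 by simp
    have M0: "0 \<le> M" by (simp add: M_def)
    define \<eta> where "\<eta> = 2 * real n * real n powr (- 10)"
    have eta0: "0 \<le> \<eta>" by (simp add: \<eta>_def)
    have bad: "measure ES.P {x\<in>space ES.P. \<not> ES.good x} \<le> \<eta>" using elim(3) by (simp add: \<eta>_def PPn)
    have K: "real n + M * (C2 * l) \<le> real n + real n * (C2 * l)"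
      using MN1 Nn C2 l1 by (intro add_left_mono mult_right_mono) auto
    have K0: "0 \<le> real n + M * (C2 * l)" using M0 C2 l1 by simp
    have Ksq: "2 * (real n + M * (C2 * l))\<^sup>2 * \<eta> \<le> 1 / real n"
    proof -
      have "2 * (real n + M * (C2 * l))\<^sup>2 * \<eta> \<le> 2 * (real n + real n * (C2 * l))\<^sup>2 * \<eta>"
        using K K0 eta0 by (intro mult_right_mono mult_left_mono power_mono) auto
      also have "\<dots> \<le> 1 / real n" using elim(6) by (simp add: \<eta>_def l_def)
      finally show ?thesis .
    qed
    have eps: "ES.eps = q * l\<^sup>2 * M / real n"
      unfolding ES.eps_def q_def l_def M_def using n0 by (simp add: power2_eq_square field_simps)
    \<comment> \<open>From N^3 \<le> n, which rests on \<open>3 * growth_exp \<le> 1\<close>, it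
      follows that M * \<open>eps\<close> is at most q * l^2 / N and M^2 * \<open>eps\<close> at
      most q * l^2.\<close>
    have N3: "N * N * N \<le> real n"
    proof -
      have "N * N * N = real n powr (3 * growth_exp)" unfolding N_def by (simp flip: powr_add)
      also have "\<dots> \<le> real n powr 1" using growth_exp_range n1 by (intro powr_mono) auto
      finally show ?thesis using n0 by simp
    qed
    have Neq: "real n powr (- growth_exp) = 1 / N" by (simp add: N_def powr_minus field_simps)
    have Meps: "M * ES.eps \<le> q * l\<^sup>2 * real n powr (- growth_exp)"
    proof -
      have "M * M \<le> N * N" using MN1 M0 by (intro mult_mono) auto
      then have "M * M / real n \<le> N * N / real n" using n0 by (simp add: divide_right_mono)
      also have "\<dots> \<le> 1 / N" using N3 N0 n0 by (simp add: field_simps)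
      finally have "q * l\<^sup>2 * (M * M / real n) \<le> q * l\<^sup>2 * (1 / N)" using q by (intro mult_left_mono) auto
      then show ?thesis unfolding eps Neq by (simp add: mult_ac)
    qed
    have MMeps: "M\<^sup>2 * ES.eps \<le> q * l\<^sup>2"
    proof -
      have "M * (M * ES.eps) \<le> N * (q * l\<^sup>2 * (1 / N))"
        by (rule mult_mono[OF MN1 Meps[unfolded Neq]]) (use N0 M0 ES.eps_nonneg in auto)
      then show ?thesis using N0 by (simp add: power2_eq_square mult.assoc)
    qed
    have WfW: "Wf n = ES.W" by (simp add: Wf_def)
    have EWn: "EW n = ES.P.expectation ES.W" by (simp add: EW_def WfW PPn)
    have vn: "v n = ES.P.variance ES.W" by (simp add: v_def EW_def WfW PPn)
    have C2l: "0 \<le> C2 * l" using C2 l1 by simp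
    have d1: "\<bar>var_count n - v n\<bar> \<le> 1 / real n"
      using ES.bad_bounds(2)[OF bad] Ksq unfolding VLn vn l_def M_def by linarith
    have d2: "v n \<le> 17 * (N * l powr (- growth_exp)) * (C2 * l)\<^sup>2 + (C2 * l)\<^sup>2 * (q * l ^ 2)"
    proof -
      have "v n \<le> 17 * M * (C2 * l)\<^sup>2 + (C2 * l)\<^sup>2 * (M\<^sup>2 * ES.eps)"
        using ES.variance_W_le by (simp add: vn M_def l_def mult_ac)
      also have "\<dots> \<le> 17 * (N * l powr (- growth_exp)) * (C2 * l)\<^sup>2 + (C2 * l)\<^sup>2 * (q * l ^ 2)"
        using MN MMeps by (intro add_mono mult_right_mono mult_left_mono) auto
      finally show ?thesis .
    qed
    \<comment> \<open>n times the increment of the mean is at least \<delta> * N, of which a quarter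
      survives the losses. The number of points in R has variance at most C1 * l * N. The quotient
      of the squared covariance and this variance is of order N / l.\<close>
    have d3: "\<delta>\<^sup>2 / (16 * C1) * (N / l) \<le> var_count n"
    proof -
      define \<Delta> where "\<Delta> = \<delta> * real n powr (growth_exp - 1)"
      define c0 where "c0 = real n * ((1 - real (m n) * (C1 * ln (real n) / real n)) * \<Delta> - real n * \<eta>)"
      have n\<Delta>: "real n * \<Delta> = \<delta> * N"
        using n0 by (simp add: \<Delta>_def N_def powr_diff)
      have mr: "M * (C1 * l / real n) \<le> 1 / 2"
      proof -
        have "M * (C1 * l / real n) \<le> N * (C1 * l / real n)" using MN1 C1 l1 n0 by (intro mult_right_mono) auto
        also have "\<dots> \<le> 1 / 2" using elim(7) by (simp add: N_def l_def)
        finally show ?thesis .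
      qed
      have \<Delta>0: "0 \<le> \<Delta>" using \<delta> by (simp add: \<Delta>_def)
      have ti: "real n * \<eta> \<le> \<Delta> / 4" using elim(8) by (simp add: \<eta>_def \<Delta>_def)
      have "1 / 2 * \<Delta> \<le> (1 - M * (C1 * l / real n)) * \<Delta>" using mr \<Delta>0 by (intro mult_right_mono) auto
      then have "\<Delta> / 4 \<le> (1 - M * (C1 * l / real n)) * \<Delta> - real n * \<eta>" using ti by linarith
      then have "real n * (\<Delta> / 4) \<le> c0" unfolding c0_def M_def l_def using n0 by (intro mult_left_mono) auto
      then have c0: "\<delta> * N / 4 \<le> c0" using n\<Delta> by simp
      have c00: "0 \<le> c0" using c0 \<delta> N0 by (smt (verit) divide_nonneg_nonneg mult_nonneg_nonneg)
      have "c0\<^sup>2 / (C1 * l * N) \<le> ES.P.variance ES.L"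
      proof (rule ES.variance_lower[OF bad])
        show "0 < C1 * l * N" using C1 l1 N0 by simp
        have "real n * (real (m n) * (C1 * ln (real n) / real n)) = C1 * l * M"
          using n0 by (simp add: M_def l_def)
        also have "\<dots> \<le> C1 * l * N" using MN1 C1 l1 by (intro mult_left_mono) auto
        finally show "real n * (real (m n) * (C1 * ln (real n) / real n)) \<le> C1 * l * N" .
        show "real (m n) * (C1 * ln (real n) / real n) \<le> 1" using mr unfolding M_def l_def by linarith
        show "\<Delta> \<le> mean_edges n - mean_edges (n - 1)" using elim(4) by (simp add: \<Delta>_def)
      qed (use \<Delta>0 c00 in \<open>auto simp: c0_def\<close>)
      moreover have "(\<delta> * N / 4)\<^sup>2 \<le> c0\<^sup>2" using c0 \<delta> N0 by (intro power_mono) auto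
      then have "(\<delta> * N / 4)\<^sup>2 / (C1 * l * N) \<le> c0\<^sup>2 / (C1 * l * N)" using C1 l1 N0 by (intro divide_right_mono) auto
      moreover have "(\<delta> * N / 4)\<^sup>2 / (C1 * l * N) = \<delta>\<^sup>2 / (16 * C1) * (N / l)"
        using C1 l1 N0 by (simp add: power2_eq_square field_simps)
      ultimately show ?thesis unfolding VLn by linarith
    qed
    have d4: "(\<integral>x. \<bar>edge_count n x - ES.W x\<bar> \<partial>sample_law n) \<le> 1 / real n"
    proof -
      have "(\<integral>x. \<bar>edge_count n x - ES.W x\<bar> \<partial>sample_law n) \<le> (real n + M * (C2 * l)) * \<eta>"
        using ES.bad_bounds(1)[OF bad] by (simp add: PPn LLn M_def l_def)
      also have "\<dots> \<le> 2 * (real n + M * (C2 * l))\<^sup>2 * \<eta>"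
      proof (rule mult_right_mono[OF _ eta0])
        have k1: "1 \<le> real n + M * (C2 * l)" using n1 M0 C2l by (simp add: add_increasing2)
        have "k \<le> 2 * k\<^sup>2" if "1 \<le> k" for k :: real
          using mult_left_mono[of 1 k k] that unfolding power2_eq_square by linarith
        from this[OF k1] show "real n + M * (C2 * l) \<le> 2 * (real n + M * (C2 * l))\<^sup>2" .
      qed
      finally show ?thesis using Ksq by linarith
    qed
    have d5: "norm ((\<integral>x. iexp (t / sqrt (v n) * (ES.W x - ES.P.expectation ES.W)) \<partial>sample_law n) - of_real (exp (- t\<^sup>2 / 2))) \<le>
         \<bar>t\<bar> * (2 * (C2 * l) * (q * l ^ 2 * real n powr (-growth_exp)) / sqrt (v n)
           + 3 / 2 * t\<^sup>2 * 289 * (N * (C2 * l) ^ 3) / sqrt (v n) ^ 3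
           + \<bar>t\<bar> * (sqrt (98 * N * (17 * (C2 * l)\<^sup>2)\<^sup>2 + (17 * (C2 * l)\<^sup>2)\<^sup>2 * (q * l ^ 2))
              + (C2 * l)\<^sup>2 * (q * l ^ 2)) / v n)" if vp: "0 < v n" for t
    proof -
      have 1: "norm ((\<integral>x. iexp (t / sqrt (v n) * (ES.W x - ES.P.expectation ES.W)) \<partial>sample_law n) - of_real (exp (- t\<^sup>2 / 2))) \<le>
        \<bar>t\<bar> * (2 * M * (C2 * l) * ES.eps / sqrt (v n) + 3 / 2 * t\<^sup>2 * M * 17\<^sup>2 * (C2 * l) ^ 3 / sqrt (v n) ^ 3
        + \<bar>t\<bar> * (sqrt (2 * M * 49 * (17 * (C2 * l)\<^sup>2)\<^sup>2 + M\<^sup>2 * (17 * (C2 * l)\<^sup>2)\<^sup>2 * ES.eps) + M\<^sup>2 * (C2 * l)\<^sup>2 * ES.eps) / (sqrt (v n))\<^sup>2)"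
        unfolding PPn M_def l_def vn using vp[unfolded vn] by (rule ES.char_W_bound)
      show ?thesis
        by (rule order_trans[OF 1 char_error_mono[OF M0 MN1 Meps MMeps C2l vp]])
    qed
    have d6: "\<forall>x. \<bar>ES.W x\<bar> \<le> M * (C2 * l)" using ES.W_bound by (simp add: M_def l_def)
    note e1 = d1[unfolded l_def N_def M_def] and e2 = d2[unfolded l_def N_def M_def]
      and e3 = d3[unfolded l_def N_def M_def] and e4 = d4[unfolded l_def N_def M_def]
      and e5 = d5[unfolded l_def N_def M_def] and e6 = d6[unfolded l_def N_def M_def]
    show ?case
      unfolding WfW EWn
    proof (rule conjI[OF conjI[OF e1 conjI[OF e2 e3]] conjI[OF conjI[OF _ conjI[OF e6 e4]]]])
      show "ES.W \<in> borel_measurable (sample_law n)" unfolding PPn by (rule ES.W_measurable)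
    qed (intro allI impI, rule e5)
  qed
  have a0: "\<delta>\<^sup>2 / (16 * C1) > 0" using \<delta> C1 by simp
  show thesis
  proof (rule that[OF a0 C2 q EW_def v_def, of "\<lambda>n. m n * (C2 * ln (real n))"])
    note f = facts[unfolded eventually_conj_iff]
    note g1 = conjunct1[OF f] and g2 = conjunct1[OF conjunct2[OF f]] and g3 = conjunct2[OF conjunct2[OF f]]
    show "\<forall>\<^sub>F n in sequentially. \<bar>var_count n - v n\<bar> \<le> 1 / real n" by (rule conjunct1[OF g1])
    show "\<forall>\<^sub>F n in sequentially. v n \<le> 17 * (real n powr growth_exp * ln (real n) powr (- growth_exp)) * (C2 * ln (real n))\<^sup>2 + (C2 * ln (real n))\<^sup>2 * (q * ln (real n) ^ 2)"
      by (rule conjunct1[OF conjunct2[OF g1]])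
    show "\<forall>\<^sub>F n in sequentially. \<delta>\<^sup>2 / (16 * C1) * (real n powr growth_exp / ln (real n)) \<le> var_count n"
      by (rule conjunct2[OF conjunct2[OF g1]])
    show "\<forall>\<^sub>F n in sequentially. Wf n \<in> borel_measurable (sample_law n) \<and> (\<forall>x. \<bar>Wf n x\<bar> \<le> m n * (C2 * ln (real n)))"
      unfolding eventually_conj_iff by (intro conjI conjunct1[OF g2] conjunct1[OF conjunct2[OF g2]])
    show "\<forall>\<^sub>F n in sequentially. (\<integral>x. \<bar>edge_count n x - Wf n x\<bar> \<partial>sample_law n) \<le> 1 / real n"
      by (rule conjunct2[OF conjunct2[OF g2]])
    show "\<forall>\<^sub>F n in sequentially. \<forall>t. 0 < v n \<longrightarrow> norm ((\<integral>x. iexp (t / sqrt (v n) * (Wf n x - EW n)) \<partial>sample_law n) - of_real (exp (- t\<^sup>2 / 2))) \<le>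
         \<bar>t\<bar> * (2 * (C2 * ln (real n)) * (q * ln (real n) ^ 2 * real n powr (-growth_exp)) / sqrt (v n)
           + 3 / 2 * t\<^sup>2 * 289 * (real n powr growth_exp * (C2 * ln (real n)) ^ 3) / sqrt (v n) ^ 3
           + \<bar>t\<bar> * (sqrt (98 * real n powr growth_exp * (17 * (C2 * ln (real n))\<^sup>2)\<^sup>2 + (17 * (C2 * ln (real n))\<^sup>2)\<^sup>2 * (q * ln (real n) ^ 2))
              + (C2 * ln (real n))\<^sup>2 * (q * ln (real n) ^ 2)) / v n)"
      by (rule g3)
  qed
qed

theorem fluctuation_estimates:
  shows "\<exists>c>0. \<forall>\<^sub>F n in sequentially. c * real n powr growth_exp / ln (real n) \<le> var_count n" (is ?A)
    and "\<exists>C>0. \<forall>\<^sub>F n in sequentially. var_count n \<le> C * ln (real n) powr (3 - growth_exp) * real n powr growth_exp" (is ?B)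
    and "\<And>t. (\<lambda>n. \<integral>x. iexp (t * ((edge_count n x - mean_count n) / sqrt (var_count n))) \<partial>sample_law n) \<longlonglongrightarrow> of_real (exp (- t\<^sup>2 / 2))"
proof -
  obtain a C2 q :: real and Wf :: "nat \<Rightarrow> (nat \<Rightarrow> real \<times> real) \<Rightarrow> real" and bW EW v :: "nat \<Rightarrow> real"
    where a: "a > 0" and C2: "C2 > 0" and q: "q > 0"
    and EW_def: "\<And>n. EW n = (\<integral>x. Wf n x \<partial>sample_law n)" and v_def: "\<And>n. v n = (\<integral>x. (Wf n x - EW n)\<^sup>2 \<partial>sample_law n)"
    and f1: "\<forall>\<^sub>F n in sequentially. \<bar>var_count n - v n\<bar> \<le> 1 / real n"
    and f2: "\<forall>\<^sub>F n in sequentially. v n \<le> 17 * (real n powr growth_exp * ln (real n) powr (- growth_exp)) * (C2 * ln (real n))\<^sup>2 + (C2 * ln (real n))\<^sup>2 * (q * ln (real n) ^ 2)"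
    and f3: "\<forall>\<^sub>F n in sequentially. a * (real n powr growth_exp / ln (real n)) \<le> var_count n"
    and f4: "\<forall>\<^sub>F n in sequentially. Wf n \<in> borel_measurable (sample_law n) \<and> (\<forall>x. \<bar>Wf n x\<bar> \<le> bW n)"
    and f5: "\<forall>\<^sub>F n in sequentially. (\<integral>x. \<bar>edge_count n x - Wf n x\<bar> \<partial>sample_law n) \<le> 1 / real n"
    and f6: "\<forall>\<^sub>F n in sequentially. \<forall>t. 0 < v n \<longrightarrow> norm ((\<integral>x. iexp (t / sqrt (v n) * (Wf n x - EW n)) \<partial>sample_law n) - of_real (exp (- t\<^sup>2 / 2))) \<le>
         \<bar>t\<bar> * (2 * (C2 * ln (real n)) * (q * ln (real n) ^ 2 * real n powr (-growth_exp)) / sqrt (v n)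
           + 3 / 2 * t\<^sup>2 * 289 * (real n powr growth_exp * (C2 * ln (real n)) ^ 3) / sqrt (v n) ^ 3
           + \<bar>t\<bar> * (sqrt (98 * real n powr growth_exp * (17 * (C2 * ln (real n))\<^sup>2)\<^sup>2 + (17 * (C2 * ln (real n))\<^sup>2)\<^sup>2 * (q * ln (real n) ^ 2))
              + (C2 * ln (real n))\<^sup>2 * (q * ln (real n) ^ 2)) / v n)"
    by (rule fluctuation_facts) blast
  have kk0: "0 < growth_exp" by (rule growth_exp_range)
  have l1: "\<forall>\<^sub>F n in sequentially. 1 \<le> ln (real n)" by real_asymp
  show lower: ?A
  proof (intro exI conjI)
    show "\<forall>\<^sub>F n in sequentially. a * real n powr growth_exp / ln (real n) \<le> var_count n"
      using f3 by (simp only: times_divide_eq_right)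
    show "a > 0" by (rule a)
  qed
  \<comment> \<open>Half the constant, so that \<open>v n\<close>, which differs from
    \<open>var_count n\<close> by at most 1 / n, has the lower bound cv * N / l too, N being n powr
    \<open>growth_exp\<close> and l = ln n.\<close>
  define cv where "cv = a / 2"
  have cv: "cv > 0" using a by (simp add: cv_def)
  have big: "\<forall>\<^sub>F n in sequentially. 1 / real n \<le> cv * (real n powr growth_exp / ln (real n))" using cv kk0 by real_asymp
  show ?B
  proof (intro exI conjI)
    \<comment> \<open>The left-hand side is of order ln n powr (2 - \<open>growth_exp\<close>) * n
      powr \<open>growth_exp\<close>. This is smaller than the right-hand side by a logarithm, so
      the constant 1 works eventually.\<close>
    have "\<forall>\<^sub>F n in sequentially. 17 * (real n powr growth_exp * ln (real n) powr (- growth_exp)) * (C2 * ln (real n))\<^sup>2 + (C2 * ln (real n))\<^sup>2 * (q * ln (real n) ^ 2) + 1 / real n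
        \<le> 1 * ln (real n) powr (3 - growth_exp) * real n powr growth_exp"
      using C2 q kk0 by real_asymp
    then show "\<forall>\<^sub>F n in sequentially. var_count n \<le> 1 * ln (real n) powr (3 - growth_exp) * real n powr growth_exp"
      using f1 f2 by eventually_elim linarith
  qed simp
  show "(\<lambda>n. \<integral>x. iexp (t * ((edge_count n x - mean_count n) / sqrt (var_count n))) \<partial>sample_law n) \<longlonglongrightarrow> of_real (exp (- t\<^sup>2 / 2))" for t
  proof -
    \<comment> \<open>\<open>T n\<close> is the error of the normal approximation with the variance
      replaced by its lower bound \<open>u n\<close>; each of its three terms is a power of ln n
      times a negative power of n.\<close>
    define u where "u n = cv * real n powr growth_exp / ln (real n)" for n
    define T where "T n = 2 * (C2 * ln (real n)) * (q * ln (real n) ^ 2 * real n powr (-growth_exp)) / sqrt (u n)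
           + 3 / 2 * t\<^sup>2 * 289 * (real n powr growth_exp * (C2 * ln (real n)) ^ 3) / sqrt (u n) ^ 3
           + \<bar>t\<bar> * (sqrt (98 * real n powr growth_exp * (17 * (C2 * ln (real n))\<^sup>2)\<^sup>2 + (17 * (C2 * ln (real n))\<^sup>2)\<^sup>2 * (q * ln (real n) ^ 2))
              + (C2 * ln (real n))\<^sup>2 * (q * ln (real n) ^ 2)) / u n" for n
    have T1: "(\<lambda>n. 2 * (C2 * ln (real n)) * (q * ln (real n) ^ 2 * real n powr (-growth_exp)) / sqrt (u n)) \<longlonglongrightarrow> 0"
      unfolding u_def using kk0 C2 q cv by real_asymp
    have T2: "(\<lambda>n. 3 / 2 * t\<^sup>2 * 289 * (real n powr growth_exp * (C2 * ln (real n)) ^ 3) / sqrt (u n) ^ 3) \<longlonglongrightarrow> 0"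
      unfolding u_def using kk0 C2 q cv by real_asymp
    have T3: "(\<lambda>n. \<bar>t\<bar> * (sqrt (98 * real n powr growth_exp * (17 * (C2 * ln (real n))\<^sup>2)\<^sup>2 + (17 * (C2 * ln (real n))\<^sup>2)\<^sup>2 * (q * ln (real n) ^ 2))
              + (C2 * ln (real n))\<^sup>2 * (q * ln (real n) ^ 2)) / u n) \<longlonglongrightarrow> 0"
      unfolding u_def using kk0 C2 q cv by real_asymp
    have "T \<longlonglongrightarrow> 0 + 0 + 0" unfolding T_def[abs_def] by (intro tendsto_add T1 T2 T3)
    then have "(\<lambda>n. \<bar>t\<bar> * (3 * (1 / real n)) + \<bar>t\<bar> * T n) \<longlonglongrightarrow> \<bar>t\<bar> * (3 * 0) + \<bar>t\<bar> * 0"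
      by (intro tendsto_intros lim_1_over_n) simp
    then have lim: "(\<lambda>n. \<bar>t\<bar> * (3 * (1 / real n)) + \<bar>t\<bar> * T n) \<longlonglongrightarrow> 0" by simp
    have big1: "\<forall>\<^sub>F n in sequentially. 1 \<le> cv * (real n powr growth_exp / ln (real n))" using cv kk0 by real_asymp
    show ?thesis
    proof (rule LIM_zero_cancel, rule Lim_null_comparison[OF _ lim])
      show "\<forall>\<^sub>F n in sequentially. norm ((\<integral>x. iexp (t * ((edge_count n x - mean_count n) / sqrt (var_count n))) \<partial>sample_law n) - of_real (exp (- t\<^sup>2 / 2))) \<le> \<bar>t\<bar> * (3 * (1 / real n)) + \<bar>t\<bar> * T n"
        using f1 f3 f4 f5 f6 big big1 l1 eventually_gt_at_top[of 0]
      proof eventually_elim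
        case (elim n)
        define w where "w = cv * (real n powr growth_exp / ln (real n))"
        have un: "u n = w" by (simp add: u_def w_def)
        have w1: "1 \<le> w" and wn: "1 / real n \<le> w" using elim(6,7) by (simp_all only: w_def)
        have n0: "0 < real n" using elim(9) by simp
        note v = elim(1) and low = elim(2) and Wfm = conjunct1[OF elim(3)] and Wfb = spec[OF conjunct2[OF elim(3)]]
          and dif = elim(4) and ch = mp[OF spec[OF elim(5)]]
        have "2 * w \<le> var_count n" using low by (simp add: w_def cv_def)
        then have VLw: "1 \<le> var_count n" and vw: "w \<le> v n" using v wn w1 by (auto simp: abs_le_iff)
        have v0: "0 < v n" using vw w1 by linarith
        interpret PPn: prob_space "sample_law n" unfolding sample_law_def by (intro prob_space_PiM nu_prob)
        have mL: "edge_count n \<in> borel_measurable (sample_law n)"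
          unfolding edge_count_def sample_law_def using edge_counts_measurable(1)[of \<nu> "{..<n}" "{..<n}"] by simp
        have bL: "\<bar>edge_count n x\<bar> \<le> real n" for x using upper_edges_le[of "{..<n}" x] by (simp add: edge_count_def)
        have "norm ((\<integral>x. iexp (t * ((edge_count n x - mean_count n) / sqrt (var_count n))) \<partial>sample_law n) - (\<integral>x. iexp (t / sqrt (v n) * (Wf n x - EW n)) \<partial>sample_law n))
            \<le> \<bar>t\<bar> * (2 * (1 / real n) / sqrt (var_count n) + \<bar>var_count n - v n\<bar> / var_count n)"
          unfolding mean_count_def EW_def
          by (rule PPn.char_standardised_diff[OF mL bL Wfm Wfb _ v0 _ dif]) (use VLw in \<open>simp_all add: v_def EW_def\<close>)
        also have "\<dots> \<le> \<bar>t\<bar> * (2 * (1 / real n) / 1 + (1 / real n) / 1)"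
          using VLw v n0 by (intro mult_left_mono add_mono frac_le) auto
        also have "\<dots> = \<bar>t\<bar> * (3 * (1 / real n))" by simp
        finally have 1: "norm ((\<integral>x. iexp (t * ((edge_count n x - mean_count n) / sqrt (var_count n))) \<partial>sample_law n) - (\<integral>x. iexp (t / sqrt (v n) * (Wf n x - EW n)) \<partial>sample_law n)) \<le> \<bar>t\<bar> * (3 * (1 / real n))" .
        have l0: "0 \<le> ln (real n)" using elim(8) by linarith
        have "norm ((\<integral>x. iexp (t / sqrt (v n) * (Wf n x - EW n)) \<partial>sample_law n) - of_real (exp (- t\<^sup>2 / 2))) \<le> \<bar>t\<bar> * T n"
          unfolding T_def un
          by (rule order_trans[OF ch[OF v0]], intro mult_left_mono add_mono frac_le power_mono real_sqrt_le_mono)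
             (use w1 vw C2 q l0 in auto)
        then show ?case using 1 norm_triangle_ineq[of "(\<integral>x. iexp (t * ((edge_count n x - mean_count n) / sqrt (var_count n))) \<partial>sample_law n) - (\<integral>x. iexp (t / sqrt (v n) * (Wf n x - EW n)) \<partial>sample_law n)" "(\<integral>x. iexp (t / sqrt (v n) * (Wf n x - EW n)) \<partial>sample_law n) - of_real (exp (- t\<^sup>2 / 2))"]
          by simp
      qed
    qed
  qed
qed

end

section \<open>Projections of the uniform distribution on the sphere\<close>

lemma emeasure_lborel_negligible_diff:
  fixes U :: "'a::euclidean_space set"
  assumes "U \<subseteq> S" "U \<in> sets borel" "S \<in> sets borel" "negligible (S - U)"
  shows "emeasure lborel S = emeasure lborel U"
proof -
  have b: "S - U \<in> sets borel" using assms by auto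
  have "S - U \<in> null_sets lborel"
    using assms(4) b by (auto simp: negligible_iff_null_sets null_sets_def)
  then have "emeasure lborel (U \<union> (S - U)) = emeasure lborel U"
    using assms by (intro emeasure_Un_null_set) auto
  moreover have "U \<union> (S - U) = S" using assms by auto
  ultimately show ?thesis by simp
qed

text \<open>By Vitali's covering theorem an open set is a countable disjoint union of balls up to a
  null set. An isometry maps null sets to null sets, and an orthogonal one maps balls to balls of
  the same radius. The argument is free of coordinates and holds in every Euclidean space.\<close>

lemma emeasure_orthogonal_image_open:
  fixes g :: "'a::euclidean_space \<Rightarrow> 'a"
  assumes g: "orthogonal_transformation g" and S: "open S"
  shows "emeasure lborel (g ` S) = emeasure lborel S"
proof -
  have iso: "dist (g x) (g y) = dist x y" for x y
    using g by (simp add: orthogonal_transformation_isometry)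
  have og: "open (g ` T)" if "open T" for T
  proof -
    have "g ` T = inv g -` T" using bij_vimage_eq_inv_image[OF bij_imp_bij_inv[OF orthogonal_transformation_bij[OF g]]]
      by (simp add: inv_inv_eq orthogonal_transformation_bij[OF g])
    moreover have "continuous_on UNIV (inv g)"
      using orthogonal_transformation_linear[OF orthogonal_transformation_inv[OF g]]
      by (intro linear_continuous_on) (simp add: linear_conv_bounded_linear)
    then have "open (inv g -` T)" using that by (rule open_vimage[rotated])
    ultimately show ?thesis by simp
  qed
  obtain C where C: "countable C" "C \<subseteq> {(x, r). 0 < r \<and> ball x r \<subseteq> S}"
    and pw: "pairwise (\<lambda>i j. disjnt (ball (fst i) (snd i)) (ball (fst j) (snd j))) C"
    and neg: "negligible (S - (\<Union>i\<in>C. ball (fst i) (snd i)))"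
  proof (rule Vitali_covering_theorem_balls[of S "{(x, r). 0 < r \<and> ball x r \<subseteq> S}" fst snd])
    fix x and d :: real assume "x \<in> S" "0 < d"
    moreover obtain e where "e > 0" "ball x e \<subseteq> S" using S \<open>x \<in> S\<close> by (auto simp: open_contains_ball)
    ultimately show "\<exists>i. i \<in> {(x, r). 0 < r \<and> ball x r \<subseteq> S} \<and> x \<in> ball (fst i) (snd i) \<and> snd i < d"
      by (intro exI[of _ "(x, min e (d / 2))"]) auto
  qed
  define U where "U = (\<Union>i\<in>C. ball (fst i) (snd i))"
  have "ball (fst i) (snd i) \<subseteq> S" if "i \<in> C" for i using C(2) that by (cases i) auto
  then have US: "U \<subseteq> S" and oU: "open U" unfolding U_def by blast auto
  have dj: "disjoint_family_on (\<lambda>i. ball (fst i) (snd i)) C"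
    using pw by (auto simp: disjoint_family_on_def pairwise_def disjnt_def)
  have gU: "g ` U = (\<Union>i\<in>C. ball (g (fst i)) (snd i))"
    by (simp add: U_def image_UN image_orthogonal_transformation_ball[OF g])
  have dg: "disjoint_family_on (\<lambda>i. ball (g (fst i)) (snd i)) C"
    using dj orthogonal_transformation_inj[OF g]
    by (simp add: disjoint_family_on_def image_orthogonal_transformation_ball[OF g, symmetric] image_Int[symmetric])
  have "negligible (g ` (S - U))"
  proof (rule negligible_locally_Lipschitz_image)
    show "negligible (S - U)" using neg by (simp add: U_def)
    show "\<exists>T B. open T \<and> x \<in> T \<and> (\<forall>y\<in>(S - U) \<inter> T. norm (g y - g x) \<le> B * norm (y - x))" for x
      by (rule exI[of _ UNIV], rule exI[of _ 1]) (simp add: iso dist_norm[symmetric])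
  qed simp
  moreover have "g ` (S - U) = g ` S - g ` U" using orthogonal_transformation_inj[OF g] by (rule image_set_diff)
  ultimately have "emeasure lborel (g ` S) = emeasure lborel (g ` U)"
    using US og[OF S] og[OF oU] by (intro emeasure_lborel_negligible_diff) auto
  also have "\<dots> = (\<integral>\<^sup>+i. emeasure lborel (ball (g (fst i)) (snd i)) \<partial>count_space C)"
    unfolding gU using C(1) dg by (intro emeasure_UN_countable) auto
  also have "\<dots> = (\<integral>\<^sup>+i. emeasure lborel (ball (fst i) (snd i)) \<partial>count_space C)"
    using C(2) by (intro nn_integral_cong) (auto simp: emeasure_ball subset_eq)
  also have "\<dots> = emeasure lborel U"
    unfolding U_def using C(1) dj by (intro emeasure_UN_countable[symmetric]) auto
  also have "\<dots> = emeasure lborel S"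
    using US oU S neg by (intro emeasure_lborel_negligible_diff[symmetric]) (auto simp: U_def)
  finally show ?thesis .
qed

lemma orthogonal_transformation_measurable:
  fixes f :: "'a::euclidean_space \<Rightarrow> 'a"
  assumes "orthogonal_transformation f"
  shows "f \<in> borel_measurable borel"
  using linear_continuous_on[of f UNIV] orthogonal_transformation_linear[OF assms]
  by (intro borel_measurable_continuous_onI) (simp add: linear_conv_bounded_linear)

lemma distr_lborel_orthogonal:
  fixes f :: "'a::euclidean_space \<Rightarrow> 'a"
  assumes f: "orthogonal_transformation f"
  shows "distr lborel borel f = lborel"
proof (rule sym, rule lborel_eqI)
  fix l u :: 'a assume lu: "\<And>b. b \<in> Basis \<Longrightarrow> l \<bullet> b \<le> u \<bullet> b"
  have "f -` box l u = inv f ` box l u"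
    by (rule bij_vimage_eq_inv_image[OF orthogonal_transformation_bij[OF f]])
  then have "emeasure (distr lborel borel f) (box l u) = emeasure lborel (inv f ` box l u)"
    using orthogonal_transformation_measurable[OF f] by (simp add: emeasure_distr)
  also have "\<dots> = emeasure lborel (box l u)"
    by (intro emeasure_orthogonal_image_open orthogonal_transformation_inv f open_box)
  finally show "emeasure (distr lborel borel f) (box l u) = (\<Prod>b\<in>Basis. (u - l) \<bullet> b)"
    using lu by (simp add: emeasure_lborel_box)
qed simp

lemma distr_sphere_uniform_orthogonal:
  fixes f :: "'a::euclidean_space \<Rightarrow> 'a"
  assumes f: "orthogonal_transformation f"
  shows "distr sphere_uniform borel f = sphere_uniform"
proof -
  let ?U = "uniform_measure lborel (ball (0 :: 'a) 1)"
  have [measurable]: "f \<in> borel_measurable borel" by (rule orthogonal_transformation_measurable[OF f])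
  have nrm: "norm (f x) = norm x" for x using f by (rule orthogonal_transformation_norm)
  have vb: "f -` ball 0 1 = ball 0 1" by (auto simp: nrm)
  have em: "emeasure lborel (f -` A \<inter> ball 0 1) = emeasure lborel (A \<inter> ball 0 1)" if A: "A \<in> sets borel" for A
  proof -
    have "emeasure lborel (A \<inter> ball 0 1) = emeasure (distr lborel borel f) (A \<inter> ball 0 1)"
      by (simp add: distr_lborel_orthogonal[OF f])
    also have "\<dots> = emeasure lborel (f -` A \<inter> ball 0 1)"
      using A by (subst emeasure_distr) (auto simp: vimage_Int vb)
    finally show ?thesis by simp
  qed
  have fU: "distr ?U borel f = ?U"
  proof (rule measure_eqI)
    fix A assume "A \<in> sets (distr ?U borel f)"
    then have A[measurable]: "A \<in> sets borel" by simp
    have B: "f -` A \<in> sets borel" using measurable_sets_borel[of f borel A] by simp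
    show "emeasure (distr ?U borel f) A = emeasure ?U A"
      using em[OF A] B by (simp add: emeasure_distr Int_commute)
  qed simp
  have "distr sphere_uniform borel f = distr ?U borel (\<lambda>x. f (x /\<^sub>R norm x))"
    unfolding sphere_uniform_def by (subst distr_distr) (auto simp: comp_def)
  also have "(\<lambda>x. f (x /\<^sub>R norm x)) = (\<lambda>x. x /\<^sub>R norm x) \<circ> f"
    by (auto simp: linear_scale[OF orthogonal_transformation_linear[OF f]] nrm)
  also have "distr ?U borel ((\<lambda>x. x /\<^sub>R norm x) \<circ> f) = distr (distr ?U borel f) borel (\<lambda>x. x /\<^sub>R norm x)"
    by (subst distr_distr) auto
  also have "\<dots> = sphere_uniform" by (simp add: fU sphere_uniform_def)
  finally show ?thesis .
qed

section \<open>Transitivity of orthogonal maps on orthonormal pairs\<close>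

definition reflect :: "'a::real_inner \<Rightarrow> 'a \<Rightarrow> 'a" where
  "reflect v x = x - (2 * (x \<bullet> v) / (v \<bullet> v)) *\<^sub>R v"

lemma orthogonal_transformation_reflect: "orthogonal_transformation (reflect v)"
proof (cases "v = 0")
  case True
  then show ?thesis by (simp add: reflect_def[abs_def] orthogonal_transformation_id)
next
  case False
  define k where "k = 2 / (v \<bullet> v)"
  have k: "k * (v \<bullet> v) = 2" using False by (simp add: k_def)
  have r: "reflect v x = x - (k * (x \<bullet> v)) *\<^sub>R v" for x by (simp add: reflect_def k_def)
  have "reflect v x \<bullet> reflect v y = x \<bullet> y - 2 * k * (x \<bullet> v) * (y \<bullet> v) + k * (k * (v \<bullet> v)) * (x \<bullet> v) * (y \<bullet> v)" for x y
    unfolding r by (simp add: inner_diff_left inner_diff_right inner_commute algebra_simps)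
  then have "reflect v x \<bullet> reflect v y = x \<bullet> y" for x y by (simp add: k)
  moreover have "linear (reflect v)"
    by (rule linearI) (simp_all add: r inner_add_left algebra_simps)
  ultimately show ?thesis by (simp add: orthogonal_transformation_def)
qed

lemma reflect_diff: "norm a = norm b \<Longrightarrow> reflect (a - b) a = b"
proof (cases "a = b")
  case False
  assume n: "norm a = norm b"
  then have "(a - b) \<bullet> (a - b) = 2 * (a \<bullet> (a - b))"
    by (simp add: norm_eq inner_simps inner_commute)
  moreover have "(a - b) \<bullet> (a - b) \<noteq> 0" using False by simp
  ultimately show ?thesis by (simp add: reflect_def)
qed (simp add: reflect_def)

lemma reflect_orthogonal: "x \<bullet> v = 0 \<Longrightarrow> reflect v x = x"
  by (simp add: reflect_def)

text \<open>Two Householder reflections: the first sends e to e'. The second sends the image of g to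
  g' and fixes e', which is orthogonal to both of these vectors.\<close>

lemma orthogonal_transformation_exists_pair:
  fixes e g e' g' :: "'a::real_inner"
  assumes "norm e = 1" "norm g = 1" "e \<bullet> g = 0" "norm e' = 1" "norm g' = 1" "e' \<bullet> g' = 0"
  obtains f where "orthogonal_transformation f" "f e = e'" "f g = g'"
proof -
  define f where "f = reflect (e - e')"
  define h where "h = reflect (f g - g')"
  have of: "orthogonal_transformation f" and oh: "orthogonal_transformation h"
    by (simp_all add: f_def h_def orthogonal_transformation_reflect)
  have fe: "f e = e'" using assms by (simp add: f_def reflect_diff)
  have ng: "norm (f g) = norm g'" using assms of by (simp add: orthogonal_transformation_norm)
  have "e' \<bullet> f g = 0" using of assms fe by (metis orthogonal_transformation_def)
  then have "h e' = e'" unfolding h_def using assms by (intro reflect_orthogonal) (simp add: inner_simps)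
  moreover have "h (f g) = g'" using ng by (simp add: h_def reflect_diff)
  ultimately show ?thesis
    using fe that[of "h \<circ> f"] orthogonal_transformation_compose[OF oh of] by simp
qed

lemma sphere_uniform_projection_eq:
  fixes e g e' g' :: "'a::euclidean_space"
  assumes "norm e = 1" "norm g = 1" "e \<bullet> g = 0" "norm e' = 1" "norm g' = 1" "e' \<bullet> g' = 0"
  shows "distr sphere_uniform borel (plane_map e g) = distr sphere_uniform borel (plane_map e' g')"
proof -
  obtain f where f: "orthogonal_transformation f" "f e = e'" "f g = g'"
    using orthogonal_transformation_exists_pair[OF assms] .
  have [measurable]: "f \<in> borel_measurable borel" by (rule orthogonal_transformation_measurable[OF f(1)])
  have [measurable]: "plane_map u v \<in> borel_measurable (borel :: 'a measure)" for u v unfolding plane_map_def by measurable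
  have "distr sphere_uniform borel (plane_map e' g') = distr (distr sphere_uniform borel f) borel (plane_map e' g')"
    by (simp add: distr_sphere_uniform_orthogonal[OF f(1)])
  also have "\<dots> = distr sphere_uniform borel (plane_map e' g' \<circ> f)"
    by (rule distr_distr) (auto simp: sphere_uniform_def)
  also have "plane_map e' g' \<circ> f = plane_map e g"
    using f by (auto simp: plane_map_def orthogonal_transformation_def)
  finally show ?thesis by simp
qed

section \<open>Integration over the ball by two coordinates and the squared norm\<close>

definition chi_density :: "nat \<Rightarrow> real \<Rightarrow> ennreal" where
  "chi_density k u = ennreal (unit_ball_vol (real k) * (real k / 2) * u powr (real k / 2 - 1)) * indicator {0<..} u"

lemma chi_density_measurable [measurable]: "chi_density k \<in> borel_measurable borel"
  unfolding chi_density_def by measurable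

text \<open>\<open>chi_density k\<close> is the derivative of the volume of the k-dimensional ball
  with respect to the squared radius, so both measures agree on the half-lines up to t. The
  underlying measure is infinite, and therefore uniqueness uses the exhaustion by these
  half-lines.\<close>

lemma distr_sum_squares:
  assumes A: "finite A" "card A = k" "0 < k"
  shows "distr (Pi\<^sub>M A (\<lambda>_. lborel)) borel (\<lambda>x. \<Sum>i\<in>A. (x i)\<^sup>2) = density lborel (chi_density k)"
proof (rule measure_eqI_generator_eq[where E="range atMost" and \<Omega>=UNIV and A="\<lambda>n. {..real n}"])
  let ?P = "Pi\<^sub>M A (\<lambda>_. lborel :: real measure)"
  let ?V = "unit_ball_vol (real k)"
  let ?S = "\<lambda>t. {x \<in> space ?P. (\<Sum>i\<in>A. (x i)\<^sup>2) \<le> t}"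
  have S[measurable]: "?S t \<in> sets ?P" for t by measurable
  have pos: "emeasure ?P (?S t) = ennreal (?V * t powr (real k / 2))" if t: "0 < t" for t
  proof -
    have "?S t = {f. sqrt (\<Sum>i\<in>A. (f i)\<^sup>2) \<le> sqrt t} \<inter> space ?P" by auto
    then have "emeasure ?P (?S t) = ennreal (?V * sqrt t ^ k)"
      using emeasure_cball_aux[OF A(1), of "sqrt t"] t A(2) by simp
    also have "sqrt t ^ k = t powr (real k / 2)"
      using t by (simp add: powr_half_sqrt[symmetric] powr_realpow[symmetric] powr_powr)
    finally show ?thesis .
  qed
  \<comment> \<open>For t = 0 the set is a point, whose measure is squeezed between 0 and the
    volumes of balls of squared radius 1 / (n + 1); here k > 0 matters.\<close>
  have zero: "emeasure ?P (?S t) = 0" if t: "t \<le> 0" for t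
  proof -
    have "emeasure ?P (?S t) \<le> ennreal (?V * (1 / real (Suc n)) powr (real k / 2))" for n
      by (subst pos[symmetric]) (use t in \<open>auto intro!: emeasure_mono intro: order_trans\<close>)
    moreover have "(\<lambda>n. ennreal (?V * (1 / real (Suc n)) powr (real k / 2))) \<longlonglongrightarrow> ennreal (?V * 0)"
    proof (intro tendsto_ennrealI tendsto_mult tendsto_const)
      have "(\<lambda>n. (1 / real n) powr (real k / 2)) \<longlonglongrightarrow> 0" using A(3) by real_asymp
      then show "(\<lambda>n. (1 / real (Suc n)) powr (real k / 2)) \<longlonglongrightarrow> 0" by (rule LIMSEQ_Suc)
    qed
    ultimately have "emeasure ?P (?S t) \<le> ennreal (?V * 0)"
      by (intro LIMSEQ_le_const) auto
    then show ?thesis by simp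
  qed
  have l: "emeasure (distr ?P borel (\<lambda>x. \<Sum>i\<in>A. (x i)\<^sup>2)) {..t} = emeasure ?P (?S t)" for t
    by (subst emeasure_distr) (auto intro!: arg_cong[where f="emeasure ?P"])
  have d: "emeasure (density lborel (chi_density k)) {..t} = (if t \<le> 0 then 0 else ennreal (?V * t powr (real k / 2)))" for t
  proof (cases "t \<le> 0")
    case True
    then have "(\<lambda>u. chi_density k u * indicator {..t} u) = (\<lambda>_. 0)"
      by (auto simp: chi_density_def split: split_indicator)
    then show ?thesis using True by (simp add: emeasure_density)
  next
    case False
    have "emeasure (density lborel (chi_density k)) {..t} = (\<integral>\<^sup>+u. ennreal (?V * (real k / 2) * u powr (real k / 2 - 1)) * indicator {0..t} u \<partial>lborel)"
      by (subst emeasure_density) (auto intro!: nn_integral_cong simp: chi_density_def split: split_indicator)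
    also have "\<dots> = ennreal (?V * (real k / 2) * (t powr (real k / 2 - 1 + 1) / (real k / 2 - 1 + 1)))"
      using A(3) False
      by (intro nn_integral_has_integral_lebesgue' has_integral_mult_right has_integral_powr_from_0) auto
    finally show ?thesis using False A(3) by simp
  qed
  show "emeasure (distr ?P borel (\<lambda>x. \<Sum>i\<in>A. (x i)\<^sup>2)) X = emeasure (density lborel (chi_density k)) X" if "X \<in> range atMost" for X
    using that pos zero by (auto simp: l d not_le)
  show "emeasure (distr ?P borel (\<lambda>x. \<Sum>i\<in>A. (x i)\<^sup>2)) {..real n} \<noteq> \<infinity>" for n
    using pos[of "real n"] zero[of "real n"] by (cases "real n \<le> 0") (auto simp: l)
  show "Int_stable (range atMost :: real set set)" by (auto simp: Int_stable_def)
  show "(\<Union>n. {..real n}) = UNIV" using real_arch_simple by auto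
qed (auto simp: borel_eq_atMost)

lemma chi_density_scale:
  assumes "0 < w"
  shows "chi_density k (w * v) = ennreal (w powr (real k / 2 - 1)) * chi_density k v"
proof (cases "0 < v")
  case True
  then show ?thesis using assms
    by (simp add: chi_density_def powr_mult ennreal_mult'[symmetric] mult_ac unit_ball_vol_nonneg)
next
  case False
  then have "\<not> 0 < w * v" using assms by (simp add: zero_less_mult_iff)
  then show ?thesis using False by (simp add: chi_density_def)
qed

text \<open>All other coordinates enter through their sum of squares, so Fubini's theorem and
  \<open>distr_sum_squares\<close> replace them by a single variable u.\<close>

lemma nn_integral_lborel_two_coordinates:
  fixes b0 b1 :: "'a::euclidean_space"
  assumes b: "b0 \<in> Basis" "b1 \<in> Basis" "b0 \<noteq> b1" and d: "2 < DIM('a)"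
    and G: "(\<lambda>(a, b, w). G a b w) \<in> borel_measurable (borel :: (real \<times> real \<times> real) measure)"
  shows "(\<integral>\<^sup>+x. G (x \<bullet> b0) (x \<bullet> b1) ((norm x)\<^sup>2) \<partial>(lborel :: 'a measure)) =
    (\<integral>\<^sup>+a. \<integral>\<^sup>+b. \<integral>\<^sup>+u. chi_density (DIM('a) - 2) u * G a b (a\<^sup>2 + b\<^sup>2 + u) \<partial>lborel \<partial>lborel \<partial>lborel)"
proof -
  define A where "A = Basis - {b0, b1}"
  have A: "finite A" "card A = DIM('a) - 2" "0 < DIM('a) - 2" "b0 \<notin> insert b1 A" "b1 \<notin> A" "insert b0 (insert b1 A) = Basis"
    using b d by (auto simp: A_def card_Diff_subset)
  have G': "(\<lambda>x. G (f x) (g x) (h x)) \<in> borel_measurable N"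
    if "f \<in> borel_measurable N" "g \<in> borel_measurable N" "h \<in> borel_measurable N" for f g h and N :: "'n measure"
    using measurable_compose[OF _ G, of "\<lambda>x. (f x, g x, h x)" N] that by simp
  interpret product_sigma_finite "\<lambda>_::'a. lborel :: real measure" by standard
  let ?P = "\<lambda>I. Pi\<^sub>M I (\<lambda>_::'a. lborel :: real measure)"
  have "(\<integral>\<^sup>+x. G (x \<bullet> b0) (x \<bullet> b1) ((norm x)\<^sup>2) \<partial>(lborel :: 'a measure))
      = (\<integral>\<^sup>+f. G (f b0) (f b1) (\<Sum>i\<in>Basis. (f i)\<^sup>2) \<partial>?P Basis)"
  proof -
    have n2: "(norm (\<Sum>b\<in>Basis. f b *\<^sub>R b :: 'a))\<^sup>2 = (\<Sum>i\<in>Basis. (f i)\<^sup>2)" for f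
      by (subst power2_norm_eq_inner, subst euclidean_inner) (simp add: power2_eq_square)
    show ?thesis
      by (subst lborel_eq, subst nn_integral_distr) (auto intro!: nn_integral_cong G' simp: n2 b)
  qed
  also have "\<dots> = (\<integral>\<^sup>+a. \<integral>\<^sup>+f. G a (f b1) (a\<^sup>2 + (\<Sum>i\<in>insert b1 A. (f i)\<^sup>2)) \<partial>?P (insert b1 A) \<partial>lborel)"
  proof -
    have "(\<integral>\<^sup>+f. G (f b0) (f b1) (\<Sum>i\<in>Basis. (f i)\<^sup>2) \<partial>?P (insert b0 (insert b1 A)))
       = (\<integral>\<^sup>+a. \<integral>\<^sup>+f. G ((f(b0 := a)) b0) ((f(b0 := a)) b1) (\<Sum>i\<in>insert b0 (insert b1 A). ((f(b0 := a)) i)\<^sup>2) \<partial>?P (insert b1 A) \<partial>lborel)"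
      using A b by (subst product_nn_integral_insert_rev) (auto intro!: G')
    also have "\<dots> = (\<integral>\<^sup>+a. \<integral>\<^sup>+f. G a (f b1) (a\<^sup>2 + (\<Sum>i\<in>insert b1 A. (f i)\<^sup>2)) \<partial>?P (insert b1 A) \<partial>lborel)"
    proof (rule nn_integral_cong, rule nn_integral_cong)
      fix a :: real and f :: "'a \<Rightarrow> real"
      have "(\<Sum>i\<in>insert b1 A. ((f(b0 := a)) i)\<^sup>2) = (\<Sum>i\<in>insert b1 A. (f i)\<^sup>2)"
        using A(4) by (intro sum.cong) auto
      then show "G ((f(b0 := a)) b0) ((f(b0 := a)) b1) (\<Sum>i\<in>insert b0 (insert b1 A). ((f(b0 := a)) i)\<^sup>2) = G a (f b1) (a\<^sup>2 + (\<Sum>i\<in>insert b1 A. (f i)\<^sup>2))"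
        using A(1,4) b(3) by (subst sum.insert) auto
    qed
    finally show ?thesis using A(6) by simp
  qed
  also have "\<dots> = (\<integral>\<^sup>+a. \<integral>\<^sup>+b. \<integral>\<^sup>+f. G a b (a\<^sup>2 + b\<^sup>2 + (\<Sum>i\<in>A. (f i)\<^sup>2)) \<partial>?P A \<partial>lborel \<partial>lborel)"
  proof (rule nn_integral_cong)
    fix a
    have "(\<integral>\<^sup>+f. G a (f b1) (a\<^sup>2 + (\<Sum>i\<in>insert b1 A. (f i)\<^sup>2)) \<partial>?P (insert b1 A))
       = (\<integral>\<^sup>+b. \<integral>\<^sup>+f. G a ((f(b1 := b)) b1) (a\<^sup>2 + (\<Sum>i\<in>insert b1 A. ((f(b1 := b)) i)\<^sup>2)) \<partial>?P A \<partial>lborel)"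
      using A by (subst product_nn_integral_insert_rev) (auto intro!: G')
    also have "\<dots> = (\<integral>\<^sup>+b. \<integral>\<^sup>+f. G a b (a\<^sup>2 + b\<^sup>2 + (\<Sum>i\<in>A. (f i)\<^sup>2)) \<partial>?P A \<partial>lborel)"
    proof (rule nn_integral_cong, rule nn_integral_cong)
      fix b :: real and f :: "'a \<Rightarrow> real"
      have "(\<Sum>i\<in>A. ((f(b1 := b)) i)\<^sup>2) = (\<Sum>i\<in>A. (f i)\<^sup>2)"
        using A(5) by (intro sum.cong) auto
      then show "G a ((f(b1 := b)) b1) (a\<^sup>2 + (\<Sum>i\<in>insert b1 A. ((f(b1 := b)) i)\<^sup>2)) = G a b (a\<^sup>2 + b\<^sup>2 + (\<Sum>i\<in>A. (f i)\<^sup>2))"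
        using A(1,5) by (subst sum.insert) (auto simp: add.assoc)
    qed
    finally show "(\<integral>\<^sup>+f. G a (f b1) (a\<^sup>2 + (\<Sum>i\<in>insert b1 A. (f i)\<^sup>2)) \<partial>?P (insert b1 A))
       = (\<integral>\<^sup>+b. \<integral>\<^sup>+f. G a b (a\<^sup>2 + b\<^sup>2 + (\<Sum>i\<in>A. (f i)\<^sup>2)) \<partial>?P A \<partial>lborel)" .
  qed
  also have "\<dots> = (\<integral>\<^sup>+a. \<integral>\<^sup>+b. \<integral>\<^sup>+u. chi_density (DIM('a) - 2) u * G a b (a\<^sup>2 + b\<^sup>2 + u) \<partial>lborel \<partial>lborel \<partial>lborel)"
  proof (rule nn_integral_cong, rule nn_integral_cong)
    fix a b
    have "(\<integral>\<^sup>+f. G a b (a\<^sup>2 + b\<^sup>2 + (\<Sum>i\<in>A. (f i)\<^sup>2)) \<partial>?P A)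
      = (\<integral>\<^sup>+u. G a b (a\<^sup>2 + b\<^sup>2 + u) \<partial>distr (?P A) borel (\<lambda>f. \<Sum>i\<in>A. (f i)\<^sup>2))"
      by (subst nn_integral_distr) (auto intro!: G')
    also have "\<dots> = (\<integral>\<^sup>+u. chi_density (DIM('a) - 2) u * G a b (a\<^sup>2 + b\<^sup>2 + u) \<partial>lborel)"
      unfolding distr_sum_squares[OF A(1-3)]
      by (subst nn_integral_density) (auto intro!: G')
    finally show "(\<integral>\<^sup>+f. G a b (a\<^sup>2 + b\<^sup>2 + (\<Sum>i\<in>A. (f i)\<^sup>2)) \<partial>?P A)
      = (\<integral>\<^sup>+u. chi_density (DIM('a) - 2) u * G a b (a\<^sup>2 + b\<^sup>2 + u) \<partial>lborel)" .
  qed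
  finally show ?thesis .
qed

text \<open>The radial variable is substituted by the squared norm \<open>w\<close>, a translation; afterwards the plane is
  rescaled by \<open>sqrt w\<close>, which decouples \<open>w\<close> from the direction.\<close>

lemma nn_integral_ball_direction:
  fixes b0 b1 :: "'a::euclidean_space"
  assumes b: "b0 \<in> Basis" "b1 \<in> Basis" "b0 \<noteq> b1" and d: "2 < DIM('a)"
    and h[measurable]: "h \<in> borel_measurable (borel :: (real \<times> real) measure)"
  shows "(\<integral>\<^sup>+x. h (x \<bullet> b0 / norm x, x \<bullet> b1 / norm x) * indicator (ball 0 1) x \<partial>(lborel :: 'a measure)) =
    (\<integral>\<^sup>+w. ennreal (w * w powr (real (DIM('a) - 2) / 2 - 1)) * indicator {0<..<1} w \<partial>lborel) *
    (\<integral>\<^sup>+z. chi_density (DIM('a) - 2) (1 - (fst z)\<^sup>2 - (snd z)\<^sup>2) * h z \<partial>lborel)"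
proof -
  define k where "k = DIM('a) - 2"
  define G where "G a b w = h (a / sqrt w, b / sqrt w) * indicator {..<1} w" for a b w :: real
  let ?\<phi> = "chi_density k"
  have G: "(\<lambda>(a, b, w). G a b w) \<in> borel_measurable (borel :: (real \<times> real \<times> real) measure)"
    unfolding G_def borel_prod[symmetric] by measurable
  have G'[measurable (raw)]: "(\<lambda>x. G (f x) (g x) (h x)) \<in> borel_measurable N"
    if "f \<in> borel_measurable N" "g \<in> borel_measurable N" "h \<in> borel_measurable N" for f g h and N :: "'n measure"
    using measurable_compose[OF _ G, of "\<lambda>x. (f x, g x, h x)" N] that by simp
  have "(\<integral>\<^sup>+x. h (x \<bullet> b0 / norm x, x \<bullet> b1 / norm x) * indicator (ball 0 1) x \<partial>(lborel :: 'a measure))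
      = (\<integral>\<^sup>+x. G (x \<bullet> b0) (x \<bullet> b1) ((norm x)\<^sup>2) \<partial>(lborel :: 'a measure))"
    by (intro nn_integral_cong) (auto simp: G_def split: split_indicator simp: abs_square_less_1)
  also have "\<dots> = (\<integral>\<^sup>+a. \<integral>\<^sup>+b. \<integral>\<^sup>+u. ?\<phi> u * G a b (a\<^sup>2 + b\<^sup>2 + u) \<partial>lborel \<partial>lborel \<partial>lborel)"
    unfolding k_def by (rule nn_integral_lborel_two_coordinates[OF b d G])
  also have "\<dots> = (\<integral>\<^sup>+a. \<integral>\<^sup>+b. \<integral>\<^sup>+w. ?\<phi> (w - a\<^sup>2 - b\<^sup>2) * G a b w \<partial>lborel \<partial>lborel \<partial>lborel)"
  proof (rule nn_integral_cong, rule nn_integral_cong)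
    fix a b :: real
    show "(\<integral>\<^sup>+u. ?\<phi> u * G a b (a\<^sup>2 + b\<^sup>2 + u) \<partial>lborel) = (\<integral>\<^sup>+w. ?\<phi> (w - a\<^sup>2 - b\<^sup>2) * G a b w \<partial>lborel)"
      by (subst nn_integral_real_affine[where c=1 and t="- (a\<^sup>2 + b\<^sup>2)"]) (auto simp: algebra_simps)
  qed
  also have "\<dots> = (\<integral>\<^sup>+a. \<integral>\<^sup>+w. \<integral>\<^sup>+b. ?\<phi> (w - a\<^sup>2 - b\<^sup>2) * G a b w \<partial>lborel \<partial>lborel \<partial>lborel)"
    by (rule nn_integral_cong, rule lborel_pair.Fubini') measurable
  also have "\<dots> = (\<integral>\<^sup>+w. \<integral>\<^sup>+a. \<integral>\<^sup>+b. ?\<phi> (w - a\<^sup>2 - b\<^sup>2) * G a b w \<partial>lborel \<partial>lborel \<partial>lborel)"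
    by (rule lborel_pair.Fubini') measurable
  also have "\<dots> = (\<integral>\<^sup>+w. ennreal (w * w powr (real k / 2 - 1)) * indicator {0<..<1} w *
      (\<integral>\<^sup>+p. \<integral>\<^sup>+q. ?\<phi> (1 - p\<^sup>2 - q\<^sup>2) * h (p, q) \<partial>lborel \<partial>lborel) \<partial>lborel)"
  proof (rule nn_integral_cong)
    fix w :: real
    let ?R = "\<integral>\<^sup>+p. \<integral>\<^sup>+q. ?\<phi> (1 - p\<^sup>2 - q\<^sup>2) * h (p, q) \<partial>lborel \<partial>lborel"
    show "(\<integral>\<^sup>+a. \<integral>\<^sup>+b. ?\<phi> (w - a\<^sup>2 - b\<^sup>2) * G a b w \<partial>lborel \<partial>lborel)
       = ennreal (w * w powr (real k / 2 - 1)) * indicator {0<..<1} w * ?R"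
    proof (cases "0 < w \<and> w < 1")
      case False
      have "?\<phi> (w - a\<^sup>2 - b\<^sup>2) * G a b w = 0" for a b
      proof (cases "w \<le> 0")
        case True
        then have "\<not> 0 < w - a\<^sup>2 - b\<^sup>2" using zero_le_power2[of a] zero_le_power2[of b] by linarith
        then show ?thesis by (simp add: chi_density_def)
      qed (use False in \<open>simp add: G_def\<close>)
      then have "(\<integral>\<^sup>+a. \<integral>\<^sup>+b. ?\<phi> (w - a\<^sup>2 - b\<^sup>2) * G a b w \<partial>lborel \<partial>lborel) = 0" by (simp only: nn_integral_const) simp
      then show ?thesis using False by simp
    next
      case True
      define s where "s = sqrt w"
      have s: "s > 0" "s * s = w" "w = s\<^sup>2" "s \<noteq> 0" using True by (auto simp: s_def)
      have "(\<integral>\<^sup>+a. \<integral>\<^sup>+b. ?\<phi> (w - a\<^sup>2 - b\<^sup>2) * G a b w \<partial>lborel \<partial>lborel)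
          = s * (\<integral>\<^sup>+p. \<integral>\<^sup>+b. ?\<phi> (w - (s * p)\<^sup>2 - b\<^sup>2) * G (s * p) b w \<partial>lborel \<partial>lborel)"
        using s by (subst nn_integral_real_affine[where c=s and t=0]) (auto simp: ennreal_mult)
      also have "\<dots> = s * (\<integral>\<^sup>+p. s * (\<integral>\<^sup>+q. ?\<phi> (w - (s * p)\<^sup>2 - (s * q)\<^sup>2) * G (s * p) (s * q) w \<partial>lborel) \<partial>lborel)"
        using s by (subst (2) nn_integral_real_affine[where c=s and t=0]) (auto simp: ennreal_mult)
      also have "\<dots> = s * (\<integral>\<^sup>+p. s * (\<integral>\<^sup>+q. ennreal (w powr (real k / 2 - 1)) * (?\<phi> (1 - p\<^sup>2 - q\<^sup>2) * h (p, q)) \<partial>lborel) \<partial>lborel)"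
      proof -
        have "?\<phi> (w - (s * p)\<^sup>2 - (s * q)\<^sup>2) * G (s * p) (s * q) w = ennreal (w powr (real k / 2 - 1)) * (?\<phi> (1 - p\<^sup>2 - q\<^sup>2) * h (p, q))" for p q
        proof -
          have "w - (s * p)\<^sup>2 - (s * q)\<^sup>2 = w * (1 - p\<^sup>2 - q\<^sup>2)" by (simp add: s(3) power_mult_distrib algebra_simps)
          then show ?thesis using True s by (simp add: chi_density_scale G_def s_def[symmetric] mult_ac)
        qed
        then show ?thesis by simp
      qed
      also have "\<dots> = ennreal (w * w powr (real k / 2 - 1)) * ?R"
      proof -
        have "s * (\<integral>\<^sup>+p. s * (\<integral>\<^sup>+q. ennreal (w powr (real k / 2 - 1)) * (?\<phi> (1 - p\<^sup>2 - q\<^sup>2) * h (p, q)) \<partial>lborel) \<partial>lborel)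
            = ennreal s * (ennreal s * (ennreal (w powr (real k / 2 - 1)) * ?R))"
          by (simp add: nn_integral_cmult)
        also have "\<dots> = (ennreal s * ennreal s) * ennreal (w powr (real k / 2 - 1)) * ?R"
          by (simp only: mult.assoc)
        also have "(ennreal s * ennreal s) * ennreal (w powr (real k / 2 - 1)) = ennreal (w * w powr (real k / 2 - 1))"
          using s True by (simp add: ennreal_mult[symmetric])
        finally show ?thesis .
      qed
      finally show ?thesis using True by simp
    qed
  qed
  also have "\<dots> = (\<integral>\<^sup>+w. ennreal (w * w powr (real k / 2 - 1)) * indicator {0<..<1} w \<partial>lborel) *
      (\<integral>\<^sup>+p. \<integral>\<^sup>+q. ?\<phi> (1 - p\<^sup>2 - q\<^sup>2) * h (p, q) \<partial>lborel \<partial>lborel)"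
    by (rule nn_integral_multc) measurable
  also have "(\<integral>\<^sup>+p. \<integral>\<^sup>+q. ?\<phi> (1 - p\<^sup>2 - q\<^sup>2) * h (p, q) \<partial>lborel \<partial>lborel) = (\<integral>\<^sup>+z. ?\<phi> (1 - (fst z)\<^sup>2 - (snd z)\<^sup>2) * h z \<partial>lborel)"
    unfolding lborel_prod[symmetric] by (subst lborel.nn_integral_fst[symmetric]) (auto simp: lborel_prod)
  finally show ?thesis by (simp only: k_def)
qed

text \<open>By orthogonal invariance two basis vectors are representative. For them the radial
  integral over the unit ball splits off as a constant, and what remains is the density in the
  plane.\<close>

theorem sphere_uniform_projection:
  assumes d: "4 \<le> DIM('a::euclidean_space)"
  obtains c where "0 < c"
    "\<And>e g :: 'a. norm e = 1 \<Longrightarrow> norm g = 1 \<Longrightarrow> e \<bullet> g = 0 \<Longrightarrow>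
      distr sphere_uniform borel (plane_map e g) = density lborel (\<lambda>z. radial_density DIM('a) c ((fst z)\<^sup>2 + (snd z)\<^sup>2))"
proof -
  define k where "k = DIM('a) - 2"
  have k: "2 < DIM('a)" "real k / 2 - 1 = (real DIM('a) - 4) / 2" using d by (auto simp: k_def field_simps of_nat_diff)
  obtain b0 :: 'a where b0: "b0 \<in> Basis" using nonempty_Basis by blast
  obtain b1 :: 'a where b1: "b1 \<in> Basis" "b1 \<noteq> b0"
  proof -
    have "Basis \<noteq> {b0}"
    proof
      assume "Basis = {b0}"
      from arg_cong[OF this, of card] have "DIM('a) = 1" by simp
      then show False using d by simp
    qed
    then show ?thesis using b0 that by blast
  qed
  define D where "D = (\<integral>\<^sup>+w. ennreal (w * w powr (real k / 2 - 1)) * indicator {0<..<1} w \<partial>lborel)"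
  define V where "V = emeasure lborel (ball (0::'a) 1)"
  have "D \<le> (\<integral>\<^sup>+w. indicator {0<..<1::real} w \<partial>lborel)"
    unfolding D_def using k(2) d
    by (intro nn_integral_mono) (auto split: split_indicator intro!: ennreal_le_1 mult_le_one powr_le1)
  then have "D < \<infinity>" by (simp add: order_le_less_trans)
  have V: "V \<noteq> 0"
    using open_not_negligible[of "ball (0::'a) 1"] by (auto simp: V_def negligible_iff_null_sets intro!: null_sets_completionI)
  define c1 where "c1 = enn2real (D / V)"
  have DV: "D / V = ennreal c1"
    using \<open>D < \<infinity>\<close> V unfolding c1_def
    by (auto simp: ennreal_divide_eq_top_iff less_top[symmetric] ennreal_enn2real_if)
  have c1: "0 \<le> c1" by (simp add: c1_def)
  define c where "c = c1 * (unit_ball_vol (real k) * (real k / 2))"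
  have c0: "0 \<le> c" by (simp add: c_def c1 unit_ball_vol_nonneg)
  have rd: "D / V * chi_density k (1 - x - y) = radial_density DIM('a) c (x + y)" for x y
  proof (cases "x + y < 1")
    case True
    then show ?thesis
      using c1 unfolding DV by (simp add: chi_density_def radial_density_def c_def k(2) ennreal_mult'[symmetric] mult.assoc diff_diff_eq)
  qed (simp add: chi_density_def radial_density_def)
  have [measurable]: "plane_map u v \<in> borel_measurable (borel :: 'a measure)" for u v unfolding plane_map_def by measurable
  have rm[measurable]: "(\<lambda>z::real \<times> real. radial_density DIM('a) c ((fst z)\<^sup>2 + (snd z)\<^sup>2)) \<in> borel_measurable borel"
    by measurable
  have ax: "distr sphere_uniform borel (plane_map b0 b1) = density lborel (\<lambda>z. radial_density DIM('a) c ((fst z)\<^sup>2 + (snd z)\<^sup>2))"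
  proof (rule measure_eqI)
    fix B assume "B \<in> sets (distr (sphere_uniform :: 'a measure) borel (plane_map b0 b1))"
    then have B[measurable]: "B \<in> sets borel" by simp
    have "emeasure (distr sphere_uniform borel (plane_map b0 b1)) B = (\<integral>\<^sup>+y. indicator B y \<partial>distr sphere_uniform borel (plane_map b0 b1))"
      by simp
    also have "\<dots> = (\<integral>\<^sup>+x. indicator B (plane_map b0 b1 (x /\<^sub>R norm x)) \<partial>uniform_measure lborel (ball 0 1))"
      unfolding sphere_uniform_def by (subst nn_integral_distr, simp, simp)+ (rule refl)
    also have "\<dots> = (\<integral>\<^sup>+x. indicator B (x \<bullet> b0 / norm x, x \<bullet> b1 / norm x) * indicator (ball 0 1) x \<partial>lborel) / V"
      unfolding V_def by (subst nn_integral_uniform_measure) (simp_all add: plane_map_def divide_inverse mult.commute)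
    also have "\<dots> = D * (\<integral>\<^sup>+z. chi_density k (1 - (fst z)\<^sup>2 - (snd z)\<^sup>2) * indicator B z \<partial>lborel) / V"
      using b0 b1 k(1) by (subst nn_integral_ball_direction) (auto simp: D_def k_def)
    also have "\<dots> = (D / V) * (\<integral>\<^sup>+z. chi_density k (1 - (fst z)\<^sup>2 - (snd z)\<^sup>2) * indicator B z \<partial>lborel)"
      by (simp add: ennreal_times_divide divide_ennreal_def mult_ac)
    also have "\<dots> = (\<integral>\<^sup>+z. radial_density DIM('a) c ((fst z)\<^sup>2 + (snd z)\<^sup>2) * indicator B z \<partial>lborel)"
      by (subst nn_integral_cmult[symmetric]) (auto simp: rd mult.assoc[symmetric])
    also have "\<dots> = emeasure (density lborel (\<lambda>z. radial_density DIM('a) c ((fst z)\<^sup>2 + (snd z)\<^sup>2))) B"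
      by (subst emeasure_density) auto
    finally show "emeasure (distr sphere_uniform borel (plane_map b0 b1)) B = emeasure (density lborel (\<lambda>z. radial_density DIM('a) c ((fst z)\<^sup>2 + (snd z)\<^sup>2))) B" .
  qed simp
  \<comment> \<open>With c = 0 the density would vanish, although the projected law has total mass
    one.\<close>
  have "c \<noteq> 0"
  proof
    assume c: "c = 0"
    have rd0: "radial_density DIM('a) c t = 0" for t by (simp add: radial_density_def c)
    have "emeasure (distr (sphere_uniform :: 'a measure) borel (plane_map b0 b1)) UNIV = 0"
      unfolding ax by (subst emeasure_density) (auto simp: rd0)
    moreover interpret prob_space "distr (sphere_uniform :: 'a measure) borel (plane_map b0 b1)"
      by (intro prob_space.prob_space_distr prob_space_sphere_uniform) (simp add: sphere_uniform_def)
    have "emeasure (distr (sphere_uniform :: 'a measure) borel (plane_map b0 b1)) UNIV = 1"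
      using emeasure_space_1 by simp
    ultimately show False by simp
  qed
  then have "0 < c" using c0 by simp
  then show thesis
  proof (rule that)
    fix e g :: 'a assume eg: "norm e = 1" "norm g = 1" "e \<bullet> g = 0"
    show "distr sphere_uniform borel (plane_map e g) = density lborel (\<lambda>z. radial_density DIM('a) c ((fst z)\<^sup>2 + (snd z)\<^sup>2))"
      unfolding ax[symmetric] using eg b0 b1 by (intro sphere_uniform_projection_eq) (auto simp: inner_not_same_Basis)
  qed
qed

section \<open>The length of the coherent path\<close>

text \<open>Up to a positive factor, (v, 1) is the general normal vector with positive second
  coordinate, so the upper faces are the sets of maximisers of these linear forms.\<close>

definition elevation :: "'a::euclidean_space \<Rightarrow> 'a \<Rightarrow> real \<Rightarrow> 'a \<Rightarrow> real" where
  "elevation c w v x = v * (x \<bullet> c) + x \<bullet> w"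

definition top_face :: "'a::euclidean_space set \<Rightarrow> 'a \<Rightarrow> 'a \<Rightarrow> real \<Rightarrow> 'a set" where
  "top_face P c w v = {x \<in> P. \<forall>y\<in>P. elevation c w v y \<le> elevation c w v x}"

definition top_indices :: "'i set \<Rightarrow> 'a::euclidean_space \<Rightarrow> 'a \<Rightarrow> ('i \<Rightarrow> 'a) \<Rightarrow> real \<Rightarrow> 'i set" where
  "top_indices I c w z v = {i \<in> I. \<forall>k\<in>I. elevation c w v (z k) \<le> elevation c w v (z i)}"

lemma elevation_eq: "elevation c w v x = plane_map c w x \<bullet> (v, 1)"
  by (simp add: elevation_def plane_map_def inner_prod_def mult.commute)

lemma elevation_inner: "elevation c w v x = (v *\<^sub>R c + w) \<bullet> x"
  by (simp add: elevation_def inner_add_left inner_commute[of x])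

lemma top_face_eq:
  assumes "x0 \<in> top_face P c w v"
  shows "top_face P c w v = P \<inter> {x. (v *\<^sub>R c + w) \<bullet> x = elevation c w v x0}"
  using assms unfolding top_face_def by (auto simp: elevation_inner intro: antisym)

lemma top_face_face_of:
  assumes "convex P" "top_face P c w v \<noteq> {}"
  shows "top_face P c w v face_of P"
proof -
  obtain x0 where x0: "x0 \<in> top_face P c w v" using assms(2) by blast
  have "(v *\<^sub>R c + w) \<bullet> y \<le> elevation c w v x0" if "y \<in> P" for y
    using x0 that by (simp add: top_face_def elevation_inner)
  then show ?thesis
    unfolding top_face_eq[OF x0] by (rule face_of_Int_supporting_hyperplane_le[OF assms(1)])
qed

lemma top_indices_nonempty:
  assumes "finite I" "I \<noteq> {}"
  shows "top_indices I c w z v \<noteq> {}"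
proof -
  obtain i where "i \<in> I" "elevation c w v (z i) = Max ((\<lambda>k. elevation c w v (z k)) ` I)"
    using Max_in[of "(\<lambda>k. elevation c w v (z k)) ` I"] assms
    by (metis (no_types, lifting) finite_imageI image_is_empty imageE)
  then have "i \<in> top_indices I c w z v" using assms(1) by (auto simp: top_indices_def)
  then show ?thesis by blast
qed

lemma elevation_convex_hull_le:
  assumes "i \<in> top_indices I c w z v" "x \<in> convex hull (z ` I)"
  shows "elevation c w v x \<le> elevation c w v (z i)"
proof -
  have "convex hull (z ` I) \<subseteq> {x. (v *\<^sub>R c + w) \<bullet> x \<le> elevation c w v (z i)}"
    using assms(1) by (intro hull_minimal convex_halfspace_le) (auto simp: top_indices_def elevation_inner)
  then show ?thesis using assms(2) by (auto simp: elevation_inner)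
qed

lemma top_face_iff:
  assumes "finite I" "k \<in> I"
  shows "z k \<in> top_face (convex hull (z ` I)) c w v \<longleftrightarrow> k \<in> top_indices I c w z v"
proof
  assume "z k \<in> top_face (convex hull (z ` I)) c w v"
  then show "k \<in> top_indices I c w z v"
    using assms by (auto simp: top_face_def top_indices_def intro: hull_inc)
next
  assume "k \<in> top_indices I c w z v"
  then show "z k \<in> top_face (convex hull (z ` I)) c w v"
    using assms elevation_convex_hull_le by (auto simp: top_face_def intro: hull_inc)
qed

text \<open>A face of the convex hull of finitely many points is the hull of some of these points,
  and \<open>top_face_iff\<close> identifies the candidates.\<close>

lemma top_face_convex_hull:
  assumes "finite I" "I \<noteq> {}"
  shows "top_face (convex hull (z ` I)) c w v = convex hull (z ` top_indices I c w z v)"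
    (is "?M = convex hull (z ` ?S)")
proof
  obtain i where i: "i \<in> ?S" using top_indices_nonempty[OF assms] by blast
  then have "z i \<in> ?M" using assms by (subst top_face_iff) (auto simp: top_indices_def)
  then have face: "?M face_of convex hull (z ` I)" by (intro top_face_face_of) auto
  obtain s where s: "s \<subseteq> z ` I" "?M = convex hull s"
    using face_of_convex_hull_subset[OF _ face] assms(1) finite_imp_compact by blast
  have "s \<subseteq> z ` ?S"
  proof
    fix y assume "y \<in> s"
    then obtain k where k: "y = z k" "k \<in> I" using s(1) by blast
    have "y \<in> ?M" using s(2) \<open>y \<in> s\<close> by (simp add: hull_inc)
    then show "y \<in> z ` ?S" using k assms by (simp add: top_face_iff)
  qed
  then show "?M \<subseteq> convex hull (z ` ?S)" unfolding s(2) by (rule hull_mono)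
  show "convex hull (z ` ?S) \<subseteq> ?M"
    using face_of_imp_convex[OF face] assms
    by (intro hull_minimal) (auto simp: top_face_iff top_indices_def[of I])
qed

text \<open>A vertex of the polygon with an upper normal \<open>u\<close> is a strict maximum in the direction \<open>u + \<epsilon> a\<close>,
  where \<open>a\<close> exposes it; this turns every upper face into the set of all maximisers of a linear form.\<close>

lemma upper_face_maximisers:
  fixes Q :: "(real \<times> real) set"
  assumes Q: "polytope Q" and F: "upper_face Q F"
  shows "\<exists>v. F = {q \<in> Q. \<forall>y\<in>Q. y \<bullet> (v, 1) \<le> q \<bullet> (v, 1)}"
proof -
  define T where "T v = {q \<in> Q. \<forall>y\<in>Q. y \<bullet> (v, 1) \<le> q \<bullet> (v, 1)}" for v :: real
  have face: "F face_of Q" and dim: "aff_dim F = 0 \<or> aff_dim F = 1" using F by (auto simp: upper_face_def)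
  obtain u where u: "\<forall>y\<in>F. \<forall>z\<in>Q. z \<bullet> u \<le> y \<bullet> u" "snd u > 0"
    using F unfolding upper_face_def outer_normal_def by blast
  have scale: "y \<bullet> (fst u / snd u, 1) = (y \<bullet> u) / snd u" if "snd u > 0" for u y :: "real \<times> real"
    using that by (simp add: inner_prod_def field_simps)
  define v where "v = fst u / snd u"
  have v: "z \<bullet> (v, 1) \<le> y \<bullet> (v, 1)" if "y \<in> F" "z \<in> Q" for y z
    using u that unfolding v_def scale[OF u(2)] by (simp add: divide_right_mono)
  have FQ: "F \<subseteq> Q" using face by (rule face_of_imp_subset)
  show ?thesis
  proof (cases "aff_dim F = 1")
    case True
    then have "F \<noteq> {}" by auto
    then obtain y where y: "y \<in> F" by blast
    then have yQ: "y \<in> Q" using FQ by blast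
    have FT: "F \<subseteq> T v" using v FQ by (auto simp: T_def)
    have Tv: "T v = Q \<inter> {x. (v, 1) \<bullet> x = y \<bullet> (v, 1)}"
    proof (intro equalityI subsetI)
      fix x assume "x \<in> T v"
      then have "x \<in> Q" "y \<bullet> (v, 1) \<le> x \<bullet> (v, 1)" using yQ by (simp_all add: T_def)
      then show "x \<in> Q \<inter> {x. (v, 1) \<bullet> x = y \<bullet> (v, 1)}" using v[OF y, of x] by (simp add: inner_commute[of "(v, 1)"])
    next
      fix x assume "x \<in> Q \<inter> {x. (v, 1) \<bullet> x = y \<bullet> (v, 1)}"
      then show "x \<in> T v" using v[OF y] by (simp add: T_def inner_commute[of "(v, 1)"])
    qed
    have "(v, 1) \<bullet> x \<le> y \<bullet> (v, 1)" if "x \<in> Q" for x using v[OF y that] by (simp add: inner_commute)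
    then have "T v face_of Q" unfolding Tv
      by (intro face_of_Int_supporting_hyperplane_le polytope_imp_convex[OF Q])
    then have conv: "convex (T v)" by (rule face_of_imp_convex)
    \<comment> \<open>The set of maximisers lies on a line and has F as a face. An edge F has the
      same dimension, hence is the whole set.\<close>
    have "aff_dim (T v) \<le> aff_dim {x :: real \<times> real. (v, 1) \<bullet> x = y \<bullet> (v, 1)}"
      unfolding Tv by (rule aff_dim_subset) auto
    also have "\<dots> = 1" by (subst aff_dim_hyperplane) (auto simp: zero_prod_def)
    finally have "aff_dim (T v) \<le> aff_dim F" using True by simp
    moreover have "F face_of T v" using face FT by (rule face_of_subset) (auto simp: T_def)
    ultimately have "F = T v" using face_of_aff_dim_lt[OF conv] by fastforce
    then show ?thesis unfolding T_def by blast
  next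
    case False
    then obtain y where y: "F = {y}" using dim aff_dim_eq_0 by blast
    obtain a b where ab: "Q \<subseteq> {x. a \<bullet> x \<le> b}" "F = Q \<inter> {x. a \<bullet> x = b}"
      using exposed_face_of_polyhedron[OF polytope_imp_polyhedron[OF Q]] face unfolding exposed_face_of_def by blast
    \<comment> \<open>Small enough for adding \<open>e *\<^sub>R a\<close> to leave the second
      coordinate of the normal positive.\<close>
    define e where "e = 1 / (1 + \<bar>snd a\<bar>)"
    have e: "e > 0" "e * \<bar>snd a\<bar> < 1" by (auto simp: e_def divide_simps)
    define u' where "u' = (v, 1) + e *\<^sub>R a"
    have "\<bar>e * snd a\<bar> < 1" using e by (simp add: abs_mult)
    then have su: "snd u' > 0" by (simp add: u'_def)
    have lt: "q \<bullet> u' < y \<bullet> u'" if "q \<in> Q" "q \<noteq> y" for q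
    proof -
      have "a \<bullet> q \<le> b" "a \<bullet> q \<noteq> b" "a \<bullet> y = b" using ab that y by auto
      then have "e * (q \<bullet> a) < e * (y \<bullet> a)" using e(1) by (simp add: inner_commute)
      then show ?thesis using v[of y q] y that by (simp add: u'_def inner_add_right)
    qed
    define v' where "v' = fst u' / snd u'"
    have "q \<bullet> (v', 1) < y \<bullet> (v', 1)" if "q \<in> Q" "q \<noteq> y" for q
      using lt[OF that] su unfolding v'_def scale[OF su] by (simp add: divide_strict_right_mono)
    then have "T v' = {y}" using y FQ unfolding T_def by (fastforce simp: not_le[symmetric])
    then show ?thesis using y unfolding T_def by blast
  qed
qed

text \<open>The preimage of a set of maximisers in the polygon is the corresponding
  \<open>top_face\<close>. Excluding P itself expresses that faces are proper, since a set of
  maximisers is the whole polygon only if its preimage is P.\<close>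

lemma coherent_path_eq:
  fixes z :: "'i \<Rightarrow> 'a::euclidean_space"
  assumes "finite I" "I \<noteq> {}"
  defines "P \<equiv> convex hull (z ` I)"
  shows "coherent_path P c w = {top_face P c w v | v. top_face P c w v \<noteq> P}"
proof -
  let ?Q = "shadow_polygon P c w"
  define T where "T v = {q \<in> ?Q. \<forall>y\<in>?Q. y \<bullet> (v, 1) \<le> q \<bullet> (v, 1)}" for v :: real
  have polP: "polytope P" unfolding P_def using assms(1) by (simp add: polytope_convex_hull)
  have polQ: "polytope ?Q" using polP by (rule polytope_linear_image[OF linear_plane_map])
  have pre: "P \<inter> plane_map c w -` T v = top_face P c w v" for v
    by (auto simp: T_def top_face_def elevation_eq)
  have sub: "T v \<noteq> ?Q" if "top_face P c w v \<noteq> P" for v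
    using that unfolding pre[symmetric] by auto
  show ?thesis
  proof (intro equalityI subsetI)
    fix G assume "G \<in> coherent_path P c w"
    then obtain F where F: "upper_face ?Q F" "G = P \<inter> plane_map c w -` F" by (auto simp: coherent_path_def)
    obtain v where v: "F = T v" using upper_face_maximisers[OF polQ F(1)] unfolding T_def by blast
    have G: "G = top_face P c w v" using F(2) v pre by simp
    moreover have "G \<noteq> P"
    proof
      assume "G = P"
      then have "plane_map c w x \<in> F" if "x \<in> P" for x using F(2) that by blast
      then have "?Q \<subseteq> F" by blast
      moreover have "F \<subseteq> ?Q" "F \<noteq> ?Q" using F(1) face_of_imp_subset by (auto simp: upper_face_def)
      ultimately show False by auto
    qed
    ultimately show "G \<in> {top_face P c w v | v. top_face P c w v \<noteq> P}" by blast
  next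
    fix G assume "G \<in> {top_face P c w v | v. top_face P c w v \<noteq> P}"
    then obtain v where v: "G = top_face P c w v" "G \<noteq> P" by blast
    obtain i where i: "i \<in> top_indices I c w z v" using top_indices_nonempty[OF assms(1,2)] by blast
    have "z i \<in> top_face P c w v" using i assms(1) unfolding P_def
      by (subst top_face_iff) (auto simp: top_indices_def)
    then have y: "plane_map c w (z i) \<in> T v" using pre[of v] by auto
    define y where "y = plane_map c w (z i)"
    have Tv: "T v = ?Q \<inter> {x. (v, 1) \<bullet> x = y \<bullet> (v, 1)}"
      using y unfolding y_def[symmetric] by (auto simp: T_def inner_commute intro: antisym)
    have le: "x \<bullet> (v, 1) \<le> y \<bullet> (v, 1)" if "x \<in> ?Q" for x using y that by (auto simp: T_def y_def)
    have face: "T v face_of ?Q" unfolding Tv using le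
      by (intro face_of_Int_supporting_hyperplane_le polytope_imp_convex[OF polQ]) (auto simp: inner_commute)
    have "aff_dim (T v) \<le> aff_dim {x :: real \<times> real. (v, 1) \<bullet> x = y \<bullet> (v, 1)}"
      unfolding Tv by (rule aff_dim_subset) auto
    also have "\<dots> = 1" by (subst aff_dim_hyperplane) (auto simp: zero_prod_def)
    finally have "aff_dim (T v) \<le> 1" .
    moreover have "aff_dim (T v) \<noteq> -1" using y by (metis aff_dim_empty empty_iff)
    moreover have "-1 \<le> aff_dim (T v)" by (rule aff_dim_geq)
    ultimately have "aff_dim (T v) = 0 \<or> aff_dim (T v) = 1" by linarith
    moreover have "outer_normal ?Q (T v) (v, 1)" by (auto simp: outer_normal_def T_def zero_prod_def)
    moreover have "T v \<noteq> ?Q" using sub[of v] v by simp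
    ultimately have "upper_face ?Q (T v)"
      unfolding upper_face_def using face by (intro conjI exI[of _ "(v, 1)"]) simp_all
    then show "G \<in> coherent_path P c w" using v pre[of v] by (auto simp: coherent_path_def)
  qed
qed

text \<open>A face determines its index set, namely the indices of the points that it contains.
  Counting index sets instead of faces keeps the family of candidates fixed and finite when the
  points vary, which serves measurability.\<close>

lemma path_length_eq_card:
  assumes "finite I" "I \<noteq> {}"
  shows "path_length (convex hull (z ` I)) c w =
    card {S \<in> Pow I. (\<exists>v. top_indices I c w z v = S) \<and> S \<noteq> I \<and> aff_dim (z ` S) = 1}"
proof -
  let ?P = "convex hull (z ` I)"
  let ?A = "{S \<in> Pow I. (\<exists>v. top_indices I c w z v = S) \<and> S \<noteq> I \<and> aff_dim (z ` S) = 1}"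
  let ?S = "top_indices I c w z"
  have TI: "?S v \<subseteq> I" for v by (auto simp: top_indices_def)
  have recover: "?S v = {k \<in> I. z k \<in> convex hull (z ` ?S v)}" for v
    unfolding top_face_convex_hull[OF assms, symmetric] using top_face_iff[OF assms(1)] TI by blast
  have neq: "top_face ?P c w v \<noteq> ?P \<longleftrightarrow> ?S v \<noteq> I" for v
  proof
    assume "top_face ?P c w v \<noteq> ?P" then show "?S v \<noteq> I" by (auto simp: top_face_convex_hull[OF assms])
  next
    assume n: "?S v \<noteq> I"
    show "top_face ?P c w v \<noteq> ?P"
    proof
      assume "top_face ?P c w v = ?P"
      then have "\<forall>k\<in>I. z k \<in> top_face ?P c w v" by (auto intro: hull_inc)
      then show False using n TI top_face_iff[OF assms(1)] by blast
    qed
  qed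
  have edge: "top_face ?P c w v edge_of ?P \<longleftrightarrow> aff_dim (z ` ?S v) = 1" for v
  proof -
    have "top_face ?P c w v \<noteq> {}"
      using top_indices_nonempty[OF assms, of c w z v] by (auto simp: top_face_convex_hull[OF assms])
    then have "top_face ?P c w v face_of ?P" by (intro top_face_face_of) auto
    then show ?thesis by (simp add: edge_of_def top_face_convex_hull[OF assms] aff_dim_convex_hull)
  qed
  have "{G \<in> coherent_path ?P c w. G edge_of ?P} = (\<lambda>S. convex hull (z ` S)) ` ?A"
  proof (intro equalityI subsetI)
    fix G assume "G \<in> {G \<in> coherent_path ?P c w. G edge_of ?P}"
    then obtain v where "G = top_face ?P c w v" "G \<noteq> ?P" "G edge_of ?P"
      by (auto simp: coherent_path_eq[OF assms])
    then show "G \<in> (\<lambda>S. convex hull (z ` S)) ` ?A"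
      using neq[of v] edge[of v] TI[of v] by (intro image_eqI[where x="?S v"]) (auto simp: top_face_convex_hull[OF assms])
  next
    fix G assume "G \<in> (\<lambda>S. convex hull (z ` S)) ` ?A"
    then obtain v where v: "G = convex hull (z ` ?S v)" "?S v \<noteq> I" "aff_dim (z ` ?S v) = 1" by auto
    then have "G = top_face ?P c w v" by (simp add: top_face_convex_hull[OF assms])
    then show "G \<in> {G \<in> coherent_path ?P c w. G edge_of ?P}"
      using neq[of v] edge[of v] v by (auto simp: coherent_path_eq[OF assms])
  qed
  moreover have "inj_on (\<lambda>S. convex hull (z ` S)) ?A"
  proof (rule inj_onI)
    have r: "S = {k \<in> I. z k \<in> convex hull (z ` S)}" if S: "S \<in> ?A" for S
    proof -
      obtain v where "?S v = S" using S by blast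
      then show ?thesis using recover[of v] by simp
    qed
    fix S S' assume "S \<in> ?A" "S' \<in> ?A" "convex hull (z ` S) = convex hull (z ` S')"
    then show "S = S'" using r[of S] r[of S'] by metis
  qed
  ultimately show ?thesis unfolding path_length_def by (simp add: card_image)
qed

section \<open>Measurability of the path length\<close>

lemma top_indices_eq_iff:
  assumes "S \<noteq> {}" "S \<subseteq> I"
  shows "top_indices I c w z v = S \<longleftrightarrow> (\<forall>i\<in>S. \<forall>j\<in>S. elevation c w v (z i) = elevation c w v (z j)) \<and>
    (\<forall>i\<in>S. \<forall>k\<in>I - S. elevation c w v (z k) < elevation c w v (z i))" (is "?L \<longleftrightarrow> ?R")
proof
  assume ?L
  show ?R
  proof (intro conjI ballI)
    fix i j assume "i \<in> S" "j \<in> S"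
    then show "elevation c w v (z i) = elevation c w v (z j)"
      using \<open>?L\<close>[symmetric] by (auto simp: top_indices_def intro: antisym)
  next
    fix i k assume i: "i \<in> S" and k: "k \<in> I - S"
    then have "k \<notin> top_indices I c w z v" using \<open>?L\<close> by simp
    then obtain l where "l \<in> I" "elevation c w v (z k) < elevation c w v (z l)"
      using k by (auto simp: top_indices_def not_le)
    moreover have "elevation c w v (z l) \<le> elevation c w v (z i)"
      using i \<open>?L\<close>[symmetric] \<open>l \<in> I\<close> by (simp add: top_indices_def)
    ultimately show "elevation c w v (z k) < elevation c w v (z i)" by simp
  qed
next
  assume R: ?R
  obtain s where s: "s \<in> S" using assms by blast
  have le: "elevation c w v (z k) \<le> elevation c w v (z i)" if "i \<in> S" "k \<in> I" for i k
  proof (cases "k \<in> S")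
    case True
    then have "elevation c w v (z k) = elevation c w v (z i)" using R that by blast
    then show ?thesis by simp
  next
    case False
    then have "elevation c w v (z k) < elevation c w v (z i)" using R that by blast
    then show ?thesis by simp
  qed
  have nle: "\<not> elevation c w v (z s) \<le> elevation c w v (z k)" if "k \<in> I - S" for k
    using R s that unfolding not_le by blast
  show ?L using assms(2) le nle s unfolding top_indices_def by blast
qed

text \<open>If the index set \<open>S\<close> of maximisers contains two points with different first coordinates, they
  determine \<open>v\<close>; otherwise the admissible \<open>v\<close> form an open set. Hence countably many \<open>v\<close> suffice.\<close>

lemma ex_top_indices_iff:
  assumes "finite I" "S \<noteq> {}" "S \<subseteq> I"
  shows "(\<exists>v. top_indices I c w z v = S) \<longleftrightarrow>
    (\<exists>q::rat. top_indices I c w z (of_rat q) = S) \<or>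
    (\<exists>i\<in>S. \<exists>j\<in>S. top_indices I c w z (- ((z i - z j) \<bullet> w) / ((z i - z j) \<bullet> c)) = S)"
proof (intro iffI)
  assume "\<exists>v. top_indices I c w z v = S"
  then obtain v where v: "top_indices I c w z v = S" by blast
  note R = v[unfolded top_indices_eq_iff[OF assms(2,3)]]
  show "(\<exists>q::rat. top_indices I c w z (of_rat q) = S) \<or>
    (\<exists>i\<in>S. \<exists>j\<in>S. top_indices I c w z (- ((z i - z j) \<bullet> w) / ((z i - z j) \<bullet> c)) = S)"
  proof (cases "\<exists>i\<in>S. \<exists>j\<in>S. (z i - z j) \<bullet> c \<noteq> 0")
    case True
    then obtain i j where ij: "i \<in> S" "j \<in> S" "(z i - z j) \<bullet> c \<noteq> 0" by blast
    have "elevation c w v (z i) = elevation c w v (z j)" using R ij by blast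
    then have "v * ((z i - z j) \<bullet> c) + (z i - z j) \<bullet> w = 0"
      by (simp add: elevation_def inner_diff_left algebra_simps)
    then have "v = - ((z i - z j) \<bullet> w) / ((z i - z j) \<bullet> c)"
      using ij(3) by (simp add: field_simps)
    then show ?thesis using v ij by blast
  next
    case False
    obtain s where s: "s \<in> S" using assms(2) by blast
    have same: "z i \<bullet> c = z s \<bullet> c" "z i \<bullet> w = z s \<bullet> w" if "i \<in> S" for i
    proof -
      have "(z i - z s) \<bullet> c = 0" using False that s by blast
      then show c: "z i \<bullet> c = z s \<bullet> c" by (simp add: inner_diff_left)
      have "elevation c w v (z i) = elevation c w v (z s)" using R that s by blast
      then show "z i \<bullet> w = z s \<bullet> w" using c by (simp add: elevation_def)
    qed
    have "eventually (\<lambda>v'. \<forall>k\<in>I - S. elevation c w v' (z k) < elevation c w v' (z s)) (at_right v)"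
    proof (rule eventually_ball_finite)
      show "\<forall>k\<in>I - S. eventually (\<lambda>v'. elevation c w v' (z k) < elevation c w v' (z s)) (at_right v)"
      proof
        fix k assume k: "k \<in> I - S"
        have "((\<lambda>v'. elevation c w v' (z s) - elevation c w v' (z k)) \<longlongrightarrow> elevation c w v (z s) - elevation c w v (z k)) (at_right v)"
          unfolding elevation_def by (intro tendsto_intros)
        moreover have "elevation c w v (z k) < elevation c w v (z s)" using R s k by blast
        then have "0 < elevation c w v (z s) - elevation c w v (z k)" by simp
        ultimately have "eventually (\<lambda>v'. 0 < elevation c w v' (z s) - elevation c w v' (z k)) (at_right v)"
          by (rule order_tendstoD)
        then show "eventually (\<lambda>v'. elevation c w v' (z k) < elevation c w v' (z s)) (at_right v)"
          by (rule eventually_mono) simp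
      qed
    qed (use assms(1) in simp)
    then obtain b where b: "b > v" "\<And>v'. v < v' \<Longrightarrow> v' < b \<Longrightarrow> \<forall>k\<in>I - S. elevation c w v' (z k) < elevation c w v' (z s)"
      by (auto simp: eventually_at_right_field)
    obtain q where q: "v < of_rat q" "of_rat q < b" using of_rat_dense[OF b(1)] by blast
    have eqv: "elevation c w v' (z i) = elevation c w v' (z s)" if "i \<in> S" for i v'
      using same[OF that] by (simp add: elevation_def)
    have "top_indices I c w z (of_rat q) = S"
      unfolding top_indices_eq_iff[OF assms(2,3)] using b(2)[OF q] eqv by auto
    then show ?thesis by blast
  qed
qed blast

text \<open>Collinearity appears as equality in the Cauchy-Schwarz inequality, so the condition
  consists of finitely many equations between measurable functions.\<close>

lemma aff_dim_image_eq_1_iff: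
  fixes z :: "'i \<Rightarrow> 'a::euclidean_space"
  shows "aff_dim (z ` S) = 1 \<longleftrightarrow> (\<exists>i\<in>S. \<exists>j\<in>S. z i \<noteq> z j \<and>
    (\<forall>k\<in>S. \<bar>(z i - z j) \<bullet> (z k - z j)\<bar> = norm (z i - z j) * norm (z k - z j)))"
proof -
  have col: "collinear (z ` S) \<longleftrightarrow> (\<forall>k\<in>S. \<bar>(z i - z j) \<bullet> (z k - z j)\<bar> = norm (z i - z j) * norm (z k - z j))"
    if "i \<in> S" "j \<in> S" "z i \<noteq> z j" for i j
  proof -
    have "z ` S = insert (z i) (insert (z j) (z ` S))" using that by auto
    then have "collinear (z ` S) \<longleftrightarrow> (\<forall>k\<in>S. collinear {z i, z j, z k})"
      using collinear_triples[OF that(3), of "z ` S"] by simp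
    then show ?thesis by (simp add: norm_cauchy_schwarz_equal collinear_3[of "z i" "z j"])
  qed
  have "aff_dim (z ` S) = 1 \<longleftrightarrow> collinear (z ` S) \<and> (\<exists>i\<in>S. \<exists>j\<in>S. z i \<noteq> z j)"
  proof
    assume d: "aff_dim (z ` S) = 1"
    have "\<exists>i\<in>S. \<exists>j\<in>S. z i \<noteq> z j"
    proof (rule ccontr)
      assume n: "\<not> (\<exists>i\<in>S. \<exists>j\<in>S. z i \<noteq> z j)"
      have "S \<noteq> {}" using d by auto
      then obtain i where "i \<in> S" by blast
      then have "z ` S = {z i}" using n by blast
      then show False using d by simp
    qed
    then show "collinear (z ` S) \<and> (\<exists>i\<in>S. \<exists>j\<in>S. z i \<noteq> z j)" using d by (simp add: collinear_aff_dim)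
  next
    assume r: "collinear (z ` S) \<and> (\<exists>i\<in>S. \<exists>j\<in>S. z i \<noteq> z j)"
    then obtain i j where ij: "i \<in> S" "j \<in> S" "z i \<noteq> z j" by blast
    have "1 = aff_dim {z i, z j}" using ij by (simp add: aff_dim_2)
    also have "\<dots> \<le> aff_dim (z ` S)" using ij by (intro aff_dim_subset) auto
    finally show "aff_dim (z ` S) = 1" using r by (simp add: collinear_aff_dim)
  qed
  then show ?thesis using col by blast
qed

text \<open>The length is a sum of indicators over the subsets of I. By
  \<open>ex_top_indices_iff\<close> each of them is a countable combination of comparisons, even
  though the existential over v is uncountable.\<close>

lemma path_length_measurable:
  fixes c w :: "'b \<Rightarrow> 'a::euclidean_space" and z :: "'b \<Rightarrow> 'i \<Rightarrow> 'a"
  assumes I: "finite I" "I \<noteq> {}"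
    and [measurable]: "c \<in> borel_measurable N" "w \<in> borel_measurable N"
    and z: "\<And>i. i \<in> I \<Longrightarrow> (\<lambda>x. z x i) \<in> borel_measurable N"
  shows "(\<lambda>x. real (path_length (convex hull (z x ` I)) (c x) (w x))) \<in> borel_measurable N"
proof -
  let ?good = "\<lambda>S x. (\<exists>v. top_indices I (c x) (w x) (z x) v = S) \<and> S \<noteq> I \<and> aff_dim (z x ` S) = 1"
  have el: "(\<lambda>x. elevation (c x) (w x) (v x) (z x i)) \<in> borel_measurable N"
    if [measurable]: "v \<in> borel_measurable N" and i: "i \<in> I" for v i
    unfolding elevation_def using z[OF i] by measurable
  have eqm: "Measurable.pred N (\<lambda>x. f x = g x)" and ltm: "Measurable.pred N (\<lambda>x. f x < g x)"
    if [measurable]: "f \<in> borel_measurable N" "g \<in> borel_measurable N" for f g :: "'b \<Rightarrow> real"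
    by measurable
  have top: "Measurable.pred N (\<lambda>x. top_indices I (c x) (w x) (z x) (v x) = S)"
    if v: "v \<in> borel_measurable N" and S: "S \<noteq> {}" "S \<subseteq> I" for v S
  proof -
    have fS: "finite S" "finite (I - S)" using I(1) S(2) finite_subset by auto
    show ?thesis
      unfolding top_indices_eq_iff[OF S]
      using el[OF v] S(2) fS
      by (intro pred_intros_logic pred_intros_finite eqm ltm) auto
  qed
  have good: "Measurable.pred N (?good S)" if S: "S \<in> Pow I" for S
  proof (cases "S = {}")
    case False
    have fS: "finite S" and SI: "S \<subseteq> I" using S I finite_subset by auto
    have [measurable]: "(\<lambda>x. z x i) \<in> borel_measurable N" if "i \<in> S" for i using z SI that by auto
    have slope: "(\<lambda>x. - ((z x i - z x j) \<bullet> w x) / ((z x i - z x j) \<bullet> c x)) \<in> borel_measurable N" if "i \<in> S" "j \<in> S" for i j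
      using that by measurable
    have col: "Measurable.pred N (\<lambda>x. z x i \<noteq> z x j)"
       "Measurable.pred N (\<lambda>x. \<bar>(z x i - z x j) \<bullet> (z x k - z x j)\<bar> = norm (z x i - z x j) * norm (z x k - z x j))"
      if "i \<in> S" "j \<in> S" "k \<in> S" for i j k
      using that by measurable
    show ?thesis
      unfolding aff_dim_image_eq_1_iff ex_top_indices_iff[OF I(1) False SI]
      using fS
      by (intro pred_intros_logic pred_intros_finite pred_intros_countable top slope col False SI borel_measurable_const) auto
  qed simp
  have fin: "finite (Pow I)" using I(1) by simp
  have "real (path_length (convex hull (z x ` I)) (c x) (w x)) = (\<Sum>S\<in>Pow I. of_bool (?good S x))" for x
    using fin by (simp add: path_length_eq_card[OF I] Int_def)
  moreover have "(\<lambda>x. \<Sum>S\<in>Pow I. of_bool (?good S x) :: real) \<in> borel_measurable N"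
    using good unfolding of_bool_def by (intro borel_measurable_sum measurable_If borel_measurable_const) auto
  ultimately show ?thesis by simp
qed

section \<open>General position and the reduction to the planar law\<close>

definition planar_generic :: "'i set \<Rightarrow> ('i \<Rightarrow> real \<times> real) \<Rightarrow> bool" where
  "planar_generic I x \<longleftrightarrow> (\<forall>i\<in>I. \<forall>j\<in>I. i \<noteq> j \<longrightarrow> fst (x i) \<noteq> fst (x j)) \<and>
    (\<forall>i\<in>I. \<forall>j\<in>I. \<forall>k\<in>I. i \<noteq> j \<longrightarrow> k \<noteq> i \<longrightarrow> k \<noteq> j \<longrightarrow>
      (fst (x j) - fst (x i)) * (snd (x k) - snd (x i)) \<noteq> (snd (x j) - snd (x i)) * (fst (x k) - fst (x i)))"

text \<open>In general position a set of maximisers spanning a segment consists of exactly two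
  points, and v is their negated slope. With only two points the edge would be the whole polygon,
  hence improper; this is excluded by \<open>3 \<le> card I\<close>.\<close>

lemma path_length_generic:
  fixes z :: "'i \<Rightarrow> 'a::euclidean_space"
  assumes I: "finite I" "3 \<le> card I" and gen: "planar_generic I (\<lambda>k. plane_map c w (z k))"
  shows "path_length (convex hull (z ` I)) c w = upper_edges I (\<lambda>k. plane_map c w (z k))"
proof -
  have ne: "I \<noteq> {}" using I by auto
  let ?x = "\<lambda>k. plane_map c w (z k)"
  let ?A = "{S \<in> Pow I. (\<exists>v. top_indices I c w z v = S) \<and> S \<noteq> I \<and> aff_dim (z ` S) = 1}"
  have fx: "fst (?x k) = z k \<bullet> c" "snd (?x k) = z k \<bullet> w" for k by (simp_all add: plane_map_def)
  have inj: "z i \<bullet> c \<noteq> z j \<bullet> c" if "i \<in> I" "j \<in> I" "i \<noteq> j" for i j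
    using gen that by (simp add: planar_generic_def fx)
  have line: "(z j \<bullet> c - z i \<bullet> c) * (z k \<bullet> w - z i \<bullet> w) \<noteq> (z j \<bullet> w - z i \<bullet> w) * (z k \<bullet> c - z i \<bullet> c)"
    if "i \<in> I" "j \<in> I" "k \<in> I" "i \<noteq> j" "k \<noteq> i" "k \<noteq> j" for i j k
    using gen that by (simp add: planar_generic_def fx)
  \<comment> \<open>If i and j have equal elevation for v, the orientation determinant of i, j, k is
    the horizontal distance of i and j times the elevation of k above them.\<close>
  have key: "(z j \<bullet> c - z i \<bullet> c) * (z k \<bullet> w - z i \<bullet> w) - (z j \<bullet> w - z i \<bullet> w) * (z k \<bullet> c - z i \<bullet> c)
      = (z j \<bullet> c - z i \<bullet> c) * (elevation c w v (z k) - elevation c w v (z i))"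
    if "elevation c w v (z i) = elevation c w v (z j)" for i j k v
  proof -
    have "z j \<bullet> w - z i \<bullet> w = - v * (z j \<bullet> c - z i \<bullet> c)" using that by (simp add: elevation_def algebra_simps)
    then show ?thesis by (simp only: elevation_def) (simp add: algebra_simps)
  qed
  have "?A = (\<lambda>(i, j). {i, j}) ` {(i, j). upper_edge I ?x i j}"
  proof (intro equalityI subsetI)
    fix S assume "S \<in> ?A"
    then obtain v where v: "top_indices I c w z v = S" and SI: "S \<subseteq> I" and d: "aff_dim (z ` S) = 1" by blast
    obtain i' j' where "i' \<in> S" "j' \<in> S" "z i' \<noteq> z j'" using d by (auto simp: aff_dim_image_eq_1_iff)
    moreover from this have "i' \<noteq> j'" by auto
    ultimately obtain i j where ij: "i \<in> S" "j \<in> S" "z i \<bullet> c < z j \<bullet> c"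
      using inj[of i' j'] SI by (metis linorder_neqE_linordered_idom subsetD)
    then have ij': "i \<in> I" "j \<in> I" "i \<noteq> j" using SI by auto
    have "S \<noteq> {}" using ij by auto
    note R = v[unfolded top_indices_eq_iff[OF this SI]]
    have e: "elevation c w v (z i) = elevation c w v (z j)" using R ij by blast
    have S: "S = {i, j}"
    proof (rule ccontr)
      assume "S \<noteq> {i, j}"
      then obtain k where k: "k \<in> S" "k \<noteq> i" "k \<noteq> j" using ij by blast
      have "elevation c w v (z k) = elevation c w v (z i)" using R k ij by blast
      then show False using key[OF e, of k] line[of i j k] ij' k SI by auto
    qed
    have "upper_edge I ?x i j"
      unfolding upper_edge_def below_def fx
    proof (intro conjI ballI ij' ij(3))
      fix k assume k: "k \<in> I - {i, j}"
      then have "elevation c w v (z k) < elevation c w v (z i)" using R ij(1) S by blast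
      then have "elevation c w v (z k) - elevation c w v (z i) < 0" by simp
      then have "(z j \<bullet> c - z i \<bullet> c) * (elevation c w v (z k) - elevation c w v (z i)) < 0"
        using ij(3) by (intro mult_pos_neg) auto
      then show "(z j \<bullet> c - z i \<bullet> c) * (z k \<bullet> w - z i \<bullet> w) < (z j \<bullet> w - z i \<bullet> w) * (z k \<bullet> c - z i \<bullet> c)"
        using key[OF e, of k] by linarith
    qed
    then show "S \<in> (\<lambda>(i, j). {i, j}) ` {(i, j). upper_edge I ?x i j}" using S by auto
  next
    fix S assume "S \<in> (\<lambda>(i, j). {i, j}) ` {(i, j). upper_edge I ?x i j}"
    then obtain i j where S: "S = {i, j}" and u: "upper_edge I ?x i j" by auto
    have ij: "i \<in> I" "j \<in> I" "z i \<bullet> c < z j \<bullet> c" using u by (simp_all add: upper_edge_def fx)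
    define v where "v = - (z j \<bullet> w - z i \<bullet> w) / (z j \<bullet> c - z i \<bullet> c)"
    have "v * (z j \<bullet> c - z i \<bullet> c) = - (z j \<bullet> w - z i \<bullet> w)" using ij(3) by (simp add: v_def)
    then have e: "elevation c w v (z i) = elevation c w v (z j)" by (simp add: elevation_def algebra_simps)
    have SI: "S \<subseteq> I" "S \<noteq> {}" using S ij by auto
    have lt: "elevation c w v (z k) < elevation c w v (z i)" if "k \<in> I - S" for k
    proof -
      have "below (?x i) (?x j) (?x k)" using u that S by (simp add: upper_edge_def)
      then have "(z j \<bullet> c - z i \<bullet> c) * (elevation c w v (z k) - elevation c w v (z i)) < 0"
        using key[OF e, of k] by (simp add: below_def fx)
      then show ?thesis using ij(3) by (simp add: mult_less_0_iff)
    qed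
    have "top_indices I c w z v = S"
      unfolding top_indices_eq_iff[OF SI(2,1)]
    proof (intro conjI ballI)
      show "elevation c w v (z p) = elevation c w v (z q)" if "p \<in> S" "q \<in> S" for p q using that S e by auto
      show "elevation c w v (z k) < elevation c w v (z p)" if "p \<in> S" "k \<in> I - S" for p k using that S e lt[of k] by auto
    qed
    moreover have "card S \<le> 2" unfolding S by (simp add: card_insert_if)
    then have "S \<noteq> I" using I by auto
    moreover have "aff_dim (z ` S) = 1" using ij(3) by (auto simp: S aff_dim_2)
    ultimately show "S \<in> ?A" using SI by blast
  qed
  moreover have "inj_on (\<lambda>(i, j). {i, j}) {(i, j). upper_edge I ?x i j}"
    by (auto simp: inj_on_def upper_edge_def doubleton_eq_iff)
  ultimately show ?thesis
    unfolding path_length_eq_card[OF I(1) ne] upper_edges_def by (simp add: card_image)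
qed

text \<open>A triangular map with positive diagonal keeps the order of the first coordinates and
  multiplies every orientation determinant by \<alpha> * \<beta> > 0. Orthonormalising the two
  vectors is such a map on the plane.\<close>

lemma upper_edges_affine:
  assumes xy: "\<And>k. k \<in> I \<Longrightarrow> fst (x k) = \<alpha> * fst (y k)" "\<And>k. k \<in> I \<Longrightarrow> snd (x k) = \<gamma> * fst (y k) + \<beta> * snd (y k)"
    and pos: "0 < \<alpha>" "0 < \<beta>"
  shows "upper_edges I x = upper_edges I y" and "planar_generic I x = planar_generic I y"
proof -
  have d: "(fst (x q) - fst (x p)) * (snd (x r) - snd (x p)) - (snd (x q) - snd (x p)) * (fst (x r) - fst (x p))
    = (\<alpha> * \<beta>) * ((fst (y q) - fst (y p)) * (snd (y r) - snd (y p)) - (snd (y q) - snd (y p)) * (fst (y r) - fst (y p)))"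
    if "p \<in> I" "q \<in> I" "r \<in> I" for p q r
    using that by (simp add: xy algebra_simps)
  have ab: "0 < \<alpha> * \<beta>" using pos by simp
  have 1: "fst (x p) < fst (x q) \<longleftrightarrow> fst (y p) < fst (y q)" "fst (x p) = fst (x q) \<longleftrightarrow> fst (y p) = fst (y q)"
    if "p \<in> I" "q \<in> I" for p q
    using xy(1) pos that by simp_all
  have lt: "a < b \<longleftrightarrow> a' < b'" and eq: "a = b \<longleftrightarrow> a' = b'" if "a - b = (\<alpha> * \<beta>) * (a' - b')" for a b a' b' :: real
  proof -
    have "a < b \<longleftrightarrow> (\<alpha> * \<beta>) * (a' - b') < 0" "a = b \<longleftrightarrow> (\<alpha> * \<beta>) * (a' - b') = 0" using that by auto
    then show "a < b \<longleftrightarrow> a' < b'" "a = b \<longleftrightarrow> a' = b'" using pos ab by (auto simp: mult_less_0_iff)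
  qed
  have "below (x p) (x q) (x r) = below (y p) (y q) (y r)" if "p \<in> I" "q \<in> I" "r \<in> I" for p q r
    unfolding below_def by (rule lt[OF d[OF that]])
  then have "upper_edge I x p q = upper_edge I y p q" for p q
    unfolding upper_edge_def by (metis 1(1) DiffD1)
  then show "upper_edges I x = upper_edges I y" by (simp add: upper_edges_def)
  show "planar_generic I x = planar_generic I y"
    unfolding planar_generic_def by (intro conj_cong ball_cong refl imp_cong arg_cong[where f=Not] 1(2) eq[OF d])
qed

context planar_beta
begin

lemma AE_not_on_line:
  assumes "a \<noteq> 0"
  shows "AE z in \<nu>. a * (snd z - s) \<noteq> b * (fst z - t)"
proof -
  have "(\<integral>\<^sup>+z. indicator {z. a * (snd z - s) = b * (fst z - t)} z \<partial>\<nu>)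
      = (\<integral>\<^sup>+x. \<integral>\<^sup>+y. radial_density d c (x\<^sup>2 + y\<^sup>2) * indicator {z. a * (snd z - s) = b * (fst z - t)} (x, y) \<partial>lborel \<partial>lborel)"
    by (rule nn_integral_nu) measurable
  also have "\<dots> = (\<integral>\<^sup>+(x::real). 0 \<partial>lborel)"
  proof (rule nn_integral_cong)
    fix x :: real
    have "AE y in lborel. y \<noteq> s + b * (x - t) / a" by (rule AE_lborel_singleton)
    then have "AE y in lborel. radial_density d c (x\<^sup>2 + y\<^sup>2) * indicator {z. a * (snd z - s) = b * (fst z - t)} (x, y) = 0"
      by eventually_elim (use assms in \<open>auto simp: indicator_def field_simps\<close>)
    then have "(\<integral>\<^sup>+y. radial_density d c (x\<^sup>2 + y\<^sup>2) * indicator {z. a * (snd z - s) = b * (fst z - t)} (x, y) \<partial>lborel) = (\<integral>\<^sup>+(y::real). 0 \<partial>lborel)"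
      by (rule nn_integral_cong_AE)
    then show "(\<integral>\<^sup>+y. radial_density d c (x\<^sup>2 + y\<^sup>2) * indicator {z. a * (snd z - s) = b * (fst z - t)} (x, y) \<partial>lborel) = 0" by simp
  qed
  also have "\<dots> = 0" by simp
  finally have "AE z in \<nu>. indicator {z. a * (snd z - s) = b * (fst z - t)} z = (0 :: ennreal)"
    by (subst (asm) nn_integral_0_iff_AE) auto
  then show ?thesis by eventually_elim (auto simp: indicator_def split: if_splits)
qed

text \<open>Fubini's theorem in the k-th coordinate: almost sure properties may be checked with all
  other points fixed.\<close>

lemma AE_PiM_fun_updI:
  assumes I: "finite I" "k \<in> I" and Q: "Measurable.pred (Pi\<^sub>M I (\<lambda>_. \<nu>)) Q"
    and AE: "\<And>x. AE y in \<nu>. Q (x(k := y))"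
  shows "AE x in Pi\<^sub>M I (\<lambda>_. \<nu>). Q x"
proof -
  interpret product_sigma_finite "\<lambda>_. \<nu>" by standard
  have I': "I = insert k (I - {k})" using I by auto
  let ?f = "\<lambda>x. if Q x then 0 else 1 :: ennreal"
  have m: "?f \<in> borel_measurable (Pi\<^sub>M I (\<lambda>_. \<nu>))" using Q by measurable
  have "(\<integral>\<^sup>+x. ?f x \<partial>Pi\<^sub>M I (\<lambda>_. \<nu>)) = (\<integral>\<^sup>+x. \<integral>\<^sup>+y. ?f (x(k := y)) \<partial>\<nu> \<partial>Pi\<^sub>M (I - {k}) (\<lambda>_. \<nu>))"
    using product_nn_integral_insert[of "I - {k}" k ?f] m I I'[symmetric] by simp
  also have "\<dots> = (\<integral>\<^sup>+x. 0 \<partial>Pi\<^sub>M (I - {k}) (\<lambda>_. \<nu>))"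
  proof (rule nn_integral_cong)
    fix x
    have "(\<integral>\<^sup>+y. ?f (x(k := y)) \<partial>\<nu>) = (\<integral>\<^sup>+y. 0 \<partial>\<nu>)"
      by (rule nn_integral_cong_AE) (use AE[of x] in \<open>auto elim!: eventually_mono\<close>)
    then show "(\<integral>\<^sup>+y. ?f (x(k := y)) \<partial>\<nu>) = 0" by simp
  qed
  also have "\<dots> = 0" by simp
  finally have "AE x in Pi\<^sub>M I (\<lambda>_. \<nu>). ?f x = 0" using m by (subst (asm) nn_integral_0_iff_AE) auto
  then show ?thesis by eventually_elim (auto split: if_splits)
qed

lemma AE_planar_generic:
  assumes I: "finite I"
  shows "AE x in Pi\<^sub>M I (\<lambda>_. \<nu>). planar_generic I x"
proof -
  have c: "(\<lambda>x. fst (x k)) \<in> borel_measurable (Pi\<^sub>M I (\<lambda>_. \<nu>))" "(\<lambda>x. snd (x k)) \<in> borel_measurable (Pi\<^sub>M I (\<lambda>_. \<nu>))"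
    if "k \<in> I" for k
    by (rule measurable_compose[OF measurable_component_singleton[OF that]], simp add: fst_snd_measurable cong: measurable_cong_sets)+
  have neq: "Measurable.pred N (\<lambda>x. f x \<noteq> g x)"
    if [measurable]: "f \<in> borel_measurable N" "g \<in> borel_measurable N" for f g :: "'x \<Rightarrow> real" and N
    by measurable
  have 1: "AE x in Pi\<^sub>M I (\<lambda>_. \<nu>). fst (x i) \<noteq> fst (x j)" if "i \<in> I" "j \<in> I" "i \<noteq> j" for i j
  proof (rule AE_PiM_fun_updI[OF I that(1)])
    show "Measurable.pred (Pi\<^sub>M I (\<lambda>_. \<nu>)) (\<lambda>x. fst (x i) \<noteq> fst (x j))"
      by (intro neq c that)
    show "AE y in \<nu>. fst ((x(i := y)) i) \<noteq> fst ((x(i := y)) j)" for x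
      using AE_fst_neq[of "fst (x j)"] that by simp
  qed
  \<comment> \<open>The premise makes the coefficient required to be nonzero in
    \<open>AE_not_on_line\<close> nonzero; it is removed at the end by combining with
    \<open>1\<close>.\<close>
  have 2: "AE x in Pi\<^sub>M I (\<lambda>_. \<nu>). fst (x i) \<noteq> fst (x j) \<longrightarrow>
      (fst (x j) - fst (x i)) * (snd (x k) - snd (x i)) \<noteq> (snd (x j) - snd (x i)) * (fst (x k) - fst (x i))"
    if "i \<in> I" "j \<in> I" "k \<in> I" "i \<noteq> j" "k \<noteq> i" "k \<noteq> j" for i j k
  proof (rule AE_PiM_fun_updI[OF I that(3)])
    show "Measurable.pred (Pi\<^sub>M I (\<lambda>_. \<nu>)) (\<lambda>x. fst (x i) \<noteq> fst (x j) \<longrightarrow>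
      (fst (x j) - fst (x i)) * (snd (x k) - snd (x i)) \<noteq> (snd (x j) - snd (x i)) * (fst (x k) - fst (x i)))"
      by (intro pred_intros_logic neq borel_measurable_times borel_measurable_diff c that)
    show "AE y in \<nu>. fst ((x(k := y)) i) \<noteq> fst ((x(k := y)) j) \<longrightarrow>
      (fst ((x(k := y)) j) - fst ((x(k := y)) i)) * (snd ((x(k := y)) k) - snd ((x(k := y)) i))
        \<noteq> (snd ((x(k := y)) j) - snd ((x(k := y)) i)) * (fst ((x(k := y)) k) - fst ((x(k := y)) i))" for x
    proof (cases "fst (x i) = fst (x j)")
      case False
      then show ?thesis
        using AE_not_on_line[of "fst (x j) - fst (x i)" "snd (x i)" "snd (x j) - snd (x i)" "fst (x i)"] that by simp
    qed (use that in simp)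
  qed
  have "AE x in Pi\<^sub>M I (\<lambda>_. \<nu>). \<forall>i\<in>I. \<forall>j\<in>I. i \<noteq> j \<longrightarrow> fst (x i) \<noteq> fst (x j)"
    using 1 I by (intro AE_finite_allI AE_impI) auto
  moreover have "AE x in Pi\<^sub>M I (\<lambda>_. \<nu>). \<forall>i\<in>I. \<forall>j\<in>I. \<forall>k\<in>I. i \<noteq> j \<longrightarrow> k \<noteq> i \<longrightarrow> k \<noteq> j \<longrightarrow> fst (x i) \<noteq> fst (x j) \<longrightarrow>
      (fst (x j) - fst (x i)) * (snd (x k) - snd (x i)) \<noteq> (snd (x j) - snd (x i)) * (fst (x k) - fst (x i))"
    by (intro AE_finite_allI I AE_impI) (rule 2)
  ultimately show ?thesis unfolding planar_generic_def by eventually_elim blast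
qed

end

lemma planar_beta_sphere:
  assumes d: "4 \<le> DIM('a::euclidean_space)"
  obtains \<nu> c where "planar_beta \<nu> DIM('a) c"
    "\<And>e g :: 'a. norm e = 1 \<Longrightarrow> norm g = 1 \<Longrightarrow> e \<bullet> g = 0 \<Longrightarrow> distr sphere_uniform borel (plane_map e g) = \<nu>"
proof -
  obtain c where c: "0 < c" and law: "\<And>e g :: 'a. norm e = 1 \<Longrightarrow> norm g = 1 \<Longrightarrow> e \<bullet> g = 0 \<Longrightarrow>
      distr sphere_uniform borel (plane_map e g) = density lborel (\<lambda>z. radial_density DIM('a) c ((fst z)\<^sup>2 + (snd z)\<^sup>2))"
    by (rule sphere_uniform_projection[OF d], rule that, assumption, blast)
  define \<nu> where "\<nu> = density lborel (\<lambda>z::real \<times> real. radial_density DIM('a) c ((fst z)\<^sup>2 + (snd z)\<^sup>2))"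
  obtain e :: 'a where e: "e \<in> Basis" using nonempty_Basis by blast
  have "Basis \<noteq> {e}"
  proof
    assume "Basis = {e}"
    from arg_cong[OF this, of card] have "DIM('a) = 1" by simp
    then show False using d by simp
  qed
  then obtain g :: 'a where g: "g \<in> Basis" "g \<noteq> e" using e by blast
  have eg: "norm e = 1" "norm g = 1" "e \<bullet> g = 0" "g \<bullet> e = 0" "e \<bullet> e = 1" "g \<bullet> g = 1"
    using e g by (auto simp: inner_not_same_Basis)
  have [measurable]: "plane_map u v \<in> borel_measurable (borel :: 'a measure)" for u v unfolding plane_map_def by measurable
  have [simp]: "space (sphere_uniform :: 'a measure) = UNIV" "sets (sphere_uniform :: 'a measure) = sets borel"
    by (simp_all add: sphere_uniform_def)
  have ms[measurable_cong]: "sets (sphere_uniform :: 'a measure) = sets borel" by simp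
  have \<nu>: "\<nu> = distr sphere_uniform borel (plane_map u v)" if "norm u = 1" "norm v = 1" "u \<bullet> v = 0" for u v :: 'a
    using law[OF that] by (simp add: \<nu>_def)
  have "planar_beta \<nu> DIM('a) c"
  proof (rule planar_beta.intro)
    show "prob_space \<nu>" unfolding \<nu>[OF eg(1-3)]
      by (intro prob_space.prob_space_distr prob_space_sphere_uniform) measurable
    show "distr \<nu> borel (\<lambda>z. z \<bullet> dir \<phi>) = distr \<nu> borel snd" for \<phi>
    proof -
      \<comment> \<open>The orthonormal pair e, g rotated in its plane: the projection to
        \<open>dir \<phi>\<close> becomes the second coordinate with respect to the new pair, which
        has the same law.\<close>
      define u v where "u = cos \<phi> *\<^sub>R e - sin \<phi> *\<^sub>R g" and "v = sin \<phi> *\<^sub>R e + cos \<phi> *\<^sub>R g"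
      have n1: "norm u = 1"
        unfolding norm_eq_1 u_def by (simp add: inner_simps eg power2_eq_square[symmetric])
      have n2: "norm v = 1"
        unfolding norm_eq_1 v_def by (simp add: inner_simps eg power2_eq_square[symmetric])
      have n3: "u \<bullet> v = 0"
        unfolding u_def v_def by (simp add: inner_simps eg)
      have "distr \<nu> borel (\<lambda>z. z \<bullet> dir \<phi>) = distr sphere_uniform borel ((\<lambda>z. z \<bullet> dir \<phi>) \<circ> plane_map e g)"
        unfolding \<nu>[OF eg(1-3)] by (rule distr_distr) measurable
      also have "(\<lambda>z. z \<bullet> dir \<phi>) \<circ> plane_map e g = snd \<circ> plane_map u v"
        by (auto simp: plane_map_def dir_def inner_prod_def v_def inner_simps)
      also have "distr sphere_uniform borel (snd \<circ> plane_map u v) = distr \<nu> borel snd"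
        unfolding \<nu>[OF n1 n2 n3] by (rule distr_distr[symmetric]) measurable
      finally show ?thesis .
    qed
  qed (use d c \<nu>_def in auto)
  then show thesis by (rule that) (simp add: \<nu>[symmetric])
qed

text \<open>The upper edges only depend on the span of \<open>C\<close> and \<open>W\<close> and its orientation, so orthonormalising
  reduces every pair to the planar law.\<close>

lemma (in planar_beta) path_length_law:
  fixes C W :: "'a::euclidean_space"
  assumes proj: "\<And>e g :: 'a. norm e = 1 \<Longrightarrow> norm g = 1 \<Longrightarrow> e \<bullet> g = 0 \<Longrightarrow> distr sphere_uniform borel (plane_map e g) = \<nu>"
    and ind: "C \<noteq> W" "independent {C, W}" and n: "3 \<le> n"
  shows "distr (Pi\<^sub>M {..<n} (\<lambda>_. sphere_uniform)) borel (\<lambda>z. real (path_length (convex hull (z ` {..<n})) C W)) = distr (sample_law n) borel (edge_count n)"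
proof -
  let ?S = "Pi\<^sub>M {..<n} (\<lambda>_. sphere_uniform :: 'a measure)"
  have C0: "C \<noteq> 0" using ind dependent_zero by blast
  define \<alpha> where "\<alpha> = norm C"
  define e where "e = C /\<^sub>R \<alpha>"
  define \<gamma> where "\<gamma> = W \<bullet> e"
  define w where "w = W - \<gamma> *\<^sub>R e"
  define \<beta> where "\<beta> = norm w"
  define g where "g = w /\<^sub>R \<beta>"
  have \<alpha>: "\<alpha> > 0" using C0 by (simp add: \<alpha>_def)
  have Ce: "C = \<alpha> *\<^sub>R e" and e1: "norm e = 1" using \<alpha> by (simp_all add: e_def \<alpha>_def)
  have ee: "e \<bullet> e = 1" using e1 by (simp add: norm_eq_1)
  have w0: "w \<noteq> 0"
  proof
    assume "w = 0"
    then have "W = (\<gamma> / \<alpha>) *\<^sub>R C" using \<alpha> by (simp add: w_def e_def divide_inverse)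
    then have "W \<in> span {C}" by (simp add: span_mul span_base)
    then show False using ind by (simp add: independent_insert insert_commute[of C])
  qed
  then have \<beta>: "\<beta> > 0" by (simp add: \<beta>_def)
  have g1: "norm g = 1" using w0 by (simp add: g_def \<beta>_def)
  have Wg: "W = \<gamma> *\<^sub>R e + \<beta> *\<^sub>R g" using \<beta> by (simp add: g_def w_def)
  have eg: "e \<bullet> g = 0" by (simp add: g_def w_def inner_simps \<gamma>_def ee inner_commute[of e W])
  have \<nu>: "distr sphere_uniform borel (plane_map e g) = \<nu>" by (rule proj[OF e1 g1 eg])
  have sS: "sets (sphere_uniform :: 'a measure) = sets borel" by (simp add: sphere_uniform_def)
  have pm[measurable]: "plane_map e g \<in> borel_measurable sphere_uniform"
    unfolding plane_map_def measurable_cong_sets[OF sS refl] by measurable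
  let ?h = "compose {..<n} (plane_map e g)"
  have hd: "distr ?S (sample_law n) ?h = sample_law n"
  proof -
    have "distr ?S (sample_law n) ?h = distr ?S (Pi\<^sub>M {..<n} (\<lambda>_. \<nu>)) ?h" by (simp add: sample_law_def)
    also have "\<dots> = Pi\<^sub>M {..<n} (\<lambda>_. distr sphere_uniform \<nu> (plane_map e g))"
      using pm by (intro distr_PiM_finite_prob_space product_prob_spaceI prob_space_sphere_uniform nu_prob)
        (simp_all cong: measurable_cong_sets)
    also have "distr sphere_uniform \<nu> (plane_map e g) = distr sphere_uniform borel (plane_map e g)"
      by (rule distr_cong) simp_all
    finally show ?thesis by (simp add: \<nu> sample_law_def)
  qed
  have LLm: "edge_count n \<in> borel_measurable (sample_law n)"
    unfolding edge_count_def sample_law_def using edge_counts_measurable(1)[of \<nu> "{..<n}" "{..<n}"] by simp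
  have comp: "(\<lambda>z. z i) \<in> borel_measurable ?S" if "i < n" for i
    using measurable_component_singleton[of i "{..<n}" "\<lambda>_. sphere_uniform :: 'a measure"] that sS by (simp cong: measurable_cong_sets)
  have pb[measurable]: "plane_map e g \<in> borel_measurable borel" unfolding plane_map_def by measurable
  have hm: "?h \<in> ?S \<rightarrow>\<^sub>M sample_law n"
    unfolding sample_law_def compose_def
  proof (rule measurable_restrict)
    fix i assume "i \<in> {..<n}"
    then have "(\<lambda>z. plane_map e g (z i)) \<in> borel_measurable ?S" by (intro measurable_compose[OF comp pb]) simp
    then show "(\<lambda>z. plane_map e g (z i)) \<in> ?S \<rightarrow>\<^sub>M \<nu>" by (simp cong: measurable_cong_sets)
  qed
  have pl: "(\<lambda>z. real (path_length (convex hull (z ` {..<n})) C W)) \<in> borel_measurable ?S"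
    using n comp by (intro path_length_measurable) (auto simp: lessThan_empty_iff)
  have "AE x in sample_law n. planar_generic {..<n} x" unfolding sample_law_def by (rule AE_planar_generic) simp
  then have "AE z in ?S. planar_generic {..<n} (?h z)"
    by (rule AE_distrD[OF hm, unfolded hd])
  then have "AE z in ?S. real (path_length (convex hull (z ` {..<n})) C W) = edge_count n (?h z)"
  proof eventually_elim
    case (elim z)
    let ?x = "\<lambda>k. plane_map C W (z k)"
    have x: "fst (?x k) = \<alpha> * fst (?h z k)" "snd (?x k) = \<gamma> * fst (?h z k) + \<beta> * snd (?h z k)" if "k \<in> {..<n}" for k
      using that by (simp_all add: compose_def plane_map_def Ce Wg inner_simps)
    note aff = upper_edges_affine[of "{..<n}" ?x \<alpha> "?h z" \<gamma> \<beta>, OF x \<alpha> \<beta>]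
    have "planar_generic {..<n} ?x" using elim aff(2) by simp
    then have "path_length (convex hull (z ` {..<n})) C W = upper_edges {..<n} ?x"
      using n by (intro path_length_generic) auto
    then show ?case using aff(1) by (simp add: edge_count_def)
  qed
  then have "distr ?S borel (\<lambda>z. real (path_length (convex hull (z ` {..<n})) C W)) = distr ?S borel (edge_count n \<circ> ?h)"
    using pl measurable_comp[OF hm LLm] by (intro distr_cong_AE) (auto simp: comp_def)
  also have "\<dots> = distr (distr ?S (sample_law n) ?h) borel (edge_count n)" by (rule distr_distr[OF LLm hm, symmetric])
  finally show ?thesis by (simp add: hd)
qed

section \<open>Random vectors and the limit theorem\<close>

lemma (in prob_space) indep_rv_distr_pair:
  assumes ind: "indep_rv M N X N' Y" and f: "f \<in> N' \<rightarrow>\<^sub>M L"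
  shows "distr M (N \<Otimes>\<^sub>M L) (\<lambda>x. (X x, f (Y x))) = distr M N X \<Otimes>\<^sub>M distr M L (\<lambda>x. f (Y x))"
proof (rule pair_measure_eqI[symmetric])
  have X[measurable]: "X \<in> M \<rightarrow>\<^sub>M N" and Y[measurable]: "Y \<in> M \<rightarrow>\<^sub>M N'"
    and ind': "indep_set (sets (vimage_algebra (space M) X N)) (sets (vimage_algebra (space M) Y N'))"
    using ind by (auto simp: indep_rv_def)
  have fY[measurable]: "(\<lambda>x. f (Y x)) \<in> M \<rightarrow>\<^sub>M L" by (rule measurable_compose[OF Y f])
  show "sigma_finite_measure (distr M N X)"
    by (rule prob_space_imp_sigma_finite, rule prob_space_distr[OF X])
  show "sigma_finite_measure (distr M L (\<lambda>x. f (Y x)))"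
    by (rule prob_space_imp_sigma_finite, rule prob_space_distr[OF fY])
  show "sets (distr M N X \<Otimes>\<^sub>M distr M L (\<lambda>x. f (Y x))) = sets (distr M (N \<Otimes>\<^sub>M L) (\<lambda>x. (X x, f (Y x))))"
    by (simp cong: sets_pair_measure_cong)
  fix A B assume "A \<in> sets (distr M N X)" "B \<in> sets (distr M L (\<lambda>x. f (Y x)))"
  then have A: "A \<in> sets N" and B: "B \<in> sets L" by simp_all
  have "f -` B \<inter> space N' \<in> sets N'" using f B by (rule measurable_sets)
  then have "Y -` (f -` B \<inter> space N') \<inter> space M \<in> sets (vimage_algebra (space M) Y N')" by (rule in_vimage_algebra)
  moreover have "Y -` (f -` B \<inter> space N') \<inter> space M = (\<lambda>x. f (Y x)) -` B \<inter> space M"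
    using measurable_space[OF Y] by auto
  ultimately have "prob ((X -` A \<inter> space M) \<inter> ((\<lambda>x. f (Y x)) -` B \<inter> space M)) = prob (X -` A \<inter> space M) * prob ((\<lambda>x. f (Y x)) -` B \<inter> space M)"
    using in_vimage_algebra[OF A, of X "space M"] by (intro indep_setD[OF ind']) simp_all
  moreover have "(X -` A \<inter> space M) \<inter> ((\<lambda>x. f (Y x)) -` B \<inter> space M) = (\<lambda>x. (X x, f (Y x))) -` (A \<times> B) \<inter> space M" by auto
  ultimately show "emeasure (distr M N X) A * emeasure (distr M L (\<lambda>x. f (Y x))) B = emeasure (distr M (N \<Otimes>\<^sub>M L) (\<lambda>x. (X x, f (Y x)))) (A \<times> B)"
    using A B by (simp add: emeasure_distr emeasure_eq_measure ennreal_mult[symmetric])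
qed

lemma path_length_empty: "path_length {} c w = 0"
proof -
  have "coherent_path {} c w = {}"
    by (auto simp: coherent_path_def upper_face_def)
  then show ?thesis by (simp add: path_length_def)
qed

lemma random_path_length_measurable:
  assumes "C \<in> borel_measurable M" "W \<in> borel_measurable M" "\<And>i. Z i \<in> borel_measurable M"
  shows "random_path_length C W Z n \<in> borel_measurable M"
proof (cases "n = 0")
  case True
  then show ?thesis by (simp add: random_path_length_def[abs_def] path_length_empty)
next
  case False
  show ?thesis unfolding random_path_length_def[abs_def]
    by (rule path_length_measurable) (use assms False in \<open>auto simp: lessThan_empty_iff\<close>)
qed

text \<open>If the conditional law given X is the same measure D for almost every value, mixing over
  X gives D. Applied to X = (C, W), this removes the randomness of the vectors.\<close>

lemma (in prob_space) distr_pair_AE_const: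
  assumes X: "X \<in> M \<rightarrow>\<^sub>M N" and L: "prob_space L" and G: "G \<in> borel_measurable (N \<Otimes>\<^sub>M L)"
    and AE: "AE x in M. distr L borel (\<lambda>z. G (X x, z)) = D"
  shows "distr (distr M N X \<Otimes>\<^sub>M L) borel G = D"
proof -
  interpret L: prob_space L by (rule L)
  \<comment> \<open>A single such x shows that D is a measure on the Borel sets.\<close>
  have "\<exists>x. distr L borel (\<lambda>z. G (X x, z)) = D"
  proof (rule ccontr)
    assume "\<nexists>x. distr L borel (\<lambda>z. G (X x, z)) = D"
    then have "AE x in M. False" using AE by simp
    then show False by simp
  qed
  then have D: "sets D = sets borel" by auto
  show ?thesis
  proof (rule measure_eqI)
    fix A assume "A \<in> sets (distr (distr M N X \<Otimes>\<^sub>M L) borel G)"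
    then have A: "A \<in> sets borel" by simp
    have G': "G \<in> borel_measurable (distr M N X \<Otimes>\<^sub>M L)" using G by (simp cong: measurable_cong_sets sets_pair_measure_cong)
    let ?S = "G -` A \<inter> space (N \<Otimes>\<^sub>M L)"
    have S: "?S \<in> sets (N \<Otimes>\<^sub>M L)" using G A by (rule measurable_sets)
    have S': "?S \<in> sets (distr M N X \<Otimes>\<^sub>M L)" using S by (simp cong: sets_pair_measure_cong)
    have "emeasure (distr (distr M N X \<Otimes>\<^sub>M L) borel G) A = emeasure (distr M N X \<Otimes>\<^sub>M L) ?S"
      using emeasure_distr[OF G' A] by (simp add: space_pair_measure)
    also have "\<dots> = (\<integral>\<^sup>+y. emeasure L (Pair y -` ?S) \<partial>distr M N X)"
      by (rule L.emeasure_pair_measure_alt[OF S'])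
    also have "\<dots> = (\<integral>\<^sup>+x. emeasure L (Pair (X x) -` ?S) \<partial>M)"
      by (rule nn_integral_distr[OF X L.measurable_emeasure_Pair[OF S']])
    also have "\<dots> = (\<integral>\<^sup>+x. emeasure D A \<partial>M)"
    proof (rule nn_integral_cong_AE)
      show "AE x in M. emeasure L (Pair (X x) -` ?S) = emeasure D A"
        using AE AE_space
      proof eventually_elim
        case (elim x)
        have Xx: "X x \<in> space N" using measurable_space[OF X elim(2)] .
        have m: "(\<lambda>z. G (X x, z)) \<in> borel_measurable L"
          by (rule measurable_compose[OF measurable_Pair1'[OF Xx] G])
        have "Pair (X x) -` ?S = (\<lambda>z. G (X x, z)) -` A \<inter> space L"
          using Xx by (auto simp: space_pair_measure)
        then show ?case using elim(1) emeasure_distr[OF m A] by simp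
      qed
    qed
    also have "\<dots> = emeasure D A" by (simp add: emeasure_space_1)
    finally show "emeasure (distr (distr M N X \<Otimes>\<^sub>M L) borel G) A = emeasure D A" .
  qed (simp add: D)
qed

theorem theorem5p1:
  fixes M :: "'w measure"
    and C W :: "'w \<Rightarrow> real ^ 'd"
    and Z :: "nat \<Rightarrow> 'w \<Rightarrow> real ^ 'd"
  assumes "CARD('d) \<ge> 4"
    and "prob_space M"
    and "AE x in M. C x \<noteq> W x \<and> independent {C x, W x}"
    and "prob_space.indep_vars M (\<lambda>_. borel) Z UNIV"
    and "\<And>i. distr M borel (Z i) = sphere_uniform"
    and "indep_rv M (borel \<Otimes>\<^sub>M borel) (\<lambda>x. (C x, W x)) (Pi\<^sub>M UNIV (\<lambda>_. borel)) (\<lambda>x i. Z i x)"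
  shows "weak_conv_m
           (\<lambda>n. distr M borel (\<lambda>x.
              (random_path_length C W Z n x - prob_space.expectation M (random_path_length C W Z n))
                / sqrt (prob_space.variance M (random_path_length C W Z n))))
           std_normal_distribution
       \<and> (\<exists>c>0. (\<lambda>n. prob_space.expectation M (random_path_length C W Z n))
              \<sim>[sequentially] (\<lambda>n. c * real n powr (1 / (real CARD('d) - 1))))
       \<and> (\<forall>a>0. \<exists>c'>0. \<exists>c''>0. \<forall>\<^sub>F n in sequentially.
              c' * real n powr (1 / (real CARD('d) - 1) - a)
                \<le> prob_space.variance M (random_path_length C W Z n)
            \<and> prob_space.variance M (random_path_length C W Z n)
                \<le> c'' * ln (real n) powr (3 - 1 / (real CARD('d) - 1))
                     * real n powr (1 / (real CARD('d) - 1)))"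
proof -
  interpret M: prob_space M by fact
  have dim: "4 \<le> DIM(real ^ 'd)" using assms(1) by simp
  obtain \<nu> c where pb: "planar_beta \<nu> DIM(real ^ 'd) c"
    and proj: "\<And>e g :: real ^ 'd. norm e = 1 \<Longrightarrow> norm g = 1 \<Longrightarrow> e \<bullet> g = 0 \<Longrightarrow> distr sphere_uniform borel (plane_map e g) = \<nu>"
    by (rule planar_beta_sphere[OF dim], rule that, assumption, blast)
  interpret planar_beta \<nu> "CARD('d)" c using pb by simp
  let ?L = "random_path_length C W Z"
  let ?S = "\<lambda>n. Pi\<^sub>M {..<n} (\<lambda>_. sphere_uniform :: (real ^ 'd) measure)"
  let ?B = "\<lambda>n::nat. Pi\<^sub>M {..<n} (\<lambda>_. borel :: (real ^ 'd) measure)"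
  have CWm: "(\<lambda>x. (C x, W x)) \<in> M \<rightarrow>\<^sub>M borel \<Otimes>\<^sub>M borel" using assms(6) by (simp add: indep_rv_def)
  have Cm[measurable]: "C \<in> borel_measurable M" and Wm[measurable]: "W \<in> borel_measurable M"
    using measurable_compose[OF CWm measurable_fst] measurable_compose[OF CWm measurable_snd] by simp_all
  have Zm[measurable]: "Z i \<in> borel_measurable M" for i
    using assms(4) by (simp add: M.indep_vars_def)
  have Lm: "?L n \<in> borel_measurable M" for n by (rule random_path_length_measurable) measurable
  \<comment> \<open>From three points on, a proper upper edge cannot be the whole polygon almost
    surely, so the length has the law of the planar edge count; smaller n do not affect the
    limits.\<close>
  have law: "distr M borel (?L n) = distr (sample_law n) borel (edge_count n)" if n: "3 \<le> n" for n
  proof -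
    have ne: "{..<n} \<noteq> {}" using n by (auto simp: lessThan_empty_iff)
    have "M.indep_vars (\<lambda>_. borel) Z {..<n}" by (rule M.indep_vars_subset[OF assms(4)]) simp
    then have ZS: "distr M (?B n) (\<lambda>x. \<lambda>i\<in>{..<n}. Z i x) = ?S n"
      using M.indep_vars_iff_distr_eq_PiM[OF ne, where M'="\<lambda>_. borel" and X=Z] by (simp add: assms(5))
    have "(\<lambda>z. restrict z {..<n}) \<in> Pi\<^sub>M UNIV (\<lambda>_. borel :: (real ^ 'd) measure) \<rightarrow>\<^sub>M ?B n"
      by (rule measurable_restrict_subset) simp
    from M.indep_rv_distr_pair[OF assms(6) this]
    have joint: "distr M ((borel \<Otimes>\<^sub>M borel) \<Otimes>\<^sub>M ?B n) (\<lambda>x. ((C x, W x), \<lambda>i\<in>{..<n}. Z i x))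
        = distr M (borel \<Otimes>\<^sub>M borel) (\<lambda>x. (C x, W x)) \<Otimes>\<^sub>M ?S n"
      by (simp add: ZS)
    define G where "G y = real (path_length (convex hull (snd y ` {..<n})) (fst (fst y)) (snd (fst y)))"
      for y :: "((real ^ 'd) \<times> (real ^ 'd)) \<times> (nat \<Rightarrow> real ^ 'd)"
    have Gm: "G \<in> borel_measurable ((borel \<Otimes>\<^sub>M borel) \<Otimes>\<^sub>M ?B n)"
      unfolding G_def[abs_def]
    proof (rule path_length_measurable[OF _ ne])
      show "(\<lambda>x. snd x i) \<in> borel_measurable ((borel \<Otimes>\<^sub>M borel) \<Otimes>\<^sub>M ?B n)" if "i \<in> {..<n}" for i
        using measurable_compose[OF measurable_snd measurable_component_singleton[OF that]] .
    qed simp_all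
    have mm: "(\<lambda>x. ((C x, W x), \<lambda>i\<in>{..<n}. Z i x)) \<in> M \<rightarrow>\<^sub>M (borel \<Otimes>\<^sub>M borel) \<Otimes>\<^sub>M ?B n"
      using CWm by (intro measurable_Pair measurable_restrict) simp_all
    have "distr M borel (?L n) = distr (distr M ((borel \<Otimes>\<^sub>M borel) \<Otimes>\<^sub>M ?B n) (\<lambda>x. ((C x, W x), \<lambda>i\<in>{..<n}. Z i x))) borel G"
      by (subst distr_distr[OF Gm mm]) (simp add: comp_def G_def random_path_length_def[abs_def])
    also have "\<dots> = distr (sample_law n) borel (edge_count n)"
      unfolding joint
    proof (rule M.distr_pair_AE_const[OF CWm])
      show "prob_space (?S n)" by (intro prob_space_PiM prob_space_sphere_uniform)
      have sets_S: "sets (?S n) = sets (?B n)" by (intro sets_PiM_cong) (simp_all add: sphere_uniform_def)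
      show "G \<in> borel_measurable ((borel \<Otimes>\<^sub>M borel) \<Otimes>\<^sub>M ?S n)"
        unfolding measurable_cong_sets[OF sets_pair_measure_cong[OF refl sets_S] refl] by (rule Gm)
      show "AE x in M. distr (?S n) borel (\<lambda>z. G ((C x, W x), z)) = distr (sample_law n) borel (edge_count n)"
        using assms(3)
      proof eventually_elim
        case (elim x)
        show ?case
          unfolding G_def fst_conv snd_conv
          by (rule path_length_law) (use elim in \<open>auto intro: proj n\<close>)
      qed
    qed
    finally show ?thesis .
  qed
  have LLm: "edge_count n \<in> borel_measurable (sample_law n)" for n
    unfolding edge_count_def sample_law_def using edge_counts_measurable(1)[of \<nu> "{..<n}" "{..<n}"] by simp
  have E: "M.expectation (?L n) = mean_count n" if n: "3 \<le> n" for n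
  proof -
    have "M.expectation (?L n) = (\<integral>y. y \<partial>distr M borel (?L n))" using Lm by (simp add: integral_distr)
    also have "\<dots> = mean_count n" unfolding law[OF n] mean_count_def using LLm by (simp add: integral_distr)
    finally show ?thesis .
  qed
  have V: "M.variance (?L n) = var_count n" if n: "3 \<le> n" for n
  proof -
    have "M.variance (?L n) = (\<integral>y. (y - mean_count n)\<^sup>2 \<partial>distr M borel (?L n))" using Lm by (simp add: integral_distr E[OF n])
    also have "\<dots> = var_count n" unfolding law[OF n] var_count_def using LLm by (simp add: integral_distr)
    finally show ?thesis .
  qed
  have ev3: "\<forall>\<^sub>F n in sequentially. 3 \<le> n" by (rule eventually_ge_at_top)
  have growth_exp: "1 / (real CARD('d) - 1) = growth_exp" by (simp add: growth_exp_def)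
  have weak: "weak_conv_m (\<lambda>n. distr M borel (\<lambda>x. (?L n x - M.expectation (?L n)) / sqrt (M.variance (?L n)))) std_normal_distribution"
  proof (rule levy_continuity)
    have std: "(\<lambda>x. (?L n x - e) / s) \<in> borel_measurable M" for n e s using Lm[of n] by measurable
    show "real_distribution (distr M borel (\<lambda>x. (?L n x - M.expectation (?L n)) / sqrt (M.variance (?L n))))" for n
      by (rule M.real_distribution_distr[OF std])
    show "(\<lambda>n. char (distr M borel (\<lambda>x. (?L n x - M.expectation (?L n)) / sqrt (M.variance (?L n)))) t) \<longlonglongrightarrow> char std_normal_distribution t" for t
    proof -
      have "char (distr M borel (\<lambda>x. (?L n x - M.expectation (?L n)) / sqrt (M.variance (?L n)))) t
          = (\<integral>x. iexp (t * ((edge_count n x - mean_count n) / sqrt (var_count n))) \<partial>sample_law n)" if n: "3 \<le> n" for n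
      proof -
        have "char (distr M borel (\<lambda>x. (?L n x - M.expectation (?L n)) / sqrt (M.variance (?L n)))) t
          = (\<integral>x. iexp (t * ((?L n x - mean_count n) / sqrt (var_count n))) \<partial>M)"
          unfolding char_def V[OF n] unfolding E[OF n] using Lm[of n] by (subst integral_distr) simp_all
        also have "\<dots> = (\<integral>y. iexp (t * ((y - mean_count n) / sqrt (var_count n))) \<partial>distr M borel (?L n))"
          using Lm[of n] by (subst integral_distr) simp_all
        also have "\<dots> = (\<integral>x. iexp (t * ((edge_count n x - mean_count n) / sqrt (var_count n))) \<partial>sample_law n)"
          unfolding law[OF n] using LLm[of n] by (subst integral_distr) simp_all
        finally show ?thesis .
      qed
      then have "\<forall>\<^sub>F n in sequentially. char (distr M borel (\<lambda>x. (?L n x - M.expectation (?L n)) / sqrt (M.variance (?L n)))) t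
          = (\<integral>x. iexp (t * ((edge_count n x - mean_count n) / sqrt (var_count n))) \<partial>sample_law n)"
        using ev3 by (rule eventually_mono[rotated])
      then show ?thesis
        using fluctuation_estimates(3)[of t] by (simp add: tendsto_cong char_std_normal_distribution)
    qed
  qed (rule real_dist_normal_dist)
  have asymp: "\<exists>c>0. (\<lambda>n. M.expectation (?L n)) \<sim>[sequentially] (\<lambda>n. c * real n powr growth_exp)"
  proof -
    obtain c where c: "c > 0" "(\<lambda>n. mean_count n / real n powr growth_exp) \<longlonglongrightarrow> c" using mean_count_asymp by blast
    have "(\<lambda>n. (mean_count n / real n powr growth_exp) / c) \<longlonglongrightarrow> c / c" using c by (intro tendsto_intros) auto
    moreover have "\<forall>\<^sub>F n in sequentially. (mean_count n / real n powr growth_exp) / c = M.expectation (?L n) / (c * real n powr growth_exp)"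
      using ev3 by eventually_elim (simp add: E)
    ultimately have "(\<lambda>n. M.expectation (?L n) / (c * real n powr growth_exp)) \<longlonglongrightarrow> 1"
      using c(1) by (simp add: tendsto_cong)
    then show ?thesis using c(1) by (intro exI[of _ c] conjI asymp_equivI') auto
  qed
  obtain cl where cl: "cl > 0" "\<forall>\<^sub>F n in sequentially. cl * real n powr growth_exp / ln (real n) \<le> var_count n"
    using fluctuation_estimates(1) by blast
  obtain cu where cu: "cu > 0" "\<forall>\<^sub>F n in sequentially. var_count n \<le> cu * ln (real n) powr (3 - growth_exp) * real n powr growth_exp"
    using fluctuation_estimates(2) by blast
  have var: "\<exists>c'>0. \<exists>c''>0. \<forall>\<^sub>F n in sequentially. c' * real n powr (growth_exp - a) \<le> M.variance (?L n)
      \<and> M.variance (?L n) \<le> c'' * ln (real n) powr (3 - growth_exp) * real n powr growth_exp" if a: "a > 0" for a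
  proof (intro exI conjI)
    \<comment> \<open>The factor n powr (- a) absorbs the logarithm in the denominator.\<close>
    have "\<forall>\<^sub>F n in sequentially. cl * real n powr (growth_exp - a) \<le> cl * real n powr growth_exp / ln (real n)"
      using cl(1) a growth_exp_range(1) by real_asymp
    then show "\<forall>\<^sub>F n in sequentially. cl * real n powr (growth_exp - a) \<le> M.variance (?L n)
      \<and> M.variance (?L n) \<le> cu * ln (real n) powr (3 - growth_exp) * real n powr growth_exp"
      using cl(2) cu(2) ev3 by eventually_elim (auto simp: V)
  qed (use cl cu in auto)
  show ?thesis unfolding growth_exp using weak asymp var by blast
qed

end
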